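(* Let $n\ge 1$ and let $\varphi:\mathbb{C}^n\to\mathbb{R}$ be a plurisubharmonic $\mathcal{C}^2$-function. Suppose that the lowest eigenvalue $\mu_\varphi(z)$ of the Levi matrix $M_\varphi(z)=\left(\frac{\partial^2\varphi}{\partial z_j\,\partial\overline z_k}(z)\right)_{j,k=1}^n$ satisfies $$\lim_{|z|\to\infty}\mu_\varphi(z)=+\infty .$$ Then the embedding $$j_\varphi:\mathcal{W}^{Q_\varphi}\hookrightarrow L^2_{(0,1)}(\mathbb{C}^n,e^{-\varphi})$$ is compact. Consequently, the $\overline\partial$-Neumann operator $N_\varphi^{(0,1)}:L^2_{(0,1)}(\mathbb{C}^n,e^{-\varphi})\to L^2_{(0,1)}(\mathbb{C}^n,e^{-\varphi})$ is compact.
   Context: $\lambda$ is Lebesgue measure on $\mathbb{C}^n$. $L^2(\mathbb{C}^n,e^{-\varphi})$ is the Hilbert space of measurable $g:\mathbb{C}^n\to\mathbb{C}$ with $\|g\|_\varphi^2=\int_{\mathbb{C}^n}|g|^2e^{-\varphi}\,d\lambda<\infty$. For $0\le q\le n$, $L^2_{(0,q)}(\mathbb{C}^n,e^{-\varphi})$ is the space of $(0,q)$-forms $f=\sum'_{|J|=q}f_J\,d\overline z_J$ (sum over strictly increasing multi-indices $J=(j_1,\dots,j_q)$, $d\overline z_J=d\overline z_{j_1}\wedge\dots\wedge d\overline z_{j_q}$) with all $f_J\in L^2(\mathbb{C}^n,e^{-\varphi})$, and norm $\|f\|_\varphi^2=\sum'_{|J|=q}\|f_J\|_\varphi^2$;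 for $q>n$ it is $\{0\}$. The operator $\overline\partial f=\sum'_{|J|=q}\sum_{j=1}^n\frac{\partial f_J}{\partial\overline z_j}\,d\overline z_j\wedge d\overline z_J$ is taken in the sense of distributions, with domain $\mathrm{dom}(\overline\partial)=\{f\in L^2_{(0,q)}(\mathbb{C}^n,e^{-\varphi}):\overline\partial f\in L^2_{(0,q+1)}(\mathbb{C}^n,e^{-\varphi})\}$; it is a densely defined closed operator. Its Hilbert space adjoint (with respect to the weighted inner products), mapping from $L^2_{(0,q+1)}(\mathbb{C}^n,e^{-\varphi})$ to $L^2_{(0,q)}(\mathbb{C}^n,e^{-\varphi})$, is denoted $\overline\partial^*_\varphi$, with domain $\mathrm{dom}(\overline\partial^*_\varphi)$. The complex Laplacian is $\Box_\varphi^{(0,q)}=\overline\partial\,\overline\partial^*_\varphi+\overline\partial^*_\varphi\,\overline\partial$ on $L^2_{(0,q)}(\mathbb{C}^n,e^{-\varphi})$, with domain $\{u\in\mathrm{dom}(\overline\partial)\cap\mathrm{dom}(\overline\partial^*_\varphi):\overline\partial u\in\mathrm{dom}(\overline\partial^*_\varphi),\ \overline\partial^*_\varphi u\in\mathrm{dom}(\overline\partial)\}$; it is non-negative and self-adjoint. If $\liminf_{|z|\to\infty}\mu_\varphi(z)>0$, then $\Box_\varphi^{(0,1)}$ has a bounded inverse, denoted $N_\varphi^{(0,1)}$ (the $\overline\partial$-Neumann operator), and there is a constant $C$ with $\|u\|_\varphi^2\le C(\|\overline\partial u\|_\varphi^2+\|\overline\partial^*_\varphi u\|_\varphi^2)$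 for all $u\in\mathrm{dom}(\overline\partial)\cap\mathrm{dom}(\overline\partial^*_\varphi)\subseteq L^2_{(0,1)}(\mathbb{C}^n,e^{-\varphi})$. $\mathcal{W}^{Q_\varphi}=\{u\in L^2_{(0,1)}(\mathbb{C}^n,e^{-\varphi}):u\in\mathrm{dom}(\overline\partial)\cap\mathrm{dom}(\overline\partial^*_\varphi)\}$, with norm $\|u\|_{Q_\varphi}=(\|\overline\partial u\|_\varphi^2+\|\overline\partial^*_\varphi u\|_\varphi^2)^{1/2}$. *)

theory Defs
  imports "HOL-Analysis.Analysis" "HOL-Library.Function_Algebras"
begin

section \<open>Differentiability classes and Wirtinger derivatives\<close>

fun Ck :: "nat \<Rightarrow> ('a::euclidean_space \<Rightarrow> 'b::real_normed_vector) \<Rightarrow> bool" where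
  "Ck 0 f \<longleftrightarrow> continuous_on UNIV f"
| "Ck (Suc k) f \<longleftrightarrow>
    (\<forall>x. f differentiable (at x)) \<and> (\<forall>v. Ck k (\<lambda>x. frechet_derivative f (at x) v))"

definition test_function :: "('a::euclidean_space \<Rightarrow> complex) \<Rightarrow> bool" where
  "test_function \<eta> \<longleftrightarrow> (\<forall>k. Ck k \<eta>) \<and> compact (closure {z. \<eta> z \<noteq> 0})"

definition wirtinger :: "'n::finite \<Rightarrow> (complex ^ 'n \<Rightarrow> complex) \<Rightarrow> complex ^ 'n \<Rightarrow> complex" where
  "wirtinger j f z =
    (frechet_derivative f (at z) (axis j 1) - \<i> * frechet_derivative f (at z) (axis j \<i>)) / 2"

definition wirtinger_bar :: "'n::finite \<Rightarrow> (complex ^ 'n \<Rightarrow> complex) \<Rightarrow> complex ^ 'n \<Rightarrow> complex" where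
  "wirtinger_bar j f z =
    (frechet_derivative f (at z) (axis j 1) + \<i> * frechet_derivative f (at z) (axis j \<i>)) / 2"


section \<open>Plurisubharmonic functions and the Levi matrix\<close>

definition upper_semicontinuous :: "('a::topological_space \<Rightarrow> real) \<Rightarrow> bool" where
  "upper_semicontinuous u \<longleftrightarrow> (\<forall>t. open {z. u z < t})"

text \<open>The integrability clause only excludes the value \<open>0\<close> that the library integral takes on
  non-integrable functions; circle means of subharmonic functions that are finite at the centre
  always exist.\<close>

definition subharmonic :: "(complex \<Rightarrow> real) \<Rightarrow> bool" where
  "subharmonic u \<longleftrightarrow> upper_semicontinuous u \<and>
    (\<forall>a. \<forall>r>0. set_integrable lborel {0..2*pi} (\<lambda>\<theta>. u (a + of_real r * cis \<theta>)) \<and>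
      u a \<le> (LINT \<theta>:{0..2*pi}|lborel. u (a + of_real r * cis \<theta>)) / (2 * pi))"

definition plurisubharmonic :: "(complex ^ 'n::finite \<Rightarrow> real) \<Rightarrow> bool" where
  "plurisubharmonic \<phi> \<longleftrightarrow> upper_semicontinuous \<phi> \<and>
    (\<forall>a w. subharmonic (\<lambda>\<tau>. \<phi> (a + \<tau> *s w)))"

definition levi_matrix :: "(complex ^ 'n::finite \<Rightarrow> real) \<Rightarrow> complex ^ 'n \<Rightarrow> complex ^ 'n ^ 'n" where
  "levi_matrix \<phi> z = (\<chi> j k. wirtinger j (wirtinger_bar k (\<lambda>w. complex_of_real (\<phi> w))) z)"

text \<open>For use with Hermitian matrices, whose eigenvalues are real.\<close>

definition lowest_eigenvalue :: "complex ^ 'n ^ 'n::finite \<Rightarrow> real" where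
  "lowest_eigenvalue A = Min {t::real. \<exists>v. v \<noteq> 0 \<and> A *v v = complex_of_real t *s v}"


section \<open>Measurable functions modulo equality almost everywhere\<close>

quotient_type (overloaded) 'a aefun = "'a::euclidean_space \<Rightarrow> complex" /
  partial: "\<lambda>f g. f \<in> borel_measurable lebesgue \<and> g \<in> borel_measurable lebesgue \<and>
    (AE x in lebesgue. f x = g x)"
proof (rule part_equivpI)
  show "\<exists>f::'a \<Rightarrow> complex. f \<in> borel_measurable lebesgue \<and> f \<in> borel_measurable lebesgue \<and>
      (AE x in lebesgue. f x = f x)"
    by (rule exI[of _ "\<lambda>_. 0"]) auto
  show "symp (\<lambda>f g :: 'a \<Rightarrow> complex. f \<in> borel_measurable lebesgue \<and>
      g \<in> borel_measurable lebesgue \<and> (AE x in lebesgue. f x = g x))"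
    by (auto intro!: sympI elim: eventually_mono)
  show "transp (\<lambda>f g :: 'a \<Rightarrow> complex. f \<in> borel_measurable lebesgue \<and>
      g \<in> borel_measurable lebesgue \<and> (AE x in lebesgue. f x = g x))"
    by (auto intro!: transpI elim: eventually_elim2)
qed

instantiation aefun :: (euclidean_space) ab_group_add
begin

lift_definition zero_aefun :: "'a aefun" is "\<lambda>_. 0"
  by simp

lift_definition plus_aefun :: "'a aefun \<Rightarrow> 'a aefun \<Rightarrow> 'a aefun" is "\<lambda>f g x. f x + g x"
  by (auto elim: eventually_elim2)

lift_definition minus_aefun :: "'a aefun \<Rightarrow> 'a aefun \<Rightarrow> 'a aefun" is "\<lambda>f g x. f x - g x"
  by (auto elim: eventually_elim2)

lift_definition uminus_aefun :: "'a aefun \<Rightarrow> 'a aefun" is "\<lambda>f x. - f x"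
  by (auto elim: eventually_mono)

instance
  by standard (transfer; auto simp: algebra_simps)+

end

lift_definition aescale :: "complex \<Rightarrow> 'a::euclidean_space aefun \<Rightarrow> 'a aefun" is "\<lambda>c f x. c * f x"
  by (auto elim: eventually_mono)

lemma rep_aefun_measurable [measurable, simp]: "rep_aefun f \<in> borel_measurable lebesgue"
  using Quotient3_aefun Quotient3_rep_reflp by fastforce

lemma rep_abs_aefun:
  assumes "f \<in> borel_measurable lebesgue"
  shows "AE x in lebesgue. rep_aefun (abs_aefun f) x = f x"
  using rep_abs_rsp_left[OF Quotient3_aefun, of f f] assms by auto

lemma rep_minus_aefun: "AE x in lebesgue. rep_aefun (f - g) x = rep_aefun f x - rep_aefun g x"
proof -
  have "f - g = abs_aefun (\<lambda>x. rep_aefun f x - rep_aefun g x)"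
    by (simp add: minus_aefun_def)
  then show ?thesis
    using rep_abs_aefun[of "\<lambda>x. rep_aefun f x - rep_aefun g x"] by simp
qed

lemma aefun_eq_iff: "f = g \<longleftrightarrow> (AE x in lebesgue. rep_aefun f x = rep_aefun g x)"
  using Quotient3_rel_rep[OF Quotient3_aefun, of f g] by auto


section \<open>Weighted spaces of forms\<close>

text \<open>A strictly increasing multi-index is identified with its set of entries, and a form assigns
  to each multi-index its coefficient.  Forms of type \<open>(0,q)\<close> are those whose coefficients vanish
  outside multi-indices of length \<open>q\<close>, so there are no degrees to carry around in the
  norms and in the formula for the Cauchy--Riemann operator.\<close>

type_synonym 'n form = "'n set \<Rightarrow> (complex ^ 'n) aefun"

definition form_scale :: "complex \<Rightarrow> 'n::finite form \<Rightarrow> 'n form" where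
  "form_scale c f = (\<lambda>J. aescale c (f J))"

definition L2 :: "(complex ^ 'n::finite \<Rightarrow> real) \<Rightarrow> nat \<Rightarrow> 'n form set" where
  "L2 \<phi> q = {f. (\<forall>J. card J = q \<longrightarrow>
        integrable lebesgue (\<lambda>z. (cmod (rep_aefun (f J) z))\<^sup>2 * exp (- \<phi> z))) \<and>
      (\<forall>J. card J \<noteq> q \<longrightarrow> f J = 0)}"

definition inner_L2 :: "(complex ^ 'n::finite \<Rightarrow> real) \<Rightarrow> 'n form \<Rightarrow> 'n form \<Rightarrow> complex" where
  "inner_L2 \<phi> f g = (\<Sum>J\<in>UNIV. LINT z|lebesgue.
      rep_aefun (f J) z * cnj (rep_aefun (g J) z) * of_real (exp (- \<phi> z)))"

definition norm_L2 :: "(complex ^ 'n::finite \<Rightarrow> real) \<Rightarrow> 'n form \<Rightarrow> real" where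
  "norm_L2 \<phi> f = sqrt (\<Sum>J\<in>UNIV. LINT z|lebesgue. (cmod (rep_aefun (f J) z))\<^sup>2 * exp (- \<phi> z))"


section \<open>The Cauchy--Riemann operator, its adjoint and the complex Laplacian\<close>

text \<open>Writing \<open>e\<^sub>j\<close> for the differential of the conjugate of the coordinate \<open>z\<^sub>j\<close>, this is the
  coefficient of \<open>e\<^sub>K\<close> in \<open>e\<^sub>j \<and> e\<^sub>J\<close>.\<close>

definition wedge_coeff :: "'n::{finite,linorder} \<Rightarrow> 'n set \<Rightarrow> 'n set \<Rightarrow> complex" where
  "wedge_coeff j J K =
    (if j \<notin> J \<and> K = insert j J then (-1) ^ card {i \<in> J. i < j} else 0)"

text \<open>\<open>g\<close> is the Cauchy--Riemann operator applied to \<open>f\<close> in the sense of distributions.\<close>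

definition weak_dbar :: "'n::{finite,linorder} form \<Rightarrow> 'n form \<Rightarrow> bool" where
  "weak_dbar f g \<longleftrightarrow> (\<forall>K \<eta>. test_function \<eta> \<longrightarrow>
    (LINT z|lebesgue. rep_aefun (g K) z * \<eta> z) =
    (\<Sum>J\<in>UNIV. \<Sum>j\<in>UNIV. wedge_coeff j J K *
      - (LINT z|lebesgue. rep_aefun (f J) z * wirtinger_bar j \<eta> z)))"

definition dom_dbar :: "(complex ^ 'n::{finite,linorder} \<Rightarrow> real) \<Rightarrow> nat \<Rightarrow> 'n form set" where
  "dom_dbar \<phi> q = {f \<in> L2 \<phi> q. \<exists>g \<in> L2 \<phi> (q + 1). weak_dbar f g}"

definition dbar :: "(complex ^ 'n::{finite,linorder} \<Rightarrow> real) \<Rightarrow> nat \<Rightarrow> 'n form \<Rightarrow> 'n form" where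
  "dbar \<phi> q f = (THE g. g \<in> L2 \<phi> (q + 1) \<and> weak_dbar f g)"

text \<open>\<open>dbar_adj \<phi> q\<close> is the Hilbert space adjoint of \<open>dbar \<phi> q\<close>, so it acts on
  \<open>(0,q+1)\<close>-forms.\<close>

definition dom_dbar_adj :: "(complex ^ 'n::{finite,linorder} \<Rightarrow> real) \<Rightarrow> nat \<Rightarrow> 'n form set" where
  "dom_dbar_adj \<phi> q = {v \<in> L2 \<phi> (q + 1). \<exists>w \<in> L2 \<phi> q.
    \<forall>u \<in> dom_dbar \<phi> q. inner_L2 \<phi> (dbar \<phi> q u) v = inner_L2 \<phi> u w}"

definition dbar_adj :: "(complex ^ 'n::{finite,linorder} \<Rightarrow> real) \<Rightarrow> nat \<Rightarrow> 'n form \<Rightarrow> 'n form" where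
  "dbar_adj \<phi> q v = (THE w. w \<in> L2 \<phi> q \<and>
    (\<forall>u \<in> dom_dbar \<phi> q. inner_L2 \<phi> (dbar \<phi> q u) v = inner_L2 \<phi> u w))"

text \<open>The complex Laplacian on \<open>(0,1)\<close>-forms.\<close>

definition dom_laplacian :: "(complex ^ 'n::{finite,linorder} \<Rightarrow> real) \<Rightarrow> 'n form set" where
  "dom_laplacian \<phi> = {u \<in> dom_dbar \<phi> 1 \<inter> dom_dbar_adj \<phi> 0.
    dbar \<phi> 1 u \<in> dom_dbar_adj \<phi> 1 \<and> dbar_adj \<phi> 0 u \<in> dom_dbar \<phi> 0}"

definition laplacian :: "(complex ^ 'n::{finite,linorder} \<Rightarrow> real) \<Rightarrow> 'n form \<Rightarrow> 'n form" where
  "laplacian \<phi> u = dbar \<phi> 0 (dbar_adj \<phi> 0 u) + dbar_adj \<phi> 1 (dbar \<phi> 1 u)"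

text \<open>Meaningful when \<open>laplacian \<phi>\<close> maps its domain bijectively onto \<open>L2 \<phi> 1\<close>.\<close>

definition dbar_neumann :: "(complex ^ 'n::{finite,linorder} \<Rightarrow> real) \<Rightarrow> 'n form \<Rightarrow> 'n form" where
  "dbar_neumann \<phi> = inv_into (dom_laplacian \<phi>) (laplacian \<phi>)"

definition WQ :: "(complex ^ 'n::{finite,linorder} \<Rightarrow> real) \<Rightarrow> 'n form set" where
  "WQ \<phi> = {u \<in> L2 \<phi> 1. u \<in> dom_dbar \<phi> 1 \<inter> dom_dbar_adj \<phi> 0}"

definition norm_Q :: "(complex ^ 'n::{finite,linorder} \<Rightarrow> real) \<Rightarrow> 'n form \<Rightarrow> real" where
  "norm_Q \<phi> u = sqrt ((norm_L2 \<phi> (dbar \<phi> 1 u))\<^sup>2 + (norm_L2 \<phi> (dbar_adj \<phi> 0 u))\<^sup>2)"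


section \<open>Compact operators\<close>

text \<open>\<open>X\<close> and \<open>Y\<close> are spaces of forms, normed by \<open>nX\<close> and \<open>nY\<close>.\<close>

definition compact_operator ::
  "'n::finite form set \<Rightarrow> ('n form \<Rightarrow> real) \<Rightarrow> 'n form set \<Rightarrow> ('n form \<Rightarrow> real) \<Rightarrow>
    ('n form \<Rightarrow> 'n form) \<Rightarrow> bool" where
  "compact_operator X nX Y nY T \<longleftrightarrow>
    T ` X \<subseteq> Y \<and>
    (\<forall>f\<in>X. \<forall>g\<in>X. T (f + g) = T f + T g) \<and>
    (\<forall>c. \<forall>f\<in>X. T (form_scale c f) = form_scale c (T f)) \<and>
    (\<forall>S\<subseteq>X. (\<exists>B. \<forall>f\<in>S. nX f \<le> B) \<longrightarrow>
      compactin (Metric_space.mtopology Y (\<lambda>f g. nY (f - g)))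
        ((Metric_space.mtopology Y (\<lambda>f g. nY (f - g))) closure_of (T ` S)))"

text \<open>The topology used for the target \<open>L2 \<phi> q\<close> is indeed that of a metric space.\<close>

context
  fixes \<phi> :: "complex ^ 'n::finite \<Rightarrow> real"
  assumes cont: "continuous_on UNIV \<phi>"
begin

lemma weight_measurable [measurable]: "(\<lambda>z. exp (- \<phi> z)) \<in> borel_measurable lebesgue"
proof -
  have "(\<lambda>z. exp (- \<phi> z)) \<in> borel_measurable borel"
    by (intro borel_measurable_continuous_onI continuous_intros cont)
  then show ?thesis
    by (intro measurable_completion) simp
qed

lemma integrable_L2:
  assumes "f \<in> L2 \<phi> q"
  shows "integrable lebesgue (\<lambda>z. (cmod (rep_aefun (f J) z))\<^sup>2 * exp (- \<phi> z))"
proof (cases "card J = q")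
  case True
  then show ?thesis using assms by (simp add: L2_def)
next
  case False
  have "AE z in lebesgue. rep_aefun (0::(complex^'n) aefun) z = 0"
    using rep_abs_aefun[of "\<lambda>_. 0"] by (simp add: zero_aefun_def)
  then have "AE z in lebesgue. 0 = (cmod (rep_aefun (f J) z))\<^sup>2 * exp (- \<phi> z)"
    using assms False by (auto simp: L2_def elim: eventually_mono)
  from integrable_cong_AE_imp[OF _ _ this] show ?thesis
    by simp
qed

lemma norm_sq_L2:
  "(norm_L2 \<phi> f)\<^sup>2 = (\<Sum>J\<in>UNIV. LINT z|lebesgue. (cmod (rep_aefun (f J) z))\<^sup>2 * exp (- \<phi> z))"
  unfolding norm_L2_def by (intro real_sqrt_pow2 sum_nonneg integral_nonneg_AE) auto

lemma norm_L2_nonneg: "0 \<le> norm_L2 \<phi> f"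
  unfolding norm_L2_def by (intro real_sqrt_ge_zero sum_nonneg integral_nonneg_AE) auto

lemma norm_L2_commute: "norm_L2 \<phi> (f - g) = norm_L2 \<phi> (g - f)"
proof -
  have "(LINT z|lebesgue. (cmod (rep_aefun ((f - g) J) z))\<^sup>2 * exp (- \<phi> z)) =
        (LINT z|lebesgue. (cmod (rep_aefun ((g - f) J) z))\<^sup>2 * exp (- \<phi> z))" for J
  proof (rule integral_cong_AE)
    show "AE z in lebesgue. (cmod (rep_aefun ((f - g) J) z))\<^sup>2 * exp (- \<phi> z) =
        (cmod (rep_aefun ((g - f) J) z))\<^sup>2 * exp (- \<phi> z)"
      using rep_minus_aefun[of "f J" "g J"] rep_minus_aefun[of "g J" "f J"]
      by eventually_elim (simp add: norm_minus_commute)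
  qed measurable
  then show ?thesis by (simp add: norm_L2_def)
qed

lemma peter_paul:
  fixes a b :: complex and t :: real
  assumes "t > 0"
  shows "(cmod (a + b))\<^sup>2 \<le> (1 + t) * (cmod a)\<^sup>2 + (1 + 1 / t) * (cmod b)\<^sup>2"
proof -
  have "0 \<le> (t * cmod a - cmod b)\<^sup>2 / t" using assms by simp
  also have "\<dots> = t * (cmod a)\<^sup>2 + (cmod b)\<^sup>2 / t - 2 * cmod a * cmod b"
    using assms by (simp add: field_simps power2_eq_square)
  finally have "(cmod a + cmod b)\<^sup>2 \<le> (1 + t) * (cmod a)\<^sup>2 + (1 + 1 / t) * (cmod b)\<^sup>2"
    by (simp add: power2_sum algebra_simps)
  moreover have "(cmod (a + b))\<^sup>2 \<le> (cmod a + cmod b)\<^sup>2"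
    by (intro power_mono norm_triangle_ineq) auto
  ultimately show ?thesis by linarith
qed

lemma norm_L2_triangle:
  assumes f: "f \<in> L2 \<phi> q" and g: "g \<in> L2 \<phi> q" and h: "h \<in> L2 \<phi> q"
    and fg: "f - g \<in> L2 \<phi> q" and gh: "g - h \<in> L2 \<phi> q" and fh: "f - h \<in> L2 \<phi> q"
  shows "norm_L2 \<phi> (f - h) \<le> norm_L2 \<phi> (f - g) + norm_L2 \<phi> (g - h)"
proof -
  define A where "A = norm_L2 \<phi> (f - g)"
  define B where "B = norm_L2 \<phi> (g - h)"
  have AB: "0 \<le> A" "0 \<le> B" by (auto simp: A_def B_def norm_L2_nonneg)
  have main: "(norm_L2 \<phi> (f - h))\<^sup>2 \<le> (1 + t) * A\<^sup>2 + (1 + 1 / t) * B\<^sup>2" if t: "t > 0" for t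
  proof -
    have "(LINT z|lebesgue. (cmod (rep_aefun ((f - h) J) z))\<^sup>2 * exp (- \<phi> z)) \<le>
      (1 + t) * (LINT z|lebesgue. (cmod (rep_aefun ((f - g) J) z))\<^sup>2 * exp (- \<phi> z)) +
      (1 + 1 / t) * (LINT z|lebesgue. (cmod (rep_aefun ((g - h) J) z))\<^sup>2 * exp (- \<phi> z))" for J
    proof -
      have "AE z in lebesgue. (cmod (rep_aefun ((f - h) J) z))\<^sup>2 * exp (- \<phi> z) \<le>
        (1 + t) * ((cmod (rep_aefun ((f - g) J) z))\<^sup>2 * exp (- \<phi> z)) +
        (1 + 1 / t) * ((cmod (rep_aefun ((g - h) J) z))\<^sup>2 * exp (- \<phi> z))"
        using rep_minus_aefun[of "f J" "g J"] rep_minus_aefun[of "g J" "h J"]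
          rep_minus_aefun[of "f J" "h J"]
      proof eventually_elim
        case (elim z)
        have "(cmod (rep_aefun ((f - h) J) z))\<^sup>2 \<le> (1 + t) * (cmod (rep_aefun ((f - g) J) z))\<^sup>2 +
            (1 + 1 / t) * (cmod (rep_aefun ((g - h) J) z))\<^sup>2"
          using peter_paul[OF t, of "rep_aefun ((f - g) J) z" "rep_aefun ((g - h) J) z"] elim
          by simp
        from mult_right_mono[OF this, of "exp (- \<phi> z)"] show ?case
          by (simp add: algebra_simps)
      qed
      from integral_mono_AE[OF integrable_L2[OF fh, of J] _ this] show ?thesis
        using integrable_L2[OF fg, of J]
          integrable_L2[OF gh, of J] by simp
    qed
    then show ?thesis
      unfolding A_def B_def norm_sq_L2 sum_distrib_left sum.distrib[symmetric]
      by (intro sum_mono)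
  qed
  have "(norm_L2 \<phi> (f - h))\<^sup>2 \<le> (A + B + 2 * e)\<^sup>2" if e: "e > 0" for e
  proof -
    have pos: "A + e > 0" "B + e > 0" using AB e by auto
    have "(norm_L2 \<phi> (f - h))\<^sup>2 \<le>
        (1 + (B + e) / (A + e)) * A\<^sup>2 + (1 + 1 / ((B + e) / (A + e))) * B\<^sup>2"
      using pos by (intro main) simp
    also have "\<dots> \<le> (1 + (B + e) / (A + e)) * (A + e)\<^sup>2 + (1 + (A + e) / (B + e)) * (B + e)\<^sup>2"
      using AB e pos by (intro add_mono mult_mono power_mono) auto
    also have "\<dots> = (A + e)\<^sup>2 + (B + e) * (A + e) + ((B + e)\<^sup>2 + (A + e) * (B + e))"
    proof -
      have "(1 + y / x) * x\<^sup>2 = x\<^sup>2 + y * x" if "x > 0" for x y :: real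
        using that by (simp add: field_simps power2_eq_square)
      from this[OF pos(1), of "B + e"] this[OF pos(2), of "A + e"] show ?thesis by simp
    qed
    also have "\<dots> = (A + B + 2 * e)\<^sup>2"
      by (simp add: power2_eq_square algebra_simps)
    finally show ?thesis .
  qed
  then have le: "norm_L2 \<phi> (f - h) \<le> A + B + 2 * e" if "e > 0" for e
    using power2_le_imp_le AB that by (smt (verit, best))
  have "norm_L2 \<phi> (f - h) \<le> A + B"
  proof (rule field_le_epsilon)
    fix e :: real assume "0 < e"
    then show "norm_L2 \<phi> (f - h) \<le> A + B + e" using le[of "e / 2"] by simp
  qed
  then show ?thesis by (simp add: A_def B_def)
qed

lemma L2_diff:
  assumes f: "f \<in> L2 \<phi> q" and g: "g \<in> L2 \<phi> q"
  shows "f - g \<in> L2 \<phi> q"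
proof -
  have "integrable lebesgue (\<lambda>z. (cmod (rep_aefun ((f - g) J) z))\<^sup>2 * exp (- \<phi> z))" for J
  proof (rule Bochner_Integration.integrable_bound)
    show "integrable lebesgue (\<lambda>z. 2 * ((cmod (rep_aefun (f J) z))\<^sup>2 * exp (- \<phi> z)) +
        2 * ((cmod (rep_aefun (g J) z))\<^sup>2 * exp (- \<phi> z)))"
      using integrable_L2[OF f, of J] integrable_L2[OF g, of J] by simp
    show "AE z in lebesgue. norm ((cmod (rep_aefun ((f - g) J) z))\<^sup>2 * exp (- \<phi> z)) \<le>
        norm (2 * ((cmod (rep_aefun (f J) z))\<^sup>2 * exp (- \<phi> z)) +
          2 * ((cmod (rep_aefun (g J) z))\<^sup>2 * exp (- \<phi> z)))"
      using rep_minus_aefun[of "f J" "g J"]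
    proof eventually_elim
      case (elim z)
      have "(cmod (rep_aefun ((f - g) J) z))\<^sup>2 \<le>
          2 * (cmod (rep_aefun (f J) z))\<^sup>2 + 2 * (cmod (rep_aefun (g J) z))\<^sup>2"
        using peter_paul[of 1 "rep_aefun (f J) z" "- rep_aefun (g J) z"] elim by simp
      from mult_right_mono[OF this, of "exp (- \<phi> z)"] show ?case
        by (simp add: algebra_simps)
    qed
  qed measurable
  then show ?thesis using f g by (simp add: L2_def)
qed

lemma Metric_space_L2: "Metric_space (L2 \<phi> q) (\<lambda>f g. norm_L2 \<phi> (f - g))"
proof
  fix f g h
  show "0 \<le> norm_L2 \<phi> (f - g)" by (rule norm_L2_nonneg)
  show "norm_L2 \<phi> (f - g) = norm_L2 \<phi> (g - f)" by (rule norm_L2_commute)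
  assume f: "f \<in> L2 \<phi> q" and g: "g \<in> L2 \<phi> q"
  have *: "f J = g J \<longleftrightarrow> (LINT z|lebesgue. (cmod (rep_aefun ((f - g) J) z))\<^sup>2 * exp (- \<phi> z)) = 0"
    for J
  proof -
    have "(LINT z|lebesgue. (cmod (rep_aefun ((f - g) J) z))\<^sup>2 * exp (- \<phi> z)) = 0 \<longleftrightarrow>
        (AE z in lebesgue. rep_aefun ((f - g) J) z = 0)"
      by (subst integral_nonneg_eq_0_iff_AE[OF integrable_L2[OF L2_diff[OF f g]]]) auto
    also have "\<dots> \<longleftrightarrow> (AE z in lebesgue. rep_aefun (f J) z = rep_aefun (g J) z)"
      using rep_minus_aefun[of "f J" "g J"] by (auto elim: eventually_elim2)
    finally show ?thesis by (simp add: aefun_eq_iff)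
  qed
  have "norm_L2 \<phi> (f - g) = 0 \<longleftrightarrow>
      (\<forall>J. (LINT z|lebesgue. (cmod (rep_aefun ((f - g) J) z))\<^sup>2 * exp (- \<phi> z)) = 0)"
    unfolding norm_L2_def real_sqrt_eq_0_iff
    by (subst sum_nonneg_eq_0_iff) (auto intro!: integral_nonneg_AE)
  then show "norm_L2 \<phi> (f - g) = 0 \<longleftrightarrow> f = g"
    using * by (auto simp: fun_eq_iff)
  assume h: "h \<in> L2 \<phi> q"
  show "norm_L2 \<phi> (f - h) \<le> norm_L2 \<phi> (f - g) + norm_L2 \<phi> (g - h)"
    by (rule norm_L2_triangle[OF f g h]) (intro L2_diff f g h)+
qed

end

end

theory Submission
  imports Defs "HOL-Complex_Analysis.Great_Picard"
begin

text \<open>For test forms the Kohn--Morrey formula expresses the energy \<open>form_energy\<close> as the sum of the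
  weighted norms of all antiholomorphic derivatives plus the integral of the Levi form.  Hence bounded
  energy makes the mass outside a large ball small, because the lowest eigenvalue is large there; inside
  the ball integration by parts turns control of the antiholomorphic derivatives into control of the full
  gradient, and mollification together with the Arzela--Ascoli theorem gives compactness.  Cut-off and
  mollification carry this over to all forms in the domains of the operators.

  The resulting estimate of the norm by the energy lets the Riesz theorem solve the equation for the
  Laplacian weakly, with a bound for the energy of the solution.  That the weak solution lies in the
  domain of the Laplacian follows from the orthogonal decomposition along the kernel of the
  Cauchy--Riemann operator, which equals its own second adjoint.\<close>

section \<open>Functions of class C^k\<close>

text \<open>Two features of the hypotheses shape the proof. The lowest eigenvalue may vanish on a
  bounded set, so the Levi form controls only the tail of a form; inside, compact support and a
  Poincare inequality in a single complex direction take over. There the passage from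
  antiholomorphic to full derivatives is free: for zero weight the Kohn--Morrey identity says that
  the two Wirtinger derivatives of a compactly supported function have equal norm. Moreover
  \<open>\<phi>\<close> is only C^2, so the formal adjoint has variable C^1 coefficients and does
  not commute with convolution; its commutator is split into two ordinary mollification errors,
  after a cut-off that makes the gradient of \<open>\<phi>\<close> bounded. Squared norms are
  compared throughout, by |a + b|^2 \<le> 2 |a|^2 + 2 |b|^2, whence factors such as 10 = 2 + 2 (2 +
  2). Compactness is extracted in its weakest useful form, two close members in every bounded
  sequence, which excludes infinite separated sets and so yields total boundedness.\<close>

definition dir_deriv :: "'a::euclidean_space \<Rightarrow> ('a \<Rightarrow> 'b::real_normed_vector) \<Rightarrow> 'a \<Rightarrow> 'b" where
  "dir_deriv v f x = frechet_derivative f (at x) v"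

lemma dir_deriv_eqI: "(f has_derivative f') (at x) \<Longrightarrow> dir_deriv v f x = f' v"
  by (metis dir_deriv_def frechet_derivative_at)

lemma has_derivative_dir_deriv:
  "f differentiable at x \<Longrightarrow> (f has_derivative (\<lambda>v. dir_deriv v f x)) (at x)"
  by (simp add: dir_deriv_def frechet_derivative_works)

lemma Ck_Suc: "Ck (Suc k) f \<longleftrightarrow> (\<forall>x. f differentiable (at x)) \<and> (\<forall>v. Ck k (dir_deriv v f))"
  by (simp add: dir_deriv_def[abs_def])

declare Ck.simps(2) [simp del]

lemma Ck_SucD: "Ck (Suc k) f \<Longrightarrow> Ck k f"
proof (induction k arbitrary: f)
  case 0
  then show ?case
    by (simp add: Ck_Suc continuous_on_eq_continuous_within differentiable_imp_continuous_within)
next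
  case (Suc k)
  then show ?case by (subst Ck_Suc, subst (asm) (2) Ck_Suc) auto
qed

lemma Ck_mono: "Ck k f \<Longrightarrow> m \<le> k \<Longrightarrow> Ck m f"
  by (induction k) (auto simp: le_Suc_eq dest: Ck_SucD)

lemma Ck_continuous: "Ck k f \<Longrightarrow> continuous_on S f"
  using Ck_mono[of k f 0] continuous_on_subset[of UNIV f S] by simp

lemma Ck_differentiable: "Ck k f \<Longrightarrow> 0 < k \<Longrightarrow> f differentiable (at x)"
  by (cases k) (auto simp: Ck_Suc)

lemma Ck_dir_deriv: "Ck (Suc k) f \<Longrightarrow> Ck k (dir_deriv v f)"
  by (simp add: Ck_Suc)

lemma dir_deriv_const [simp]: "dir_deriv v (\<lambda>_. c) = (\<lambda>_. 0)"
  by (rule ext) (rule dir_deriv_eqI, rule has_derivative_const)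

lemma Ck_const [simp]: "Ck k (\<lambda>_. c)"
  by (induction k arbitrary: c) (auto simp: Ck_Suc)

lemma dir_deriv_bounded_linear:
  "bounded_linear T \<Longrightarrow> f differentiable at x \<Longrightarrow>
    dir_deriv v (\<lambda>y. T (f y)) x = T (dir_deriv v f x)"
  by (rule dir_deriv_eqI, rule bounded_linear.has_derivative) (auto intro: has_derivative_dir_deriv)

lemma Ck_bounded_linear: "bounded_linear T \<Longrightarrow> Ck k f \<Longrightarrow> Ck k (\<lambda>y. T (f y))"
proof (induction k arbitrary: f)
  case 0
  then show ?case by (auto intro: bounded_linear.continuous_on)
next
  case (Suc k)
  have d: "f differentiable (at x)" for x using Suc.prems by (simp add: Ck_Suc)
  have "dir_deriv v (\<lambda>y. T (f y)) = (\<lambda>y. T (dir_deriv v f y))" for v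
    using dir_deriv_bounded_linear[OF Suc.prems(1) d] by blast
  then show ?case using Suc d
    using differentiable_compose[OF bounded_linear_imp_differentiable[OF Suc.prems(1)] d]
    by (auto simp: Ck_Suc)
qed

lemma dir_deriv_add:
  "f differentiable at x \<Longrightarrow> g differentiable at x \<Longrightarrow>
    dir_deriv v (\<lambda>y. f y + g y) x = dir_deriv v f x + dir_deriv v g x"
  by (rule dir_deriv_eqI, rule has_derivative_add) (auto intro: has_derivative_dir_deriv)

lemma Ck_add: "Ck k f \<Longrightarrow> Ck k g \<Longrightarrow> Ck k (\<lambda>y. f y + g y)"
proof (induction k arbitrary: f g)
  case 0
  then show ?case by (auto intro: continuous_intros)
next
  case (Suc k)
  have d: "f differentiable (at x)" "g differentiable (at x)" for x
    using Suc.prems by (auto simp: Ck_Suc)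
  have "dir_deriv v (\<lambda>y. f y + g y) = (\<lambda>y. dir_deriv v f y + dir_deriv v g y)" for v
    using dir_deriv_add[OF d] by blast
  then show ?case using Suc d by (auto simp: Ck_Suc)
qed

lemma dir_deriv_bilinear:
  assumes "bounded_bilinear pr" "f differentiable at x" "g differentiable at x"
  shows "dir_deriv v (\<lambda>y. pr (f y) (g y)) x = pr (f x) (dir_deriv v g x) + pr (dir_deriv v f x) (g x)"
  by (rule dir_deriv_eqI, rule bounded_bilinear.FDERIV[OF assms(1)])
    (use assms in \<open>auto intro: has_derivative_dir_deriv\<close>)

text \<open>One induction for an arbitrary bounded bilinear product covers multiplication and
  \<open>scaleR\<close>. The derivative of a product keeps one factor undifferentiated, so
  \<open>Ck_SucD\<close> must also place both factors in the lower class.\<close>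

lemma Ck_bilinear:
  assumes pr: "bounded_bilinear pr"
  shows "Ck k f \<Longrightarrow> Ck k g \<Longrightarrow> Ck k (\<lambda>y. pr (f y) (g y))"
proof (induction k arbitrary: f g)
  case 0
  then show ?case using bounded_bilinear.continuous_on[OF pr] by auto
next
  case (Suc k)
  have d: "f differentiable (at x)" "g differentiable (at x)" for x
    using Suc.prems by (auto simp: Ck_Suc)
  have *: "dir_deriv v (\<lambda>y. pr (f y) (g y)) =
      (\<lambda>y. pr (f y) (dir_deriv v g y) + pr (dir_deriv v f y) (g y))" for v
    using dir_deriv_bilinear[OF pr d] by blast
  have "(\<lambda>y. pr (f y) (g y)) differentiable (at x)" for x
    using bounded_bilinear.FDERIV[OF pr has_derivative_dir_deriv[OF d(1)] has_derivative_dir_deriv[OF d(2)]]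
    by (auto simp: differentiable_def)
  then show ?case using Suc.prems
    by (auto simp: Ck_Suc * intro!: Ck_add Suc.IH dest: Ck_SucD)
      (auto intro!: Ck_add Suc.IH Ck_SucD[of k f] Ck_SucD[of k g] simp: Ck_Suc)
qed

lemmas Ck_mult = Ck_bilinear[OF bounded_bilinear_mult]
  and Ck_scaleR = Ck_bilinear[OF bounded_bilinear_scaleR]
  and dir_deriv_mult = dir_deriv_bilinear[OF bounded_bilinear_mult]
  and dir_deriv_scaleR = dir_deriv_bilinear[OF bounded_bilinear_scaleR]

lemmas Ck_cnj = Ck_bounded_linear[OF bounded_linear_cnj]
  and Ck_of_real = Ck_bounded_linear[OF bounded_linear_of_real]
  and dir_deriv_cnj = dir_deriv_bounded_linear[OF bounded_linear_cnj]
  and dir_deriv_of_real = dir_deriv_bounded_linear[OF bounded_linear_of_real]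

lemma Ck_minus: "Ck k f \<Longrightarrow> Ck k (\<lambda>y. - f y)"
  by (rule Ck_bounded_linear[OF bounded_linear_minus[OF bounded_linear_ident]])

lemma dir_deriv_minus: "f differentiable at x \<Longrightarrow> dir_deriv v (\<lambda>y. - f y) x = - dir_deriv v f x"
  by (rule dir_deriv_bounded_linear[OF bounded_linear_minus[OF bounded_linear_ident]])

lemma Ck_diff: "Ck k f \<Longrightarrow> Ck k g \<Longrightarrow> Ck k (\<lambda>y. f y - g y)"
  using Ck_add[of k f "\<lambda>y. - g y"] Ck_minus[of k g] by simp

lemma dir_deriv_exp:
  fixes f :: "'a::euclidean_space \<Rightarrow> real"
  shows "f differentiable at x \<Longrightarrow> dir_deriv v (\<lambda>y. exp (f y)) x = exp (f x) * dir_deriv v f x"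
  by (rule dir_deriv_eqI) (auto intro!: derivative_eq_intros has_derivative_dir_deriv)

lemma Ck_exp:
  fixes f :: "'a::euclidean_space \<Rightarrow> real"
  shows "Ck k f \<Longrightarrow> Ck k (\<lambda>y. exp (f y))"
proof (induction k)
  case 0
  then show ?case by (auto intro: continuous_intros)
next
  case (Suc k)
  have d: "f differentiable (at x)" for x using Suc.prems by (auto simp: Ck_Suc)
  have *: "dir_deriv v (\<lambda>y. exp (f y)) = (\<lambda>y. exp (f y) * dir_deriv v f y)" for v
    using dir_deriv_exp[OF d] by blast
  have "(\<lambda>y. exp (f y)) differentiable (at x)" for x
    using has_derivative_exp[OF has_derivative_dir_deriv[OF d]] by (auto simp: differentiable_def)
  then show ?case using Suc.prems Suc.IH[OF Ck_SucD] by (auto simp: Ck_Suc * intro!: Ck_mult)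
qed

lemma dir_deriv_affine:
  assumes "bounded_linear L" "f differentiable at (a + L x)"
  shows "dir_deriv v (\<lambda>y. f (a + L y)) x = dir_deriv (L v) f (a + L x)"
proof (rule dir_deriv_eqI)
  have "((\<lambda>y. a + L y) has_derivative L) (at x)"
    using assms(1) by (auto intro!: derivative_eq_intros bounded_linear_imp_has_derivative)
  from has_derivative_compose[OF this has_derivative_dir_deriv[OF assms(2)]]
  show "((\<lambda>y. f (a + L y)) has_derivative (\<lambda>v. dir_deriv (L v) f (a + L x))) (at x)" .
qed

lemma Ck_affine:
  assumes L: "bounded_linear L"
  shows "Ck k f \<Longrightarrow> Ck k (\<lambda>y. f (a + L y))"
proof (induction k arbitrary: f)
  case 0
  have "continuous_on UNIV (\<lambda>y. a + L y)"
    using L by (intro continuous_intros) (simp add: linear_continuous_on)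
  then show ?case using continuous_on_compose2[of UNIV f UNIV "\<lambda>y. a + L y"] 0 by simp
next
  case (Suc k)
  have d: "f differentiable (at x)" for x using Suc.prems by (auto simp: Ck_Suc)
  have *: "dir_deriv v (\<lambda>y. f (a + L y)) = (\<lambda>y. dir_deriv (L v) f (a + L y))" for v
    using dir_deriv_affine[OF L d] by blast
  have "(\<lambda>y. f (a + L y)) differentiable (at x)" for x
  proof -
    have "(\<lambda>y. a + L y) differentiable (at x)"
      using L by (intro derivative_intros) (rule bounded_linear_imp_differentiable)
    then show ?thesis using differentiable_compose[OF d] by blast
  qed
  then show ?case using Suc by (auto simp: Ck_Suc *)
qed

lemma dir_deriv_lincomb:
  assumes "f differentiable at x"
  shows "dir_deriv (a + b) f x = dir_deriv a f x + dir_deriv b f x"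
    and "dir_deriv (r *\<^sub>R a) f x = r *\<^sub>R dir_deriv a f x"
  using linear_simps(1,5)[OF has_derivative_bounded_linear[OF has_derivative_dir_deriv[OF assms]]]
  by auto

lemma dir_deriv_line:
  assumes "f differentiable at (x + t *\<^sub>R v)"
  shows "((\<lambda>t. f (x + t *\<^sub>R v)) has_vector_derivative dir_deriv v f (x + t *\<^sub>R v)) (at t)"
proof -
  have "((\<lambda>t. x + t *\<^sub>R v) has_derivative (\<lambda>h. h *\<^sub>R v)) (at t)"
    by (auto intro!: derivative_eq_intros)
  from has_derivative_compose[OF this has_derivative_dir_deriv[OF assms]]
  show ?thesis by (simp add: has_vector_derivative_def dir_deriv_lincomb(2)[OF assms])
qed

lemma dir_deriv_expand:
  assumes "f differentiable at x"
  shows "dir_deriv v f x = (\<Sum>b\<in>Basis. (v \<bullet> b) *\<^sub>R dir_deriv b f x)"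
proof -
  have "linear (\<lambda>v. dir_deriv v f x)"
    using has_derivative_dir_deriv[OF assms] by (rule has_derivative_linear)
  then have "dir_deriv (\<Sum>b\<in>Basis. (v \<bullet> b) *\<^sub>R b) f x = (\<Sum>b\<in>Basis. (v \<bullet> b) *\<^sub>R dir_deriv b f x)"
    using linear_sum[of "\<lambda>v. dir_deriv v f x" "\<lambda>b. (v \<bullet> b) *\<^sub>R b" Basis]
      linear_scale[of "\<lambda>v. dir_deriv v f x"] by simp
  then show ?thesis by (simp add: euclidean_representation)
qed

text \<open>Serves where no differentiation rule applies: bump functions at the edge of their
  support, and convolutions. In both cases the estimates provide a quadratic bound of the remainder
  for all \<open>y\<close>.\<close>

lemma has_derivative_quadratic:
  assumes "bounded_linear f'" and C: "\<And>y. norm (f y - f x - f' (y - x)) \<le> C * (norm (y - x))\<^sup>2"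
  shows "(f has_derivative f') (at x)"
proof -
  have "((\<lambda>y. norm (f y - f x - f' (y - x)) / norm (y - x)) \<longlongrightarrow> 0) (at x)"
  proof (rule tendsto_sandwich[OF _ _ tendsto_const])
    show "\<forall>\<^sub>F y in at x. 0 \<le> norm (f y - f x - f' (y - x)) / norm (y - x)" by auto
    show "\<forall>\<^sub>F y in at x. norm (f y - f x - f' (y - x)) / norm (y - x) \<le> C * norm (y - x)"
      using C by (auto simp: eventually_at_filter divide_le_eq power2_eq_square mult.assoc)
    have "((\<lambda>y. C * norm (y - x)) \<longlongrightarrow> C * norm (x - x)) (at x)" by (intro tendsto_intros)
    then show "((\<lambda>y. C * norm (y - x)) \<longlongrightarrow> 0) (at x)" by simp
  qed
  then show ?thesis using assms by (simp add: has_derivative_iff_norm)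
qed

text \<open>Maclaurin's formula for the restriction of \<open>f\<close> to the line through
  \<open>x\<close> in direction \<open>v\<close>.\<close>

lemma taylor2:
  fixes f :: "'a::euclidean_space \<Rightarrow> real"
  assumes f: "Ck 2 f"
  obtains t where "0 < t" "t < 1"
    "f (x + v) = f x + dir_deriv v f x + dir_deriv v (dir_deriv v f) (x + t *\<^sub>R v) / 2"
proof -
  have f2: "Ck (Suc 1) f" using f by (simp add: numeral_2_eq_2)
  have d: "f differentiable (at y)" for y using f2 by (simp add: Ck_Suc)
  have d': "dir_deriv v f differentiable (at y)" for y
    using Ck_dir_deriv[OF f2, of v] by (simp add: Ck_Suc)
  define D where "D m t = (if m = 0 then f (x + t *\<^sub>R v) else if m = 1 then dir_deriv v f (x + t *\<^sub>R v)
    else dir_deriv v (dir_deriv v f) (x + t *\<^sub>R v))" for m :: nat and t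
  have "\<exists>t>0. t < 1 \<and> f (x + 1 *\<^sub>R v) = (\<Sum>m<2. D m 0 / fact m * 1 ^ m) + D 2 t / fact 2 * 1 ^ 2"
  proof (rule Maclaurin[of 1 2 D "\<lambda>t. f (x + t *\<^sub>R v)"])
    show "\<forall>m t. m < 2 \<and> 0 \<le> t \<and> t \<le> 1 \<longrightarrow> (D m has_real_derivative D (Suc m) t) (at t)"
    proof (intro allI impI)
      fix m t assume "m < (2::nat) \<and> 0 \<le> t \<and> t \<le> (1::real)"
      then consider "m = 0" | "m = 1" by linarith
      then show "(D m has_real_derivative D (Suc m) t) (at t)"
        by cases (simp_all add: D_def[abs_def] has_real_derivative_iff_has_vector_derivative
            dir_deriv_line[OF d] dir_deriv_line[OF d'])
    qed
  qed (auto simp: D_def)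
  then obtain t where "0 < t" "t < 1"
    "f (x + 1 *\<^sub>R v) = (\<Sum>m<2. D m 0 / fact m * 1 ^ m) + D 2 t / fact 2 * 1 ^ 2" by blast
  then show ?thesis by (intro that[of t]) (auto simp: D_def numeral_2_eq_2)
qed

lemma dir_deriv2_expand:
  assumes f: "Ck 2 f"
  shows "dir_deriv v (dir_deriv w f) x =
    (\<Sum>b\<in>Basis. \<Sum>c\<in>Basis. ((v \<bullet> b) * (w \<bullet> c)) *\<^sub>R dir_deriv b (dir_deriv c f) x)"
proof -
  have f2: "Ck (Suc 1) f" using f by (simp add: numeral_2_eq_2)
  have d: "f differentiable (at y)" for y using f2 by (simp add: Ck_Suc)
  have d': "dir_deriv u f differentiable (at y)" for y u
    using Ck_dir_deriv[OF f2, of u] by (simp add: Ck_Suc)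
  have "dir_deriv b (dir_deriv w f) x = (\<Sum>c\<in>Basis. (w \<bullet> c) *\<^sub>R dir_deriv b (dir_deriv c f) x)" for b
  proof (rule dir_deriv_eqI)
    have "dir_deriv w f = (\<lambda>y. \<Sum>c\<in>Basis. (w \<bullet> c) *\<^sub>R dir_deriv c f y)"
      using dir_deriv_expand[OF d] by blast
    then show "(dir_deriv w f has_derivative (\<lambda>v. \<Sum>c\<in>Basis. (w \<bullet> c) *\<^sub>R dir_deriv v (dir_deriv c f) x)) (at x)"
      by (auto intro!: derivative_eq_intros has_derivative_dir_deriv d')
  qed
  then show ?thesis
    by (subst dir_deriv_expand[OF d']) (simp add: scaleR_sum_right)
qed

subsection \<open>Symmetry of second derivatives\<close>

text \<open>The mean value theorem is used twice: in direction \<open>u\<close> for the increment of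
  \<open>f\<close> along \<open>v\<close>, then in direction \<open>v\<close> for the derivative
  along \<open>u\<close>. The left side is symmetric in \<open>u\<close> and \<open>v\<close>, the
  right side is not, and this gap is the point.\<close>

lemma second_difference_mvt:
  fixes f :: "'a::euclidean_space \<Rightarrow> real"
  assumes f: "Ck 2 f" and h: "h > 0"
  shows "\<exists>s\<in>{0<..<h}. \<exists>t\<in>{0<..<h}.
    f (x + h *\<^sub>R u + h *\<^sub>R v) - f (x + h *\<^sub>R u) - f (x + h *\<^sub>R v) + f x =
      h * h * dir_deriv v (dir_deriv u f) (x + s *\<^sub>R u + t *\<^sub>R v)"
proof -
  have f2: "Ck (Suc 1) f" using f by (simp add: numeral_2_eq_2)
  have d: "f differentiable (at y)" for y using f2 by (simp add: Ck_Suc)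
  have d': "dir_deriv u f differentiable (at y)" for y
    using Ck_dir_deriv[OF f2, of u] by (simp add: Ck_Suc)
  define g where "g s = f (x + h *\<^sub>R v + s *\<^sub>R u) - f (x + s *\<^sub>R u)" for s
  have g: "(g has_real_derivative dir_deriv u f (x + h *\<^sub>R v + s *\<^sub>R u) - dir_deriv u f (x + s *\<^sub>R u)) (at s)" for s
    unfolding g_def has_real_derivative_iff_has_vector_derivative
    by (intro has_vector_derivative_diff dir_deriv_line d)
  obtain s where s: "0 < s" "s < h"
    "g h - g 0 = (h - 0) * (dir_deriv u f (x + h *\<^sub>R v + s *\<^sub>R u) - dir_deriv u f (x + s *\<^sub>R u))"
    using MVT2[OF h, of g "\<lambda>s. dir_deriv u f (x + h *\<^sub>R v + s *\<^sub>R u) - dir_deriv u f (x + s *\<^sub>R u)"] g by blast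
  define k where "k t = dir_deriv u f (x + s *\<^sub>R u + t *\<^sub>R v)" for t
  have k: "(k has_real_derivative dir_deriv v (dir_deriv u f) (x + s *\<^sub>R u + t *\<^sub>R v)) (at t)" for t
    unfolding k_def has_real_derivative_iff_has_vector_derivative
    by (intro dir_deriv_line d')
  obtain t where t: "0 < t" "t < h"
    "k h - k 0 = (h - 0) * dir_deriv v (dir_deriv u f) (x + s *\<^sub>R u + t *\<^sub>R v)"
    using MVT2[OF h, of k "\<lambda>t. dir_deriv v (dir_deriv u f) (x + s *\<^sub>R u + t *\<^sub>R v)"] k by blast
  have "g h - g 0 = h * (k h - k 0)"
    using s(3) by (simp add: k_def algebra_simps)
  then have "g h - g 0 = h * h * dir_deriv v (dir_deriv u f) (x + s *\<^sub>R u + t *\<^sub>R v)"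
    using t(3) by simp
  then show ?thesis using s t by (intro bexI[of _ s] bexI[of _ t]) (auto simp: g_def algebra_simps)
qed

text \<open>The symmetric second difference equals \<open>h * h\<close> times either mixed
  derivative at some point near \<open>x\<close>. As \<open>h\<close> tends to zero, continuity of
  both mixed derivatives carries the equality to \<open>x\<close>.\<close>

lemma dir_deriv_commute_real:
  fixes f :: "'a::euclidean_space \<Rightarrow> real"
  assumes f: "Ck 2 f"
  shows "dir_deriv v (dir_deriv u f) x = dir_deriv u (dir_deriv v f) x"
proof -
  define h where "h n = inverse (real (Suc n))" for n
  have h: "h n > 0" for n by (simp add: h_def)
  have h0: "h \<longlonglongrightarrow> 0" unfolding h_def by (rule LIMSEQ_inverse_real_of_nat)
  obtain s t where st: "s n \<in> {0<..<h n}" "t n \<in> {0<..<h n}"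
    "f (x + h n *\<^sub>R u + h n *\<^sub>R v) - f (x + h n *\<^sub>R u) - f (x + h n *\<^sub>R v) + f x =
      h n * h n * dir_deriv v (dir_deriv u f) (x + s n *\<^sub>R u + t n *\<^sub>R v)" for n
    using second_difference_mvt[OF f h, where x = x and u = u and v = v] unfolding Bex_def by metis
  obtain s' t' where st': "s' n \<in> {0<..<h n}" "t' n \<in> {0<..<h n}"
    "f (x + h n *\<^sub>R v + h n *\<^sub>R u) - f (x + h n *\<^sub>R v) - f (x + h n *\<^sub>R u) + f x =
      h n * h n * dir_deriv u (dir_deriv v f) (x + s' n *\<^sub>R v + t' n *\<^sub>R u)" for n
    using second_difference_mvt[OF f h, where x = x and u = v and v = u] unfolding Bex_def by metis
  have lim0: "r \<longlonglongrightarrow> 0" if "\<And>n. r n \<in> {0<..<h n}" for r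
    using that by (intro tendsto_sandwich[OF _ _ tendsto_const h0]) (auto intro!: always_eventually less_imp_le)
  have c: "isCont (dir_deriv a (dir_deriv b f)) y" for a b y
    using f Ck_continuous[of 0 "dir_deriv a (dir_deriv b f)" UNIV]
    by (simp add: numeral_2_eq_2 Ck_Suc continuous_on_eq_continuous_at)
  have 1: "(\<lambda>n. dir_deriv v (dir_deriv u f) (x + s n *\<^sub>R u + t n *\<^sub>R v)) \<longlonglongrightarrow>
      dir_deriv v (dir_deriv u f) (x + 0 *\<^sub>R u + 0 *\<^sub>R v)"
    by (intro isCont_tendsto_compose[OF c] tendsto_intros lim0 st)
  have 2: "(\<lambda>n. dir_deriv u (dir_deriv v f) (x + s' n *\<^sub>R v + t' n *\<^sub>R u)) \<longlonglongrightarrow>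
      dir_deriv u (dir_deriv v f) (x + 0 *\<^sub>R v + 0 *\<^sub>R u)"
    by (intro isCont_tendsto_compose[OF c] tendsto_intros lim0 st')
  have "dir_deriv v (dir_deriv u f) (x + s n *\<^sub>R u + t n *\<^sub>R v) =
      dir_deriv u (dir_deriv v f) (x + s' n *\<^sub>R v + t' n *\<^sub>R u)" for n
  proof -
    have "f (x + h n *\<^sub>R u + h n *\<^sub>R v) - f (x + h n *\<^sub>R u) - f (x + h n *\<^sub>R v) + f x =
      f (x + h n *\<^sub>R v + h n *\<^sub>R u) - f (x + h n *\<^sub>R v) - f (x + h n *\<^sub>R u) + f x"
      by (simp add: algebra_simps)
    then have "h n * h n * dir_deriv v (dir_deriv u f) (x + s n *\<^sub>R u + t n *\<^sub>R v) =
      h n * h n * dir_deriv u (dir_deriv v f) (x + s' n *\<^sub>R v + t' n *\<^sub>R u)"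
      using st(3)[of n] st'(3)[of n] by linarith
    then show ?thesis using h[of n] by simp
  qed
  then show ?thesis using LIMSEQ_unique[OF 1] 2 by simp
qed

text \<open>Taken componentwise, because the intermediate points of the mean value theorem depend on
  the component.\<close>

lemma dir_deriv_commute:
  fixes f :: "'a::euclidean_space \<Rightarrow> 'b::euclidean_space"
  assumes f: "Ck 2 f"
  shows "dir_deriv v (dir_deriv u f) x = dir_deriv u (dir_deriv v f) x"
proof (rule euclidean_eqI)
  fix b :: 'b
  have f2: "Ck (Suc 1) f" using f by (simp add: numeral_2_eq_2)
  have bl: "bounded_linear (\<lambda>y::'b. y \<bullet> b)" by (rule bounded_linear_inner_left)
  have d: "f differentiable (at y)" for y using f2 by (simp add: Ck_Suc)
  have d': "dir_deriv w f differentiable (at y)" for y w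
    using Ck_dir_deriv[OF f2, of w] by (simp add: Ck_Suc)
  have 1: "dir_deriv w (\<lambda>y. f y \<bullet> b) = (\<lambda>y. dir_deriv w f y \<bullet> b)" for w
    using dir_deriv_bounded_linear[OF bl d] by blast
  have 2: "dir_deriv w' (dir_deriv w (\<lambda>y. f y \<bullet> b)) y = dir_deriv w' (dir_deriv w f) y \<bullet> b" for w w' y
    unfolding 1 using dir_deriv_bounded_linear[OF bl d'] by blast
  show "dir_deriv v (dir_deriv u f) x \<bullet> b = dir_deriv u (dir_deriv v f) x \<bullet> b"
    using dir_deriv_commute_real[OF Ck_bounded_linear[OF bl f], of v u x] by (simp add: 2)
qed

subsection \<open>Compactly supported functions and integration by parts\<close>

text \<open>Support in a ball keeps explicit radii through derivatives, products and convolutions;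
  \<open>compact_support_iff\<close> relates it to the compact closure in
  \<open>test_function\<close>.\<close>

definition Cc :: "nat \<Rightarrow> ('a::euclidean_space \<Rightarrow> 'b::real_normed_vector) \<Rightarrow> bool" where
  "Cc k f \<longleftrightarrow> Ck k f \<and> (\<exists>R. \<forall>x. norm x > R \<longrightarrow> f x = 0)"

lemma compact_support_iff:
  fixes f :: "'a::euclidean_space \<Rightarrow> 'b::zero"
  shows "compact (closure {x. f x \<noteq> 0}) \<longleftrightarrow> (\<exists>R. \<forall>x. norm x > R \<longrightarrow> f x = 0)"
proof -
  have "compact (closure {x. f x \<noteq> 0}) \<longleftrightarrow> bounded {x. f x \<noteq> 0}"
    by (metis bounded_closure closure_subset bounded_subset closed_closure compact_eq_bounded_closed)
  also have "\<dots> \<longleftrightarrow> (\<exists>R. \<forall>x. norm x > R \<longrightarrow> f x = 0)"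
    unfolding bounded_iff by (auto simp: not_less) (metis not_less)+
  finally show ?thesis .
qed

lemma test_function_iff: "test_function \<eta> \<longleftrightarrow> (\<forall>k. Cc k \<eta>)"
  unfolding test_function_def Cc_def compact_support_iff by blast

lemma CcD: "Cc k f \<Longrightarrow> Ck k f"
  by (simp add: Cc_def)

lemma Cc_mono: "Cc k f \<Longrightarrow> m \<le> k \<Longrightarrow> Cc m f"
  by (auto simp: Cc_def intro: Ck_mono)

lemma Cc_bilinear:
  assumes pr: "bounded_bilinear pr"
  shows "Cc k f \<Longrightarrow> Ck k g \<Longrightarrow> Cc k (\<lambda>y. pr (f y) (g y))"
    and "Ck k f \<Longrightarrow> Cc k g \<Longrightarrow> Cc k (\<lambda>y. pr (f y) (g y))"
  by (auto simp: Cc_def intro!: Ck_bilinear[OF pr])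
    (metis bounded_bilinear.zero_left[OF pr] bounded_bilinear.zero_right[OF pr])+

lemmas Cc_mult = Cc_bilinear[OF bounded_bilinear_mult]
  and Cc_scaleR = Cc_bilinear[OF bounded_bilinear_scaleR]

lemma Cc_add: "Cc k f \<Longrightarrow> Cc k g \<Longrightarrow> Cc k (\<lambda>y. f y + g y)"
proof -
  assume "Cc k f" "Cc k g"
  then obtain R S where "\<forall>x. norm x > R \<longrightarrow> f x = 0" "\<forall>x. norm x > S \<longrightarrow> g x = 0" "Ck k f" "Ck k g"
    by (auto simp: Cc_def)
  then show ?thesis by (auto simp: Cc_def intro!: Ck_add exI[of _ "max R S"])
qed

lemma Cc_bounded_linear: "bounded_linear T \<Longrightarrow> Cc k f \<Longrightarrow> Cc k (\<lambda>y. T (f y))"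
  unfolding Cc_def by (metis Ck_bounded_linear linear_simps(3))

lemmas Cc_cnj = Cc_bounded_linear[OF bounded_linear_cnj]
  and Cc_of_real = Cc_bounded_linear[OF bounded_linear_of_real]
  and Cc_minus = Cc_bounded_linear[OF bounded_linear_minus[OF bounded_linear_ident]]

lemma Cc_zero [simp]: "Cc k (\<lambda>_. 0)"
  by (simp add: Cc_def)

lemma Cc_sum: "(\<And>i. i \<in> I \<Longrightarrow> Cc k (f i)) \<Longrightarrow> Cc k (\<lambda>y. \<Sum>i\<in>I. f i y)"
  by (induction I rule: infinite_finite_induct) (auto intro: Cc_add)

lemma Cc_diff: "Cc k f \<Longrightarrow> Cc k g \<Longrightarrow> Cc k (\<lambda>y. f y - g y)"
  using Cc_add[of k f "\<lambda>y. - g y"] Cc_minus[of k g] by simp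

lemma dir_deriv_outside:
  assumes "\<And>x. norm x > R \<Longrightarrow> f x = 0" "norm x > R"
  shows "dir_deriv v f x = 0"
proof -
  have "open {x::'a. norm x > R}" by (intro open_Collect_less continuous_intros)
  then have "(f has_derivative (\<lambda>_. 0)) (at x)"
    by (intro has_derivative_transform_within_open[OF has_derivative_const[of 0]])
      (use assms in auto)
  from dir_deriv_eqI[OF this] show ?thesis .
qed

lemma Cc_dir_deriv: "Cc (Suc k) f \<Longrightarrow> Cc k (dir_deriv v f)"
  unfolding Cc_def by (metis Ck_dir_deriv dir_deriv_outside)

lemma Cc_integrable:
  fixes f :: "'a::euclidean_space \<Rightarrow> 'b::euclidean_space"
  assumes "Cc k f"
  shows "integrable lborel f" and "integrable lebesgue f" and "f \<in> borel_measurable borel"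
proof -
  obtain R where R: "\<And>x. norm x > R \<Longrightarrow> f x = 0" using assms by (auto simp: Cc_def)
  have c: "continuous_on S f" for S using assms Ck_continuous by (auto simp: Cc_def)
  show m: "f \<in> borel_measurable borel" using c by (rule borel_measurable_continuous_onI)
  have "integrable lborel (\<lambda>x. indicator (cball 0 R) x *\<^sub>R f x)"
    by (intro borel_integrable_compact c compact_cball)
  also have "(\<lambda>x. indicator (cball 0 R) x *\<^sub>R f x) = f"
    using R by (fastforce simp: indicator_def not_le)
  finally show "integrable lborel f" .
  then show "integrable lebesgue f" using m by (simp add: integrable_completion)
qed

lemma Cc_bounded:
  fixes f :: "'a::euclidean_space \<Rightarrow> 'b::real_normed_vector"
  assumes "Cc k f"
  obtains K where "K > 0" "\<And>x. norm (f x) \<le> K"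
proof -
  obtain R where R: "\<And>x. norm x > R \<Longrightarrow> f x = 0" using assms by (auto simp: Cc_def)
  have "bounded (f ` cball 0 R)"
    by (intro compact_imp_bounded compact_continuous_image compact_cball Ck_continuous[OF CcD[OF assms]])
  then obtain K where K: "K > 0" "\<And>x. norm x \<le> R \<Longrightarrow> norm (f x) \<le> K"
    by (auto simp: bounded_pos)
  have "norm (f x) \<le> K" for x using K R[of x] by (cases "norm x \<le> R") auto
  with K(1) that show ?thesis by blast
qed

lemma dir_deriv_lipschitz:
  assumes "\<And>y. f differentiable (at y)" "\<And>y. norm (dir_deriv v f y) \<le> K"
  shows "norm (f (x + t *\<^sub>R v) - f x) \<le> K * \<bar>t\<bar>"
proof -
  have "norm (f (x + t *\<^sub>R v) - f (x + 0 *\<^sub>R v)) \<le> K * norm (t - 0)"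
    using dir_deriv_line[OF assms(1), unfolded has_vector_derivative_def] 
    by (intro differentiable_bound[of UNIV "\<lambda>t. f (x + t *\<^sub>R v)" "\<lambda>t h. h *\<^sub>R dir_deriv v f (x + t *\<^sub>R v)"])
      (auto intro!: onorm_le mult_left_mono assms(2) simp: mult.commute[of K])
  then show ?thesis by simp
qed

lemma lborel_integral_translate:
  fixes f :: "'a::euclidean_space \<Rightarrow> 'b::{banach, second_countable_topology}"
  assumes "f \<in> borel_measurable borel"
  shows "(LINT x|lborel. f (a + x)) = (LINT x|lborel. f x)"
proof -
  have "(LINT x|lborel. f x) = (LINT x|distr lborel borel ((+) a). f x)"
    by (simp add: lborel_distr_plus)
  also have "\<dots> = (LINT x|lborel. f (a + x))" by (rule integral_distr) (use assms in auto)
  finally show ?thesis by simp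
qed

text \<open>Differentiates the translation-invariant integral of \<open>f\<close> along \<open>v\<close>.\<close>

lemma integral_dir_deriv:
  fixes f :: "'a::euclidean_space \<Rightarrow> 'b::euclidean_space"
  assumes f: "Cc (Suc k) f"
  shows "(LINT x|lebesgue. dir_deriv v f x) = 0"
proof -
  have f1: "Cc (Suc 0) f" using f Cc_mono by fastforce
  obtain R where R: "\<And>x. norm x > R \<Longrightarrow> f x = 0" using f by (auto simp: Cc_def)
  have d: "f differentiable (at y)" for y using f by (auto simp: Cc_def Ck_Suc)
  obtain K where K: "K > 0" "\<And>x. norm (dir_deriv v f x) \<le> K"
    using Cc_bounded[OF Cc_dir_deriv[OF f]] by blast
  define h where "h n = inverse (real (Suc n))" for n
  have h: "h n > 0" "h n \<le> 1" for n by (auto simp: h_def inverse_le_1_iff)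
  have h0: "filterlim h (at 0) sequentially"
    unfolding filterlim_at h_def by (intro conjI LIMSEQ_inverse_real_of_nat) auto
  define q where "q n x = (f (x + h n *\<^sub>R v) - f x) /\<^sub>R h n" for n x
  have fm [measurable]: "f \<in> borel_measurable borel" using Cc_integrable[OF f] by blast
  have fi: "integrable lborel f" using Cc_integrable[OF f] by blast
  have tr: "integrable lborel (\<lambda>x. f (x + a))" for a
  proof -
    have "integrable (distr lborel borel ((+) a)) f" by (simp add: lborel_distr_plus fi)
    then have "integrable lborel (\<lambda>x. f (a + x))" by (subst (asm) integrable_distr_eq) auto
    then show ?thesis by (simp add: add.commute)
  qed
  have q0: "(LINT x|lborel. q n x) = 0" for n
  proof -
    have "(LINT x|lborel. q n x) = ((LINT x|lborel. f (x + h n *\<^sub>R v)) - (LINT x|lborel. f x)) /\<^sub>R h n"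
      unfolding q_def using tr[of "h n *\<^sub>R v"] fi by simp
    also have "(LINT x|lborel. f (x + h n *\<^sub>R v)) = (LINT x|lborel. f x)"
      using lborel_integral_translate[OF fm, of "h n *\<^sub>R v"] by (simp add: add.commute)
    finally show ?thesis by simp
  qed
  have "(\<lambda>n. LINT x|lborel. q n x) \<longlonglongrightarrow> (LINT x|lborel. dir_deriv v f x)"
  proof (rule integral_dominated_convergence)
    show "dir_deriv v f \<in> borel_measurable lborel"
      using Cc_integrable(3)[OF Cc_dir_deriv[OF f]] by simp
    show "q n \<in> borel_measurable lborel" for n unfolding q_def by measurable
    \<comment> \<open>Since \<open>h n \<le> 1\<close>, all difference quotients vanish outside the
      ball of radius \<open>R + norm v\<close>; the bound \<open>K\<close> of the derivative bounds
      them inside.\<close>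
    show "integrable lborel (\<lambda>x. indicator (cball 0 (R + norm v)) x *\<^sub>R K)"
      by (intro borel_integrable_compact) auto
    show "AE x in lborel. (\<lambda>n. q n x) \<longlonglongrightarrow> dir_deriv v f x"
    proof (intro always_eventually allI)
      fix x
      have "((\<lambda>t. f (x + t *\<^sub>R v)) has_vector_derivative dir_deriv v f x) (at 0)"
        using dir_deriv_line[of f x 0 v] d by simp
      then have "((\<lambda>t. norm (f (x + t *\<^sub>R v) - f x - t *\<^sub>R dir_deriv v f x) / norm t) \<longlongrightarrow> 0) (at 0)"
        by (simp add: has_vector_derivative_def has_derivative_iff_norm)
      also have "?this \<longleftrightarrow> ((\<lambda>t. norm ((f (x + t *\<^sub>R v) - f x) /\<^sub>R t - dir_deriv v f x)) \<longlongrightarrow> 0) (at 0)"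
      proof (rule tendsto_cong, rule eventually_mono[OF eventually_neq_at_within[of 0]])
        fix t :: real assume t: "t \<noteq> 0"
        have "(f (x + t *\<^sub>R v) - f x) /\<^sub>R t - dir_deriv v f x =
            (f (x + t *\<^sub>R v) - f x - t *\<^sub>R dir_deriv v f x) /\<^sub>R t"
          using t by (simp add: scaleR_diff_right)
        then show "norm (f (x + t *\<^sub>R v) - f x - t *\<^sub>R dir_deriv v f x) / norm t =
            norm ((f (x + t *\<^sub>R v) - f x) /\<^sub>R t - dir_deriv v f x)"
          by (simp add: divide_inverse_commute)
      qed
      finally have "((\<lambda>t. (f (x + t *\<^sub>R v) - f x) /\<^sub>R t) \<longlongrightarrow> dir_deriv v f x) (at 0)"
        by (rule LIM_zero_cancel[OF tendsto_norm_zero_cancel])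
      from filterlim_compose[OF this h0] show "(\<lambda>n. q n x) \<longlonglongrightarrow> dir_deriv v f x"
        by (simp add: q_def)
    qed
    show "AE x in lborel. norm (q n x) \<le> indicator (cball 0 (R + norm v)) x *\<^sub>R K" for n
    proof (intro always_eventually allI)
      fix x
      have 1: "norm (q n x) \<le> K"
      proof -
        have "norm (q n x) = norm (f (x + h n *\<^sub>R v) - f x) / h n"
          using h[of n] by (simp add: q_def divide_inverse_commute)
        then show ?thesis
          using dir_deriv_lipschitz[OF d K(2), of x "h n"] h[of n] by (simp add: pos_divide_le_eq)
      qed
      have 2: "q n x = 0" if "norm x > R + norm v"
      proof -
        have "norm x \<le> norm (x + h n *\<^sub>R v) + norm (h n *\<^sub>R v)"
          using norm_triangle_ineq4[of "x + h n *\<^sub>R v" "h n *\<^sub>R v"] by simp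
        moreover have "norm (h n *\<^sub>R v) \<le> norm v" using h[of n] mult_right_mono[of "h n" 1 "norm v"] by simp
        ultimately have "norm (x + h n *\<^sub>R v) > R" using that by linarith
        moreover have "norm x > R" using that norm_ge_zero[of v] by linarith
        ultimately show ?thesis using R by (simp add: q_def)
      qed
      show "norm (q n x) \<le> indicator (cball 0 (R + norm v)) x *\<^sub>R K"
        using 1 2 by (auto simp: indicator_def)
    qed
  qed
  then have "(LINT x|lborel. dir_deriv v f x) = 0"
    using q0 LIMSEQ_unique by (simp add: LIMSEQ_const_iff)
  then show ?thesis
    using Cc_integrable(3)[OF Cc_dir_deriv[OF f]] by (simp add: integral_completion)
qed

section \<open>Smooth bump functions\<close>

text \<open>The derivative in a fixed direction is again a polynomial; this keeps the family
  \<open>bump\<close> closed under differentiation.\<close>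

lemma real_polynomial_function_has_derivative:
  "real_polynomial_function p \<Longrightarrow>
    \<exists>p'. (\<forall>v. real_polynomial_function (p' v)) \<and> (\<forall>x. (p has_derivative (\<lambda>v. p' v x)) (at x))"
proof (induction rule: real_polynomial_function.induct)
  case (linear f)
  then show ?case
    by (intro exI[of _ "\<lambda>v _. f v"]) (auto intro: bounded_linear_imp_has_derivative)
next
  case (const c)
  then show ?case by (intro exI[of _ "\<lambda>_ _. 0"]) auto
next
  case (add f g)
  then obtain f' g' where "\<forall>v. real_polynomial_function (f' v)" "\<forall>x. (f has_derivative (\<lambda>v. f' v x)) (at x)"
    "\<forall>v. real_polynomial_function (g' v)" "\<forall>x. (g has_derivative (\<lambda>v. g' v x)) (at x)" by blast
  then show ?case by (intro exI[of _ "\<lambda>v x. f' v x + g' v x"]) (auto intro: derivative_intros)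
next
  case (mult f g)
  then obtain f' g' where "\<forall>v. real_polynomial_function (f' v)" "\<forall>x. (f has_derivative (\<lambda>v. f' v x)) (at x)"
    "\<forall>v. real_polynomial_function (g' v)" "\<forall>x. (g has_derivative (\<lambda>v. g' v x)) (at x)" by blast
  with mult(1,2) show ?case
    by (intro exI[of _ "\<lambda>v x. f x * g' v x + f' v x * g x"] conjI allI
        real_polynomial_function.intros(3) real_polynomial_function.intros(4) has_derivative_mult) auto
qed

lemma real_polynomial_function_inner_self:
  "real_polynomial_function (\<lambda>x::'a::euclidean_space. x \<bullet> x)"
proof -
  have "real_polynomial_function (\<lambda>x::'a. \<Sum>b\<in>Basis. (x \<bullet> b) * (x \<bullet> b))"
    by (intro real_polynomial_function_sum real_polynomial_function.intros(4) real_polynomial_function.intros(1)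
        bounded_linear_inner_left finite_Basis)
  then show ?thesis by (subst euclidean_inner)
qed

text \<open>A family closed under directional derivatives, hence consisting of smooth functions.\<close>

definition bump :: "('a::euclidean_space \<Rightarrow> real) \<Rightarrow> nat \<Rightarrow> 'a \<Rightarrow> real" where
  "bump p m x = (if norm x < 1 then p x * (exp (- 1 / (1 - x \<bullet> x)) / (1 - x \<bullet> x) ^ m) else 0)"

text \<open>The single term of order \<open>m + 2\<close> of the exponential series at
  \<open>1 / s\<close> suffices. Its two powers beyond \<open>m\<close> give the factor
  \<open>s\<^sup>2\<close> that makes bump functions flat to second order at the unit
  sphere.\<close>

lemma exp_over_power_le:
  fixes s :: real
  assumes "0 < s" shows "exp (- 1 / s) / s ^ m \<le> fact (m + 2) * s\<^sup>2"
proof -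
  have "(1 / s) ^ (m + 2) / fact (m + 2) \<le> exp (1 / s)"
  proof -
    have sm: "summable (\<lambda>n. (1 / s) ^ n /\<^sub>R fact n)" by (rule summable_exp_generic)
    have "(\<Sum>n\<in>{m+2}. (1 / s) ^ n /\<^sub>R fact n) \<le> (\<Sum>n. (1 / s) ^ n /\<^sub>R fact n)"
      using assms by (intro sum_le_suminf sm) auto
    then show ?thesis unfolding exp_def by (simp only: sum.insert sum.empty finite.intros empty_iff
      if_False simp_thms add_0_right real_scaleR_def divide_inverse_commute)
  qed
  then have "1 \<le> exp (1 / s) * fact (m + 2) * s ^ (m + 2)"
    using assms by (simp add: power_one_over pos_divide_le_eq mult_ac)
  then have "inverse (exp (1 / s)) * 1 \<le> inverse (exp (1 / s)) * (exp (1 / s) * fact (m + 2) * s ^ (m + 2))"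
    by (intro mult_left_mono) auto
  also have "\<dots> = fact (m + 2) * s\<^sup>2 * s ^ m" by (simp only: power_add mult_ac) simp
  finally show ?thesis using assms by (simp only: exp_minus minus_divide_left[symmetric] pos_divide_le_eq
        zero_less_power mult_1_right)
qed

text \<open>For \<open>y\<close> in the open ball, \<open>1 - norm y\<close> is at most the distance
  to any \<open>x\<close> outside it, so \<open>1 - y \<bullet> y\<close> is at most twice that
  distance and \<open>exp_over_power_le\<close> gives the square.\<close>

lemma bump_quadratic:
  assumes p: "real_polynomial_function p"
  shows "\<exists>C. \<forall>x y. 1 \<le> norm x \<longrightarrow> \<bar>bump p m y\<bar> \<le> C * (norm (y - x))\<^sup>2"
proof -
  have "continuous_on (cball 0 1) p"
    using p by (simp add: continuous_on_polymonial_function real_polynomial_function_eq)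
  then have "bounded (p ` cball 0 1)"
    by (intro compact_imp_bounded compact_continuous_image compact_cball)
  then obtain P where P: "P > 0" "\<And>x. norm x \<le> 1 \<Longrightarrow> \<bar>p x\<bar> \<le> P" by (auto simp: bounded_pos)
  have "\<bar>bump p m y\<bar> \<le> P * fact (m + 2) * 4 * (norm (y - x))\<^sup>2" if x: "1 \<le> norm x" for x y :: 'a
  proof (cases "norm y < 1")
    case True
    define s where "s = 1 - y \<bullet> y"
    have s': "s = (1 - norm y) * (1 + norm y)" by (simp add: s_def dot_square_norm algebra_simps power2_eq_square)
    have s: "s > 0" unfolding s' using True norm_ge_zero[of y] by (intro mult_pos_pos) linarith+
    have "1 - norm y \<le> norm (y - x)" using x norm_triangle_ineq2[of x y] by (simp add: norm_minus_commute)
    then have "s \<le> norm (y - x) * 2" unfolding s' using True by (intro mult_mono) auto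
    then have "s\<^sup>2 \<le> (norm (y - x) * 2)\<^sup>2" using s by (intro power_mono) auto
    then have "exp (- 1 / s) / s ^ m \<le> fact (m + 2) * (norm (y - x) * 2)\<^sup>2"
      by (intro order_trans[OF exp_over_power_le[OF s]] mult_left_mono) auto
    then have "\<bar>p y\<bar> * (exp (- 1 / s) / s ^ m) \<le> P * (fact (m + 2) * (norm (y - x) * 2)\<^sup>2)"
      using P True s by (intro mult_mono) auto
    then show ?thesis using True s by (simp add: bump_def s_def[symmetric] abs_mult power_mult_distrib algebra_simps)
  next
    case False
    then show ?thesis using P by (simp add: bump_def)
  qed
  then show ?thesis by blast
qed

lemma bump_has_derivative:
  assumes p: "real_polynomial_function p"
  shows "\<exists>q. (\<forall>v. real_polynomial_function (q v)) \<and>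
    (\<forall>x. (bump p m has_derivative (\<lambda>v. bump (q v) (m + 2) x)) (at x))"
proof -
  obtain p' where p': "\<forall>v. real_polynomial_function (p' v)" "\<And>x. (p has_derivative (\<lambda>v. p' v x)) (at x)"
    using real_polynomial_function_has_derivative[OF p] by blast
  define s where "s x = 1 - x \<bullet> x" for x :: 'a
  \<comment> \<open>The factor exp(-1/s)/s^m has the derivative exp(-1/s)/s^(m+2) * (1 - m s) in s,
    and \<open>s\<close> has the derivative -2 (x \<bullet> v) in direction \<open>v\<close>. The
    factor \<open>s x * s x\<close> in the first summand brings the undifferentiated power
    \<open>m\<close> to the common exponent \<open>m + 2\<close>.\<close>
  define q where "q v x = p' v x * (s x * s x) + p x * ((-2 * (x \<bullet> v)) * (1 - real m * s x))" for v x
  have s: "real_polynomial_function s"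
    unfolding s_def[abs_def]
    by (intro real_polynomial_function_diff real_polynomial_function.intros(2) real_polynomial_function_inner_self)
  have "real_polynomial_function (\<lambda>x. x \<bullet> v)" for v :: 'a
    by (rule real_polynomial_function.intros(1)[OF bounded_linear_inner_left])
  then have "real_polynomial_function (q v)" for v
    unfolding q_def[abs_def] using p' p s
    by (intro real_polynomial_function.intros(2-4) real_polynomial_function_diff) auto
  moreover have "(bump p m has_derivative (\<lambda>v. bump (q v) (m + 2) x)) (at x)" for x
  proof (cases "norm x < 1")
    case True
    have sx: "s x > 0"
    proof -
      have "s x = (1 - norm x) * (1 + norm x)" by (simp add: s_def dot_square_norm algebra_simps power2_eq_square)
      then show ?thesis using True norm_ge_zero[of x] by (simp only:) (intro mult_pos_pos; linarith)
    qed
    have G: "((\<lambda>t. exp (- 1 / t) / t ^ m) has_real_derivative exp (-1 / s x) / s x ^ (m + 2) * (1 - real m * s x)) (at (s x))"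
    proof -
      have nz: "s x \<noteq> 0" using sx by simp
      have E: "((\<lambda>t. exp (- 1 / t)) has_real_derivative exp (-1 / s x) / (s x)\<^sup>2) (at (s x))"
        using sx by (auto intro!: derivative_eq_intros simp: power2_eq_square)
      have "s x ^ m \<noteq> 0" using nz by simp
      note DERIV_divide[OF E DERIV_pow this]
      moreover have "(exp (- 1 / s x) / (s x)\<^sup>2 * s x ^ m - exp (- 1 / s x) * (real m * s x ^ (m - Suc 0))) / (s x ^ m * s x ^ m)
          = exp (-1 / s x) / s x ^ (m + 2) * (1 - real m * s x)"
      proof (cases m)
        case (Suc k)
        have "(E / t\<^sup>2 * (t * a) - E * (c * a)) / (t * a * (t * a)) = E / (t * a * t * t) * (1 - c * t)"
          if "t \<noteq> 0" "a \<noteq> 0" for E t a c :: real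
          using that by (simp add: field_simps power2_eq_square)
        from this[OF nz, of "s x ^ k" "exp (- 1 / s x)" "real m"] show ?thesis
          using Suc nz by (simp add: power_add power2_eq_square mult_ac)
      qed (simp add: power2_eq_square)
      ultimately show ?thesis by (rule DERIV_cong)
    qed
    have S: "(s has_derivative (\<lambda>v. - 2 * (x \<bullet> v))) (at x)"
      unfolding s_def[abs_def] by (auto intro!: derivative_eq_intros simp: inner_commute)
    have C: "((\<lambda>x. exp (- 1 / s x) / s x ^ m) has_derivative
        (\<lambda>v. exp (-1 / s x) / s x ^ (m + 2) * (1 - real m * s x) * (- 2 * (x \<bullet> v)))) (at x)"
      using has_derivative_compose[OF S G[unfolded has_field_derivative_def]] .
    have D: "((\<lambda>x. p x * (exp (- 1 / s x) / s x ^ m)) has_derivative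
        (\<lambda>v. p x * (exp (-1 / s x) / s x ^ (m + 2) * (1 - real m * s x) * (- 2 * (x \<bullet> v))) +
          p' v x * (exp (- 1 / s x) / s x ^ m))) (at x)"
      by (rule has_derivative_mult[OF p'(2) C])
    have "(\<lambda>v. p x * (exp (-1 / s x) / s x ^ (m + 2) * (1 - real m * s x) * (- 2 * (x \<bullet> v))) +
          p' v x * (exp (- 1 / s x) / s x ^ m)) = (\<lambda>v. bump (q v) (m + 2) x)"
    proof
      fix v
      have "exp (- 1 / s x) / s x ^ m = exp (-1 / s x) / s x ^ (m + 2) * (s x * s x)"
        using sx by (simp add: power_add power2_eq_square)
      then show "p x * (exp (-1 / s x) / s x ^ (m + 2) * (1 - real m * s x) * (- 2 * (x \<bullet> v))) +
          p' v x * (exp (- 1 / s x) / s x ^ m) = bump (q v) (m + 2) x"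
      proof -
        have "a * (Y * o' * w) + b * (Y * t) = (b * t + a * (w * o')) * Y" for a b Y o' w t :: real
          by (simp add: algebra_simps)
        with \<open>exp (- 1 / s x) / s x ^ m = _\<close> show ?thesis
          using True unfolding bump_def q_def s_def[symmetric] by (simp only: if_True)
      qed
    qed
    with D have D': "((\<lambda>x. p x * (exp (- 1 / s x) / s x ^ m)) has_derivative (\<lambda>v. bump (q v) (m + 2) x)) (at x)"
      by (simp only:)
    show ?thesis
    proof (rule has_derivative_transform_within_open[OF D'])
      show "open (ball (0::'a) 1)" "x \<in> ball 0 1" using True by auto
      show "p y * (exp (- 1 / s y) / s y ^ m) = bump p m y" if "y \<in> ball 0 1" for y
        using that by (simp add: bump_def s_def)
    qed
  next
    case False
    \<comment> \<open>On and outside the sphere all bump functions vanish, so the derivative to be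
      shown is zero and the value itself is the remainder.\<close>
    obtain C where C: "\<And>y. \<bar>bump p m y\<bar> \<le> C * (norm (y - x))\<^sup>2"
      using bump_quadratic[OF p, of m] False by (meson not_less)
    have b0: "bump r k x = 0" for r k using False by (auto simp: bump_def)
    then show ?thesis unfolding b0 by (intro has_derivative_quadratic[where C = C]) (auto simp: b0 C)
  qed
  ultimately show ?thesis by blast
qed

lemma Ck_bump: "real_polynomial_function p \<Longrightarrow> Ck k (bump p m)"
proof (induction k arbitrary: p m)
  case 0
  obtain q where "\<And>x. (bump p m has_derivative (\<lambda>v. bump (q v) (m + 2) x)) (at x)"
    using bump_has_derivative[OF 0] by blast
  then have "isCont (bump p m) x" for x by (rule has_derivative_continuous)
  then show ?case by (simp add: continuous_at_imp_continuous_on)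
next
  case (Suc k)
  obtain q where q: "\<And>v. real_polynomial_function (q v)"
    "\<And>x. (bump p m has_derivative (\<lambda>v. bump (q v) (m + 2) x)) (at x)"
    using bump_has_derivative[OF Suc.prems] by blast
  have "dir_deriv v (bump p m) = bump (q v) (m + 2)" for v
    using dir_deriv_eqI[OF q(2)] by blast
  then show ?case using Suc.IH[OF q(1)] differentiableI[OF q(2)] by (auto simp: Ck_Suc)
qed

definition mollifier :: "real \<Rightarrow> ('a::euclidean_space \<Rightarrow> real) \<Rightarrow> bool" where
  "mollifier \<delta> \<rho> \<longleftrightarrow> (\<forall>k. Ck k \<rho>) \<and> (\<forall>x. 0 \<le> \<rho> x) \<and> (\<forall>x. norm x > \<delta> \<longrightarrow> \<rho> x = 0) \<and>
    (LINT x|lborel. \<rho> x) = 1"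

lemma mollifier_exists:
  assumes d: "\<delta> > 0"
  shows "\<exists>\<rho>::'a::euclidean_space \<Rightarrow> real. mollifier \<delta> \<rho>"
proof -
  define b where "b x = bump (\<lambda>_. 1) 0 (0 + x /\<^sub>R \<delta>)" for x :: 'a
  have "bounded_linear (\<lambda>x::'a. x /\<^sub>R \<delta>)"
    by (rule bounded_linear_scaleR_right)
  from Ck_affine[OF this Ck_bump[OF real_polynomial_function.intros(2)]]
  have bk: "Ck k b" for k
    unfolding b_def[abs_def] .
  have b0: "b x \<ge> 0" for x by (simp add: b_def bump_def)
  have bs: "b x = 0" if "norm x > \<delta>" for x
    using that d by (simp add: b_def bump_def field_simps)
  have bp: "b x > 0" if "norm x < \<delta>" for x
    using that d by (simp add: b_def bump_def field_simps)
  have bc: "Cc k b" for k using bk bs by (auto simp: Cc_def)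
  have bi: "integrable lborel b" using Cc_integrable[OF bc[of 0]] by blast
  define c where "c = (LINT x|lborel. b x)"
  \<comment> \<open>Otherwise \<open>b\<close> vanishes almost everywhere, although it is positive
    on an open ball, which is not negligible.\<close>
  have "c \<noteq> 0"
  proof
    assume "c = 0"
    then have "AE x in lborel. b x = 0"
      using integral_nonneg_eq_0_iff_AE[OF bi] b0 by (simp add: c_def)
    then have "AE x in lebesgue. b x = 0" by (rule AE_completion)
    then obtain N where N: "negligible N" "{x. b x \<noteq> 0} \<subseteq> N"
      by (auto simp: eventually_ae_filter_negligible)
    have "ball 0 \<delta> \<subseteq> {x. b x \<noteq> 0}" using bp by force
    with N have "negligible (ball (0::'a) \<delta>)" by (meson negligible_subset)
    then show False using d open_not_negligible[of "ball (0::'a) \<delta>"] by auto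
  qed
  moreover have "c \<ge> 0" unfolding c_def using b0 by (intro integral_nonneg_AE) auto
  ultimately have c: "c > 0" by simp
  have "mollifier \<delta> (\<lambda>x. b x / c)"
    unfolding mollifier_def
  proof (intro conjI allI impI)
    show "Ck k (\<lambda>x. b x / c)" for k
      by (rule Ck_bounded_linear[OF bounded_linear_divide bk])
  qed (use b0 bs c bi in \<open>auto simp: c_def[symmetric]\<close>)
  then show ?thesis by blast
qed

section \<open>Wirtinger derivatives\<close>

text \<open>The cases \<open>s = -\<i>\<close> and \<open>s = \<i>\<close> are the two Wirtinger derivatives.\<close>

definition cr :: "complex \<Rightarrow> 'n::finite \<Rightarrow> (complex ^ 'n \<Rightarrow> complex) \<Rightarrow> complex ^ 'n \<Rightarrow> complex" where
  "cr s j f z = (dir_deriv (axis j 1) f z + s * dir_deriv (axis j \<i>) f z) / 2"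

lemma wirtinger_eq_cr: "wirtinger j f = cr (- \<i>) j f" "wirtinger_bar j f = cr \<i> j f"
  by (auto simp: fun_eq_iff wirtinger_def wirtinger_bar_def cr_def dir_deriv_def)

lemma cr_add:
  "f differentiable at x \<Longrightarrow> g differentiable at x \<Longrightarrow>
    cr s j (\<lambda>z. f z + g z) x = cr s j f x + cr s j g x"
  by (simp add: cr_def dir_deriv_add algebra_simps add_divide_distrib)

lemma cr_minus: "f differentiable at x \<Longrightarrow> cr s j (\<lambda>z. - f z) x = - cr s j f x"
  by (simp add: cr_def dir_deriv_minus algebra_simps)

lemma cr_diff:
  "f differentiable at x \<Longrightarrow> g differentiable at x \<Longrightarrow>
    cr s j (\<lambda>z. f z - g z) x = cr s j f x - cr s j g x"
  using cr_add[of f x "\<lambda>z. - g z"] cr_minus[of g x] by simp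

lemma cr_const [simp]: "cr s j (\<lambda>_. c) = (\<lambda>_. 0)"
  by (simp add: cr_def fun_eq_iff)

lemma cr_mult:
  "f differentiable at x \<Longrightarrow> g differentiable at x \<Longrightarrow>
    cr s j (\<lambda>z. f z * g z) x = f x * cr s j g x + cr s j f x * g x"
  by (simp add: cr_def dir_deriv_mult algebra_simps add_divide_distrib)

lemma cr_cmult: "f differentiable at x \<Longrightarrow> cr s j (\<lambda>z. c * f z) x = c * cr s j f x"
  using cr_mult[of "\<lambda>_. c" x f] by simp

lemma cr_cnj: "f differentiable at x \<Longrightarrow> cr s j (\<lambda>z. cnj (f z)) x = cnj (cr (cnj s) j f x)"
  by (simp add: cr_def dir_deriv_cnj)

lemma cr_exp:
  fixes f :: "complex ^ 'n::finite \<Rightarrow> real"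
  assumes d: "f differentiable at x"
  shows "cr s j (\<lambda>z. complex_of_real (exp (f z))) x = of_real (exp (f x)) * cr s j (\<lambda>z. of_real (f z)) x"
proof -
  have "(\<lambda>z. exp (f z)) differentiable at x"
    using has_derivative_exp[OF has_derivative_dir_deriv[OF d]] by (auto simp: differentiable_def)
  then show ?thesis using d
    by (simp add: cr_def dir_deriv_of_real dir_deriv_exp algebra_simps add_divide_distrib)
qed

lemma Ck_cr: "Ck (Suc k) f \<Longrightarrow> Ck k (cr s j f)"
  unfolding cr_def[abs_def]
  by (intro Ck_bounded_linear[OF bounded_linear_divide] Ck_add Ck_mult Ck_const Ck_dir_deriv)

lemma Cc_cr: "Cc (Suc k) f \<Longrightarrow> Cc k (cr s j f)"
  unfolding cr_def[abs_def]
  by (intro Cc_bounded_linear[OF bounded_linear_divide] Cc_add Cc_mult(2) Ck_const Cc_dir_deriv)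

lemma cr_outside: "(\<And>x. norm x > R \<Longrightarrow> f x = 0) \<Longrightarrow> norm x > R \<Longrightarrow> cr s j f x = 0"
  by (simp add: cr_def dir_deriv_outside[of R])

lemma cr_commute:
  assumes f: "Ck 2 f"
  shows "cr s j (cr t k f) x = cr t k (cr s j f) x"
proof -
  have f2: "Ck (Suc 1) f" using f by (simp add: numeral_2_eq_2)
  have d: "dir_deriv w f differentiable (at y)" for y w
    using Ck_dir_deriv[OF f2, of w] by (simp add: Ck_Suc)
  have *: "dir_deriv w (cr t k f) x =
      (dir_deriv w (dir_deriv (axis k 1) f) x + t * dir_deriv w (dir_deriv (axis k \<i>) f) x) / 2" for w t k
    unfolding cr_def[abs_def]
    by (subst dir_deriv_bounded_linear[OF bounded_linear_divide])
      (auto intro!: differentiable_add differentiable_mult d simp: dir_deriv_add dir_deriv_mult d)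
  show ?thesis
    unfolding cr_def[of s j "cr t k f"] cr_def[of t k "cr s j f"] *
    by (simp add: dir_deriv_commute[OF f, of "axis j _"] field_simps)
qed

lemma cr_reflect:
  assumes "\<And>y. f differentiable at y"
  shows "cr s j (\<lambda>y. f (a - y)) x = - cr s j f (a - x)"
proof -
  have "dir_deriv v (\<lambda>y. f (a - y)) x = - dir_deriv v f (a - x)" for v
    using dir_deriv_affine[of "\<lambda>y. - y" f a x v] assms dir_deriv_lincomb(2)[OF assms, of "-1" v "a - x"]
    by (simp add: bounded_linear_minus)
  then show ?thesis by (simp add: cr_def field_simps)
qed

lemma integral_cr: "Cc (Suc k) f \<Longrightarrow> (LINT z|lebesgue. cr s j f z) = 0"
  unfolding cr_def using integral_dir_deriv[of k f] Cc_integrable(2)[OF Cc_dir_deriv[of k f]]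
  by (simp add: integral_dir_deriv)

lemma cr_by_parts:
  assumes f: "Cc (Suc k) f" and g: "Ck (Suc k) g"
  shows "(LINT z|lebesgue. f z * cr s j g z) = - (LINT z|lebesgue. cr s j f z * g z)"
proof -
  have d: "f differentiable at x" "g differentiable at x" for x
    using f g by (auto simp: Cc_def Ck_Suc)
  have "0 = (LINT z|lebesgue. cr s j (\<lambda>z. f z * g z) z)"
    using integral_cr[OF Cc_mult(1)[OF f g]] by simp
  also have "\<dots> = (LINT z|lebesgue. f z * cr s j g z) + (LINT z|lebesgue. cr s j f z * g z)"
    unfolding cr_mult[OF d]
    by (intro Bochner_Integration.integral_add Cc_integrable(2)[where k=k] Cc_mult(1) Cc_cr f Ck_cr g
        Cc_mono[OF f] Ck_SucD[OF g]) simp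
  finally show ?thesis by (simp add: eq_neg_iff_add_eq_0)
qed

section \<open>Mollification\<close>

definition conv :: "('a::euclidean_space \<Rightarrow> real) \<Rightarrow> ('a \<Rightarrow> complex) \<Rightarrow> 'a \<Rightarrow> complex" where
  "conv \<rho> f x = (LINT y|lebesgue. \<rho> (x - y) *\<^sub>R f y)"

lemma integrable_reflect_scaleR:
  fixes f :: "'a::euclidean_space \<Rightarrow> complex"
  assumes \<rho>: "Cc k \<rho>" and f: "integrable lebesgue f"
  shows "integrable lebesgue (\<lambda>y. \<rho> (x - y) *\<^sub>R f y)"
proof -
  obtain K where K: "K > 0" "\<And>x. norm (\<rho> x) \<le> K" using Cc_bounded[OF \<rho>] by blast
  have "continuous_on UNIV (\<lambda>y. \<rho> (x - y))"
    by (rule continuous_on_compose2[OF Ck_continuous[OF CcD[OF \<rho>]], of _ _ UNIV]) (auto intro!: continuous_intros)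
  then have m: "(\<lambda>y. \<rho> (x - y)) \<in> borel_measurable lebesgue"
    by (intro measurable_completion) (simp add: borel_measurable_continuous_onI)
  show ?thesis
  proof (rule Bochner_Integration.integrable_bound)
    show "integrable lebesgue (\<lambda>y. K *\<^sub>R norm (f y))" using f by simp
    show "(\<lambda>y. \<rho> (x - y) *\<^sub>R f y) \<in> borel_measurable lebesgue" using m f by measurable
    show "AE y in lebesgue. norm (\<rho> (x - y) *\<^sub>R f y) \<le> norm (K *\<^sub>R norm (f y))"
      using K by (auto intro!: mult_right_mono always_eventually)
  qed
qed

text \<open>All smoothness is taken from the kernel: its second derivatives are bounded by compact
  support, so its Taylor remainder is at most \<open>C * (norm v)\<^sup>2\<close> uniformly in the
  base point, and integration against the integrable \<open>f\<close> preserves a quadratic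
  bound.\<close>

lemma conv_has_derivative:
  assumes \<rho>: "Cc 2 \<rho>" and f: "integrable lebesgue f"
  shows "(conv \<rho> f has_derivative (\<lambda>v. conv (dir_deriv v \<rho>) f x)) (at x)"
proof -
  have \<rho>2: "Cc (Suc 1) \<rho>" using \<rho> by (simp add: numeral_2_eq_2)
  have d: "\<rho> differentiable (at y)" for y using \<rho>2 by (simp add: Cc_def Ck_Suc)
  have dd: "Cc 1 (dir_deriv v \<rho>)" for v using Cc_dir_deriv[OF \<rho>2] .
  have ddd: "Cc 0 (dir_deriv v (dir_deriv w \<rho>))" for v w
    using Cc_dir_deriv[of 0 "dir_deriv w \<rho>"] dd by simp
  have int0: "integrable lebesgue (\<lambda>y. \<rho> (z - y) *\<^sub>R f y)" for z
    by (rule integrable_reflect_scaleR[OF \<rho> f])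
  have int1: "integrable lebesgue (\<lambda>y. dir_deriv v \<rho> (z - y) *\<^sub>R f y)" for z v
    by (rule integrable_reflect_scaleR[OF dd f])
  have "\<forall>v w. \<exists>K>0. \<forall>x. norm (dir_deriv v (dir_deriv w \<rho>) x) \<le> K"
    using Cc_bounded[OF ddd] by metis
  then obtain K where K: "\<And>v w x. norm (dir_deriv v (dir_deriv w \<rho>) x) \<le> K v w" "\<And>v w. K v w > 0"
    by metis
  define C where "C = (\<Sum>b\<in>Basis. \<Sum>c\<in>Basis. K b c)"
  have C: "\<bar>dir_deriv v (dir_deriv v \<rho>) z\<bar> \<le> C * (norm v)\<^sup>2" for v z
  proof -
    have "\<bar>dir_deriv v (dir_deriv v \<rho>) z\<bar> \<le>
        (\<Sum>b\<in>Basis. \<Sum>c\<in>Basis. \<bar>((v \<bullet> b) * (v \<bullet> c)) *\<^sub>R dir_deriv b (dir_deriv c \<rho>) z\<bar>)"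
      unfolding dir_deriv2_expand[OF CcD[OF \<rho>], of v v z]
      by (intro order_trans[OF sum_abs] sum_mono order_trans[OF sum_abs]) simp
    also have "\<dots> \<le> (\<Sum>b\<in>Basis. \<Sum>c\<in>Basis. (norm v * norm v) * K b c)"
      using K by (intro sum_mono) (auto simp: abs_mult Basis_le_norm intro!: mult_mono)
    also have "\<dots> = C * (norm v)\<^sup>2"
      by (simp add: C_def sum_distrib_right[symmetric] sum_distrib_left[symmetric] power2_eq_square mult.commute)
    finally show ?thesis .
  qed
  have C0: "C \<ge> 0" unfolding C_def using K(2) by (intro sum_nonneg less_imp_le)
  have lin: "conv (dir_deriv v \<rho>) f x = (\<Sum>b\<in>Basis. (v \<bullet> b) *\<^sub>R conv (dir_deriv b \<rho>) f x)" for v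
  proof -
    have "conv (dir_deriv v \<rho>) f x =
        (LINT y|lebesgue. (\<Sum>b\<in>Basis. (v \<bullet> b) *\<^sub>R (dir_deriv b \<rho> (x - y) *\<^sub>R f y)))"
      unfolding conv_def by (subst dir_deriv_expand[OF d]) (simp add: scaleR_sum_left)
    also have "\<dots> = (\<Sum>b\<in>Basis. (v \<bullet> b) *\<^sub>R conv (dir_deriv b \<rho>) f x)"
      unfolding conv_def using int1 by (subst Bochner_Integration.integral_sum) (auto simp del: scaleR_scaleR)
    finally show ?thesis .
  qed
  show ?thesis
  proof (rule has_derivative_quadratic)
    show "bounded_linear (\<lambda>v. conv (dir_deriv v \<rho>) f x)"
      by (subst ext[OF lin]) (rule bounded_linear_sum, rule bounded_linear_scaleR_const, rule bounded_linear_inner_left)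
    fix y
    let ?v = "y - x"
    have "conv \<rho> f y - conv \<rho> f x - conv (dir_deriv ?v \<rho>) f x =
        (LINT z|lebesgue. (\<rho> (y - z) - \<rho> (x - z) - dir_deriv ?v \<rho> (x - z)) *\<^sub>R f z)"
      unfolding conv_def using int0 int1 by (simp add: scaleR_diff_left)
    also have "norm \<dots> \<le> (LINT z|lebesgue. (C * (norm ?v)\<^sup>2) * norm (f z))"
    proof (rule Bochner_Integration.integral_norm_bound_integral)
      show "integrable lebesgue (\<lambda>z. (\<rho> (y - z) - \<rho> (x - z) - dir_deriv ?v \<rho> (x - z)) *\<^sub>R f z)"
        using int0 int1 by (simp add: scaleR_diff_left)
      show "integrable lebesgue (\<lambda>z. (C * (norm ?v)\<^sup>2) * norm (f z))" using f by simp
      fix z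
      obtain t where t: "\<rho> (x - z + ?v) = \<rho> (x - z) + dir_deriv ?v \<rho> (x - z) +
          dir_deriv ?v (dir_deriv ?v \<rho>) (x - z + t *\<^sub>R ?v) / 2"
        using taylor2[OF CcD[OF \<rho>], of "x - z" ?v] by blast
      have e: "x - z + ?v = y - z" by simp
      have "\<bar>\<rho> (y - z) - \<rho> (x - z) - dir_deriv ?v \<rho> (x - z)\<bar> = \<bar>dir_deriv ?v (dir_deriv ?v \<rho>) (x - z + t *\<^sub>R ?v)\<bar> / 2"
        using t unfolding e by simp
      also have "\<dots> \<le> C * (norm ?v)\<^sup>2"
        using C[of ?v "x - z + t *\<^sub>R ?v"] by linarith
      finally show "norm ((\<rho> (y - z) - \<rho> (x - z) - dir_deriv ?v \<rho> (x - z)) *\<^sub>R f z) \<le> (C * (norm ?v)\<^sup>2) * norm (f z)"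
        by (simp add: mult_right_mono)
    qed
    also have "\<dots> = (C * (LINT z|lebesgue. norm (f z))) * (norm ?v)\<^sup>2" by simp
    finally show "norm (conv \<rho> f y - conv \<rho> f x - conv (dir_deriv ?v \<rho>) f x) \<le>
        (C * (LINT z|lebesgue. norm (f z))) * (norm ?v)\<^sup>2" .
  qed
qed

lemma dir_deriv_conv:
  assumes "Cc 2 \<rho>" "integrable lebesgue f"
  shows "dir_deriv v (conv \<rho> f) = conv (dir_deriv v \<rho>) f"
  using dir_deriv_eqI[OF conv_has_derivative[OF assms]] by blast

lemma Ck_conv:
  assumes f: "integrable lebesgue f"
  shows "(\<And>k. Cc k \<rho>) \<Longrightarrow> Ck k (conv \<rho> f)"
proof (induction k arbitrary: \<rho>)
  case 0
  have "isCont (conv \<rho> f) x" for x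
    using conv_has_derivative[OF 0 f] by (rule has_derivative_continuous)
  then show ?case by (simp add: continuous_at_imp_continuous_on)
next
  case (Suc k)
  show ?case
    using differentiableI[OF conv_has_derivative[OF Suc.prems f]] Suc.IH[OF Cc_dir_deriv[OF Suc.prems]]
    by (auto simp: Ck_Suc dir_deriv_conv[OF Suc.prems f])
qed

lemma conv_outside:
  assumes "\<And>x. norm x > \<delta> \<Longrightarrow> \<rho> x = 0" "\<And>x. norm x > R \<Longrightarrow> f x = 0" "norm x > R + \<delta>"
  shows "conv \<rho> f x = 0"
proof -
  have "\<rho> (x - y) *\<^sub>R f y = 0" for y
    using assms(1)[of "x - y"] assms(2)[of y] assms(3) norm_triangle_ineq2[of x y]
    by (cases "norm y > R") auto
  then show ?thesis unfolding conv_def by (simp only: integral_zero)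
qed

lemma mollifier_Cc: "mollifier \<delta> \<rho> \<Longrightarrow> Cc k \<rho>"
  by (auto simp: mollifier_def Cc_def)

lemma test_function_conv:
  assumes f: "integrable lebesgue f" "\<And>x. norm x > R \<Longrightarrow> f x = 0" and \<rho>: "mollifier \<delta> \<rho>"
  shows "test_function (conv \<rho> f)"
proof -
  have "conv \<rho> f x = 0" if "norm x > R + \<delta>" for x
    by (rule conv_outside[OF _ f(2) that]) (use \<rho> in \<open>auto simp: mollifier_def\<close>)
  then show ?thesis
    using Ck_conv[OF f(1) mollifier_Cc[OF \<rho>]] by (auto simp: test_function_iff Cc_def)
qed

lemma cr_conv:
  assumes f: "integrable lebesgue f" and \<rho>: "Cc 2 \<rho>"
  shows "cr s j (conv \<rho> f) x = (LINT y|lebesgue. cr s j (\<lambda>z. of_real (\<rho> z)) (x - y) * f y)"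
proof -
  have \<rho>2: "Cc (Suc 1) \<rho>" using \<rho> by (simp add: numeral_2_eq_2)
  have d: "\<rho> differentiable (at y)" for y using \<rho>2 by (simp add: Cc_def Ck_Suc)
  have i: "integrable lebesgue (\<lambda>y. dir_deriv v \<rho> (x - y) *\<^sub>R f y)" for v
    by (rule integrable_reflect_scaleR[OF Cc_dir_deriv[OF \<rho>2] f])
  have "cr s j (conv \<rho> f) x = (LINT y|lebesgue. (dir_deriv (axis j 1) \<rho> (x - y) *\<^sub>R f y +
      s * (dir_deriv (axis j \<i>) \<rho> (x - y) *\<^sub>R f y)) / 2)"
    unfolding cr_def dir_deriv_conv[OF \<rho> f] conv_def using i by (simp del: mult_scaleR_right)
  also have "\<dots> = (LINT y|lebesgue. cr s j (\<lambda>z. of_real (\<rho> z)) (x - y) * f y)"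
    by (rule Bochner_Integration.integral_cong)
      (auto simp: cr_def dir_deriv_of_real[OF d] scaleR_conv_of_real algebra_simps add_divide_distrib)
  finally show ?thesis .
qed

section \<open>Translations in L^2 and the error of mollification\<close>

lemma lborel_reflect:
  "distr lborel borel (\<lambda>y::'a::euclidean_space. x - y) = lborel"
  using lborel_affine[of "-1" x] by (simp add: density_1)

lemma nn_integral_lborel_reflect:
  assumes "f \<in> borel_measurable borel"
  shows "(\<integral>\<^sup>+y. f (x - y) \<partial>lborel) = (\<integral>\<^sup>+y. f (y::'a::euclidean_space) \<partial>lborel)"
  using nn_integral_distr[of "\<lambda>y. x - y" lborel borel f] assms by (simp add: lborel_reflect)

lemma nn_integral_lborel_translate:
  assumes [measurable]: "f \<in> borel_measurable borel"
  shows "(\<integral>\<^sup>+y. f (y - x) \<partial>lborel) = (\<integral>\<^sup>+y. f (y::'a::euclidean_space) \<partial>lborel)"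
proof -
  have "(\<integral>\<^sup>+y. f (y - x) \<partial>lborel) = (\<integral>\<^sup>+y. f ((0 - y) - x) \<partial>lborel)"
    by (rule nn_integral_lborel_reflect[symmetric]) measurable
  also have "\<dots> = (\<integral>\<^sup>+y. f (- x - y) \<partial>lborel)"
    by (intro nn_integral_cong arg_cong[where f = f]) (simp add: algebra_simps)
  also have "\<dots> = (\<integral>\<^sup>+y. f y \<partial>lborel)" by (rule nn_integral_lborel_reflect) measurable
  finally show ?thesis .
qed

lemma integral_lborel_reflect:
  fixes f :: "'a::euclidean_space \<Rightarrow> complex"
  assumes "f \<in> borel_measurable borel"
  shows "(LINT y|lborel. f (x - y)) = (LINT y|lborel. f y)"
  using integral_distr[of "\<lambda>y. x - y" lborel borel f] assms by (simp add: lborel_reflect)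

lemma integrable_lborel_reflect:
  fixes f :: "'a::euclidean_space \<Rightarrow> complex"
  assumes "f \<in> borel_measurable borel"
  shows "integrable lborel (\<lambda>y. f (x - y)) \<longleftrightarrow> integrable lborel f"
  using integrable_distr_eq[of "\<lambda>y. x - y" lborel borel f] assms by (simp add: lborel_reflect)

text \<open>Jensen's inequality for the probability density \<open>\<rho>\<close>, followed by Tonelli's theorem.\<close>

lemma mollify_le_translations:
  fixes f :: "'a::euclidean_space \<Rightarrow> complex"
  assumes f [measurable]: "f \<in> borel_measurable borel" and fi: "integrable lborel f"
    and \<rho>: "mollifier \<delta> \<rho>"
    and K: "\<And>y. norm y \<le> \<delta> \<Longrightarrow> (\<integral>\<^sup>+x. ennreal ((cmod (f x - f (x - y)))\<^sup>2) \<partial>lborel) \<le> K"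
  shows "(\<integral>\<^sup>+x. ennreal ((cmod (f x - conv \<rho> f x))\<^sup>2) \<partial>lborel) \<le> K"
proof -
  have \<rho>c: "Cc 0 \<rho>" using \<rho> by (rule mollifier_Cc)
  have \<rho>0: "\<rho> y \<ge> 0" "norm y > \<delta> \<Longrightarrow> \<rho> y = 0" for y using \<rho> by (auto simp: mollifier_def)
  have [measurable]: "\<rho> \<in> borel_measurable borel" using Cc_integrable(3)[OF \<rho>c] .
  have \<rho>i: "integrable lborel \<rho>" using Cc_integrable(1)[OF \<rho>c] .
  have \<rho>1: "(\<integral>\<^sup>+y. ennreal (\<rho> y) \<partial>lborel) = 1"
    using nn_integral_eq_integral[OF \<rho>i] \<rho>0 \<rho> by (simp add: mollifier_def)
  have fil: "integrable lebesgue f" using fi f by (simp add: integrable_completion)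
  have pw: "ennreal ((cmod (f x - conv \<rho> f x))\<^sup>2) \<le> (\<integral>\<^sup>+y. ennreal (\<rho> y * (cmod (f x - f (x - y)))\<^sup>2) \<partial>lborel)" for x
  proof -
    have i1: "integrable lborel (\<lambda>y. \<rho> (x - y) *\<^sub>R f y)"
      using integrable_reflect_scaleR[OF \<rho>c fil, of x] by (subst (asm) integrable_completion) auto
    have m1: "(\<lambda>y. \<rho> y *\<^sub>R f (x - y)) \<in> borel_measurable borel" by measurable
    have i2: "integrable lborel (\<lambda>y. \<rho> y *\<^sub>R f (x - y))"
      using integrable_lborel_reflect[OF m1, of x] i1 by simp
    have i3: "integrable lborel (\<lambda>y. \<rho> y *\<^sub>R f x)" using \<rho>i by simp
    have "conv \<rho> f x = (LINT y|lborel. \<rho> (x - y) *\<^sub>R f y)"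
      unfolding conv_def by (subst integral_completion) auto
    also have "\<dots> = (LINT y|lborel. \<rho> y *\<^sub>R f (x - y))"
      using integral_lborel_reflect[OF m1, of x] by simp
    finally have c: "conv \<rho> f x = (LINT y|lborel. \<rho> y *\<^sub>R f (x - y))" .
    have "f x = (LINT y|lborel. \<rho> y *\<^sub>R f x)" using \<rho> by (simp add: mollifier_def \<rho>i)
    then have "f x - conv \<rho> f x = (LINT y|lborel. \<rho> y *\<^sub>R f x) - (LINT y|lborel. \<rho> y *\<^sub>R f (x - y))"
      using c by simp
    also have "\<dots> = (LINT y|lborel. \<rho> y *\<^sub>R (f x - f (x - y)))"
      using i2 i3 by (simp add: scaleR_diff_right)
    finally have e: "f x - conv \<rho> f x = (LINT y|lborel. \<rho> y *\<^sub>R (f x - f (x - y)))" .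
    have i4: "integrable lborel (\<lambda>y. \<rho> y *\<^sub>R (f x - f (x - y)))"
      using i2 i3 by (simp add: scaleR_diff_right)
    have "ennreal (cmod (f x - conv \<rho> f x)) \<le> (\<integral>\<^sup>+y. ennreal (cmod (\<rho> y *\<^sub>R (f x - f (x - y)))) \<partial>lborel)"
      unfolding e by (rule integral_norm_bound_ennreal[OF i4])
    also have "\<dots> = (\<integral>\<^sup>+y. ennreal (sqrt (\<rho> y)) * ennreal (sqrt (\<rho> y) * cmod (f x - f (x - y))) \<partial>lborel)"
      using \<rho>0 by (intro nn_integral_cong) (simp add: ennreal_mult[symmetric] mult.assoc[symmetric])
    finally have "(ennreal (cmod (f x - conv \<rho> f x)))\<^sup>2 \<le>
        (\<integral>\<^sup>+y. ennreal (sqrt (\<rho> y)) * ennreal (sqrt (\<rho> y) * cmod (f x - f (x - y))) \<partial>lborel)\<^sup>2"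
      by (intro power_mono) auto
    also have "\<dots> \<le> (\<integral>\<^sup>+y. (ennreal (sqrt (\<rho> y)))\<^sup>2 \<partial>lborel) *
        (\<integral>\<^sup>+y. (ennreal (sqrt (\<rho> y) * cmod (f x - f (x - y))))\<^sup>2 \<partial>lborel)"
      by (rule Cauchy_Schwarz_nn_integral) measurable
    also have "\<dots> = (\<integral>\<^sup>+y. ennreal (\<rho> y * (cmod (f x - f (x - y)))\<^sup>2) \<partial>lborel)"
      using \<rho>0 \<rho>1 by (simp add: ennreal_power power_mult_distrib)
    finally show ?thesis by (simp add: ennreal_power)
  qed
  have "(\<integral>\<^sup>+x. ennreal ((cmod (f x - conv \<rho> f x))\<^sup>2) \<partial>lborel) \<le>
      (\<integral>\<^sup>+x. (\<integral>\<^sup>+y. ennreal (\<rho> y * (cmod (f x - f (x - y)))\<^sup>2) \<partial>lborel) \<partial>lborel)"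
    by (intro nn_integral_mono pw)
  also have "\<dots> = (\<integral>\<^sup>+y. (\<integral>\<^sup>+x. ennreal (\<rho> y * (cmod (f x - f (x - y)))\<^sup>2) \<partial>lborel) \<partial>lborel)"
    by (rule lborel_pair.Fubini'[symmetric]) measurable
  also have "\<dots> \<le> (\<integral>\<^sup>+y. ennreal (\<rho> y) * K \<partial>lborel)"
  proof (rule nn_integral_mono)
    fix y
    have "(\<integral>\<^sup>+x. ennreal (\<rho> y * (cmod (f x - f (x - y)))\<^sup>2) \<partial>lborel) =
        ennreal (\<rho> y) * (\<integral>\<^sup>+x. ennreal ((cmod (f x - f (x - y)))\<^sup>2) \<partial>lborel)"
      using \<rho>0 by (subst nn_integral_cmult[symmetric]) (auto simp: ennreal_mult)
    also have "\<dots> \<le> ennreal (\<rho> y) * K"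
      using K[of y] \<rho>0(2)[of y] by (cases "norm y \<le> \<delta>") (auto intro: mult_left_mono)
    finally show "(\<integral>\<^sup>+x. ennreal (\<rho> y * (cmod (f x - f (x - y)))\<^sup>2) \<partial>lborel) \<le> ennreal (\<rho> y) * K" .
  qed
  also have "\<dots> = K" using \<rho>1 by (simp add: nn_integral_multc)
  finally show ?thesis .
qed

text \<open>The increment is the integral of the derivative over the unit segment from
  \<open>x - y\<close> to \<open>x\<close>. Cauchy--Schwarz in the segment parameter, Tonelli's
  theorem and translation invariance then remove the parameter.\<close>

lemma translation_Cc:
  fixes g :: "'a::euclidean_space \<Rightarrow> complex"
  assumes g: "Cc 1 g"
  shows "(\<integral>\<^sup>+x. ennreal ((cmod (g x - g (x - y)))\<^sup>2) \<partial>lborel) \<le>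
    (\<integral>\<^sup>+x. ennreal ((cmod (dir_deriv y g x))\<^sup>2) \<partial>lborel)"
proof -
  have g1: "Cc (Suc 0) g" using g by simp
  have d: "g differentiable (at x)" for x using g1 by (simp add: Cc_def Ck_Suc)
  have dc: "continuous_on S (dir_deriv y g)" for S
    using Cc_dir_deriv[OF g1, of y] by (auto simp: Cc_def intro: continuous_on_subset)
  have [measurable]: "g \<in> borel_measurable borel" "dir_deriv y g \<in> borel_measurable borel"
    using Cc_integrable(3)[OF g] Cc_integrable(3)[OF Cc_dir_deriv[OF g1]] by auto
  let ?D = "\<lambda>x t. indicator {0..1::real} t *\<^sub>R dir_deriv y g (x - y + t *\<^sub>R y)"
  have pw: "ennreal ((cmod (g x - g (x - y)))\<^sup>2) \<le> (\<integral>\<^sup>+t. ennreal ((cmod (?D x t))\<^sup>2) \<partial>lborel)" for x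
  proof -
    have cont: "continuous_on {0..1} (\<lambda>t. dir_deriv y g (x - y + t *\<^sub>R y))"
    proof -
      have "continuous_on {0..1} (\<lambda>t. x - y + t *\<^sub>R y)" by (intro continuous_intros)
      then show ?thesis using continuous_on_compose2[OF dc[of UNIV]] by auto
    qed
    define F f' where "F t = g (x - y + t *\<^sub>R y)" and "f' t = dir_deriv y g (x - y + t *\<^sub>R y)" for t
    have der: "(F has_vector_derivative f' t) (at t within {0..1})" for t
      unfolding F_def f'_def by (rule has_vector_derivative_at_within, rule dir_deriv_line, rule d)
    have cont': "continuous_on {0..1} f'" using cont by (simp add: f'_def)
    note hb = has_bochner_integral_FTC_Icc[OF zero_le_one der cont']
    have i: "integrable lborel (?D x)" and "F 1 - F 0 = (LINT t|lborel. ?D x t)"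
      using hb unfolding has_bochner_integral_iff f'_def by simp_all
    then have e: "g x - g (x - y) = (LINT t|lborel. ?D x t)" by (simp add: F_def)
    have "ennreal (cmod (g x - g (x - y))) \<le> (\<integral>\<^sup>+t. ennreal (cmod (?D x t)) \<partial>lborel)"
      unfolding e by (rule integral_norm_bound_ennreal[OF i])
    also have "\<dots> = (\<integral>\<^sup>+t. indicator {0..1::real} t * ennreal (cmod (?D x t)) \<partial>lborel)"
      by (intro nn_integral_cong) (auto split: split_indicator)
    finally have "(ennreal (cmod (g x - g (x - y))))\<^sup>2 \<le>
        (\<integral>\<^sup>+t. indicator {0..1::real} t * ennreal (cmod (?D x t)) \<partial>lborel)\<^sup>2"
      by (intro power_mono) auto
    also have "\<dots> \<le> (\<integral>\<^sup>+t. (indicator {0..1::real} t)\<^sup>2 \<partial>lborel) * (\<integral>\<^sup>+t. (ennreal (cmod (?D x t)))\<^sup>2 \<partial>lborel)"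
      by (rule Cauchy_Schwarz_nn_integral) measurable
    also have "(\<integral>\<^sup>+t. (indicator {0..1::real} t)\<^sup>2 \<partial>lborel) = (\<integral>\<^sup>+t. indicator {0..1::real} t \<partial>lborel)"
      by (intro nn_integral_cong) (auto split: split_indicator)
    also have "\<dots> = 1" by simp
    finally show ?thesis by (simp add: ennreal_power)
  qed
  have "(\<integral>\<^sup>+x. ennreal ((cmod (g x - g (x - y)))\<^sup>2) \<partial>lborel) \<le>
      (\<integral>\<^sup>+x. (\<integral>\<^sup>+t. ennreal ((cmod (?D x t))\<^sup>2) \<partial>lborel) \<partial>lborel)"
    by (intro nn_integral_mono pw)
  also have "\<dots> = (\<integral>\<^sup>+t. (\<integral>\<^sup>+x. ennreal ((cmod (?D x t))\<^sup>2) \<partial>lborel) \<partial>lborel)"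
    by (rule lborel_pair.Fubini'[symmetric]) measurable
  also have "\<dots> = (\<integral>\<^sup>+t. indicator {0..1::real} t * (\<integral>\<^sup>+x. ennreal ((cmod (dir_deriv y g x))\<^sup>2) \<partial>lborel) \<partial>lborel)"
  proof (rule nn_integral_cong)
    fix t :: real
    have "(\<integral>\<^sup>+x. ennreal ((cmod (dir_deriv y g (x - (1 - t) *\<^sub>R y)))\<^sup>2) \<partial>lborel) =
        (\<integral>\<^sup>+x. ennreal ((cmod (dir_deriv y g x))\<^sup>2) \<partial>lborel)"
      by (rule nn_integral_lborel_translate) measurable
    then show "(\<integral>\<^sup>+x. ennreal ((cmod (?D x t))\<^sup>2) \<partial>lborel) =
        indicator {0..1::real} t * (\<integral>\<^sup>+x. ennreal ((cmod (dir_deriv y g x))\<^sup>2) \<partial>lborel)"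
      by (auto split: split_indicator simp: algebra_simps)
  qed
  also have "\<dots> = (\<integral>\<^sup>+x. ennreal ((cmod (dir_deriv y g x))\<^sup>2) \<partial>lborel)"
    by (simp add: nn_integral_multc)
  finally show ?thesis .
qed

section \<open>Density of continuous functions and continuity of translations in L^2\<close>

definition nn2 :: "'a measure \<Rightarrow> ('a \<Rightarrow> complex) \<Rightarrow> ennreal" where
  "nn2 M f = (\<integral>\<^sup>+x. ennreal ((cmod (f x))\<^sup>2) \<partial>M)"

lemma nn2_lebesgue: "nn2 lebesgue f = nn2 lborel f"
  by (simp add: nn2_def nn_integral_completion)

lemma cmod_add_sq: "(cmod (a + b))\<^sup>2 \<le> 2 * (cmod a)\<^sup>2 + 2 * (cmod b)\<^sup>2"
proof -
  have "(cmod (a + b))\<^sup>2 \<le> (cmod a + cmod b)\<^sup>2"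
    by (intro power_mono norm_triangle_ineq) auto
  also have "\<dots> \<le> 2 * (cmod a)\<^sup>2 + 2 * (cmod b)\<^sup>2"
    using sum_squares_bound[of "cmod a" "cmod b"] by (simp add: power2_sum)
  finally show ?thesis .
qed

lemma nn2_add:
  assumes [measurable]: "f \<in> borel_measurable M" "g \<in> borel_measurable M"
  shows "nn2 M (\<lambda>x. f x + g x) \<le> 2 * nn2 M f + 2 * nn2 M g"
proof -
  have "nn2 M (\<lambda>x. f x + g x) \<le>
      (\<integral>\<^sup>+x. 2 * ennreal ((cmod (f x))\<^sup>2) + 2 * ennreal ((cmod (g x))\<^sup>2) \<partial>M)"
    unfolding nn2_def
  proof (rule nn_integral_mono)
    fix x
    have "ennreal ((cmod (f x + g x))\<^sup>2) \<le> ennreal (2 * (cmod (f x))\<^sup>2 + 2 * (cmod (g x))\<^sup>2)"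
      by (intro ennreal_leI cmod_add_sq)
    then show "ennreal ((cmod (f x + g x))\<^sup>2) \<le> 2 * ennreal ((cmod (f x))\<^sup>2) + 2 * ennreal ((cmod (g x))\<^sup>2)"
      by (simp add: ennreal_plus ennreal_mult)
  qed
  also have "\<dots> = 2 * nn2 M f + 2 * nn2 M g"
    unfolding nn2_def by (simp add: nn_integral_add nn_integral_cmult)
  finally show ?thesis .
qed

lemma nn2_dominated:
  assumes [measurable]: "\<And>n. f n \<in> borel_measurable M" "g \<in> borel_measurable M"
    and "nn2 M g < \<infinity>" and "\<And>n. AE x in M. cmod (f n x) \<le> cmod (g x)"
    and "AE x in M. (\<lambda>n. f n x) \<longlonglongrightarrow> 0"
  shows "(\<lambda>n. nn2 M (f n)) \<longlonglongrightarrow> 0"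
proof -
  have "(\<lambda>n. \<integral>\<^sup>+x. ennreal ((cmod (f n x))\<^sup>2) \<partial>M) \<longlonglongrightarrow> (\<integral>\<^sup>+x. 0 \<partial>M)"
  proof (rule nn_integral_dominated_convergence[where w = "\<lambda>x. ennreal ((cmod (g x))\<^sup>2)"])
    show "AE x in M. ennreal ((cmod (f n x))\<^sup>2) \<le> ennreal ((cmod (g x))\<^sup>2)" for n
      using assms(4)[of n] by eventually_elim (auto intro!: ennreal_leI power_mono)
    show "AE x in M. (\<lambda>n. ennreal ((cmod (f n x))\<^sup>2)) \<longlonglongrightarrow> 0"
      using assms(5)
    proof eventually_elim
      case (elim x)
      have "(\<lambda>n. ennreal ((cmod (f n x))\<^sup>2)) \<longlonglongrightarrow> ennreal ((cmod 0)\<^sup>2)"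
        by (intro tendsto_ennrealI tendsto_intros elim)
      then show ?case by simp
    qed
  qed (use assms(3) in \<open>auto simp: nn2_def\<close>)
  then show ?thesis by (simp add: nn2_def)
qed

lemma nn2_small:
  assumes "(\<lambda>n. nn2 M (f n)) \<longlonglongrightarrow> 0" "e > 0"
  obtains n where "nn2 M (f n) < e"
proof -
  have "\<forall>\<^sub>F n in sequentially. nn2 M (f n) < e" by (rule order_tendstoD(2)[OF assms])
  from eventually_happens'[OF sequentially_bot this] show ?thesis using that by blast
qed

lemma finite_cball_nn2: "nn2 lebesgue (\<lambda>x::'a::euclidean_space. of_real (c * indicator (cball 0 R) x)) < \<infinity>"
proof -
  have "nn2 lebesgue (\<lambda>x::'a. of_real (c * indicator (cball 0 R) x)) =
      (\<integral>\<^sup>+x. ennreal (c\<^sup>2) * indicator (cball (0::'a) R) x \<partial>lebesgue)"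
    unfolding nn2_def by (intro nn_integral_cong) (auto split: split_indicator)
  also have "\<dots> = ennreal (c\<^sup>2) * emeasure lebesgue (cball (0::'a) R)"
    by (subst nn_integral_cmult_indicator) auto
  also have "\<dots> < \<infinity>"
    using emeasure_bounded_finite[of "cball (0::'a) R"] by (simp add: ennreal_mult_less_top)
  finally show ?thesis .
qed

text \<open>Truncation in value and in space leaves a small error. The truncated function is an
  almost everywhere limit of continuous functions; once these are clipped and cut off in the same
  way, the convergence is dominated and hence holds in L^2.\<close>

lemma L2_approx_continuous:
  fixes f :: "'a::euclidean_space \<Rightarrow> complex"
  assumes f [measurable]: "f \<in> borel_measurable lebesgue" and fin: "nn2 lebesgue f < \<infinity>" and e: "e > (0::real)"
  shows "\<exists>g R. continuous_on UNIV g \<and> (\<forall>x. norm x > R \<longrightarrow> g x = 0) \<and>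
    nn2 lebesgue (\<lambda>x. f x - g x) < ennreal e"
proof -
  have [measurable]: "norm \<in> borel_measurable (lebesgue :: 'a measure)"
    by (intro measurable_completion) simp
  define F where "F n x = (if cmod (f x) \<le> real n \<and> norm x \<le> real n then f x else 0)" for n x
  have Fm [measurable]: "F n \<in> borel_measurable lebesgue" for n
    unfolding F_def by measurable
  have "(\<lambda>n. nn2 lebesgue (\<lambda>x. f x - F n x)) \<longlonglongrightarrow> 0"
  proof (rule nn2_dominated[OF _ f fin])
    show "AE x in lebesgue. (\<lambda>n. f x - F n x) \<longlonglongrightarrow> 0"
    proof (intro always_eventually allI)
      fix x
      obtain N where "max (cmod (f x)) (norm x) \<le> real N" using real_arch_simple by blast
      then have "\<forall>n\<ge>N. f x - F n x = 0" by (auto simp: F_def)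
      then show "(\<lambda>n. f x - F n x) \<longlonglongrightarrow> 0"
        by (intro tendsto_eventually) (auto simp: eventually_sequentially)
    qed
  qed (auto simp: F_def)
  then obtain n where n: "nn2 lebesgue (\<lambda>x. f x - F n x) < ennreal (e / 4)"
    using e nn2_small[of lebesgue "\<lambda>n x. f x - F n x" "ennreal (e / 4)"] by auto
  define m where "m = real (Suc n)"
  have m: "m > 0" by (simp add: m_def)
  have Fn: "cmod (F n x) \<le> m" "norm x > real n \<Longrightarrow> F n x = 0" for x by (auto simp: F_def m_def)
  have "F n measurable_on UNIV"
    using lebesgue_measurable_imp_measurable_on[OF Fm, of UNIV] by simp
  then obtain N g where N: "negligible N" "\<And>k. continuous_on UNIV (g k)"
    "\<And>x. x \<notin> N \<Longrightarrow> (\<lambda>k. g k x) \<longlonglongrightarrow> F n x"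
    unfolding measurable_on_def by auto
  \<comment> \<open>The radial retraction onto the disc of radius \<open>m\<close>: continuous, and
    the identity on the values of \<open>F n\<close>. Taking \<open>Suc n\<close> in
    \<open>m\<close> keeps the division meaningful for \<open>n = 0\<close>.\<close>
  define cl where "cl w = w /\<^sub>R max 1 (cmod w / m)" for w
  have cl1: "cmod (cl w) \<le> m" for w
  proof -
    have "cmod w = m * (cmod w / m)" using m by simp
    also have "\<dots> \<le> m * max 1 (cmod w / m)" using m by (intro mult_left_mono) auto
    finally have "cmod w \<le> m * max 1 (cmod w / m)" .
    moreover have "cmod (cl w) = cmod w / max 1 (cmod w / m)"
      unfolding cl_def norm_scaleR by (simp add: divide_inverse_commute)
    ultimately show ?thesis by (simp add: pos_divide_le_eq)
  qed
  have cl2: "cmod w \<le> m \<Longrightarrow> cl w = w" for w using m by (simp add: cl_def max_def)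
  have clc: "continuous_on UNIV cl" unfolding cl_def[abs_def]
    using m by (intro continuous_intros) auto
  \<comment> \<open>A continuous cut-off, 1 on the ball of radius \<open>n\<close> and 0 beyond
    radius \<open>n + 1\<close>.\<close>
  define ct where "ct x = max 0 (min 1 (real n + 1 - norm x))" for x :: 'a
  have ctc: "continuous_on UNIV ct" unfolding ct_def[abs_def] by (intro continuous_intros)
  have ct: "0 \<le> ct x" "ct x \<le> 1" "norm x \<le> real n \<Longrightarrow> ct x = 1" "norm x > real n + 1 \<Longrightarrow> ct x = 0" for x
    by (auto simp: ct_def)
  define G where "G k x = ct x *\<^sub>R cl (g k x)" for k x
  have Gc: "continuous_on UNIV (G k)" for k
    unfolding G_def[abs_def]
    by (intro continuous_intros ctc continuous_on_compose2[OF clc N(2)]) auto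
  have Gm [measurable]: "G k \<in> borel_measurable lebesgue" for k
    using Gc[of k] by (intro measurable_completion) (simp add: borel_measurable_continuous_onI)
  have "(\<lambda>k. nn2 lebesgue (\<lambda>x. F n x - G k x)) \<longlonglongrightarrow> 0"
  proof (rule nn2_dominated[OF _ _ finite_cball_nn2[of "2 * m" "real n + 1"]])
    show "AE x in lebesgue. (\<lambda>k. F n x - G k x) \<longlonglongrightarrow> 0"
    proof -
      have "(\<lambda>k. F n x - G k x) \<longlonglongrightarrow> 0" if "x \<notin> N" for x
      proof -
        have "(\<lambda>k. G k x) \<longlonglongrightarrow> ct x *\<^sub>R cl (F n x)"
          unfolding G_def using N(3)[OF that] clc
          by (intro tendsto_intros continuous_on_tendsto_compose[of UNIV cl]) auto
        also have "ct x *\<^sub>R cl (F n x) = F n x"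
          using Fn[of x] cl2 ct[of x] by (cases "norm x \<le> real n") (auto simp: cl_def)
        finally show ?thesis using tendsto_diff[OF tendsto_const[of "F n x"]] by fastforce
      qed
      then show ?thesis
        using N(1) unfolding eventually_ae_filter_negligible by blast
    qed
    show "AE x in lebesgue. cmod (F n x - G k x) \<le> cmod (of_real (2 * m * indicator (cball 0 (real n + 1)) x))" for k
    proof (intro always_eventually allI)
      fix x
      have "cmod (G k x) \<le> 1 * m" unfolding G_def norm_scaleR
        using ct[of x] cl1 by (intro mult_mono) auto
      then have "cmod (F n x - G k x) \<le> 2 * m"
        using Fn(1)[of x] norm_triangle_ineq4[of "F n x" "G k x"] by linarith
      moreover have "F n x - G k x = 0" if "norm x > real n + 1"
        using that Fn(2)[of x] ct(4)[of x] by (simp add: G_def)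
      ultimately show "cmod (F n x - G k x) \<le> cmod (of_real (2 * m * indicator (cball 0 (real n + 1)) x))"
        using m by (cases "norm x \<le> real n + 1") (auto simp: indicator_def)
    qed
    show "(\<lambda>x. F n x - G k x) \<in> borel_measurable lebesgue" for k by measurable
    have [measurable]: "cball (0::'a) r \<in> sets lebesgue" for r by simp
    show "(\<lambda>x::'a. complex_of_real (2 * m * indicator (cball 0 (real n + 1)) x)) \<in> borel_measurable lebesgue"
      by measurable
  qed
  then obtain k where k: "nn2 lebesgue (\<lambda>x. F n x - G k x) < ennreal (e / 4)"
    using e nn2_small[of lebesgue "\<lambda>k x. F n x - G k x" "ennreal (e / 4)"] by auto
  have "nn2 lebesgue (\<lambda>x. f x - G k x) = nn2 lebesgue (\<lambda>x. (f x - F n x) + (F n x - G k x))" by simp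
  also have "\<dots> \<le> 2 * nn2 lebesgue (\<lambda>x. f x - F n x) + 2 * nn2 lebesgue (\<lambda>x. F n x - G k x)"
    by (rule nn2_add) measurable
  also have "\<dots> < 2 * ennreal (e / 4) + 2 * ennreal (e / 4)"
    using n k by (intro add_strict_mono ennreal_mult_strict_left_mono) auto
  also have "\<dots> = ennreal e"
    using e by (simp add: ennreal_mult''[symmetric] ennreal_plus[symmetric] mult.commute[of 2] del: ennreal_plus flip: ennreal_numeral)
  finally show ?thesis using Gc[of k] ct(4) by (intro exI[of _ "G k"] exI[of _ "real n + 1"]) (auto simp: G_def)
qed

lemma translation_continuous_compact_support:
  fixes g :: "'a::euclidean_space \<Rightarrow> complex"
  assumes g: "continuous_on UNIV g" and R: "\<And>x. norm x > R \<Longrightarrow> g x = 0" and e: "e > (0::real)"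
  shows "\<exists>\<delta>>0. \<forall>y. norm y \<le> \<delta> \<longrightarrow> nn2 lborel (\<lambda>x. g x - g (x - y)) \<le> ennreal e"
proof -
  \<comment> \<open>Adding 1 keeps \<open>V\<close> positive, so that \<open>h\<close> can be chosen
    with \<open>h\<^sup>2 * V = e\<close>: a pointwise increment below \<open>h\<close> on a set of
    volume at most \<open>V\<close> costs at most \<open>e\<close>.\<close>
  define V where "V = measure lborel (cball (0::'a) (R + 1)) + 1"
  have V: "V > 0" by (simp add: V_def add_nonneg_pos)
  define h where "h = sqrt (e / V)"
  have h: "h > 0" "h\<^sup>2 * V = e" using e V by (auto simp: h_def)
  have "uniformly_continuous_on (cball 0 (R + 2)) g"
    by (intro compact_uniformly_continuous continuous_on_subset[OF g]) auto
  then obtain d where d: "d > 0" "\<And>x x'. x \<in> cball 0 (R + 2) \<Longrightarrow> x' \<in> cball 0 (R + 2) \<Longrightarrow>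
      dist x' x < d \<Longrightarrow> dist (g x') (g x) < h"
    unfolding uniformly_continuous_on_def using h by metis
  have "nn2 lborel (\<lambda>x. g x - g (x - y)) \<le> ennreal e" if y: "norm y \<le> min (d / 2) 1" for y
  proof -
    have "ennreal ((cmod (g x - g (x - y)))\<^sup>2) \<le> ennreal (h\<^sup>2) * indicator (cball 0 (R + 1)) x" for x
    proof (cases "norm x \<le> R + 1")
      case True
      have "norm (x - y) \<le> norm x + norm y" by (rule norm_triangle_ineq4)
      then have "dist (g (x - y)) (g x) < h"
        using True y d(1) by (intro d(2)) (auto simp: dist_norm norm_minus_commute[of y x])
      then have "cmod (g x - g (x - y)) \<le> h" by (simp add: dist_norm norm_minus_commute)
      then show ?thesis using True by (auto intro!: ennreal_leI power_mono)
    next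
      case False
      have "norm x \<le> norm (x - y) + norm y" using norm_triangle_ineq[of "x - y" y] by simp
      then have "norm (x - y) > R" "norm x > R" using False y by auto
      then show ?thesis using R by simp
    qed
    then have "nn2 lborel (\<lambda>x. g x - g (x - y)) \<le> (\<integral>\<^sup>+x. ennreal (h\<^sup>2) * indicator (cball (0::'a) (R + 1)) x \<partial>lborel)"
      unfolding nn2_def by (intro nn_integral_mono)
    also have "\<dots> = ennreal (h\<^sup>2) * emeasure lborel (cball (0::'a) (R + 1))"
      by (subst nn_integral_cmult_indicator) auto
    also have "\<dots> \<le> ennreal (h\<^sup>2) * ennreal V"
    proof (rule mult_left_mono)
      have "emeasure lborel (cball (0::'a) (R + 1)) = ennreal (measure lborel (cball (0::'a) (R + 1)))"
        using emeasure_bounded_finite[of "cball (0::'a) (R + 1)"] by (intro emeasure_eq_ennreal_measure) auto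
      also have "\<dots> \<le> ennreal V" unfolding V_def by (intro ennreal_leI) simp
      finally show "emeasure lborel (cball (0::'a) (R + 1)) \<le> ennreal V" .
    qed simp
    also have "\<dots> = ennreal e" using V h by (simp add: ennreal_mult[symmetric])
    finally show ?thesis .
  qed
  then show ?thesis using d(1) by (intro exI[of _ "min (d / 2) 1"]) auto
qed

lemma translation_continuous:
  fixes f :: "'a::euclidean_space \<Rightarrow> complex"
  assumes f [measurable]: "f \<in> borel_measurable borel" and fin: "nn2 lborel f < \<infinity>" and e: "e > (0::real)"
  shows "\<exists>\<delta>>0. \<forall>y. norm y \<le> \<delta> \<longrightarrow> nn2 lborel (\<lambda>x. f x - f (x - y)) \<le> ennreal e"
proof -
  have "f \<in> borel_measurable lebesgue" by (intro measurable_completion) simp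
  \<comment> \<open>Splitting into three summands with \<open>nn2_add\<close> costs 2 + 2 * (2 + 2)
    = 10 copies of the individual bound.\<close>
  from L2_approx_continuous[OF this, of "e / 10"] fin e
  obtain g R where g: "continuous_on UNIV g" "\<And>x. norm x > R \<Longrightarrow> g x = 0"
    and fg: "nn2 lborel (\<lambda>x. f x - g x) < ennreal (e / 10)"
    by (auto simp: nn2_lebesgue)
  have [measurable]: "g \<in> borel_measurable borel" using g(1) by (rule borel_measurable_continuous_onI)
  obtain \<delta> where \<delta>: "\<delta> > 0" "\<And>y. norm y \<le> \<delta> \<Longrightarrow> nn2 lborel (\<lambda>x. g x - g (x - y)) \<le> ennreal (e / 10)"
    using translation_continuous_compact_support[OF g, where e = "e / 10"] e by auto
  have "nn2 lborel (\<lambda>x. f x - f (x - y)) \<le> ennreal e" if y: "norm y \<le> \<delta>" for y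
  proof -
    have "nn2 lborel (\<lambda>x. g (x - y) - f (x - y)) = nn2 lborel (\<lambda>x. g x - f x)"
      unfolding nn2_def by (rule nn_integral_lborel_translate) measurable
    also have "\<dots> = nn2 lborel (\<lambda>x. f x - g x)" by (simp add: nn2_def norm_minus_commute)
    finally have 3: "nn2 lborel (\<lambda>x. g (x - y) - f (x - y)) \<le> ennreal (e / 10)" using fg by simp
    have "nn2 lborel (\<lambda>x. f x - f (x - y)) =
        nn2 lborel (\<lambda>x. (f x - g x) + ((g x - g (x - y)) + (g (x - y) - f (x - y))))" by simp
    also have "\<dots> \<le> 2 * nn2 lborel (\<lambda>x. f x - g x) +
        2 * nn2 lborel (\<lambda>x. (g x - g (x - y)) + (g (x - y) - f (x - y)))"
      by (rule nn2_add) measurable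
    also have "nn2 lborel (\<lambda>x. (g x - g (x - y)) + (g (x - y) - f (x - y))) \<le>
        2 * nn2 lborel (\<lambda>x. g x - g (x - y)) + 2 * nn2 lborel (\<lambda>x. g (x - y) - f (x - y))"
      by (rule nn2_add) measurable
    also have "2 * nn2 lborel (\<lambda>x. f x - g x) +
        2 * (2 * nn2 lborel (\<lambda>x. g x - g (x - y)) + 2 * nn2 lborel (\<lambda>x. g (x - y) - f (x - y))) \<le>
        2 * ennreal (e / 10) + 2 * (2 * ennreal (e / 10) + 2 * ennreal (e / 10))"
      using fg \<delta>(2)[OF y] 3 by (intro add_mono mult_left_mono) auto
    also have "\<dots> = ennreal e"
      using e by (simp add: ennreal_mult''[symmetric] ennreal_plus[symmetric] mult.commute[of 2] del: ennreal_plus flip: ennreal_numeral)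
    finally show ?thesis by (simp add: add_left_mono mult_left_mono)
  qed
  with \<delta>(1) show ?thesis by blast
qed

text \<open>The use of Tonelli's theorem for translates rests on Borel measurability, which a
  Lebesgue measurable function has only after a change on a null set.\<close>

lemma lebesgue_ex_borel_complex:
  fixes f :: "'a::euclidean_space \<Rightarrow> complex"
  assumes "f \<in> borel_measurable lebesgue"
  obtains f' where "f' \<in> borel_measurable borel" "AE x in lebesgue. f x = f' x"
proof -
  have "(\<lambda>x. Re (f x)) \<in> borel_measurable lebesgue" "(\<lambda>x. Im (f x)) \<in> borel_measurable lebesgue"
    using assms by measurable
  then obtain r s where rs [measurable]: "r \<in> borel_measurable lborel" "s \<in> borel_measurable lborel"
    and "AE x in lborel. Re (f x) = r x" "AE x in lborel. Im (f x) = s x"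
    using completion_ex_borel_measurable_real by metis
  then have "AE x in lborel. f x = Complex (r x) (s x)"
    by (auto elim: eventually_elim2 simp: complex_eq_iff)
  then have "AE x in lebesgue. f x = Complex (r x) (s x)" by (rule AE_completion)
  moreover have "(\<lambda>x. Complex (r x) (s x)) \<in> borel_measurable borel"
    using rs unfolding Complex_eq by simp
  ultimately show ?thesis using that by blast
qed

lemma integrable_L2_compact_support:
  fixes f :: "'a::euclidean_space \<Rightarrow> complex"
  assumes [measurable]: "f \<in> borel_measurable lebesgue" and "nn2 lebesgue f < \<infinity>" and R: "\<And>x. norm x > R \<Longrightarrow> f x = 0"
  shows "integrable lebesgue f"
proof (rule Bochner_Integration.integrable_bound)
  have "integrable lebesgue (\<lambda>x. (cmod (f x))\<^sup>2)"
    using assms(2) by (intro integrableI_bounded) (auto simp: nn2_def)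
  moreover have "integrable lebesgue (indicator (cball (0::'a) R) :: _ \<Rightarrow> real)"
    using emeasure_bounded_finite[of "cball (0::'a) R"] by (intro integrable_real_indicator) auto
  ultimately show "integrable lebesgue (\<lambda>x. indicator (cball 0 R) x + (cmod (f x))\<^sup>2)" by simp
  show "AE x in lebesgue. norm (f x) \<le> norm (indicator (cball 0 R) x + (cmod (f x))\<^sup>2)"
  proof (intro always_eventually allI)
    fix x
    have "t \<le> 1 + t\<^sup>2" for t :: real
      using zero_le_power2[of "t - 1/2"] by (simp add: power2_eq_square algebra_simps)
    then show "norm (f x) \<le> norm (indicator (cball 0 R) x + (cmod (f x))\<^sup>2)"
      using R[of x] by (cases "norm x \<le> R") (auto simp: indicator_def)
  qed
qed simp

text \<open>Convolution averages translates, so continuity of translations bounds its error. The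
  threshold serves every mollifier of smaller radius, which later lets one kernel work for finitely
  many functions.\<close>

lemma mollify_L2:
  fixes f :: "'a::euclidean_space \<Rightarrow> complex"
  assumes f: "f \<in> borel_measurable lebesgue" and fin: "nn2 lebesgue f < \<infinity>" and R: "\<And>x. norm x > R \<Longrightarrow> f x = 0"
    and e: "e > (0::real)"
  shows "\<exists>\<delta>0>0. \<forall>\<delta> \<rho>. \<delta> \<le> \<delta>0 \<longrightarrow> mollifier \<delta> \<rho> \<longrightarrow> nn2 lebesgue (\<lambda>x. f x - conv \<rho> f x) \<le> ennreal e"
proof -
  obtain f' where f' [measurable]: "f' \<in> borel_measurable borel" and eq: "AE x in lebesgue. f x = f' x"
    using lebesgue_ex_borel_complex[OF f] by blast
  have f'l: "f' \<in> borel_measurable lebesgue" by (intro measurable_completion) simp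
  have "integrable lebesgue f'"
    using integrable_L2_compact_support[OF f fin R] integrable_cong_AE[OF f f'l eq] by simp
  then have fi: "integrable lborel f'" by (simp add: integrable_completion)
  have "nn2 lebesgue f' = nn2 lebesgue f"
    unfolding nn2_def using eq by (intro nn_integral_cong_AE) (auto elim: eventually_mono)
  then have "nn2 lborel f' < \<infinity>" using fin by (simp add: nn2_lebesgue)
  then obtain d where d: "d > 0" "\<And>y. norm y \<le> d \<Longrightarrow> nn2 lborel (\<lambda>x. f' x - f' (x - y)) \<le> ennreal e"
    using translation_continuous[OF f' _ e] by blast
  have "nn2 lebesgue (\<lambda>x. f x - conv \<rho> f x) \<le> ennreal e" if "\<delta> \<le> d" "mollifier \<delta> \<rho>" for \<delta> \<rho>
  proof -
    have "continuous_on UNIV (\<lambda>y. \<rho> (x - y))" for x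
      using Ck_continuous[OF CcD[OF mollifier_Cc[OF that(2), of 0]], of UNIV]
      by (rule continuous_on_compose2) (auto intro!: continuous_intros)
    then have [measurable]: "(\<lambda>y. \<rho> (x - y)) \<in> borel_measurable lebesgue" for x
      by (intro measurable_completion) (simp add: borel_measurable_continuous_onI)
    have c: "conv \<rho> f x = conv \<rho> f' x" for x
      unfolding conv_def using eq f f'l
      by (intro integral_cong_AE) (auto elim: eventually_mono)
    have "nn2 lebesgue (\<lambda>x. f x - conv \<rho> f x) = nn2 lebesgue (\<lambda>x. f' x - conv \<rho> f' x)"
      unfolding nn2_def c using eq by (intro nn_integral_cong_AE) (auto elim: eventually_mono)
    also have "\<dots> \<le> ennreal e"
      unfolding nn2_lebesgue unfolding nn2_def
      by (rule mollify_le_translations[OF f' fi that(2)]) (use d that(1) in \<open>auto simp: nn2_def\<close>)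
    finally show ?thesis .
  qed
  then show ?thesis using d(1) by blast
qed

text \<open>In contrast to \<open>mollify_L2\<close> the rate depends on \<open>g\<close> only
  through the norms of its first derivatives. It is therefore uniform over a family with bounded
  gradients, as the compactness argument requires.\<close>

lemma mollify_Cc:
  fixes g :: "'a::euclidean_space \<Rightarrow> complex"
  assumes g: "Cc 1 g" and \<rho>: "mollifier \<delta> \<rho>" and \<delta>: "\<delta> \<ge> 0"
  shows "nn2 lborel (\<lambda>x. g x - conv \<rho> g x) \<le> ennreal (\<delta>\<^sup>2) * (\<Sum>b\<in>Basis. nn2 lborel (dir_deriv b g))"
  unfolding nn2_def[of _ "\<lambda>x. g x - conv \<rho> g x"]
proof (rule mollify_le_translations[OF Cc_integrable(3,1)[OF g] \<rho>])
  fix y :: 'a assume y: "norm y \<le> \<delta>"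
  have g1: "Cc (Suc 0) g" using g by simp
  have d: "g differentiable (at x)" for x using g1 by (simp add: Cc_def Ck_Suc)
  have [measurable]: "dir_deriv b g \<in> borel_measurable borel" for b
    using Cc_integrable(3)[OF Cc_dir_deriv[OF g1]] by auto
  have "(cmod (dir_deriv y g x))\<^sup>2 \<le> \<delta>\<^sup>2 * (\<Sum>b\<in>Basis. (cmod (dir_deriv b g x))\<^sup>2)" for x
  proof -
    have "cmod (dir_deriv y g x) \<le> (\<Sum>b\<in>Basis. \<bar>y \<bullet> b\<bar> * cmod (dir_deriv b g x))"
      by (subst dir_deriv_expand[OF d]) (auto intro!: order_trans[OF norm_sum])
    then have "(cmod (dir_deriv y g x))\<^sup>2 \<le> (\<Sum>b\<in>Basis. \<bar>y \<bullet> b\<bar> * cmod (dir_deriv b g x))\<^sup>2"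
      by (intro power_mono) auto
    also have "\<dots> \<le> (\<Sum>b\<in>Basis. \<bar>y \<bullet> b\<bar>\<^sup>2) * (\<Sum>b\<in>Basis. (cmod (dir_deriv b g x))\<^sup>2)"
      by (rule Cauchy_Schwarz_ineq_sum)
    also have "(\<Sum>b\<in>Basis. \<bar>y \<bullet> b\<bar>\<^sup>2) = (norm y)\<^sup>2"
    proof -
      have "(\<Sum>b\<in>Basis. \<bar>y \<bullet> b\<bar>\<^sup>2) = y \<bullet> y"
        by (subst (2) euclidean_inner) (simp add: power2_eq_square)
      then show ?thesis by (simp only: power2_norm_eq_inner)
    qed
    also have "(norm y)\<^sup>2 * (\<Sum>b\<in>Basis. (cmod (dir_deriv b g x))\<^sup>2) \<le> \<delta>\<^sup>2 * (\<Sum>b\<in>Basis. (cmod (dir_deriv b g x))\<^sup>2)"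
      using y by (intro mult_right_mono power_mono sum_nonneg) auto
    finally show ?thesis .
  qed
  then have "(\<integral>\<^sup>+x. ennreal ((cmod (dir_deriv y g x))\<^sup>2) \<partial>lborel) \<le>
      (\<integral>\<^sup>+x. ennreal (\<delta>\<^sup>2) * (\<Sum>b\<in>Basis. ennreal ((cmod (dir_deriv b g x))\<^sup>2)) \<partial>lborel)"
    by (intro nn_integral_mono) (simp add: sum_ennreal ennreal_mult[symmetric] sum_nonneg)
  also have "\<dots> = ennreal (\<delta>\<^sup>2) * (\<Sum>b\<in>Basis. nn2 lborel (dir_deriv b g))"
    unfolding nn2_def by (subst nn_integral_cmult) (auto simp: nn_integral_sum simp del: sum_ennreal)
  finally show "(\<integral>\<^sup>+x. ennreal ((cmod (g x - g (x - y)))\<^sup>2) \<partial>lborel) \<le>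
      ennreal (\<delta>\<^sup>2) * (\<Sum>b\<in>Basis. nn2 lborel (dir_deriv b g))"
    using translation_Cc[OF g] order_trans by blast
qed

text \<open>The translate of \<open>g\<close> by a long vector is orthogonal to \<open>g\<close>.\<close>

lemma poincare_Cc:
  fixes g :: "'a::euclidean_space \<Rightarrow> complex"
  assumes g: "Cc 1 g" and R: "\<And>x. norm x > R \<Longrightarrow> g x = 0" and y: "norm y > 2 * R"
  shows "2 * nn2 lborel g \<le> nn2 lborel (dir_deriv y g)"
proof -
  have [measurable]: "g \<in> borel_measurable borel" using Cc_integrable(3)[OF g] .
  have e: "(cmod (g x - g (x - y)))\<^sup>2 = (cmod (g x))\<^sup>2 + (cmod (g (x - y)))\<^sup>2" for x
  proof -
    have "norm y \<le> norm x + norm (x - y)" using norm_triangle_ineq4[of x "x - y"] by simp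
    then have "norm x > R \<or> norm (x - y) > R" using y by linarith
    then show ?thesis using R by auto
  qed
  have "(\<integral>\<^sup>+x. ennreal ((cmod (g x - g (x - y)))\<^sup>2) \<partial>lborel) =
      nn2 lborel g + (\<integral>\<^sup>+x. ennreal ((cmod (g (x - y)))\<^sup>2) \<partial>lborel)"
    unfolding e nn2_def by (simp add: nn_integral_add)
  also have "(\<integral>\<^sup>+x. ennreal ((cmod (g (x - y)))\<^sup>2) \<partial>lborel) = nn2 lborel g"
    unfolding nn2_def by (rule nn_integral_lborel_translate) measurable
  finally show ?thesis using translation_Cc[OF g, of y] by (simp add: nn2_def mult_2)
qed

section \<open>Cut-off functions and the fundamental lemma\<close>

text \<open>The transition layer has the fixed width 2, so one bound \<open>K\<close> of the first
  derivatives can serve all radii. As these derivatives vanish inside radius \<open>R\<close>, the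
  error made by the cut-off only sees the tail of a form.\<close>

definition plateau :: "real \<Rightarrow> real \<Rightarrow> ('a::euclidean_space \<Rightarrow> complex) \<Rightarrow> bool" where
  "plateau K R \<psi> \<longleftrightarrow> test_function \<psi> \<and> (\<forall>x. cmod (\<psi> x) \<le> 1) \<and>
    (\<forall>x. norm x \<le> R \<longrightarrow> \<psi> x = 1) \<and> (\<forall>x. norm x > R + 2 \<longrightarrow> \<psi> x = 0) \<and>
    (\<forall>v x. norm v \<le> 1 \<longrightarrow> cmod (dir_deriv v \<psi> x) \<le> K) \<and> (\<forall>v x. norm x < R \<longrightarrow> dir_deriv v \<psi> x = 0)"

text \<open>Mollifying the indicator of the ball of radius \<open>R + 1\<close> with a kernel of
  radius 1 gives the value 1 up to \<open>R\<close> and 0 beyond \<open>R + 2\<close>. The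
  derivative falls on the kernel and is bounded by the L^1 norms of the kernel's derivatives,
  whatever \<open>R\<close> is.\<close>

lemma plateau_exists: "\<exists>K. \<forall>R. \<exists>\<psi> :: 'a::euclidean_space \<Rightarrow> complex. plateau K R \<psi>"
proof -
  obtain \<rho> :: "'a \<Rightarrow> real" where \<rho>: "mollifier 1 \<rho>" using mollifier_exists[of 1] by auto
  have \<rho>c: "Cc k \<rho>" for k using \<rho> by (rule mollifier_Cc)
  have d: "\<rho> differentiable (at x)" for x using \<rho>c[of "Suc 0"] by (simp add: Cc_def Ck_Suc)
  have \<rho>': "\<rho> x \<ge> 0" "norm x > 1 \<Longrightarrow> \<rho> x = 0" "(LINT x|lborel. \<rho> x) = 1" for x
    using \<rho> by (auto simp: mollifier_def)
  have dc: "Cc 0 (dir_deriv v \<rho>)" for v by (rule Cc_dir_deriv[OF \<rho>c])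
  have int: "integrable lborel (\<lambda>y. h (x - y))" "(LINT y|lborel. h (x - y)) = (LINT y|lborel. h y)"
    if "Cc 0 h" for h :: "'a \<Rightarrow> real" and x
  proof -
    have hm [measurable]: "h \<in> borel_measurable borel" using Cc_integrable(3)[OF that] .
    show "integrable lborel (\<lambda>y. h (x - y))"
      using integrable_distr_eq[of "\<lambda>y. x - y" lborel borel h] Cc_integrable(1)[OF that] by (simp add: lborel_reflect)
    show "(LINT y|lborel. h (x - y)) = (LINT y|lborel. h y)"
      using integral_distr[of "\<lambda>y. x - y" lborel borel h] by (simp add: lborel_reflect)
  qed
  define K where "K = (\<Sum>b\<in>Basis. LINT y|lborel. \<bar>dir_deriv b \<rho> y\<bar>)"
  have "\<exists>\<psi> :: 'a \<Rightarrow> complex. plateau K R \<psi>" for R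
  proof -
    define f :: "'a \<Rightarrow> complex" where "f x = (if norm x \<le> R + 1 then 1 else 0)" for x
    define \<psi> where "\<psi> = conv \<rho> f"
    have fm [measurable]: "f \<in> borel_measurable borel" unfolding f_def by measurable
    have fb: "cmod (f x) \<le> 1" for x by (simp add: f_def)
    have f0: "f x = 0" if "norm x > R + 1" for x using that by (simp add: f_def)
    have fi: "integrable lebesgue f"
    proof -
      have "integrable lborel (\<lambda>x. indicator (cball 0 (R + 1)) x *\<^sub>R (1::complex))"
        by (intro borel_integrable_compact) auto
      also have "(\<lambda>x. indicator (cball 0 (R + 1)) x *\<^sub>R (1::complex)) = f"
        by (auto simp: f_def indicator_def)
      finally show ?thesis by (simp add: integrable_completion)
    qed
    have t: "test_function \<psi>" unfolding \<psi>_def by (rule test_function_conv[OF fi f0 \<rho>])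
    have cv: "conv h f x = (LINT y|lborel. h (x - y) *\<^sub>R f y)" "cmod (conv h f x) \<le> (LINT y|lborel. \<bar>h y\<bar>)"
      if h: "Cc 0 h" for h x
    proof -
      have [measurable]: "h \<in> borel_measurable borel" using Cc_integrable(3)[OF h] .
      show 1: "conv h f x = (LINT y|lborel. h (x - y) *\<^sub>R f y)"
        unfolding conv_def by (rule integral_completion) measurable
      have "cmod (conv h f x) \<le> (LINT y|lborel. \<bar>h (x - y)\<bar>)"
        unfolding 1
      proof (rule Bochner_Integration.integral_norm_bound_integral)
        have "integrable lebesgue (\<lambda>y. h (x - y) *\<^sub>R f y)" by (rule integrable_reflect_scaleR[OF h fi])
        then show "integrable lborel (\<lambda>y. h (x - y) *\<^sub>R f y)"
          by (subst (asm) integrable_completion) auto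
        show "integrable lborel (\<lambda>y. \<bar>h (x - y)\<bar>)" using int(1)[OF h] by simp
        show "cmod (h (x - y) *\<^sub>R f y) \<le> \<bar>h (x - y)\<bar>" for y
          using mult_left_mono[OF fb[of y], of "\<bar>h (x - y)\<bar>"] by simp
      qed
      also have "\<dots> = (LINT y|lborel. \<bar>h y\<bar>)"
        using integral_distr[of "\<lambda>y. x - y" lborel borel "\<lambda>y. \<bar>h y\<bar>"] by (simp add: lborel_reflect)
      finally show "cmod (conv h f x) \<le> (LINT y|lborel. \<bar>h y\<bar>)" .
    qed
    have b: "cmod (\<psi> x) \<le> 1" for x
      using cv(2)[OF \<rho>c, of x] \<rho>' by (simp add: \<psi>_def)
    have one: "\<psi> x = 1" if "norm x \<le> R" for x
    proof -
      have "\<rho> (x - y) *\<^sub>R f y = of_real (\<rho> (x - y))" for y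
        using \<rho>'(2)[of "x - y"] norm_triangle_ineq3[of y x] that
        by (cases "norm y \<le> R + 1") (auto simp: f_def scaleR_conv_of_real norm_minus_commute)
      then have "\<psi> x = (LINT y|lborel. complex_of_real (\<rho> (x - y)))"
        unfolding \<psi>_def cv(1)[OF \<rho>c] by simp
      also have "\<dots> = 1" using int(2)[OF \<rho>c, of x] \<rho>' by simp
      finally show ?thesis .
    qed
    have zero: "\<psi> x = 0" if "norm x > R + 2" for x
      unfolding \<psi>_def by (rule conv_outside[of 1 _ "R + 1"]) (use \<rho>' f0 that in auto)
    have D: "cmod (dir_deriv v \<psi> x) \<le> K" if v: "norm v \<le> 1" for v x
    proof -
      have dx: "\<psi> differentiable (at x)"
        using t by (auto simp: test_function_iff Cc_def intro: Ck_differentiable[of "Suc 0"])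
      have "cmod (dir_deriv v \<psi> x) \<le> (\<Sum>b\<in>Basis. \<bar>v \<bullet> b\<bar> * cmod (dir_deriv b \<psi> x))"
        by (subst dir_deriv_expand[OF dx]) (auto intro!: order_trans[OF norm_sum])
      also have "\<dots> \<le> (\<Sum>b\<in>Basis. 1 * (LINT y|lborel. \<bar>dir_deriv b \<rho> y\<bar>))"
        using v Basis_le_norm[of _ v] cv(2)[OF dc]
        by (intro sum_mono mult_mono) (auto simp: \<psi>_def dir_deriv_conv[OF \<rho>c fi] intro: order_trans)
      finally show ?thesis by (simp add: K_def)
    qed
    have Z: "dir_deriv v \<psi> x = 0" if "norm x < R" for v x
    proof -
      have "(\<psi> has_derivative (\<lambda>_. 0)) (at x)"
        by (rule has_derivative_transform_within_open[OF has_derivative_const[of 1], of "ball 0 R"])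
          (use that one in auto)
      from dir_deriv_eqI[OF this] show ?thesis .
    qed
    show ?thesis unfolding plateau_def using t b one zero D Z by blast
  qed
  then show ?thesis by blast
qed

lemma test_function_mult: "test_function f \<Longrightarrow> (\<And>k. Ck k g) \<Longrightarrow> test_function (\<lambda>x. f x * g x)"
  by (simp add: test_function_iff Cc_mult(1))

lemma test_function_reflect:
  assumes "mollifier \<delta> \<rho>"
  shows "test_function (\<lambda>y::'a::euclidean_space. complex_of_real (\<rho> (x - y)))"
proof -
  have "Ck k (\<lambda>y. \<rho> (x + - y))" for k
    using Ck_affine[OF bounded_linear_minus[OF bounded_linear_ident], of k \<rho> x] assms by (simp add: mollifier_def)
  moreover have "\<rho> (x - y) = 0" if "norm y > norm x + \<delta>" for y
    using assms that norm_triangle_ineq2[of y x] by (auto simp: mollifier_def norm_minus_commute)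
  ultimately show ?thesis
    by (auto simp: test_function_iff Cc_def intro!: Ck_of_real exI[of _ "norm x + \<delta>"])
qed

text \<open>Let \<open>F\<close> be \<open>f\<close> times a cut-off. The value at \<open>x\<close>
  of the convolution of \<open>F\<close> with a mollifier is the pairing of \<open>f\<close> with a
  test function, hence zero; but these convolutions approximate \<open>F\<close> in L^2.\<close>

lemma fundamental_lemma:
  fixes f :: "'a::euclidean_space \<Rightarrow> complex"
  assumes f [measurable]: "f \<in> borel_measurable lebesgue"
    and loc: "\<And>R. nn2 lebesgue (\<lambda>x. indicator (cball 0 R) x * f x) < \<infinity>"
    and z: "\<And>\<eta>. test_function \<eta> \<Longrightarrow> (LINT x|lebesgue. f x * \<eta> x) = 0"
  shows "AE x in lebesgue. f x = 0"
proof -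
  have "AE x in lebesgue. norm x \<le> real n \<longrightarrow> f x = 0" for n
  proof -
    obtain \<psi> :: "'a \<Rightarrow> complex" where \<psi>: "test_function \<psi>" "\<And>x. cmod (\<psi> x) \<le> 1"
      "\<And>x. norm x \<le> real n \<Longrightarrow> \<psi> x = 1" "\<And>x. norm x > real n + 2 \<Longrightarrow> \<psi> x = 0"
      using plateau_exists unfolding plateau_def by metis
    have \<psi>b: "\<psi> \<in> borel_measurable borel" using \<psi>(1) Cc_integrable(3) by (auto simp: test_function_iff)
    then have \<psi>m [measurable]: "\<psi> \<in> borel_measurable lebesgue" by (intro measurable_completion) simp
    define F where "F x = \<psi> x * f x" for x
    have Fm [measurable]: "F \<in> borel_measurable lebesgue" unfolding F_def by measurable
    have F0: "F x = 0" if "norm x > real n + 2" for x using \<psi>(4)[OF that] by (simp add: F_def)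
    have "nn2 lebesgue F \<le> nn2 lebesgue (\<lambda>x. indicator (cball 0 (real n + 2)) x * f x)"
      unfolding nn2_def
    proof (intro nn_integral_mono ennreal_leI power_mono)
      fix x
      show "cmod (F x) \<le> cmod (indicator (cball 0 (real n + 2)) x * f x)"
        using \<psi>(2)[of x] F0[of x] mult_right_mono[OF \<psi>(2)[of x], of "cmod (f x)"]
        by (cases "norm x \<le> real n + 2") (auto simp: F_def norm_mult)
    qed simp
    then have Ffin: "nn2 lebesgue F < \<infinity>" using loc[of "real n + 2"] by (simp add: order_le_less_trans)
    have small: "nn2 lebesgue F \<le> ennreal e" if e: "e > 0" for e
    proof -
      obtain d where d: "d > 0" "\<And>\<delta> \<rho>. \<delta> \<le> d \<Longrightarrow> mollifier \<delta> \<rho> \<Longrightarrow> nn2 lebesgue (\<lambda>x. F x - conv \<rho> F x) \<le> ennreal e"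
        using mollify_L2[OF Fm Ffin F0 e] by blast
      obtain \<rho> :: "'a \<Rightarrow> real" where \<rho>: "mollifier d \<rho>" using mollifier_exists[OF d(1)] by blast
      have "conv \<rho> F x = 0" for x
      proof -
        have "test_function (\<lambda>y. \<psi> y * complex_of_real (\<rho> (x - y)))"
          using test_function_mult[OF \<psi>(1)] test_function_reflect[OF \<rho>, of x] by (auto simp: test_function_iff Cc_def)
        from z[OF this] show ?thesis
          unfolding conv_def F_def by (simp add: scaleR_conv_of_real mult_ac)
      qed
      then show ?thesis using d(2)[OF order_refl \<rho>] by simp
    qed
    have "nn2 lebesgue F \<le> 0" by (rule ennreal_le_epsilon) (simp add: small)
    then have "AE x in lebesgue. ennreal ((cmod (F x))\<^sup>2) = 0"
      unfolding nn2_def by (subst nn_integral_0_iff_AE[symmetric]) auto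
    then show ?thesis
      by eventually_elim (use \<psi>(3) in \<open>auto simp: F_def\<close>)
  qed
  then have "AE x in lebesgue. \<forall>n. norm x \<le> real n \<longrightarrow> f x = 0"
    unfolding AE_all_countable by blast
  then show ?thesis
    by eventually_elim (use real_arch_simple in blast)
qed

section \<open>Hermitian matrices and their lowest eigenvalue\<close>

definition hermitian :: "complex ^ 'n ^ 'n \<Rightarrow> bool" where
  "hermitian A \<longleftrightarrow> (\<forall>j k. A $ j $ k = cnj (A $ k $ j))"

lemma inner_complex_vec: "x \<bullet> y = Re (\<Sum>j\<in>UNIV. x $ j * cnj (y $ j))" for x y :: "complex ^ 'n::finite"
  by (simp add: inner_vec_def inner_complex_def)

lemma hermitian_symmetric:
  fixes x y :: "complex ^ 'n::finite"
  assumes "hermitian A"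
  shows "(A *v x) \<bullet> y = x \<bullet> (A *v y)"
proof -
  have h: "cnj (A $ k $ j) = A $ j $ k" for j k using assms unfolding hermitian_def by metis
  have "(\<Sum>j\<in>UNIV. (A *v x) $ j * cnj (y $ j)) = (\<Sum>j\<in>UNIV. \<Sum>k\<in>UNIV. A $ j $ k * x $ k * cnj (y $ j))"
    by (simp add: matrix_vector_mult_def sum_distrib_right)
  also have "\<dots> = (\<Sum>k\<in>UNIV. \<Sum>j\<in>UNIV. x $ k * cnj (A $ k $ j * y $ j))"
    by (subst sum.swap) (simp add: h mult_ac)
  also have "\<dots> = (\<Sum>k\<in>UNIV. x $ k * cnj ((A *v y) $ k))"
    by (simp add: matrix_vector_mult_def sum_distrib_left)
  finally show ?thesis by (simp only: inner_complex_vec)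
qed

lemma matrix_vector_linear_complex:
  "A *v (x + y) = A *v x + A *v y" "A *v (r *\<^sub>R x) = r *\<^sub>R (A *v x)"
  for A :: "complex ^ 'n ^ 'n::finite"
  by (auto simp: vec_eq_iff matrix_vector_mult_def scaleR_sum_right algebra_simps sum.distrib)

lemma of_real_smult_vec: "complex_of_real t *s v = t *\<^sub>R v" for v :: "complex ^ 'n::finite"
  unfolding vec_eq_iff vector_smult_component vector_scaleR_component by (simp add: scaleR_conv_of_real)

text \<open>Gives meaning to \<open>Min\<close> in \<open>lowest_eigenvalue\<close>. Eigenvectors
  for distinct real eigenvalues are orthogonal in the real inner product, hence linearly
  independent, and there are only finitely many such vectors.\<close>

lemma finite_real_eigenvalues:
  fixes A :: "complex ^ 'n ^ 'n::finite"
  assumes A: "hermitian A"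
  shows "finite {t::real. \<exists>v. v \<noteq> 0 \<and> A *v v = complex_of_real t *s v}"
proof -
  let ?E = "{t::real. \<exists>v. v \<noteq> 0 \<and> A *v v = complex_of_real t *s v}"
  define w where "w t = (SOME v. v \<noteq> 0 \<and> A *v v = complex_of_real t *s v)" for t
  have w: "w t \<noteq> 0 \<and> A *v w t = t *\<^sub>R w t" if "t \<in> ?E" for t
  proof -
    have "\<exists>v. v \<noteq> 0 \<and> A *v v = complex_of_real t *s v" using that by simp
    from someI_ex[OF this] show ?thesis by (simp add: w_def of_real_smult_vec)
  qed
  have orth: "w s \<bullet> w t = 0" if "s \<in> ?E" "t \<in> ?E" "s \<noteq> t" for s t
  proof -
    have "s * (w s \<bullet> w t) = (A *v w s) \<bullet> w t" using w[OF that(1)] by simp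
    also have "\<dots> = w s \<bullet> (A *v w t)" by (rule hermitian_symmetric[OF A])
    also have "\<dots> = t * (w s \<bullet> w t)" using w[OF that(2)] by simp
    finally show ?thesis using that(3) by simp
  qed
  have inj: "inj_on w ?E"
  proof (rule inj_onI, rule ccontr)
    fix s t assume *: "s \<in> ?E" "t \<in> ?E" "w s = w t" "s \<noteq> t"
    then have "w t \<bullet> w t = 0" using orth[OF *(1,2,4)] by simp
    then show False using w[OF *(2)] by simp
  qed
  have "independent (w ` ?E)"
  proof (rule pairwise_orthogonal_independent)
    show "pairwise orthogonal (w ` ?E)"
      unfolding pairwise_def orthogonal_def using orth by (metis (no_types, lifting) imageE)
    show "0 \<notin> w ` ?E" using w by force
  qed
  then have "finite (w ` ?E)" by (rule independent_imp_finite)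
  then show ?thesis using inj by (rule finite_imageD)
qed

text \<open>A minimiser of the Rayleigh quotient on the unit sphere is an eigenvector, by the first
  variation in the direction of its own residual \<open>d\<close>. The minimum is thus among the
  eigenvalues and bounds the lowest one from above.\<close>

lemma lowest_eigenvalue_le:
  fixes A :: "complex ^ 'n ^ 'n::finite"
  assumes A: "hermitian A"
  shows "lowest_eigenvalue A * (norm v)\<^sup>2 \<le> (A *v v) \<bullet> v"
proof -
  define q where "q x = (A *v x) \<bullet> x" for x
  have "continuous_on (sphere 0 1) q"
  proof -
    have "bounded_linear (\<lambda>x. A *v x)"
      by (intro linear_conv_bounded_linear[THEN iffD1] linearI) (auto simp: matrix_vector_linear_complex)
    then show ?thesis unfolding q_def[abs_def]
      by (intro continuous_intros linear_continuous_on)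
  qed
  moreover have "axis undefined 1 \<in> sphere (0::complex ^ 'n) 1" by simp
  ultimately obtain v0 where v0: "norm v0 = 1" "\<And>x. norm x = 1 \<Longrightarrow> q v0 \<le> q x"
    using continuous_attains_inf[of "sphere (0::complex ^ 'n) 1" q] by (auto simp: compact_sphere)
  define t where "t = q v0"
  have qs: "q (r *\<^sub>R x) = r\<^sup>2 * q x" for r x
    by (simp add: q_def matrix_vector_linear_complex power2_eq_square)
  have qt: "t * (norm x)\<^sup>2 \<le> q x" for x
  proof (cases "x = 0")
    case False
    have "x = norm x *\<^sub>R (x /\<^sub>R norm x)" using False by simp
    then have "q x = (norm x)\<^sup>2 * q (x /\<^sub>R norm x)" using qs by metis
    moreover have "t \<le> q (x /\<^sub>R norm x)" unfolding t_def using False by (intro v0(2)) simp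
    ultimately show ?thesis by (simp add: mult.commute[of t] mult_left_mono)
  qed (simp add: q_def)
  have ev: "A *v v0 = t *\<^sub>R v0"
  proof -
    define d where "d = A *v v0 - t *\<^sub>R v0"
    define c where "c = q d - t * (norm d)\<^sup>2"
    have c: "c \<ge> 0" using qt[of d] by (simp add: c_def)
    have "0 \<le> 2 * s * (d \<bullet> d) + s\<^sup>2 * c" for s
    proof -
      have "q (v0 + s *\<^sub>R d) - t * (norm (v0 + s *\<^sub>R d))\<^sup>2 = 2 * s * (d \<bullet> d) + s\<^sup>2 * c"
      proof -
        have "q (v0 + s *\<^sub>R d) = q v0 + 2 * s * ((A *v v0) \<bullet> d) + s\<^sup>2 * q d"
          using hermitian_symmetric[OF A, of d v0]
          by (simp add: q_def matrix_vector_linear_complex inner_add_left inner_add_right power2_eq_square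
              inner_commute[of d v0] inner_commute[of d "A *v v0"] algebra_simps)
        moreover have "(norm (v0 + s *\<^sub>R d))\<^sup>2 = 1 + 2 * s * (v0 \<bullet> d) + s\<^sup>2 * (norm d)\<^sup>2"
          unfolding power2_norm_eq_inner using v0(1) by (simp add: inner_add_left inner_add_right inner_commute[of d v0]
              norm_eq_1 power2_eq_square algebra_simps)
        moreover have dd: "(A *v v0) \<bullet> d = d \<bullet> d + t * (v0 \<bullet> d)"
          by (subst (2) d_def) (simp add: inner_diff_left)
        ultimately show ?thesis by (simp add: c_def t_def[symmetric] algebra_simps dd)
      qed
      then show ?thesis using qt[of "v0 + s *\<^sub>R d"] by simp
    qed
    \<comment> \<open>Close to the minimiser of the quadratic in \<open>s\<close>; the denominator
      \<open>c + 1\<close> stays positive when \<open>c\<close> vanishes. A nonzero \<open>d\<close>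
      would make the value negative.\<close>
    from this[of "- (d \<bullet> d) / (c + 1)"]
    have "0 \<le> - 2 * (d \<bullet> d)\<^sup>2 / (c + 1) + (d \<bullet> d)\<^sup>2 * c / (c + 1)\<^sup>2"
      by (simp add: power2_eq_square power_divide)
    also have "\<dots> \<le> - 2 * (d \<bullet> d)\<^sup>2 / (c + 1) + (d \<bullet> d)\<^sup>2 / (c + 1)"
    proof -
      have "c / (c + 1)\<^sup>2 \<le> 1 / (c + 1)" using c by (simp add: divide_simps power2_eq_square)
      from mult_left_mono[OF this, of "(d \<bullet> d)\<^sup>2"] show ?thesis by simp
    qed
    finally have "(d \<bullet> d)\<^sup>2 / (c + 1) \<le> 0" by simp
    then have "(d \<bullet> d)\<^sup>2 \<le> 0" using c by (simp add: divide_le_0_iff)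
    then have "d = 0" by simp
    then show ?thesis by (simp add: d_def)
  qed
  have "lowest_eigenvalue A \<le> t"
    unfolding lowest_eigenvalue_def
    by (rule Min_le[OF finite_real_eigenvalues[OF A]])
      (use ev v0(1) in \<open>auto simp: of_real_smult_vec intro!: exI[of _ v0]\<close>)
  then have "lowest_eigenvalue A * (norm v)\<^sup>2 \<le> t * (norm v)\<^sup>2" by (rule mult_right_mono) simp
  then show ?thesis using qt[of v] by (simp add: q_def)
qed

section \<open>The Levi form\<close>

definition levi_form :: "(complex ^ 'n::finite \<Rightarrow> real) \<Rightarrow> complex ^ 'n \<Rightarrow> ('n \<Rightarrow> complex) \<Rightarrow> real" where
  "levi_form \<phi> z a = Re (\<Sum>j\<in>UNIV. \<Sum>k\<in>UNIV. levi_matrix \<phi> z $ j $ k * a j * cnj (a k))"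

lemma levi_matrix_cr:
  "levi_matrix \<phi> z $ j $ k = cr (- \<i>) j (cr \<i> k (\<lambda>w. complex_of_real (\<phi> w))) z"
  by (simp add: levi_matrix_def wirtinger_eq_cr)

text \<open>Since \<open>\<phi>\<close> is real, conjugation exchanges its two Wirtinger
  derivatives; the rest is the symmetry of second derivatives.\<close>

lemma hermitian_levi_matrix:
  assumes \<phi>: "Ck 2 \<phi>"
  shows "hermitian (levi_matrix \<phi> z)"
  unfolding hermitian_def
proof (intro allI)
  fix j k
  let ?f = "\<lambda>w. complex_of_real (\<phi> w)"
  have f: "Ck 2 ?f" using \<phi> by (rule Ck_of_real)
  then have f2: "Ck (Suc 1) ?f" by (simp add: numeral_2_eq_2)
  have d: "?f differentiable (at x)" for x using f2 by (simp add: Ck_Suc)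
  have d': "cr s j ?f differentiable (at x)" for s j x using Ck_cr[OF f2] by (simp add: Ck_Suc)
  have c: "cnj (cr s j ?f x) = cr (cnj s) j ?f x" for s j x
    using cr_cnj[OF d, of "cnj s" j x] by simp
  have "cnj (levi_matrix \<phi> z $ k $ j) = cr \<i> k (\<lambda>x. cnj (cr \<i> j ?f x)) z"
    unfolding levi_matrix_cr using cr_cnj[OF d', of \<i> k \<i> j z] by simp
  also have "\<dots> = cr \<i> k (cr (- \<i>) j ?f) z" by (simp add: c)
  also have "\<dots> = levi_matrix \<phi> z $ j $ k" unfolding levi_matrix_cr by (rule cr_commute[OF f])
  finally show "levi_matrix \<phi> z $ j $ k = cnj (levi_matrix \<phi> z $ k $ j)" by simp
qed

lemma levi_form_ge:
  fixes \<phi> :: "complex ^ 'n::finite \<Rightarrow> real"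
  assumes \<phi>: "Ck 2 \<phi>"
  shows "lowest_eigenvalue (levi_matrix \<phi> z) * (\<Sum>j\<in>UNIV. (cmod (a j))\<^sup>2) \<le> levi_form \<phi> z a"
proof -
  \<comment> \<open>The Levi form pairs the first index of the matrix with \<open>a j\<close>,
    whereas in the quadratic form of the matrix the first index meets the conjugate. So the
    quadratic form is evaluated at the conjugate vector.\<close>
  define v :: "complex ^ 'n" where "v = (\<chi> j. cnj (a j))"
  have "(norm v)\<^sup>2 = (\<Sum>j\<in>UNIV. (cmod (a j))\<^sup>2)"
    by (simp add: norm_vec_def L2_set_def v_def sum_nonneg)
  moreover have "(levi_matrix \<phi> z *v v) \<bullet> v = levi_form \<phi> z a"
  proof -
    have "(\<Sum>j\<in>UNIV. (levi_matrix \<phi> z *v v) $ j * cnj (v $ j)) =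
        (\<Sum>j\<in>UNIV. \<Sum>k\<in>UNIV. levi_matrix \<phi> z $ j $ k * a j * cnj (a k))"
      by (simp add: matrix_vector_mult_def v_def sum_distrib_right sum_distrib_left mult_ac)
    then show ?thesis unfolding inner_complex_vec levi_form_def by simp
  qed
  ultimately show ?thesis using lowest_eigenvalue_le[OF hermitian_levi_matrix[OF \<phi>], of z v] by simp
qed

section \<open>Plurisubharmonicity and the sign of the Levi form\<close>

lemma vec_as_axis_sum:
  "w = (\<Sum>j\<in>UNIV. Re (w $ j) *\<^sub>R axis j 1 + Im (w $ j) *\<^sub>R axis j \<i>)" for w :: "complex ^ 'n::finite"
proof -
  have "(\<Sum>j\<in>UNIV. Re (w $ j) *\<^sub>R axis j 1 + Im (w $ j) *\<^sub>R axis j \<i>) $ i =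
      (\<Sum>j\<in>UNIV. if j = i then w $ j else 0)" for i
    unfolding sum_component by (intro sum.cong) (auto simp: axis_def complex_eq_iff)
  then show ?thesis by (simp add: vec_eq_iff)
qed

lemma dir_deriv_cr:
  fixes f :: "complex ^ 'n::finite \<Rightarrow> complex"
  assumes d: "f differentiable at x"
  shows "dir_deriv w f x = (\<Sum>j\<in>UNIV. w $ j * cr (- \<i>) j f x + cnj (w $ j) * cr \<i> j f x)"
proof -
  have "linear (\<lambda>v. dir_deriv v f x)"
    using has_derivative_dir_deriv[OF d] by (rule has_derivative_linear)
  then have "dir_deriv (\<Sum>j\<in>UNIV. Re (w $ j) *\<^sub>R axis j 1 + Im (w $ j) *\<^sub>R axis j \<i>) f x =
      (\<Sum>j\<in>UNIV. Re (w $ j) *\<^sub>R dir_deriv (axis j 1) f x + Im (w $ j) *\<^sub>R dir_deriv (axis j \<i>) f x)"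
    by (subst linear_sum[of "\<lambda>v. dir_deriv v f x"]) (simp_all only: dir_deriv_lincomb[OF d])
  then have "dir_deriv w f x =
      (\<Sum>j\<in>UNIV. Re (w $ j) *\<^sub>R dir_deriv (axis j 1) f x + Im (w $ j) *\<^sub>R dir_deriv (axis j \<i>) f x)"
    by (simp flip: vec_as_axis_sum)
  also have "\<dots> = (\<Sum>j\<in>UNIV. w $ j * cr (- \<i>) j f x + cnj (w $ j) * cr \<i> j f x)"
  proof (intro sum.cong refl)
    fix j
    have "c * ((a - \<i> * b) / 2) + cnj c * ((a + \<i> * b) / 2) = Re c *\<^sub>R a + Im c *\<^sub>R b" for a b c
      by (simp add: complex_eq_iff field_simps)
    then show "Re (w $ j) *\<^sub>R dir_deriv (axis j 1) f x + Im (w $ j) *\<^sub>R dir_deriv (axis j \<i>) f x =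
        w $ j * cr (- \<i>) j f x + cnj (w $ j) * cr \<i> j f x"
      by (simp add: cr_def)
  qed
  finally show ?thesis .
qed

text \<open>The right side is the Laplacian of \<open>\<phi>\<close> along the complex line spanned
  by \<open>w\<close>. In the second derivative along \<open>c *s w\<close> the two pure parts carry
  \<open>c * c\<close> and its conjugate, which cancel between \<open>c = 1\<close> and
  \<open>c = \<i>\<close>; the mixed parts carry \<open>c * cnj c = 1\<close> and add up.\<close>

lemma levi_form_second_derivatives:
  fixes \<phi> :: "complex ^ 'n::finite \<Rightarrow> real"
  assumes \<phi>: "Ck 2 \<phi>"
  shows "4 * levi_form \<phi> z (\<lambda>j. w $ j) =
    dir_deriv w (dir_deriv w \<phi>) z + dir_deriv (\<i> *s w) (dir_deriv (\<i> *s w) \<phi>) z"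
proof -
  let ?f = "\<lambda>w. complex_of_real (\<phi> w)"
  have f: "Ck 2 ?f" using \<phi> by (rule Ck_of_real)
  then have f2: "Ck (Suc 1) ?f" by (simp add: numeral_2_eq_2)
  have \<phi>2: "Ck (Suc 1) \<phi>" using \<phi> by (simp add: numeral_2_eq_2)
  have d: "?f differentiable (at x)" for x using f2 by (simp add: Ck_Suc)
  have dr: "\<phi> differentiable (at x)" "dir_deriv v \<phi> differentiable (at x)" for x v
    using \<phi>2 Ck_dir_deriv[OF \<phi>2, of v] by (simp_all add: Ck_Suc)
  have d': "cr s j ?f differentiable (at x)" for s j x using Ck_cr[OF f2] by (simp add: Ck_Suc)
  have r: "dir_deriv v (dir_deriv v ?f) z = of_real (dir_deriv v (dir_deriv v \<phi>) z)" for v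
  proof -
    have "dir_deriv v ?f = (\<lambda>x. of_real (dir_deriv v \<phi> x))" using dir_deriv_of_real[OF dr(1)] by blast
    then show ?thesis using dir_deriv_of_real[OF dr(2)] by simp
  qed
  define P where "P s t = (\<Sum>j\<in>UNIV. \<Sum>k\<in>UNIV. (if s = \<i> then cnj (w $ j) else w $ j) *
    (if t = \<i> then cnj (w $ k) else w $ k) * cr s j (cr t k ?f) z)" for s t
  have X: "dir_deriv u (dir_deriv u ?f) z = c * c * P (-\<i>) (-\<i>) + c * cnj c * P (-\<i>) \<i> + cnj c * c * P \<i> (-\<i>) + cnj c * cnj c * P \<i> \<i>"
    if u: "u = c *s w" for u c
  proof -
    have g: "dir_deriv u ?f = (\<lambda>x. \<Sum>k\<in>UNIV. c * w $ k * cr (- \<i>) k ?f x + cnj (c * w $ k) * cr \<i> k ?f x)"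
      using dir_deriv_cr[OF d, of u] u by auto
    have gd: "(\<lambda>x. c * w $ k * cr (- \<i>) k ?f x + cnj (c * w $ k) * cr \<i> k ?f x) differentiable (at z)" for k
      by (intro derivative_intros d')
    have h: "cr s j (dir_deriv u ?f) z = (\<Sum>k\<in>UNIV. c * w $ k * cr s j (cr (- \<i>) k ?f) z + cnj (c * w $ k) * cr s j (cr \<i> k ?f) z)" for s j
    proof -
      have "cr s j (\<lambda>x. \<Sum>k\<in>I. c * w $ k * cr (- \<i>) k ?f x + cnj (c * w $ k) * cr \<i> k ?f x) z =
        (\<Sum>k\<in>I. c * w $ k * cr s j (cr (- \<i>) k ?f) z + cnj (c * w $ k) * cr s j (cr \<i> k ?f) z)" if "finite I" for I
        using that
      proof induction
        case (insert k I)
        have 1: "(\<lambda>x. \<Sum>k\<in>I. c * w $ k * cr (- \<i>) k ?f x + cnj (c * w $ k) * cr \<i> k ?f x) differentiable (at z)"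
          using insert.hyps(1) by (intro differentiable_sum ballI gd)
        have 2: "cr s j (\<lambda>x. c * w $ k * cr (- \<i>) k ?f x + cnj (c * w $ k) * cr \<i> k ?f x) z =
          c * w $ k * cr s j (cr (- \<i>) k ?f) z + cnj (c * w $ k) * cr s j (cr \<i> k ?f) z"
          by (subst cr_add) (intro derivative_intros d', intro derivative_intros d', simp only: cr_cmult[OF d'])
        show ?case using insert cr_add[OF gd 1, of s j k] 2 by simp
      qed simp
      then show ?thesis unfolding g by simp
    qed
    have "dir_deriv u ?f differentiable (at z)"
      unfolding g by (intro differentiable_sum ballI finite gd)
    then have "dir_deriv u (dir_deriv u ?f) z =
        (\<Sum>j\<in>UNIV. c * w $ j * cr (- \<i>) j (dir_deriv u ?f) z + cnj (c * w $ j) * cr \<i> j (dir_deriv u ?f) z)"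
      using dir_deriv_cr[of "dir_deriv u ?f" z u] u by simp
    then show ?thesis unfolding h P_def
      by (simp add: sum_distrib_left sum.distrib algebra_simps)
  qed
  have sw: "P \<i> (-\<i>) = P (-\<i>) \<i>"
    unfolding P_def by (subst sum.swap) (simp add: cr_commute[OF f, of \<i>] mult_ac)
  have lf: "levi_form \<phi> z (\<lambda>j. w $ j) = Re (P (-\<i>) \<i>)"
    unfolding levi_form_def P_def levi_matrix_cr by (simp add: mult_ac)
  have "complex_of_real (dir_deriv w (dir_deriv w \<phi>) z + dir_deriv (\<i> *s w) (dir_deriv (\<i> *s w) \<phi>) z) = 4 * P (-\<i>) \<i>"
    using X[of w 1] X[of "\<i> *s w" \<i>] r[of w] r[of "\<i> *s w"] sw by simp
  then have "Re (4 * P (-\<i>) \<i>) = dir_deriv w (dir_deriv w \<phi>) z + dir_deriv (\<i> *s w) (dir_deriv (\<i> *s w) \<phi>) z"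
    by (metis Re_complex_of_real)
  then show ?thesis using lf by simp
qed

text \<open>Meant for the second order Taylor polynomial on a circle: the linear and the mixed terms
  average out, and the two squares contribute \<pi> each.\<close>

lemma integral_trig_quadratic:
  "(LINT \<theta>:{0..2*pi}|lborel. c + (p * cos \<theta> + q * sin \<theta>) + (a * (cos \<theta>)\<^sup>2 + b * (cos \<theta> * sin \<theta>) + d * (sin \<theta>)\<^sup>2)) =
    2 * pi * c + pi * (a + d)"
  "set_integrable lborel {0..2*pi} (\<lambda>\<theta>. c + (p * cos \<theta> + q * sin \<theta>) + (a * (cos \<theta>)\<^sup>2 + b * (cos \<theta> * sin \<theta>) + d * (sin \<theta>)\<^sup>2))"
proof -
  let ?f = "\<lambda>\<theta>::real. c + (p * cos \<theta> + q * sin \<theta>) + (a * (cos \<theta>)\<^sup>2 + b * (cos \<theta> * sin \<theta>) + d * (sin \<theta>)\<^sup>2)"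
  let ?F = "\<lambda>\<theta>::real. c * \<theta> + (p * sin \<theta> - q * cos \<theta>) + (a * (\<theta> + sin \<theta> * cos \<theta>) / 2 + b * (sin \<theta>)\<^sup>2 / 2 + d * (\<theta> - sin \<theta> * cos \<theta>) / 2)"
  have "(?F has_real_derivative ?f x) (at x)" for x
  proof -
    have s: "(sin x)\<^sup>2 = 1 - (cos x)\<^sup>2" by (simp add: sin_squared_eq)
    show ?thesis
      by (rule derivative_eq_intros refl | simp)+ (simp add: power2_eq_square[symmetric] s field_simps)
  qed
  then have der: "(?F has_vector_derivative ?f x) (at x within {0..2*pi})" for x
    by (simp add: has_real_derivative_iff_has_vector_derivative has_vector_derivative_at_within)
  have "continuous_on {0..2*pi} ?f" by (intro continuous_intros)
  from has_bochner_integral_FTC_Icc[OF _ der this]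
  have "has_bochner_integral lborel (\<lambda>x. indicator {0..2*pi} x *\<^sub>R ?f x) (?F (2*pi) - ?F 0)" by simp
  then show "(LINT \<theta>:{0..2*pi}|lborel. ?f \<theta>) = 2 * pi * c + pi * (a + d)" "set_integrable lborel {0..2*pi} ?f"
    unfolding set_lebesgue_integral_def set_integrable_def has_bochner_integral_iff by (auto simp: field_simps)
qed

text \<open>On a small circle in the complex direction \<open>w\<close> the mean of the second order
  Taylor expansion exceeds the central value by a positive multiple of \<open>A z + C z\<close>, up
  to an error from the continuity of the second derivatives. The sub-mean value property forbids a
  negative limit.\<close>

lemma psh_levi_form_nonneg:
  fixes \<phi> :: "complex ^ 'n::finite \<Rightarrow> real"
  assumes \<phi>: "Ck 2 \<phi>" and psh: "plurisubharmonic \<phi>"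
  shows "levi_form \<phi> z v \<ge> 0"
proof -
  define w :: "complex ^ 'n" where "w = (\<chi> j. v j)"
  define u where "u = \<i> *s w"
  have \<phi>2: "Ck (Suc 1) \<phi>" using \<phi> by (simp add: numeral_2_eq_2)
  have dr: "\<phi> differentiable (at x)" "dir_deriv v \<phi> differentiable (at x)" for x v
    using \<phi>2 Ck_dir_deriv[OF \<phi>2, of v] by (simp_all add: Ck_Suc)
  define A B C where "A x = dir_deriv w (dir_deriv w \<phi>) x" and "B x = dir_deriv w (dir_deriv u \<phi>) x"
    and "C x = dir_deriv u (dir_deriv u \<phi>) x" for x
  have cont: "isCont (dir_deriv a (dir_deriv b \<phi>)) x" for a b x
    using \<phi> Ck_continuous[of 0 "dir_deriv a (dir_deriv b \<phi>)" UNIV]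
    by (simp add: numeral_2_eq_2 Ck_Suc continuous_on_eq_continuous_at)
  have "0 \<le> A z + C z"
  proof (rule field_le_epsilon)
    fix e :: real assume "e > 0"
    then have e: "e / 8 > 0" by simp
    obtain d1 where d1: "d1 > 0" "\<And>x. dist x z < d1 \<Longrightarrow> \<bar>A x - A z\<bar> < e / 8"
      using cont[where a = w and b = w and x = z] e unfolding A_def continuous_at_eps_delta dist_real_def by metis
    obtain d2 where d2: "d2 > 0" "\<And>x. dist x z < d2 \<Longrightarrow> \<bar>B x - B z\<bar> < e / 8"
      using cont[where a = w and b = u and x = z] e unfolding B_def continuous_at_eps_delta dist_real_def by metis
    obtain d3 where d3: "d3 > 0" "\<And>x. dist x z < d3 \<Longrightarrow> \<bar>C x - C z\<bar> < e / 8"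
      using cont[where a = u and b = u and x = z] e unfolding C_def continuous_at_eps_delta dist_real_def by metis
    \<comment> \<open>The factor 2 keeps the circle strictly inside the three neighbourhoods, and
      the added 1 keeps the denominator positive when \<open>w\<close> vanishes.\<close>
    define r where "r = min d1 (min d2 d3) / (2 * (norm w + norm u + 1))"
    have nn: "norm w + norm u + 1 > 0" using norm_ge_zero[of w] norm_ge_zero[of u] by linarith
    have r: "r > 0" using d1 d2 d3 nn by (simp add: r_def)
    define h where "h \<theta> = cos \<theta> *\<^sub>R w + sin \<theta> *\<^sub>R u" for \<theta>
    have h: "(of_real r * cis \<theta>) *s w = r *\<^sub>R h \<theta>" for \<theta>
      unfolding vec_eq_iff h_def u_def vector_smult_component vector_scaleR_component vector_add_component
      by (simp add: scaleR_conv_of_real cis.ctr Complex_eq algebra_simps)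
    have rh: "r * norm (h \<theta>) < min d1 (min d2 d3)" for \<theta>
    proof -
      have "norm (h \<theta>) \<le> norm w + norm u"
        unfolding h_def using abs_cos_le_one[of \<theta>] abs_sin_le_one[of \<theta>]
        by (intro order_trans[OF norm_triangle_ineq] add_mono) (auto intro: mult_left_le_one_le)
      then have "r * norm (h \<theta>) \<le> r * (norm w + norm u + 1)" using r by (intro mult_left_mono) auto
      also have "\<dots> = min d1 (min d2 d3) / 2" using nn by (simp add: r_def field_simps)
      finally show ?thesis using d1 d2 d3 by (auto simp: min_def split: if_splits)
    qed
    \<comment> \<open>Each second derivative moves by less than \<open>e / 8\<close>. The mixed
      term, by \<open>2 * \<bar>cos \<theta> * sin \<theta>\<bar> \<le> (cos \<theta>)\<^sup>2 +
      (sin \<theta>)\<^sup>2\<close>, adds another \<open>e / 8\<close> to both square coefficients,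
      which makes \<open>e / 4\<close>.\<close>
    have up: "\<phi> (z + r *\<^sub>R h \<theta>) \<le> \<phi> z + (r * dir_deriv w \<phi> z * cos \<theta> + r * dir_deriv u \<phi> z * sin \<theta>) +
      ((r\<^sup>2 / 2 * (A z + e / 4)) * (cos \<theta>)\<^sup>2 + (r\<^sup>2 * B z) * (cos \<theta> * sin \<theta>) + (r\<^sup>2 / 2 * (C z + e / 4)) * (sin \<theta>)\<^sup>2)" for \<theta>
    proof -
      obtain t where t: "0 < t" "t < 1" "\<phi> (z + r *\<^sub>R h \<theta>) = \<phi> z + dir_deriv (r *\<^sub>R h \<theta>) \<phi> z +
        dir_deriv (r *\<^sub>R h \<theta>) (dir_deriv (r *\<^sub>R h \<theta>) \<phi>) (z + t *\<^sub>R r *\<^sub>R h \<theta>) / 2"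
        using taylor2[OF \<phi>, of z "r *\<^sub>R h \<theta>"] by blast
      let ?y = "z + t *\<^sub>R r *\<^sub>R h \<theta>"
      have D1: "dir_deriv (r *\<^sub>R h \<theta>) f x = r * (cos \<theta> * dir_deriv w f x + sin \<theta> * dir_deriv u f x)"
        if "f differentiable (at x)" for f :: "complex ^ 'n \<Rightarrow> real" and x
        using dir_deriv_lincomb[OF that] by (simp add: h_def)
      have D1': "dir_deriv (r *\<^sub>R h \<theta>) \<phi> = (\<lambda>x. r * (cos \<theta> * dir_deriv w \<phi> x + sin \<theta> * dir_deriv u \<phi> x))"
        using D1[OF dr(1)] by blast
      have D2: "dir_deriv a (dir_deriv (r *\<^sub>R h \<theta>) \<phi>) x = r * (cos \<theta> * dir_deriv a (dir_deriv w \<phi>) x + sin \<theta> * dir_deriv a (dir_deriv u \<phi>) x)" for a x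
        unfolding D1' by (rule dir_deriv_eqI) (auto intro!: derivative_eq_intros has_derivative_dir_deriv dr)
      have dd: "dir_deriv (r *\<^sub>R h \<theta>) \<phi> differentiable (at x)" for x
        unfolding D1' by (intro derivative_intros dr)
      have D3: "dir_deriv (r *\<^sub>R h \<theta>) (dir_deriv (r *\<^sub>R h \<theta>) \<phi>) ?y =
          r\<^sup>2 * ((cos \<theta>)\<^sup>2 * A ?y + 2 * (cos \<theta> * sin \<theta>) * B ?y + (sin \<theta>)\<^sup>2 * C ?y)"
        unfolding D2 D1[OF dr(2)] A_def B_def C_def using dir_deriv_commute[OF \<phi>, of u w ?y]
        by (simp add: power2_eq_square algebra_simps)
      have "dist ?y z < min d1 (min d2 d3)"
      proof -
        have "dist ?y z = t * (r * norm (h \<theta>))" using t r by (simp add: dist_norm)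
        also have "\<dots> \<le> r * norm (h \<theta>)" using t r by (intro mult_left_le_one_le) auto
        finally show ?thesis using rh[of \<theta>] by simp
      qed
      then have "\<bar>A ?y - A z\<bar> < e / 8" "\<bar>B ?y - B z\<bar> < e / 8" "\<bar>C ?y - C z\<bar> < e / 8"
        using d1(2)[of ?y] d2(2)[of ?y] d3(2)[of ?y] by simp_all
      then have b: "A ?y \<le> A z + e / 8" "\<bar>B ?y - B z\<bar> \<le> e / 8" "C ?y \<le> C z + e / 8"
        by linarith+
      have cs: "2 * \<bar>cos \<theta> * sin \<theta>\<bar> \<le> (cos \<theta>)\<^sup>2 + (sin \<theta>)\<^sup>2"
        using sum_squares_bound[of "\<bar>cos \<theta>\<bar>" "\<bar>sin \<theta>\<bar>"] by (simp add: abs_mult mult.assoc)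
      have "2 * (cos \<theta> * sin \<theta>) * (B ?y - B z) \<le> (2 * \<bar>cos \<theta> * sin \<theta>\<bar>) * \<bar>B ?y - B z\<bar>"
        using abs_ge_self[of "2 * (cos \<theta> * sin \<theta>) * (B ?y - B z)"] by (simp add: abs_mult)
      also have "\<dots> \<le> ((cos \<theta>)\<^sup>2 + (sin \<theta>)\<^sup>2) * (e / 8)" using cs b by (intro mult_mono) auto
      finally have "(cos \<theta>)\<^sup>2 * A ?y + 2 * (cos \<theta> * sin \<theta>) * B ?y + (sin \<theta>)\<^sup>2 * C ?y \<le>
          (cos \<theta>)\<^sup>2 * (A z + e / 8) + (2 * (cos \<theta> * sin \<theta>) * B z + ((cos \<theta>)\<^sup>2 + (sin \<theta>)\<^sup>2) * (e / 8)) + (sin \<theta>)\<^sup>2 * (C z + e / 8)"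
        using mult_left_mono[OF b(1), of "(cos \<theta>)\<^sup>2"] mult_left_mono[OF b(3), of "(sin \<theta>)\<^sup>2"]
        by (simp add: algebra_simps)
      then have "r\<^sup>2 * ((cos \<theta>)\<^sup>2 * A ?y + 2 * (cos \<theta> * sin \<theta>) * B ?y + (sin \<theta>)\<^sup>2 * C ?y) \<le>
        r\<^sup>2 * ((cos \<theta>)\<^sup>2 * (A z + e / 8) + (2 * (cos \<theta> * sin \<theta>) * B z + ((cos \<theta>)\<^sup>2 + (sin \<theta>)\<^sup>2) * (e / 8)) + (sin \<theta>)\<^sup>2 * (C z + e / 8))"
        by (intro mult_left_mono) auto
      moreover have "r\<^sup>2 * (c2 * (a + e / 8) + (2 * y * b + (c2 + s2) * (e / 8)) + s2 * (c + e / 8)) / 2 =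
          (r\<^sup>2 / 2 * (a + e / 4)) * c2 + (r\<^sup>2 * b) * y + (r\<^sup>2 / 2 * (c + e / 4)) * s2" for c2 s2 y a b c
        by (simp add: field_simps)
      moreover have "r * (c * p + s * q) = r * p * c + r * q * s" for c s p q by (simp add: algebra_simps)
      ultimately show ?thesis using t(3) unfolding D3 D1[OF dr(1)]
        by (metis add_left_mono divide_right_mono zero_le_numeral)
    qed
    have sh: "subharmonic (\<lambda>\<tau>. \<phi> (z + \<tau> *s w))" using psh by (simp add: plurisubharmonic_def)
    have si: "set_integrable lborel {0..2*pi} (\<lambda>\<theta>. \<phi> (z + (of_real r * cis \<theta>) *s w))"
      and mv: "\<phi> z \<le> (LINT \<theta>:{0..2*pi}|lborel. \<phi> (z + (of_real r * cis \<theta>) *s w)) / (2 * pi)"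
      using sh[unfolded subharmonic_def, THEN conjunct2, rule_format, OF r, of 0] by simp_all
    have "2 * pi * \<phi> z \<le> (LINT \<theta>:{0..2*pi}|lborel. \<phi> (z + r *\<^sub>R h \<theta>))"
      using mv unfolding h by (simp add: field_simps)
    also have "\<dots> \<le> (LINT \<theta>:{0..2*pi}|lborel. \<phi> z + (r * dir_deriv w \<phi> z * cos \<theta> + r * dir_deriv u \<phi> z * sin \<theta>) +
      ((r\<^sup>2 / 2 * (A z + e / 4)) * (cos \<theta>)\<^sup>2 + (r\<^sup>2 * B z) * (cos \<theta> * sin \<theta>) + (r\<^sup>2 / 2 * (C z + e / 4)) * (sin \<theta>)\<^sup>2))"
      using si unfolding h by (intro set_integral_mono integral_trig_quadratic up)
    also have "\<dots> = 2 * pi * \<phi> z + pi * (r\<^sup>2 / 2 * (A z + e / 4) + r\<^sup>2 / 2 * (C z + e / 4))"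
      by (rule integral_trig_quadratic)
    finally have "0 \<le> pi * (r\<^sup>2 / 2 * (A z + e / 4) + r\<^sup>2 / 2 * (C z + e / 4))" by simp
    also have "\<dots> = pi * (r\<^sup>2 / 2) * (A z + C z + e / 2)" by (simp add: field_simps)
    finally have "0 \<le> pi * (r\<^sup>2 / 2) * (A z + C z + e / 2)" .
    moreover have "pi * (r\<^sup>2 / 2) > 0" using r by simp
    ultimately have "0 \<le> A z + C z + e / 2" by (metis mult_pos_neg not_le)
    then show "0 \<le> A z + C z + e" using \<open>e > 0\<close> by simp
  qed
  then have "0 \<le> 4 * levi_form \<phi> z (\<lambda>j. w $ j)"
    unfolding levi_form_second_derivatives[OF \<phi>] A_def C_def u_def .
  then show ?thesis by (simp add: w_def)
qed

section \<open>The Riesz representation theorem on a complete subspace\<close>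

text \<open>Scaling of forms is a plain function and the spaces are subsets of a type, so carrier,
  scaling and form are parameters. Instances are the weighted L^2 spaces, the space
  \<open>WQ \<phi>\<close> with the energy form, and the kernel of the Cauchy--Riemann
  operator.\<close>

locale hermitian_space =
  fixes V :: "'f::ab_group_add set" and cs :: "complex \<Rightarrow> 'f \<Rightarrow> 'f" and B :: "'f \<Rightarrow> 'f \<Rightarrow> complex"
  assumes zero: "0 \<in> V"
    and add: "x \<in> V \<Longrightarrow> y \<in> V \<Longrightarrow> x + y \<in> V"
    and scale: "x \<in> V \<Longrightarrow> cs c x \<in> V"
    and uminus_scale: "- x = cs (- 1) x"
    and B_add: "x \<in> V \<Longrightarrow> y \<in> V \<Longrightarrow> z \<in> V \<Longrightarrow> B (x + y) z = B x z + B y z"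
    and B_scale: "x \<in> V \<Longrightarrow> z \<in> V \<Longrightarrow> B (cs c x) z = c * B x z"
    and B_sym: "x \<in> V \<Longrightarrow> y \<in> V \<Longrightarrow> B y x = cnj (B x y)"
    and B_pos: "x \<in> V \<Longrightarrow> 0 \<le> Re (B x x)"
begin

abbreviation Q :: "'f \<Rightarrow> real" where "Q x \<equiv> Re (B x x)"

lemma diff: "x \<in> V \<Longrightarrow> y \<in> V \<Longrightarrow> x - y \<in> V"
  using add[of x "cs (- 1) y"] scale[of y "- 1"] uminus_scale[of y] by (metis add_uminus_conv_diff)

lemma B_add_right: "x \<in> V \<Longrightarrow> y \<in> V \<Longrightarrow> z \<in> V \<Longrightarrow> B z (x + y) = B z x + B z y"
  using B_sym[of "x + y" z] B_sym[of x z] B_sym[of y z] B_add[of x y z] add[of x y] by simp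

lemma B_scale_right: "x \<in> V \<Longrightarrow> z \<in> V \<Longrightarrow> B z (cs c x) = cnj c * B z x"
  using B_sym[of "cs c x" z] B_sym[of x z] B_scale[of x z c] scale[of x c] by simp

lemma B_diff: "x \<in> V \<Longrightarrow> y \<in> V \<Longrightarrow> z \<in> V \<Longrightarrow> B (x - y) z = B x z - B y z"
  using B_add[of "x - y" y z] diff[of x y] by simp

lemma B_diff_right: "x \<in> V \<Longrightarrow> y \<in> V \<Longrightarrow> z \<in> V \<Longrightarrow> B z (x - y) = B z x - B z y"
  using B_add_right[of "x - y" y z] diff[of x y] by simp

lemma Q_add: "x \<in> V \<Longrightarrow> y \<in> V \<Longrightarrow> Q (x + y) = Q x + 2 * Re (B x y) + Q y"
  using B_sym[of x y] by (simp add: B_add B_add_right add)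

lemma Q_diff: "x \<in> V \<Longrightarrow> y \<in> V \<Longrightarrow> Q (x - y) = Q x - 2 * Re (B x y) + Q y"
  using B_sym[of x y] by (simp add: B_diff B_diff_right diff)

lemma Q_scale: "x \<in> V \<Longrightarrow> Q (cs c x) = (cmod c)\<^sup>2 * Q x"
proof -
  assume x: "x \<in> V"
  have "B (cs c x) (cs c x) = (c * cnj c) * B x x" using x by (simp add: B_scale B_scale_right scale)
  also have "c * cnj c = of_real ((cmod c)\<^sup>2)" by (simp only: complex_norm_square)
  finally show ?thesis by simp
qed

lemma Cauchy_Schwarz_Re:
  assumes x: "x \<in> V" and y: "y \<in> V"
  shows "\<bar>Re (B x y)\<bar> \<le> sqrt (Q x) * sqrt (Q y)"
proof -
  have q: "0 \<le> Q x + 2 * t * Re (B x y) + t\<^sup>2 * Q y" for t :: real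
  proof -
    have "Q (x + cs (of_real t) y) = Q x + 2 * t * Re (B x y) + t\<^sup>2 * Q y"
      using x y by (simp add: Q_add scale B_scale B_scale_right power2_eq_square)
    then show ?thesis using B_pos[OF add[OF x scale[OF y]], of "of_real t"] by simp
  qed
  have "(Re (B x y))\<^sup>2 \<le> Q x * Q y"
  \<comment> \<open>The form is only assumed to be nonnegative. If \<open>Q y\<close> vanishes, the
    bound is linear in \<open>t\<close> and bounded below, so its slope must be zero; otherwise the
    minimising \<open>t\<close> is inserted.\<close>
  proof (cases "Q y = 0")
    case True
    have "Re (B x y) = 0"
    proof (rule ccontr)
      assume n: "Re (B x y) \<noteq> 0"
      have "0 \<le> Q x + 2 * (- (Q x + 1) / (2 * Re (B x y))) * Re (B x y)"
        using q[of "- (Q x + 1) / (2 * Re (B x y))"] True by simp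
      also have "\<dots> = - 1" using n by (simp add: field_simps)
      finally show False by simp
    qed
    then show ?thesis using True by simp
  next
    case False
    then have p: "Q y > 0" using B_pos[OF y] by simp
    have "0 \<le> Q x + 2 * (- Re (B x y) / Q y) * Re (B x y) + (- Re (B x y) / Q y)\<^sup>2 * Q y" by (rule q)
    also have "\<dots> = Q x - (Re (B x y))\<^sup>2 / Q y" using p by (simp add: field_simps power2_eq_square)
    finally show ?thesis using p by (simp add: pos_divide_le_eq)
  qed
  then have "sqrt ((Re (B x y))\<^sup>2) \<le> sqrt (Q x * Q y)" by (rule real_sqrt_le_mono)
  then show ?thesis by (simp add: real_sqrt_mult)
qed

lemma Cauchy_Schwarz:
  assumes x: "x \<in> V" and y: "y \<in> V"
  shows "cmod (B x y) \<le> sqrt (Q x) * sqrt (Q y)"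
proof (cases "B x y = 0")
  case True
  then show ?thesis using B_pos[OF x] B_pos[OF y] by simp
next
  case False
  \<comment> \<open>A unimodular factor that turns \<open>B x y\<close> into its modulus and reduces
    the claim to the real part.\<close>
  define c where "c = cnj (sgn (B x y))"
  have "c * B x y = of_real (cmod (B x y))"
  proof -
    have "c * B x y = cnj (B x y) * B x y / of_real (cmod (B x y))"
      by (simp add: c_def sgn_eq)
    also have "\<dots> = of_real (cmod (B x y))"
      using False by (simp add: mult.commute[of "cnj _"] complex_norm_square[symmetric] power2_eq_square)
    finally show ?thesis .
  qed
  then have e: "cmod (B x y) = Re (B (cs c x) y)" using x y by (simp add: B_scale)
  have "cmod c = 1" using False by (simp add: c_def norm_sgn)
  then have "Q (cs c x) = Q x" using x by (simp add: Q_scale)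
  then show ?thesis using Cauchy_Schwarz_Re[OF scale[OF x] y, of c] e by simp
qed

text \<open>The representing vector minimises \<open>Q v - 2 * Re (l v)\<close>; minimising sequences are Cauchy by the
  parallelogram identity.\<close>

lemma riesz:
  assumes complete: "\<And>s. (\<And>n. s n \<in> V) \<Longrightarrow> (\<And>e. e > 0 \<Longrightarrow> \<exists>N. \<forall>m\<ge>N. \<forall>n\<ge>N. Q (s m - s n) < e) \<Longrightarrow>
      \<exists>x\<in>V. (\<lambda>n. Q (s n - x)) \<longlonglongrightarrow> 0"
    and l_add: "\<And>x y. x \<in> V \<Longrightarrow> y \<in> V \<Longrightarrow> l (x + y) = l x + l y"
    and l_scale: "\<And>x c. x \<in> V \<Longrightarrow> l (cs c x) = c * l x"
    and bound: "\<And>x. x \<in> V \<Longrightarrow> cmod (l x) \<le> K * sqrt (Q x)"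
  shows "\<exists>u\<in>V. \<forall>v\<in>V. l v = B v u"
proof -
  define J where "J v = Q v - 2 * Re (l v)" for v
  have l_diff: "l (x - y) = l x - l y" if "x \<in> V" "y \<in> V" for x y
    using l_add[of "x - y" y] diff[OF that] that by simp
  have lK: "\<bar>Re (l x)\<bar> \<le> K * sqrt (Q x)" if "x \<in> V" for x
    using bound[OF that] abs_Re_le_cmod order_trans by blast
  have lb: "- K\<^sup>2 \<le> J v" if "v \<in> V" for v
  proof -
    have "0 \<le> (sqrt (Q v) - K)\<^sup>2" by simp
    also have "\<dots> = Q v - 2 * (K * sqrt (Q v)) + K\<^sup>2" using B_pos[OF that] by (simp add: power2_diff)
    finally show ?thesis using lK[OF that] by (simp add: J_def)
  qed
  define m where "m = Inf (J ` V)"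
  have bdd: "bdd_below (J ` V)" using lb by (intro bdd_belowI[of _ "- K\<^sup>2"]) auto
  have m: "m \<le> J v" if "v \<in> V" for v unfolding m_def using bdd that by (intro cInf_lower) auto
  have ex: "\<exists>v\<in>V. J v < m + e" if "e > 0" for e
    using cInf_lessD[of "J ` V" "m + e"] zero that by (auto simp: m_def)
  have "\<forall>n. \<exists>v. v \<in> V \<and> J v < m + inverse (real (Suc n))"
  proof
    fix n show "\<exists>v. v \<in> V \<and> J v < m + inverse (real (Suc n))"
      using ex[of "inverse (real (Suc n))"] by auto
  qed
  then obtain s where s: "\<And>n. s n \<in> V" "\<And>n. J (s n) < m + inverse (real (Suc n))" by metis
  have par: "Q (x - y) \<le> 2 * (J x - m) + 2 * (J y - m)" if x: "x \<in> V" and y: "y \<in> V" for x y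
  proof -
    have xy: "x + y \<in> V" by (rule add[OF x y])
    have "m \<le> J (cs (1/2) (x + y))" by (rule m[OF scale[OF xy]])
    also have "J (cs (1/2) (x + y)) = Q (x + y) / 4 - Re (l x) - Re (l y)"
      using xy x y by (simp add: J_def Q_scale l_scale l_add power2_eq_square) argo
    finally show ?thesis by (simp add: J_def Q_diff[OF x y] Q_add[OF x y]) argo
  qed
  have "\<exists>x\<in>V. (\<lambda>n. Q (s n - x)) \<longlonglongrightarrow> 0"
  proof (rule complete[OF s(1)])
    fix e :: real assume "e > 0"
    then obtain N where N: "inverse (real (Suc N)) < e / 4" using reals_Archimedean[of "e / 4"] by auto
    have "Q (s a - s b) < e" if "a \<ge> N" "b \<ge> N" for a b
    proof -
      have le: "inverse (real (Suc k)) \<le> inverse (real (Suc N))" if "k \<ge> N" for k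
        using that by (intro le_imp_inverse_le) auto
      have lt: "J (s k) < m + e / 4" if "k \<ge> N" for k
        using s(2)[of k] le[OF that] N by argo
      show ?thesis
        using par[OF s(1)[of a] s(1)[of b]] lt[OF that(1)] lt[OF that(2)] by argo
    qed
    then show "\<exists>N. \<forall>m\<ge>N. \<forall>n\<ge>N. Q (s m - s n) < e" by blast
  qed
  then obtain u where u: "u \<in> V" "(\<lambda>n. Q (s n - u)) \<longlonglongrightarrow> 0" by blast
  have Ju: "J u \<le> m"
  proof (rule LIMSEQ_le_const)
    have q: "(\<lambda>n. sqrt (Q (s n - u))) \<longlonglongrightarrow> 0" using tendsto_real_sqrt[OF u(2)] by simp
    have "(\<lambda>n. m + inverse (real (Suc n)) + 2 * (sqrt (Q (s n - u)) * sqrt (Q u)) + 2 * (K * sqrt (Q (s n - u)))) \<longlonglongrightarrow>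
        m + 0 + 2 * (0 * sqrt (Q u)) + 2 * (K * 0)"
      by (intro tendsto_intros q LIMSEQ_inverse_real_of_nat)
    then show "(\<lambda>n. m + inverse (real (Suc n)) + 2 * (sqrt (Q (s n - u)) * sqrt (Q u)) + 2 * (K * sqrt (Q (s n - u)))) \<longlonglongrightarrow> m"
      by simp
    have "J u \<le> m + inverse (real (Suc n)) + 2 * (sqrt (Q (s n - u)) * sqrt (Q u)) + 2 * (K * sqrt (Q (s n - u)))" for n
    proof -
      have d: "s n - u \<in> V" by (rule diff[OF s(1) u(1)])
      have "Q (s n) = Q (s n - u) + 2 * Re (B (s n - u) u) + Q u" using Q_add[OF d u(1)] by simp
      then have "J (s n) - J u = Q (s n - u) + 2 * Re (B (s n - u) u) - 2 * Re (l (s n - u))"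
        using l_diff[OF s(1)[of n] u(1)] by (simp add: J_def)
      then show ?thesis
        using s(2)[of n] Cauchy_Schwarz_Re[OF d u(1)] lK[OF d] B_pos[OF d] by linarith
    qed
    then show "\<exists>N. \<forall>n\<ge>N. J u \<le> m + inverse (real (Suc n)) + 2 * (sqrt (Q (s n - u)) * sqrt (Q u)) + 2 * (K * sqrt (Q (s n - u)))"
      by blast
  qed
  have re: "Re (B v u) = Re (l v)" if v: "v \<in> V" for v
  proof -
    define d where "d = Re (B v u) - Re (l v)"
    have q: "0 \<le> 2 * t * d + t\<^sup>2 * Q v" for t :: real
    proof -
      have tv: "cs (of_real t) v \<in> V" by (rule scale[OF v])
      have "J u \<le> J (cs (of_real t) v + u)" using Ju m[OF add[OF tv u(1)]] by simp
      also have "J (cs (of_real t) v + u) = J u + 2 * t * d + t\<^sup>2 * Q v"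
      proof -
        have "Q (cs (of_real t) v + u) = t\<^sup>2 * Q v + 2 * (t * Re (B v u)) + Q u"
          using Q_add[OF tv u(1)] Q_scale[OF v, of "of_real t"] B_scale[OF v u(1), of "of_real t"] by simp
        moreover have "Re (l (cs (of_real t) v + u)) = t * Re (l v) + Re (l u)"
          using l_add[OF tv u(1)] l_scale[OF v] by simp
        ultimately show ?thesis by (simp only: J_def d_def) (simp add: algebra_simps)
      qed
      finally show ?thesis by simp
    qed
    have c: "Q v + 1 > 0" using B_pos[OF v] by simp
    \<comment> \<open>Inserts t = -d / (Q v + 1), close to the minimiser in \<open>t\<close>, where
      the added 1 admits \<open>Q v = 0\<close>. Unless \<open>d\<close> is zero the value would be
      negative.\<close>
    have "0 \<le> - 2 * d\<^sup>2 / (Q v + 1) + d\<^sup>2 * Q v / (Q v + 1)\<^sup>2"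
      using q[of "- d / (Q v + 1)"] by (simp add: power2_eq_square power_divide)
    also have "\<dots> \<le> - 2 * d\<^sup>2 / (Q v + 1) + d\<^sup>2 / (Q v + 1)"
    proof -
      have "Q v / (Q v + 1)\<^sup>2 \<le> 1 / (Q v + 1)" using c by (simp add: divide_simps power2_eq_square)
      from mult_left_mono[OF this, of "d\<^sup>2"] show ?thesis by simp
    qed
    finally have "d\<^sup>2 / (Q v + 1) \<le> 0" by simp
    then have "d\<^sup>2 \<le> 0" using c by (simp add: divide_le_0_iff)
    then show ?thesis by (simp add: d_def)
  qed
  have "l v = B v u" if v: "v \<in> V" for v
  proof (rule complex_eqI)
    show "Re (l v) = Re (B v u)" using re[OF v] by simp
    have "Re (B (cs \<i> v) u) = Re (l (cs \<i> v))" by (rule re[OF scale[OF v]])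
    then show "Im (l v) = Im (B v u)" using v u(1) by (simp add: B_scale l_scale)
  qed
  with u(1) show ?thesis by blast
qed

end

section \<open>The Kohn--Morrey formula\<close>

definition wn :: "(complex ^ 'n::finite \<Rightarrow> real) \<Rightarrow> (complex ^ 'n \<Rightarrow> complex) \<Rightarrow> real" where
  "wn \<phi> f = (LINT z|lebesgue. (cmod (f z))\<^sup>2 * exp (- \<phi> z))"

text \<open>The formal adjoint -e^\<phi> \<Sum>_j d/dz_j (e^(-\<phi>) v_j) of the Cauchy--Riemann
  operator for the weighted inner product, with the product rule carried out.\<close>

definition form_adj :: "(complex ^ 'n::finite \<Rightarrow> real) \<Rightarrow> ('n \<Rightarrow> complex ^ 'n \<Rightarrow> complex) \<Rightarrow> complex ^ 'n \<Rightarrow> complex" where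
  "form_adj \<phi> v z = - (\<Sum>j\<in>UNIV. cr (- \<i>) j (v j) z - cr (- \<i>) j (\<lambda>w. of_real (\<phi> w)) z * v j z)"

text \<open>The sum runs over ordered pairs and meets every component of the (0,2)-form twice, hence
  the factor 1/2. For smooth forms this is the square of \<open>norm_Q\<close>, expressed by
  coefficient functions.\<close>

definition form_energy :: "(complex ^ 'n::finite \<Rightarrow> real) \<Rightarrow> ('n \<Rightarrow> complex ^ 'n \<Rightarrow> complex) \<Rightarrow> real" where
  "form_energy \<phi> v = (\<Sum>j\<in>UNIV. \<Sum>k\<in>UNIV. wn \<phi> (\<lambda>z. cr \<i> j (v k) z - cr \<i> k (v j) z)) / 2 + wn \<phi> (form_adj \<phi> v)"

lemma Ck_differentiable2: "Ck 2 f \<Longrightarrow> f differentiable (at x)"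
  by (rule Ck_differentiable) auto

lemma Ck2_cr: "Ck 2 f \<Longrightarrow> Ck 1 (cr s j f)"
  using Ck_cr[of 1 f s j] by (simp add: numeral_2_eq_2)

lemma Ck1_cr: "Ck 1 f \<Longrightarrow> Ck 0 (cr s j f)"
  using Ck_cr[of 0 f s j] by simp

lemma Cc2_cr: "Cc 2 f \<Longrightarrow> Cc 1 (cr s j f)"
  using Cc_cr[of 1 f s j] by (simp add: numeral_2_eq_2)

lemma Cc1_cr: "Cc 1 f \<Longrightarrow> Cc 0 (cr s j f)"
  using Cc_cr[of 0 f s j] by simp

lemma Ck2_cr_differentiable: "Ck 2 f \<Longrightarrow> cr s j f differentiable (at x)"
  by (rule Ck_differentiable[OF Ck2_cr]) auto

lemma cr_of_real_cnj:
  "\<phi> differentiable (at x) \<Longrightarrow> cnj (cr s j (\<lambda>w. complex_of_real (\<phi> w)) x) = cr (cnj s) j (\<lambda>w. of_real (\<phi> w)) x"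
  by (simp add: cr_def dir_deriv_of_real)

text \<open>Integration by parts moves the operator on \<open>b\<close> to \<open>a\<close> as the
  \<open>k\<close>-th antiholomorphic derivative. Exchanging it with the weighted holomorphic
  derivative in direction \<open>j\<close> costs exactly the Levi matrix entry, and a second
  integration by parts brings the latter operator back to \<open>b\<close>.\<close>

lemma kohn_morrey_pair:
  fixes \<phi> :: "complex ^ 'n::finite \<Rightarrow> real"
  assumes \<phi>: "Ck 2 \<phi>" and a: "Cc 2 a" and b: "Cc 2 b"
  defines "p \<equiv> \<lambda>j. cr (- \<i>) j (\<lambda>w. complex_of_real (\<phi> w))"
  shows "(LINT z|lebesgue. (cr (- \<i>) j a z - p j z * a z) * cnj (cr (- \<i>) k b z - p k z * b z) * of_real (exp (- \<phi> z))) =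
    (LINT z|lebesgue. cr \<i> k a z * cnj (cr \<i> j b z) * of_real (exp (- \<phi> z))) +
    (LINT z|lebesgue. levi_matrix \<phi> z $ j $ k * a z * cnj (b z) * of_real (exp (- \<phi> z)))"
proof -
  define E where "E z = complex_of_real (exp (- \<phi> z))" for z
  let ?F = "\<lambda>w. complex_of_real (\<phi> w)"
  have F: "Ck 2 ?F" using \<phi> by (rule Ck_of_real)
  have \<phi>d: "\<phi> differentiable (at x)" for x using \<phi> by (rule Ck_differentiable2)
  have E: "Ck 2 E" unfolding E_def[abs_def] by (intro Ck_of_real Ck_exp Ck_minus \<phi>)
  have ak: "Ck 2 a" "Ck 2 b" using a b by (auto simp: Cc_def)
  note d = Ck_differentiable2[OF F] Ck_differentiable2[OF E] ak[THEN Ck_differentiable2]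
  have d': "(\<lambda>z. cnj (b z)) differentiable (at x)" for x by (intro Ck_differentiable2 Ck_cnj ak)
  have dp: "p j differentiable (at x)" for x unfolding p_def by (rule Ck2_cr_differentiable[OF F])
  have crE: "cr s j E x = - E x * cr s j ?F x" for s j x
  proof -
    have "cr s j E x = E x * cr s j (\<lambda>z. complex_of_real (- \<phi> z)) x"
      unfolding E_def[abs_def] using \<phi>d by (intro cr_exp) (rule Ck_differentiable2[OF Ck_minus[OF \<phi>]])
    also have "cr s j (\<lambda>z. complex_of_real (- \<phi> z)) x = - cr s j ?F x"
      using cr_minus[OF d(1)] by simp
    finally show ?thesis by simp
  qed
  \<comment> \<open>With the weight included, the conjugated expression is a plain derivative, so
    that the unweighted integration by parts applies.\<close>
  have one: "cnj (cr (- \<i>) k b z - p k z * b z) * E z = cr \<i> k (\<lambda>z. cnj (b z) * E z) z" for z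
    unfolding p_def cr_mult[OF d' d(2)] by (simp add: crE cr_cnj[OF d(4)] cr_of_real_cnj[OF \<phi>d] algebra_simps)
  have \<delta>: "Cc 1 (\<lambda>z. cr (- \<i>) j a z - p j z * a z)"
    unfolding p_def by (intro Cc_diff Cc2_cr a Cc_mult(2) Ck2_cr F) (rule Cc_mono[OF a], simp)
  have bE: "Cc 2 (\<lambda>z. cnj (b z) * E z)" by (intro Cc_mult(1) Cc_cnj b E)
  have two: "cr \<i> k (\<lambda>z. cr (- \<i>) j a z - p j z * a z) z =
      cr (- \<i>) j (cr \<i> k a) z - p j z * cr \<i> k a z - levi_matrix \<phi> z $ j $ k * a z" for z
  proof -
    have "cr \<i> k (\<lambda>z. cr (- \<i>) j a z - p j z * a z) z = cr \<i> k (cr (- \<i>) j a) z - (p j z * cr \<i> k a z + cr \<i> k (p j) z * a z)"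
      using cr_diff[OF Ck2_cr_differentiable[OF ak(1)], of "\<lambda>z. p j z * a z"] cr_mult[OF dp d(3)] dp d(3)
      by (simp add: differentiable_mult)
    moreover have "cr \<i> k (p j) z = levi_matrix \<phi> z $ j $ k"
      unfolding p_def levi_matrix_cr by (rule cr_commute[OF F])
    ultimately show ?thesis by (simp add: cr_commute[OF ak(1), of \<i> k])
  qed
  have "(LINT z|lebesgue. (cr (- \<i>) j a z - p j z * a z) * cnj (cr (- \<i>) k b z - p k z * b z) * E z) =
      (LINT z|lebesgue. (cr (- \<i>) j a z - p j z * a z) * cr \<i> k (\<lambda>z. cnj (b z) * E z) z)"
    by (simp only: mult.assoc one)
  also have "\<dots> = - (LINT z|lebesgue. cr \<i> k (\<lambda>z. cr (- \<i>) j a z - p j z * a z) z * (cnj (b z) * E z))"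
    using cr_by_parts[of 0, of "\<lambda>z. cr (- \<i>) j a z - p j z * a z" "\<lambda>z. cnj (b z) * E z"] \<delta> Ck_mono[OF CcD[OF bE], of 1] by simp
  also have "\<dots> = - (LINT z|lebesgue. (cr (- \<i>) j (cr \<i> k a) z - p j z * cr \<i> k a z - levi_matrix \<phi> z $ j $ k * a z) * (cnj (b z) * E z))"
    by (simp only: two)
  also have "\<dots> =
     - (LINT z|lebesgue. (cr (- \<i>) j (cr \<i> k a) z * E z - cr \<i> k a z * E z * p j z) * cnj (b z) - levi_matrix \<phi> z $ j $ k * a z * cnj (b z) * E z)"
    by (simp add: algebra_simps)
  also have "\<dots> = - (LINT z|lebesgue. (cr (- \<i>) j (cr \<i> k a) z * E z - cr \<i> k a z * E z * p j z) * cnj (b z)) +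
     (LINT z|lebesgue. levi_matrix \<phi> z $ j $ k * a z * cnj (b z) * E z)"
  proof (subst Bochner_Integration.integral_diff)
    have b0: "Ck 0 (\<lambda>z. cnj (b z))" "Ck 0 E" "Ck 0 a" using Ck_cnj[OF ak(2)] E ak(1) Ck_mono by blast+
    have bc: "Cc 0 (\<lambda>z. cnj (b z))" using Cc_cnj[OF b] Cc_mono by blast
    show "integrable lebesgue (\<lambda>z. (cr (- \<i>) j (cr \<i> k a) z * E z - cr \<i> k a z * E z * p j z) * cnj (b z))"
      unfolding p_def
      by (intro Cc_integrable(2)[where k=0] Cc_mult(2) Ck_diff Ck_mult bc b0 Ck1_cr Ck2_cr ak F
          Ck_mono[OF Ck2_cr[OF ak(1)]] Ck_mono[OF Ck2_cr[OF F]]) auto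
    show "integrable lebesgue (\<lambda>z. levi_matrix \<phi> z $ j $ k * a z * cnj (b z) * E z)"
      unfolding levi_matrix_cr
      by (intro Cc_integrable(2)[where k=0] Cc_mult(1)[OF _ b0(2)] Cc_mult(2)[OF _ bc] Ck_mult b0 Ck1_cr Ck2_cr F)
  qed simp
  also have "- (LINT z|lebesgue. (cr (- \<i>) j (cr \<i> k a) z * E z - cr \<i> k a z * E z * p j z) * cnj (b z)) =
      (LINT z|lebesgue. cr \<i> k a z * cnj (cr \<i> j b z) * E z)"
  proof -
    have "cr (- \<i>) j (\<lambda>z. cr \<i> k a z * E z) z = cr (- \<i>) j (cr \<i> k a) z * E z - cr \<i> k a z * E z * p j z" for z
      unfolding p_def using cr_mult[OF Ck2_cr_differentiable[OF ak(1)] d(2)] by (simp add: crE algebra_simps)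
    then have "- (LINT z|lebesgue. (cr (- \<i>) j (cr \<i> k a) z * E z - cr \<i> k a z * E z * p j z) * cnj (b z)) =
        - (LINT z|lebesgue. cr (- \<i>) j (\<lambda>z. cr \<i> k a z * E z) z * cnj (b z))" by simp
    also have "\<dots> = (LINT z|lebesgue. (cr \<i> k a z * E z) * cr (- \<i>) j (\<lambda>z. cnj (b z)) z)"
      using cr_by_parts[of 0, of "\<lambda>z. cr \<i> k a z * E z" "\<lambda>z. cnj (b z)" "- \<i>" j]
        Cc_mult(1)[OF Cc2_cr[OF a] Ck_mono[OF E]] Ck_mono[OF Ck_cnj[OF ak(2)], of 1] by simp
    also have "\<dots> = (LINT z|lebesgue. cr \<i> k a z * cnj (cr \<i> j b z) * E z)"
      by (simp add: cr_cnj[OF d(4)] mult_ac)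
    finally show ?thesis .
  qed
  finally show ?thesis unfolding E_def .
qed

lemma wn_complex:
  assumes "integrable lebesgue (\<lambda>z. f z * cnj (f z) * complex_of_real (exp (- \<phi> z)))"
  shows "wn \<phi> f = Re (LINT z|lebesgue. f z * cnj (f z) * of_real (exp (- \<phi> z)))"
proof -
  have "Re (f z * cnj (f z) * of_real (exp (- \<phi> z))) = (cmod (f z))\<^sup>2 * exp (- \<phi> z)" for z
    by (simp add: complex_norm_square[symmetric] del: of_real_power)
  then show ?thesis unfolding wn_def using assms by (simp flip: integral_Re)
qed

text \<open>Squaring the antisymmetrised derivatives produces cross terms of the derivative of
  coefficient \<open>j\<close> in direction \<open>k\<close> with that of coefficient
  \<open>k\<close> in direction \<open>j\<close>. The norm of the formal adjoint yields, by
  \<open>kohn_morrey_pair\<close>, the same cross terms with the opposite sign, together with the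
  Levi form.\<close>

theorem kohn_morrey:
  fixes \<phi> :: "complex ^ 'n::finite \<Rightarrow> real"
  assumes \<phi>: "Ck 2 \<phi>" and v: "\<And>j. Cc 2 (v j)"
  shows "form_energy \<phi> v = (\<Sum>j\<in>UNIV. \<Sum>k\<in>UNIV. wn \<phi> (cr \<i> j (v k))) +
    (LINT z|lebesgue. levi_form \<phi> z (\<lambda>j. v j z) * exp (- \<phi> z))"
proof -
  let ?E = "\<lambda>z. complex_of_real (exp (- \<phi> z))"
  define p where "p j = cr (- \<i>) j (\<lambda>w. complex_of_real (\<phi> w))" for j
  define \<delta> where "\<delta> j z = cr (- \<i>) j (v j) z - p j z * v j z" for j z
  define a where "a j k = cr \<i> j (v k)" for j k
  have F: "Ck 2 (\<lambda>w. complex_of_real (\<phi> w))" using \<phi> by (rule Ck_of_real)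
  have E: "Ck 0 ?E" by (intro Ck_of_real Ck_exp Ck_minus Ck_mono[OF \<phi>]) simp
  have v0: "Cc 0 (v j)" for j by (rule Cc_mono[OF v]) simp
  have \<delta>c: "Cc 0 (\<delta> j)" for j
    unfolding \<delta>_def[abs_def] p_def
    by (intro Cc_diff Cc_mult(2) v0 Cc_mono[OF Cc2_cr[OF v]] Ck_mono[OF Ck2_cr[OF F]]) auto
  have ac: "Cc 0 (a j k)" for j k unfolding a_def by (rule Cc_mono[OF Cc2_cr[OF v]]) simp
  have int: "integrable lebesgue (\<lambda>z. f z * cnj (g z) * ?E z)" if "Cc 0 f" "Cc 0 g" for f g
    by (intro Cc_integrable(2)[where k=0] Cc_mult(1) that Ck_cnj CcD[OF that(2)] E)
  have intL: "integrable lebesgue (\<lambda>z. levi_matrix \<phi> z $ j $ k * v j z * cnj (v k z) * ?E z)" for j k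
    unfolding levi_matrix_cr
    by (intro Cc_integrable(2)[where k=0] Cc_mult(1)[OF _ E] Cc_mult(1)[OF Cc_mult(2)] v0 Ck_cnj CcD[OF v0] Ck1_cr Ck2_cr F)
  have w: "wn \<phi> (form_adj \<phi> v) = Re (LINT z|lebesgue. form_adj \<phi> v z * cnj (form_adj \<phi> v z) * ?E z)"
  proof (rule wn_complex, rule int)
    show "Cc 0 (form_adj \<phi> v)"
      using Cc_minus[OF Cc_sum[of UNIV 0 \<delta>]] \<delta>c by (simp add: form_adj_def[abs_def] \<delta>_def p_def)
    then show "Cc 0 (form_adj \<phi> v)" .
  qed
  have pw: "form_adj \<phi> v z * cnj (form_adj \<phi> v z) * ?E z = (\<Sum>j\<in>UNIV. \<Sum>k\<in>UNIV. \<delta> j z * cnj (\<delta> k z) * ?E z)" for z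
  proof -
    have "form_adj \<phi> v z = - (\<Sum>j\<in>UNIV. \<delta> j z)" by (simp add: form_adj_def \<delta>_def p_def)
    then have "form_adj \<phi> v z * cnj (form_adj \<phi> v z) = (\<Sum>j\<in>UNIV. \<delta> j z) * (\<Sum>k\<in>UNIV. cnj (\<delta> k z))"
      by (simp only: complex_cnj_minus cnj_sum minus_mult_minus)
    also have "\<dots> = (\<Sum>j\<in>UNIV. \<Sum>k\<in>UNIV. \<delta> j z * cnj (\<delta> k z))" by (rule sum_product)
    finally show ?thesis by (simp only: sum_distrib_right)
  qed
  have "(LINT z|lebesgue. form_adj \<phi> v z * cnj (form_adj \<phi> v z) * ?E z) =
      (LINT z|lebesgue. (\<Sum>j\<in>UNIV. \<Sum>k\<in>UNIV. \<delta> j z * cnj (\<delta> k z) * ?E z))"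
    by (simp only: pw)
  also have "(LINT z|lebesgue. (\<Sum>j\<in>UNIV. \<Sum>k\<in>UNIV. \<delta> j z * cnj (\<delta> k z) * ?E z)) =
      (\<Sum>j\<in>UNIV. \<Sum>k\<in>UNIV. LINT z|lebesgue. \<delta> j z * cnj (\<delta> k z) * ?E z)"
    by (subst Bochner_Integration.integral_sum;
        intro sum.cong refl Bochner_Integration.integral_sum Bochner_Integration.integrable_sum int \<delta>c)
  also have "\<dots> = (\<Sum>j\<in>UNIV. \<Sum>k\<in>UNIV. (LINT z|lebesgue. a k j z * cnj (a j k z) * ?E z) +
      (LINT z|lebesgue. levi_matrix \<phi> z $ j $ k * v j z * cnj (v k z) * ?E z))"
    unfolding \<delta>_def p_def a_def by (intro sum.cong refl kohn_morrey_pair[OF \<phi> v v])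
  finally have "wn \<phi> (form_adj \<phi> v) = Re (\<Sum>j\<in>UNIV. \<Sum>k\<in>UNIV. (LINT z|lebesgue. a k j z * cnj (a j k z) * ?E z) +
      (LINT z|lebesgue. levi_matrix \<phi> z $ j $ k * v j z * cnj (v k z) * ?E z))"
    using w by (simp only:)
  also have "\<dots> = (\<Sum>j\<in>UNIV. \<Sum>k\<in>UNIV. Re (LINT z|lebesgue. a k j z * cnj (a j k z) * ?E z)) +
      Re (\<Sum>j\<in>UNIV. \<Sum>k\<in>UNIV. LINT z|lebesgue. levi_matrix \<phi> z $ j $ k * v j z * cnj (v k z) * ?E z)"
    by (simp add: sum.distrib)
  also have "(\<Sum>j\<in>UNIV. \<Sum>k\<in>UNIV. LINT z|lebesgue. levi_matrix \<phi> z $ j $ k * v j z * cnj (v k z) * ?E z) =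
      (LINT z|lebesgue. (\<Sum>j\<in>UNIV. \<Sum>k\<in>UNIV. levi_matrix \<phi> z $ j $ k * v j z * cnj (v k z) * ?E z))"
    by (subst Bochner_Integration.integral_sum;
        intro sum.cong refl Bochner_Integration.integral_sum[symmetric] Bochner_Integration.integrable_sum intL)
  also have "Re (LINT z|lebesgue. (\<Sum>j\<in>UNIV. \<Sum>k\<in>UNIV. levi_matrix \<phi> z $ j $ k * v j z * cnj (v k z) * ?E z)) =
      (LINT z|lebesgue. levi_form \<phi> z (\<lambda>j. v j z) * exp (- \<phi> z))"
  proof -
    have "Re (\<Sum>j\<in>UNIV. \<Sum>k\<in>UNIV. levi_matrix \<phi> z $ j $ k * v j z * cnj (v k z) * ?E z) =
        levi_form \<phi> z (\<lambda>j. v j z) * exp (- \<phi> z)" for z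
      unfolding levi_form_def sum_distrib_right[symmetric] by simp
    moreover have "integrable lebesgue (\<lambda>z. \<Sum>j\<in>UNIV. \<Sum>k\<in>UNIV. levi_matrix \<phi> z $ j $ k * v j z * cnj (v k z) * ?E z)"
      by (intro Bochner_Integration.integrable_sum intL)
    ultimately show ?thesis by (simp flip: integral_Re)
  qed
  finally have adj: "wn \<phi> (form_adj \<phi> v) = (\<Sum>j\<in>UNIV. \<Sum>k\<in>UNIV. Re (LINT z|lebesgue. a k j z * cnj (a j k z) * ?E z)) +
      (LINT z|lebesgue. levi_form \<phi> z (\<lambda>j. v j z) * exp (- \<phi> z))" .
  have sq: "wn \<phi> (\<lambda>z. a j k z - a k j z) = wn \<phi> (a j k) + wn \<phi> (a k j) -
      2 * Re (LINT z|lebesgue. a k j z * cnj (a j k z) * ?E z)" for j k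
  proof -
    have i: "integrable lebesgue (\<lambda>z. a i l z * cnj (a i' l' z) * ?E z)" for i l i' l' by (intro int ac)
    have ir: "integrable lebesgue (\<lambda>z. (cmod (a i l z))\<^sup>2 * exp (- \<phi> z))" for i l
    proof -
      have "(\<lambda>z. (cmod (a i l z))\<^sup>2 * exp (- \<phi> z)) = (\<lambda>z. Re (a i l z * cnj (a i l z) * ?E z))"
        by (simp add: complex_norm_square[symmetric] fun_eq_iff del: of_real_power)
      then show ?thesis using integrable_Re[OF i[of i l i l]] by simp
    qed
    define r where "r z = Re (a k j z * cnj (a j k z) * ?E z)" for z
    have ri: "integrable lebesgue r" unfolding r_def[abs_def] using i by (rule integrable_Re)
    have "(cmod (a j k z - a k j z))\<^sup>2 * exp (- \<phi> z) = (cmod (a j k z))\<^sup>2 * exp (- \<phi> z) +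
        (cmod (a k j z))\<^sup>2 * exp (- \<phi> z) - 2 * r z" for z
      unfolding cmod_power2 r_def by (simp add: power2_eq_square algebra_simps)
    then have "wn \<phi> (\<lambda>z. a j k z - a k j z) = (LINT z|lebesgue. (cmod (a j k z))\<^sup>2 * exp (- \<phi> z) +
        (cmod (a k j z))\<^sup>2 * exp (- \<phi> z) - 2 * r z)"
      by (simp add: wn_def)
    also have "\<dots> = wn \<phi> (a j k) + wn \<phi> (a k j) - 2 * (LINT z|lebesgue. r z)"
      unfolding wn_def using ir ri by simp
    also have "(LINT z|lebesgue. r z) = Re (LINT z|lebesgue. a k j z * cnj (a j k z) * ?E z)"
      unfolding r_def using i[of k j j k] by (rule integral_Re)
    finally show ?thesis .
  qed
  have "(\<Sum>j\<in>UNIV. \<Sum>k\<in>UNIV. wn \<phi> (\<lambda>z. a j k z - a k j z)) =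
      (\<Sum>j\<in>UNIV. \<Sum>k\<in>UNIV. wn \<phi> (a j k)) + (\<Sum>j\<in>UNIV. \<Sum>k\<in>UNIV. wn \<phi> (a k j)) -
      2 * (\<Sum>j\<in>UNIV. \<Sum>k\<in>UNIV. Re (LINT z|lebesgue. a k j z * cnj (a j k z) * ?E z))"
    unfolding sq by (simp add: sum.distrib sum_subtractf sum_distrib_left)
  also have "(\<Sum>j\<in>UNIV. \<Sum>k\<in>UNIV. wn \<phi> (a k j)) = (\<Sum>j\<in>UNIV. \<Sum>k\<in>UNIV. wn \<phi> (a j k))"
    by (rule sum.swap)
  finally show ?thesis using adj unfolding form_energy_def a_def by argo
qed

text \<open>The zero weight makes the Levi matrix vanish, and \<open>kohn_morrey_pair\<close> with
  \<open>j = k\<close> becomes an equality of norms. Through it antiholomorphic derivatives control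
  the full gradient.\<close>

lemma unweighted_cr:
  fixes a :: "complex ^ 'n::finite \<Rightarrow> complex"
  assumes a: "Cc 2 a"
  shows "wn (\<lambda>_. 0) (cr (- \<i>) j a) = wn (\<lambda>_. 0) (cr \<i> j a)"
proof -
  have c: "Cc 0 (cr s j a)" for s by (rule Cc_mono[OF Cc2_cr[OF a]]) simp
  have i: "integrable lebesgue (\<lambda>z. cr s j a z * cnj (cr s j a z))" for s
    by (intro Cc_integrable(2)[where k=0] Cc_mult(1) c Ck_cnj CcD[OF c])
  have "levi_matrix (\<lambda>_. 0) z $ j $ j = 0" for z :: "complex ^ 'n" by (simp add: levi_matrix_cr)
  then show ?thesis
    using kohn_morrey_pair[of "\<lambda>_. 0", OF Ck_const a a, of j j] i[of "\<i>"] i[of "- \<i>"]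
    by (simp add: wn_complex)
qed

section \<open>A priori estimates for test forms\<close>

abbreviation u2 :: "(complex ^ 'n::finite \<Rightarrow> complex) \<Rightarrow> real" where "u2 \<equiv> wn (\<lambda>_. 0)"

definition tl :: "(complex ^ 'n::finite \<Rightarrow> real) \<Rightarrow> real \<Rightarrow> (complex ^ 'n \<Rightarrow> complex) \<Rightarrow> real" where
  "tl \<phi> R f = (LINT z|lebesgue. indicator {z. R \<le> norm z} z * ((cmod (f z))\<^sup>2 * exp (- \<phi> z)))"

lemma Cc_weighted:
  fixes \<phi> :: "complex ^ 'n::finite \<Rightarrow> real"
  assumes \<phi>: "Ck 0 \<phi>" and f: "Cc 0 f"
  shows "Cc 0 (\<lambda>z. (cmod (f z))\<^sup>2 * exp (- \<phi> z))"
  using assms by (auto simp: Cc_def intro!: continuous_intros)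

lemma wn_integrable:
  fixes \<phi> :: "complex ^ 'n::finite \<Rightarrow> real"
  assumes "Ck 0 \<phi>" "Cc 0 f"
  shows "integrable lebesgue (\<lambda>z. (cmod (f z))\<^sup>2 * exp (- \<phi> z))"
  by (rule Cc_integrable(2)[OF Cc_weighted[OF assms]])

lemma tl_integrable:
  fixes \<phi> :: "complex ^ 'n::finite \<Rightarrow> real"
  assumes "Ck 0 \<phi>" "Cc 0 f"
  shows "integrable lebesgue (\<lambda>z. indicator {z. R \<le> norm z} z * ((cmod (f z))\<^sup>2 * exp (- \<phi> z)))"
proof -
  have "closed {z::complex ^ 'n. R \<le> norm z}" by (intro closed_Collect_le continuous_intros)
  then have "{z::complex ^ 'n. R \<le> norm z} \<in> sets lebesgue" by (simp add: borel_closed)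
  from integrable_mult_indicator[OF this wn_integrable[OF assms]] show ?thesis by simp
qed

lemma u2_integrable:
  fixes f :: "complex ^ 'n::finite \<Rightarrow> complex"
  shows "Cc 0 f \<Longrightarrow> integrable lebesgue (\<lambda>z. (cmod (f z))\<^sup>2)"
  using wn_integrable[of "\<lambda>_. 0" f] by simp

lemma wn_nonneg: "0 \<le> wn \<phi> f"
  unfolding wn_def by (intro integral_nonneg_AE) auto

lemma nn2_u2:
  fixes f :: "complex ^ 'n::finite \<Rightarrow> complex"
  shows "Cc 0 f \<Longrightarrow> nn2 lborel f = ennreal (u2 f)"
proof -
  assume f: "Cc 0 f"
  have "nn2 lebesgue f = ennreal (LINT z|lebesgue. (cmod (f z))\<^sup>2)"
    unfolding nn2_def by (rule nn_integral_eq_integral[OF u2_integrable[OF f]]) simp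
  then show ?thesis by (simp add: nn2_lebesgue wn_def)
qed

lemma u2_add:
  fixes f g :: "complex ^ 'n::finite \<Rightarrow> complex"
  shows "Cc 0 f \<Longrightarrow> Cc 0 g \<Longrightarrow> u2 (\<lambda>z. f z + g z) \<le> 2 * u2 f + 2 * u2 g"
proof -
  assume f: "Cc 0 f" and g: "Cc 0 g"
  have "u2 (\<lambda>z. f z + g z) \<le> (LINT z|lebesgue. 2 * (cmod (f z))\<^sup>2 + 2 * (cmod (g z))\<^sup>2)"
    unfolding wn_def using u2_integrable[OF f] u2_integrable[OF g] u2_integrable[OF Cc_add[OF f g]] cmod_add_sq
    by (intro integral_mono) auto
  also have "\<dots> = 2 * u2 f + 2 * u2 g"
    unfolding wn_def using u2_integrable[OF f] u2_integrable[OF g] by simp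
  finally show ?thesis .
qed

text \<open>The real derivatives in the \<open>j\<close>-th complex coordinate are, up to a
  unimodular factor, the sum and the difference of the two Wirtinger derivatives, whose norms agree
  by \<open>unweighted_cr\<close>.\<close>

lemma u2_dir_deriv:
  fixes g :: "complex ^ 'n::finite \<Rightarrow> complex"
  assumes g: "Cc 2 g" and u: "u \<in> {1, \<i>}"
  shows "u2 (dir_deriv (axis j u) g) \<le> 4 * u2 (cr \<i> j g)"
proof -
  have c: "Cc 0 (cr s j g)" for s by (rule Cc_mono[OF Cc2_cr[OF g]]) simp
  have "\<exists>w. cmod w = 1 \<and> dir_deriv (axis j u) g = (\<lambda>z. w * (cr (- \<i>) j g z) + (w * (if u = 1 then 1 else - 1)) * cr \<i> j g z)"
    using u by (intro exI[of _ "if u = 1 then 1 else \<i>"]) (auto simp: cr_def fun_eq_iff field_simps)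
  then obtain w where w: "cmod w = 1" and D: "dir_deriv (axis j u) g = (\<lambda>z. w * (cr (- \<i>) j g z) + (w * (if u = 1 then 1 else - 1)) * cr \<i> j g z)"
    by blast
  have 1: "u2 (\<lambda>z. c * f z) = (cmod c)\<^sup>2 * u2 f" for c f
    unfolding wn_def by (simp add: norm_mult power_mult_distrib)
  have "u2 (dir_deriv (axis j u) g) \<le> 2 * u2 (\<lambda>z. w * cr (- \<i>) j g z) + 2 * u2 (\<lambda>z. (w * (if u = 1 then 1 else - 1)) * cr \<i> j g z)"
    unfolding D by (intro u2_add Cc_mult(2) Ck_const c)
  also have "\<dots> = 2 * u2 (cr (- \<i>) j g) + 2 * u2 (cr \<i> j g)"
    unfolding 1 using w by (simp add: norm_mult)
  finally show ?thesis by (simp add: unweighted_cr[OF g])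
qed

lemma poincare_cr:
  fixes g :: "complex ^ 'n::finite \<Rightarrow> complex"
  assumes g: "Cc 2 g" and r: "r \<ge> 0" "\<And>z. norm z > r \<Longrightarrow> g z = 0"
  shows "u2 g \<le> 2 * (2 * r + 1)\<^sup>2 * u2 (cr \<i> j g)"
proof -
  \<comment> \<open>Any length beyond the diameter \<open>2 * r\<close> separates the support from
    its translate. The direction is chosen inside the \<open>j\<close>-th complex coordinate, so
    that the derivative \<open>cr \<i> j g\<close> alone bounds the norm.\<close>
  define c where "c = 2 * r + 1"
  define y where "y = c *\<^sub>R axis j (1::complex)"
  have c: "c > 0" using r by (simp add: c_def)
  have g0: "Cc 0 g" "Cc 1 g" using Cc_mono[OF g] by auto
  have gd: "g differentiable (at x)" for x by (rule Ck_differentiable2[OF CcD[OF g]])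
  have dc: "Cc 0 (dir_deriv v g)" for v using Cc_dir_deriv[of 0 g v] g0 by simp
  have "norm y > 2 * r" using c by (simp add: y_def) (simp add: c_def)
  then have "2 * nn2 lborel g \<le> nn2 lborel (dir_deriv y g)" by (intro poincare_Cc[OF g0(2) r(2)])
  then have "ennreal (2 * u2 g) \<le> ennreal (u2 (dir_deriv y g))"
    by (simp add: nn2_u2[OF g0(1)] nn2_u2[OF dc] ennreal_mult')
  then have "2 * u2 g \<le> u2 (dir_deriv y g)" by (subst (asm) ennreal_le_iff[OF wn_nonneg])
  also have "u2 (dir_deriv y g) = c\<^sup>2 * u2 (dir_deriv (axis j 1) g)"
    unfolding wn_def y_def using c by (simp add: dir_deriv_lincomb(2)[OF gd] power_mult_distrib)
  also have "\<dots> \<le> c\<^sup>2 * (4 * u2 (cr \<i> j g))" by (intro mult_left_mono u2_dir_deriv[OF g]) auto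
  finally show ?thesis by (simp add: c_def mult_ac)
qed

lemma plateau_cr:
  fixes \<psi> :: "complex ^ 'n::finite \<Rightarrow> complex"
  assumes "plateau K R \<psi>" "cmod s = 1"
  shows "cmod (cr s j \<psi> z) \<le> K" and "norm z < R \<Longrightarrow> cr s j \<psi> z = 0"
proof -
  have "cmod (dir_deriv (axis j 1) \<psi> z) \<le> K" "cmod (dir_deriv (axis j \<i>) \<psi> z) \<le> K"
    using assms by (auto simp: plateau_def)
  then show "cmod (cr s j \<psi> z) \<le> K"
    using norm_triangle_ineq[of "dir_deriv (axis j 1) \<psi> z" "s * dir_deriv (axis j \<i>) \<psi> z"] assms(2)
    by (simp add: cr_def norm_divide norm_mult)
  show "cr s j \<psi> z = 0" if "norm z < R" using assms(1) that by (simp add: cr_def plateau_def)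
qed

text \<open>Translates between the weighted form and its cut-off measured without weight. On the
  support of the cut-off the weight lies between \<open>m\<close> and \<open>M\<close>, and the
  derivative of the cut-off lives at radius at least \<open>R\<close>, so its contribution is
  charged to the tail \<open>tl\<close>, for which the Levi form provides a bound.\<close>

lemma plateau_estimates:
  fixes \<psi> f :: "complex ^ 'n::finite \<Rightarrow> complex"
  assumes \<phi>: "Ck 0 \<phi>" and p: "plateau K R \<psi>" and f: "Cc 2 f"
    and m: "m > 0" "\<And>z. norm z \<le> R + 2 \<Longrightarrow> m \<le> exp (- \<phi> z)" "\<And>z. norm z \<le> R + 2 \<Longrightarrow> exp (- \<phi> z) \<le> M"
  shows "u2 (cr \<i> j (\<lambda>z. \<psi> z * f z)) \<le> 2 / m * wn \<phi> (cr \<i> j f) + 2 * K\<^sup>2 / m * tl \<phi> R f"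
    and "u2 (\<lambda>z. \<psi> z * f z) \<le> 1 / m * wn \<phi> f"
    and "wn \<phi> f \<le> tl \<phi> R f + M * u2 (\<lambda>z. \<psi> z * f z)"
proof -
  have \<psi>: "Cc k \<psi>" for k using p by (auto simp: plateau_def test_function_iff)
  have f0: "Cc 0 f" using Cc_mono[OF f] by auto
  have \<psi>f: "Cc 2 (\<lambda>z. \<psi> z * f z)" by (rule Cc_mult(1)[OF \<psi> CcD[OF f]])
  have \<psi>f0: "Cc 0 (\<lambda>z. \<psi> z * f z)" by (rule Cc_mono[OF \<psi>f]) simp
  have c: "Cc 0 (cr s j g)" if "Cc 2 g" for s g by (rule Cc_mono[OF Cc2_cr[OF that]]) simp
  have out: "\<psi> z = 0" if "norm z > R + 2" for z using p that by (auto simp: plateau_def)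
  have le1: "cmod (\<psi> z) \<le> 1" for z using p by (auto simp: plateau_def)
  have e1: "1 \<le> 1 / m * exp (- \<phi> z)" if "norm z \<le> R + 2" for z using m(1) m(2)[OF that] by (simp add: field_simps)
  have i1: "integrable lebesgue (\<lambda>z. (cmod (cr \<i> j f z))\<^sup>2 * exp (- \<phi> z))" by (rule wn_integrable[OF \<phi> c[OF f]])
  have i2: "integrable lebesgue (\<lambda>z. indicator {z. R \<le> norm z} z * ((cmod (f z))\<^sup>2 * exp (- \<phi> z)))" by (rule tl_integrable[OF \<phi> f0])
  have i3: "integrable lebesgue (\<lambda>z. (cmod (f z))\<^sup>2 * exp (- \<phi> z))" by (rule wn_integrable[OF \<phi> f0])
  have pw: "(cmod (cr \<i> j (\<lambda>z. \<psi> z * f z) z))\<^sup>2 \<le> 2 / m * ((cmod (cr \<i> j f z))\<^sup>2 * exp (- \<phi> z)) +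
      2 * K\<^sup>2 / m * (indicator {z. R \<le> norm z} z * ((cmod (f z))\<^sup>2 * exp (- \<phi> z)))" for z
  proof (cases "norm z \<le> R + 2")
    case True
    have "cr \<i> j (\<lambda>z. \<psi> z * f z) z = \<psi> z * cr \<i> j f z + cr \<i> j \<psi> z * f z"
      by (intro cr_mult Ck_differentiable2 CcD[OF \<psi>] CcD[OF f])
    then have "(cmod (cr \<i> j (\<lambda>z. \<psi> z * f z) z))\<^sup>2 \<le> 2 * (cmod (\<psi> z * cr \<i> j f z))\<^sup>2 + 2 * (cmod (cr \<i> j \<psi> z * f z))\<^sup>2"
      using cmod_add_sq by simp
    also have "\<dots> \<le> 2 * (cmod (cr \<i> j f z))\<^sup>2 + 2 * (K\<^sup>2 * (indicator {z. R \<le> norm z} z * (cmod (f z))\<^sup>2))"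
    proof (intro add_mono mult_left_mono)
      show "(cmod (\<psi> z * cr \<i> j f z))\<^sup>2 \<le> (cmod (cr \<i> j f z))\<^sup>2"
        using mult_right_mono[OF le1[of z], of "cmod (cr \<i> j f z)"] by (intro power_mono) (auto simp: norm_mult)
      show "(cmod (cr \<i> j \<psi> z * f z))\<^sup>2 \<le> K\<^sup>2 * (indicator {z. R \<le> norm z} z * (cmod (f z))\<^sup>2)"
        using plateau_cr[OF p norm_ii, where j = j and z = z] by (cases "norm z < R")
          (auto simp: norm_mult power_mult_distrib intro!: mult_right_mono power_mono)
    qed auto
    also have "\<dots> = (2 * (cmod (cr \<i> j f z))\<^sup>2 + 2 * (K\<^sup>2 * (indicator {z. R \<le> norm z} z * (cmod (f z))\<^sup>2))) * 1" by simp
    also have "\<dots> \<le> (2 * (cmod (cr \<i> j f z))\<^sup>2 + 2 * (K\<^sup>2 * (indicator {z. R \<le> norm z} z * (cmod (f z))\<^sup>2))) * (1 / m * exp (- \<phi> z))"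
      by (intro mult_left_mono e1 True) auto
    finally show ?thesis by (simp add: algebra_simps)
  next
    case False
    then have "cr \<i> j (\<lambda>z. \<psi> z * f z) z = 0" using out by (intro cr_outside[of "R + 2"]) auto
    then show ?thesis using m(1) by simp
  qed
  have "u2 (cr \<i> j (\<lambda>z. \<psi> z * f z)) \<le> (LINT z|lebesgue. 2 / m * ((cmod (cr \<i> j f z))\<^sup>2 * exp (- \<phi> z)) +
      2 * K\<^sup>2 / m * (indicator {z. R \<le> norm z} z * ((cmod (f z))\<^sup>2 * exp (- \<phi> z))))"
    unfolding wn_def using u2_integrable[OF c[OF \<psi>f]] i1 i2 pw by (intro integral_mono) auto
  also have "\<dots> = 2 / m * wn \<phi> (cr \<i> j f) + 2 * K\<^sup>2 / m * tl \<phi> R f"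
    unfolding wn_def tl_def using i1 i2 by simp
  finally show "u2 (cr \<i> j (\<lambda>z. \<psi> z * f z)) \<le> 2 / m * wn \<phi> (cr \<i> j f) + 2 * K\<^sup>2 / m * tl \<phi> R f" .
  have pw2: "(cmod (\<psi> z * f z))\<^sup>2 \<le> 1 / m * ((cmod (f z))\<^sup>2 * exp (- \<phi> z))" for z
  proof (cases "norm z \<le> R + 2")
    case True
    have "(cmod (\<psi> z * f z))\<^sup>2 \<le> (cmod (f z))\<^sup>2"
      using mult_right_mono[OF le1[of z], of "cmod (f z)"] by (intro power_mono) (auto simp: norm_mult)
    also have "\<dots> \<le> (cmod (f z))\<^sup>2 * (1 / m * exp (- \<phi> z))"
      using mult_left_mono[OF e1[OF True], of "(cmod (f z))\<^sup>2"] by simp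
    finally show ?thesis by simp
  qed (use out m(1) in simp)
  have "u2 (\<lambda>z. \<psi> z * f z) \<le> (LINT z|lebesgue. 1 / m * ((cmod (f z))\<^sup>2 * exp (- \<phi> z)))"
    unfolding wn_def using u2_integrable[OF \<psi>f0] i3 pw2 by (intro integral_mono) auto
  then show "u2 (\<lambda>z. \<psi> z * f z) \<le> 1 / m * wn \<phi> f" unfolding wn_def by simp
  have M: "M > 0" if "norm z \<le> R + 2" for z :: "complex ^ 'n" using m(1) m(2,3)[OF that] by linarith
  have pw3: "(cmod (f z))\<^sup>2 * exp (- \<phi> z) \<le> indicator {z. R \<le> norm z} z * ((cmod (f z))\<^sup>2 * exp (- \<phi> z)) +
      M * (cmod (\<psi> z * f z))\<^sup>2" for z
  proof (cases "norm z < R")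
    case True
    then have "\<psi> z = 1" using p by (simp add: plateau_def)
    then show ?thesis using True mult_left_mono[OF m(3)[of z], of "(cmod (f z))\<^sup>2"] by (simp add: mult.commute)
  next
    case False
    then show ?thesis using M[of z] out[of z] by (cases "norm z \<le> R + 2") auto
  qed
  have "wn \<phi> f \<le> (LINT z|lebesgue. indicator {z. R \<le> norm z} z * ((cmod (f z))\<^sup>2 * exp (- \<phi> z)) + M * (cmod (\<psi> z * f z))\<^sup>2)"
    unfolding wn_def using i2 i3 u2_integrable[OF \<psi>f0] pw3 by (intro integral_mono) auto
  also have "\<dots> = tl \<phi> R f + M * u2 (\<lambda>z. \<psi> z * f z)"
    unfolding wn_def tl_def using i2 u2_integrable[OF \<psi>f0] by simp
  finally show "wn \<phi> f \<le> tl \<phi> R f + M * u2 (\<lambda>z. \<psi> z * f z)" .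
qed

lemma weight_bounds:
  fixes \<phi> :: "complex ^ 'n::finite \<Rightarrow> real"
  assumes "Ck 0 \<phi>"
  obtains m M where "m > 0" "M > 0" "\<And>z. norm z \<le> r \<Longrightarrow> m \<le> exp (- \<phi> z)" "\<And>z. norm z \<le> r \<Longrightarrow> exp (- \<phi> z) \<le> M"
proof -
  have "bounded (\<phi> ` cball 0 r)"
    using assms by (intro compact_imp_bounded compact_continuous_image) (auto intro: continuous_on_subset)
  then obtain K where "\<forall>y\<in>\<phi> ` cball 0 r. norm y \<le> K" unfolding bounded_iff by blast
  then have K: "\<bar>\<phi> z\<bar> \<le> K" if "norm z \<le> r" for z using that by auto
  show ?thesis
    by (rule that[of "exp (- K)" "exp K"]) (use K in \<open>auto simp: abs_le_iff\<close>)
qed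

text \<open>The setting of the operator theory: closedness, adjoints, density of test forms. The
  order on \<open>'n\<close> fixes the signs in \<open>wedge_coeff\<close>. The extension
  \<open>psh_weight\<close> carries the hypotheses behind the estimates.\<close>

locale weight =
  fixes \<phi> :: "complex ^ 'n::{finite,linorder} \<Rightarrow> real"
  assumes C2: "Ck 2 \<phi>"
begin

lemma C0: "Ck 0 \<phi>" using Ck_mono[OF C2, of 0] by simp

end

locale psh_weight = weight \<phi> for \<phi> :: "complex ^ 'n::{finite,linorder} \<Rightarrow> real" +
  assumes psh: "plurisubharmonic \<phi>"
    and lim: "filterlim (\<lambda>z. lowest_eigenvalue (levi_matrix \<phi> z)) at_top at_infinity"
begin

lemma levi_integrable:
  assumes v: "\<And>j. Cc 0 (v j)"
  shows "integrable lebesgue (\<lambda>z. levi_form \<phi> z (\<lambda>j. v j z) * exp (- \<phi> z))"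
proof -
  have F: "Ck 2 (\<lambda>w. complex_of_real (\<phi> w))" using C2 by (rule Ck_of_real)
  have E: "Ck 0 (\<lambda>z. exp (- \<phi> z))" by (intro Ck_exp Ck_minus C0)
  have "Cc 0 (\<lambda>z. levi_form \<phi> z (\<lambda>j. v j z) * exp (- \<phi> z))"
    unfolding levi_form_def levi_matrix_cr
    by (intro Cc_mult(1)[OF _ E] Cc_bounded_linear[OF bounded_linear_Re] Cc_sum Cc_mult(1)[OF Cc_mult(2)]
        Ck1_cr Ck2_cr F v Ck_cnj CcD[OF v])
  then show ?thesis by (rule Cc_integrable(2))
qed

text \<open>Both parts of \<open>kohn_morrey\<close> are nonnegative, so each is bounded by the
  energy. In the third claim, inside radius \<open>R\<close> plurisubharmonicity alone keeps the
  Levi form from cancelling the tail.\<close>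

lemma energy_estimates:
  assumes v: "\<And>j. Cc 2 (v j)"
  shows "0 \<le> form_energy \<phi> v" and "wn \<phi> (cr \<i> j (v k)) \<le> form_energy \<phi> v"
    and "t \<ge> 0 \<Longrightarrow> (\<And>z. norm z \<ge> R \<Longrightarrow> t \<le> lowest_eigenvalue (levi_matrix \<phi> z)) \<Longrightarrow> t * tl \<phi> R (v k) \<le> form_energy \<phi> v"
proof -
  have v0: "Cc 0 (v j)" for j by (rule Cc_mono[OF v]) simp
  note km = kohn_morrey[OF C2 v]
  have L: "0 \<le> (LINT z|lebesgue. levi_form \<phi> z (\<lambda>j. v j z) * exp (- \<phi> z))"
    using psh_levi_form_nonneg[OF C2 psh] by (intro integral_nonneg_AE) auto
  have S: "0 \<le> (\<Sum>j\<in>UNIV. \<Sum>k\<in>UNIV. wn \<phi> (cr \<i> j (v k)))" by (intro sum_nonneg wn_nonneg)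
  show "0 \<le> form_energy \<phi> v" using km L S by simp
  have "wn \<phi> (cr \<i> j (v k)) \<le> (\<Sum>k\<in>UNIV. wn \<phi> (cr \<i> j (v k)))"
    by (intro member_le_sum wn_nonneg) auto
  also have "\<dots> \<le> (\<Sum>j\<in>UNIV. \<Sum>k\<in>UNIV. wn \<phi> (cr \<i> j (v k)))"
    by (rule member_le_sum[of j UNIV "\<lambda>j. \<Sum>k\<in>UNIV. wn \<phi> (cr \<i> j (v k))"]) (auto intro!: sum_nonneg wn_nonneg)
  finally show "wn \<phi> (cr \<i> j (v k)) \<le> form_energy \<phi> v" using km L by simp
  assume t: "t \<ge> 0" "\<And>z. norm z \<ge> R \<Longrightarrow> t \<le> lowest_eigenvalue (levi_matrix \<phi> z)"
  have "t * tl \<phi> R (v k) = (LINT z|lebesgue. t * (indicator {z. R \<le> norm z} z * ((cmod (v k z))\<^sup>2 * exp (- \<phi> z))))"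
    by (simp add: tl_def)
  also have "\<dots> \<le> (LINT z|lebesgue. levi_form \<phi> z (\<lambda>j. v j z) * exp (- \<phi> z))"
  proof (rule integral_mono)
    show "integrable lebesgue (\<lambda>z. t * (indicator {z. R \<le> norm z} z * ((cmod (v k z))\<^sup>2 * exp (- \<phi> z))))"
      using tl_integrable[OF C0 v0] by simp
    fix z
    show "t * (indicator {z. R \<le> norm z} z * ((cmod (v k z))\<^sup>2 * exp (- \<phi> z))) \<le> levi_form \<phi> z (\<lambda>j. v j z) * exp (- \<phi> z)"
    proof (cases "R \<le> norm z")
      case True
      have "t * (cmod (v k z))\<^sup>2 \<le> lowest_eigenvalue (levi_matrix \<phi> z) * (\<Sum>j\<in>UNIV. (cmod (v j z))\<^sup>2)"
        using t(1) t(2)[OF True] member_le_sum[of k UNIV "\<lambda>j. (cmod (v j z))\<^sup>2"]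
        by (intro mult_mono) (auto intro: sum_nonneg)
      also have "\<dots> \<le> levi_form \<phi> z (\<lambda>j. v j z)" by (rule levi_form_ge[OF C2])
      finally have "t * (cmod (v k z))\<^sup>2 * exp (- \<phi> z) \<le> levi_form \<phi> z (\<lambda>j. v j z) * exp (- \<phi> z)"
        by (rule mult_right_mono) simp
      then show ?thesis using True by (simp add: mult_ac)
    next
      case False
      then show ?thesis using psh_levi_form_nonneg[OF C2 psh, of z] by simp
    qed
  qed (rule levi_integrable[OF v0])
  finally show "t * tl \<phi> R (v k) \<le> form_energy \<phi> v" using km S by simp
qed

lemma eigenvalue_radius:
  obtains R where "R > 0" "\<And>z. norm z \<ge> R \<Longrightarrow> t \<le> lowest_eigenvalue (levi_matrix \<phi> z)"
proof -
  have "\<forall>\<^sub>F z in at_infinity. t \<le> lowest_eigenvalue (levi_matrix \<phi> z)"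
    using lim by (simp add: filterlim_at_top)
  then obtain b where "\<And>z. norm z \<ge> b \<Longrightarrow> t \<le> lowest_eigenvalue (levi_matrix \<phi> z)"
    unfolding eventually_at_infinity by blast
  then show ?thesis using that[of "max b 1"] by auto
qed

text \<open>Outside a ball the lowest eigenvalue is at least 1 and the Levi form bounds the mass.
  Inside, where it may degenerate, the cut-off coefficient is compactly supported and
  \<open>poincare_cr\<close> bounds it by its derivative; the error of the cut-off is again a tail.
  The constant \<open>C\<close> adds up these contributions.\<close>

lemma basic_estimate:
  "\<exists>C>0. \<forall>v. (\<forall>j. Cc 2 (v j)) \<longrightarrow> (\<forall>k. wn \<phi> (v k) \<le> C * form_energy \<phi> v)"
proof -
  obtain R where R: "R > 0" "\<And>z. norm z \<ge> R \<Longrightarrow> 1 \<le> lowest_eigenvalue (levi_matrix \<phi> z)"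
    using eigenvalue_radius by blast
  obtain K and \<psi> :: "(complex, 'n) vec \<Rightarrow> complex" where p: "plateau K R \<psi>" using plateau_exists by blast
  obtain m M where m: "m > 0" "M > 0" "\<And>z. norm z \<le> R + 2 \<Longrightarrow> m \<le> exp (- \<phi> z)" "\<And>z. norm z \<le> R + 2 \<Longrightarrow> exp (- \<phi> z) \<le> M"
    using weight_bounds[OF C0] by blast
  define c where "c = 2 * (2 * (R + 2) + 1)\<^sup>2"
  define C where "C = 1 + M * (c * (2 / m + 2 * K\<^sup>2 / m))"
  have c: "c \<ge> 0" by (simp add: c_def)
  have C: "C > 0" unfolding C_def using m c by (intro add_pos_nonneg mult_nonneg_nonneg add_nonneg_nonneg) auto
  have "wn \<phi> (v k) \<le> C * form_energy \<phi> v" if "\<forall>j. Cc 2 (v j)" for v k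
  proof -
    have v: "Cc 2 (v j)" for j using that by blast
    define e where "e = form_energy \<phi> v"
    have t: "tl \<phi> R (v k) \<le> e" using energy_estimates(3)[OF v, where t = 1 and R = R and k = k] R(2) by (simp add: e_def)
    have w: "wn \<phi> (cr \<i> k (v k)) \<le> e" unfolding e_def by (rule energy_estimates(2)[OF v])
    have \<psi>: "Cc j \<psi>" for j using p by (auto simp: plateau_def test_function_iff)
    have g: "Cc 2 (\<lambda>z. \<psi> z * v k z)" by (rule Cc_mult(1)[OF \<psi> CcD[OF v]])
    note pe = plateau_estimates[OF C0 p v m(1,3,4)]
    have "u2 (\<lambda>z. \<psi> z * v k z) \<le> c * u2 (cr \<i> k (\<lambda>z. \<psi> z * v k z))"
      unfolding c_def using p R(1) by (intro poincare_cr[OF g]) (auto simp: plateau_def)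
    also have "\<dots> \<le> c * (2 / m * e + 2 * K\<^sup>2 / m * e)"
      using m(1) by (intro mult_left_mono[OF order_trans[OF pe(1)]] add_mono mult_left_mono t w c) auto
    finally have "u2 (\<lambda>z. \<psi> z * v k z) \<le> c * (2 / m * e + 2 * K\<^sup>2 / m * e)" .
    then have "M * u2 (\<lambda>z. \<psi> z * v k z) \<le> M * (c * (2 / m * e + 2 * K\<^sup>2 / m * e))"
      using m(2) by (intro mult_left_mono) auto
    then have "wn \<phi> (v k) \<le> e + M * (c * (2 / m * e + 2 * K\<^sup>2 / m * e))" using pe(3)[of k] t by linarith
    also have "\<dots> = C * e" by (simp add: C_def algebra_simps)
    finally show ?thesis unfolding e_def .
  qed
  with C show ?thesis by blast
qed

end

section \<open>Compactness for test forms\<close>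

lemma Cc_lipschitz:
  fixes f :: "'a::euclidean_space \<Rightarrow> real"
  assumes f: "Cc 1 f"
  obtains L where "L > 0" "\<And>x y. \<bar>f x - f y\<bar> \<le> L * norm (x - y)"
proof -
  have f1: "Cc (Suc 0) f" using f by simp
  have d: "f differentiable (at x)" for x using f1 by (simp add: Cc_def Ck_Suc)
  have "\<forall>b. \<exists>K>0. \<forall>x. norm (dir_deriv b f x) \<le> K"
    using Cc_bounded[OF Cc_dir_deriv[OF f1]] by metis
  then obtain K where K: "\<And>b. K b > 0" "\<And>b x. norm (dir_deriv b f x) \<le> K b" by metis
  define L where "L = 1 + (\<Sum>b\<in>Basis. K b)"
  have L: "L > 0" unfolding L_def using K(1) by (intro add_pos_nonneg sum_nonneg less_imp_le) auto
  have "\<bar>f x - f y\<bar> \<le> L * norm (x - y)" for x y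
  proof -
    have D: "norm (dir_deriv (x - y) f z) \<le> L * norm (x - y)" for z
    proof -
      have "norm (dir_deriv (x - y) f z) \<le> (\<Sum>b\<in>Basis. norm (((x - y) \<bullet> b) *\<^sub>R dir_deriv b f z))"
        by (subst dir_deriv_expand[OF d]) (rule norm_sum)
      also have "\<dots> \<le> (\<Sum>b\<in>Basis. norm (x - y) * K b)"
        using K Basis_le_norm[of _ "x - y"] by (intro sum_mono) (auto simp: abs_mult intro!: mult_mono)
      also have "\<dots> = norm (x - y) * (\<Sum>b\<in>Basis. K b)" by (rule sum_distrib_left[symmetric])
      also have "\<dots> \<le> L * norm (x - y)" by (simp add: L_def algebra_simps)
      finally show ?thesis .
    qed
    have "norm (f (y + 1 *\<^sub>R (x - y)) - f y) \<le> (L * norm (x - y)) * \<bar>1\<bar>"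
      by (rule dir_deriv_lipschitz[OF d D])
    then show ?thesis by simp
  qed
  with L that show ?thesis by blast
qed

text \<open>With one fixed kernel, functions of bounded L^1 norm turn into a uniformly bounded and
  equicontinuous family, as needed for the Arzela--Ascoli theorem.\<close>

lemma conv_bounds:
  fixes f :: "'a::euclidean_space \<Rightarrow> complex"
  assumes \<rho>: "Cc 0 \<rho>" and f: "integrable lebesgue f"
  shows "(\<And>x. \<bar>\<rho> x\<bar> \<le> P) \<Longrightarrow> cmod (conv \<rho> f x) \<le> P * (LINT y|lebesgue. cmod (f y))"
    and "(\<And>x y. \<bar>\<rho> x - \<rho> y\<bar> \<le> L * norm (x - y)) \<Longrightarrow>
      cmod (conv \<rho> f x - conv \<rho> f x') \<le> L * norm (x - x') * (LINT y|lebesgue. cmod (f y))"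
proof -
  have i: "integrable lebesgue (\<lambda>y. \<rho> (x - y) *\<^sub>R f y)" for x by (rule integrable_reflect_scaleR[OF \<rho> f])
  assume P: "\<And>x. \<bar>\<rho> x\<bar> \<le> P"
  have "cmod (conv \<rho> f x) \<le> (LINT y|lebesgue. P * cmod (f y))"
    unfolding conv_def using i f P
    by (intro Bochner_Integration.integral_norm_bound_integral) (auto intro!: mult_right_mono)
  then show "cmod (conv \<rho> f x) \<le> P * (LINT y|lebesgue. cmod (f y))" by simp
next
  have i: "integrable lebesgue (\<lambda>y. \<rho> (x - y) *\<^sub>R f y)" for x by (rule integrable_reflect_scaleR[OF \<rho> f])
  assume L: "\<And>x y. \<bar>\<rho> x - \<rho> y\<bar> \<le> L * norm (x - y)"
  have "conv \<rho> f x - conv \<rho> f x' = (LINT y|lebesgue. (\<rho> (x - y) - \<rho> (x' - y)) *\<^sub>R f y)"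
    unfolding conv_def using i by (simp add: scaleR_diff_left)
  also have "cmod \<dots> \<le> (LINT y|lebesgue. (L * norm (x - x')) * cmod (f y))"
  proof (rule Bochner_Integration.integral_norm_bound_integral)
    show "integrable lebesgue (\<lambda>y. (\<rho> (x - y) - \<rho> (x' - y)) *\<^sub>R f y)"
      using i by (simp add: scaleR_diff_left)
    show "cmod ((\<rho> (x - y) - \<rho> (x' - y)) *\<^sub>R f y) \<le> L * norm (x - x') * cmod (f y)" for y
      using mult_right_mono[OF L[of "x - y" "x' - y"], of "cmod (f y)"] by simp
  qed (use f in simp)
  finally show "cmod (conv \<rho> f x - conv \<rho> f x') \<le> L * norm (x - x') * (LINT y|lebesgue. cmod (f y))" by simp
qed

lemma integral_norm_le_u2:
  fixes g :: "complex ^ 'n::finite \<Rightarrow> complex"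
  assumes g: "Cc 0 g" and r: "\<And>z. norm z > r \<Longrightarrow> g z = 0"
  shows "(LINT z|lebesgue. cmod (g z)) \<le> measure lebesgue (cball (0::complex ^ 'n) r) + u2 g"
proof -
  have i1: "integrable lebesgue (indicator (cball (0::complex ^ 'n) r) :: _ \<Rightarrow> real)"
    using emeasure_bounded_finite[of "cball (0::complex ^ 'n) r"] by (intro integrable_real_indicator) auto
  note i2 = u2_integrable[OF g]
  have "(LINT z|lebesgue. cmod (g z)) \<le> (LINT z|lebesgue. indicator (cball (0::complex ^ 'n) r) z + (cmod (g z))\<^sup>2)"
  proof (rule integral_mono)
    show "integrable lebesgue (\<lambda>z. cmod (g z))" using Cc_integrable(2)[OF g] by simp
    show "integrable lebesgue (\<lambda>z. indicator (cball (0::complex ^ 'n) r) z + (cmod (g z))\<^sup>2)" using i1 i2 by simp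
    have "t \<le> 1 + t\<^sup>2" for t :: real
      using zero_le_power2[of "t - 1/2"] by (simp add: power2_eq_square algebra_simps)
    then show "cmod (g z) \<le> indicator (cball (0::complex ^ 'n) r) z + (cmod (g z))\<^sup>2" for z
      using r[of z] by (cases "norm z \<le> r") (auto simp: indicator_def)
  qed
  also have "\<dots> = measure lebesgue (cball (0::complex ^ 'n) r) + u2 g"
    using i1 i2 by (simp add: wn_def)
  finally show ?thesis .
qed

lemma u2_le_sup:
  fixes h :: "complex ^ 'n::finite \<Rightarrow> complex"
  assumes h: "Cc 0 h" and r: "\<And>z. norm z > r \<Longrightarrow> h z = 0" and s: "\<And>z. norm z \<le> r \<Longrightarrow> cmod (h z) \<le> s"
  shows "u2 h \<le> s\<^sup>2 * measure lebesgue (cball (0::complex ^ 'n) r)"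
proof -
  have i1: "integrable lebesgue (indicator (cball (0::complex ^ 'n) r) :: _ \<Rightarrow> real)"
    using emeasure_bounded_finite[of "cball (0::complex ^ 'n) r"] by (intro integrable_real_indicator) auto
  have "u2 h \<le> (LINT z|lebesgue. s\<^sup>2 * indicator (cball (0::complex ^ 'n) r) z)"
    unfolding wn_def minus_zero exp_zero mult_1_right
  proof (rule integral_mono[OF u2_integrable[OF h]])
    show "integrable lebesgue (\<lambda>z. s\<^sup>2 * indicator (cball (0::complex ^ 'n) r) z)" using i1 by simp
    show "(cmod (h z))\<^sup>2 \<le> s\<^sup>2 * indicator (cball (0::complex ^ 'n) r) z" for z
      using r[of z] s[of z] by (cases "norm z \<le> r") (auto intro!: power_mono)
  qed
  then show ?thesis by simp
qed

text \<open>Each of the 2n real directions contributes at most \<open>4 * G\<close> by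
  \<open>u2_dir_deriv\<close>, which makes 8 n G in \<open>mollify_Cc\<close>.\<close>

lemma u2_mollify:
  fixes g :: "complex ^ 'n::finite \<Rightarrow> complex"
  assumes g: "Cc 2 g" and \<rho>: "mollifier \<delta> \<rho>" and \<delta>: "\<delta> \<ge> 0" and G: "\<And>j. u2 (cr \<i> j g) \<le> G"
  shows "u2 (\<lambda>z. g z - conv \<rho> g z) \<le> \<delta>\<^sup>2 * (8 * real CARD('n) * G)"
proof -
  have g0: "Cc 0 g" "Cc 1 g" using Cc_mono[OF g] by auto
  obtain r where r: "\<And>z. norm z > r \<Longrightarrow> g z = 0" using g by (auto simp: Cc_def)
  have "test_function (conv \<rho> g)" by (rule test_function_conv[OF Cc_integrable(2)[OF g] r \<rho>])
  then have c: "Cc 0 (\<lambda>z. g z - conv \<rho> g z)" by (intro Cc_diff g0) (auto simp: test_function_iff)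
  have dc: "Cc 0 (dir_deriv v g)" for v using Cc_dir_deriv[of 0 g v] g0 by simp
  have G0: "G \<ge> 0" using order_trans[OF wn_nonneg G] by blast
  have B: "nn2 lborel (dir_deriv b g) \<le> ennreal (4 * G)" if b: "b \<in> Basis" for b
  proof -
    obtain j u where bu: "b = axis j u" "u \<in> {1, \<i>}" using b by (auto simp: Basis_vec_def Basis_complex_def)
    have "u2 (dir_deriv b g) \<le> 4 * G" using u2_dir_deriv[OF g bu(2), of j] G[of j] by (simp add: bu)
    then show ?thesis by (simp add: nn2_u2[OF dc] ennreal_leI)
  qed
  have "ennreal (u2 (\<lambda>z. g z - conv \<rho> g z)) \<le> ennreal (\<delta>\<^sup>2) * (\<Sum>b\<in>Basis. nn2 lborel (dir_deriv b g))"
    unfolding nn2_u2[OF c, symmetric] by (rule mollify_Cc[OF g0(2) \<rho> \<delta>])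
  also have "\<dots> \<le> ennreal (\<delta>\<^sup>2) * (\<Sum>b\<in>(Basis::(complex ^ 'n) set). ennreal (4 * G))"
    by (intro mult_left_mono sum_mono B) auto
  also have "(\<Sum>b\<in>(Basis::(complex ^ 'n) set). ennreal (4 * G)) = ennreal (\<Sum>b\<in>(Basis::(complex ^ 'n) set). 4 * G)"
    using G0 by (intro sum_ennreal) auto
  also have "ennreal (\<delta>\<^sup>2) * \<dots> = ennreal (\<delta>\<^sup>2 * (\<Sum>b\<in>(Basis::(complex ^ 'n) set). 4 * G))"
    using G0 by (subst ennreal_mult) (auto intro!: sum_nonneg)
  also have "(\<Sum>b\<in>(Basis::(complex ^ 'n) set). 4 * G) = 8 * real CARD('n) * G" by simp
  finally show ?thesis using G0 by (subst (asm) ennreal_le_iff) auto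
qed

context psh_weight begin

text \<open>Two close members of an arbitrary sequence are all that is asked for, so the convergent
  subsequence is used at two consecutive indices only. The distance splits into tails, mollification
  errors and the uniform distance of the mollified cut-offs.\<close>

lemma energy_compactness:
  fixes v :: "nat \<Rightarrow> 'n \<Rightarrow> (complex, 'n) vec \<Rightarrow> complex"
  assumes v: "\<And>m j k. Cc k (v m j)" and B: "\<And>m. form_energy \<phi> (v m) \<le> B" and e: "\<epsilon> > 0"
  shows "\<exists>a b. a < b \<and> (\<forall>j. wn \<phi> (\<lambda>z. v a j z - v b j z) \<le> \<epsilon>)"
proof -
  obtain C where C: "C > 0" "\<forall>v. (\<forall>j. Cc 2 (v j)) \<longrightarrow> (\<forall>k. wn \<phi> (v k) \<le> C * form_energy \<phi> v)"
    using basic_estimate by blast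
  have B0: "B \<ge> 0" by (rule order_trans[OF energy_estimates(1)[of "v 0", OF v] B])
  \<comment> \<open>Makes every tail at most \<open>B / t \<le> \<epsilon> / 8\<close>, so the tail
    of a difference is at most twice the sum of two of them, that is \<open>\<epsilon> / 2\<close>.
    The summand 1 keeps \<open>t\<close> positive when \<open>B\<close> is zero.\<close>
  define t where "t = 8 * B / \<epsilon> + 1"
  have t: "t > 0" "t * \<epsilon> \<ge> 8 * B" using e B0 by (auto simp: t_def add_nonneg_pos field_simps)
  obtain R where R: "R > 0" "\<And>z. norm z \<ge> R \<Longrightarrow> t \<le> lowest_eigenvalue (levi_matrix \<phi> z)"
    using eigenvalue_radius by blast
  obtain K and \<psi> :: "(complex, 'n) vec \<Rightarrow> complex" where p: "plateau K R \<psi>" using plateau_exists by blast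
  have \<psi>: "Cc j \<psi>" for j using p by (auto simp: plateau_def test_function_iff)
  obtain m M where m: "m > 0" "M > 0" "\<And>z. norm z \<le> R + 2 \<Longrightarrow> m \<le> exp (- \<phi> z)" "\<And>z. norm z \<le> R + 2 \<Longrightarrow> exp (- \<phi> z) \<le> M"
    using weight_bounds[OF C0] by blast
  define g where "g a j z = \<psi> z * v a j z" for a j z
  have gc: "Cc k (g a j)" for k a j unfolding g_def[abs_def] by (rule Cc_mult(1)[OF \<psi> CcD[OF v]])
  have gs: "g a j z = 0" if "norm z > R + 2" for a j z using p that by (simp add: g_def plateau_def)
  have tlb: "tl \<phi> R (v a j) \<le> B / t" for a j
  proof -
    have "t * tl \<phi> R (v a j) \<le> form_energy \<phi> (v a)" using t R(2) by (intro energy_estimates(3) v) auto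
    then have "t * tl \<phi> R (v a j) \<le> B" using B[of a] by linarith
    then show ?thesis using t(1) by (simp add: pos_le_divide_eq mult.commute)
  qed
  have wnb: "wn \<phi> (v a j) \<le> C * B" for a j
  proof -
    have "wn \<phi> (v a j) \<le> C * form_energy \<phi> (v a)" using C(2) v by blast
    also have "\<dots> \<le> C * B" using C(1) B by (intro mult_left_mono) auto
    finally show ?thesis .
  qed
  define G where "G = 2 / m * B + 2 * K\<^sup>2 / m * (B / t)"
  have G: "u2 (cr \<i> i (g a j)) \<le> G" for a i j
  proof -
    have "u2 (cr \<i> i (g a j)) \<le> 2 / m * wn \<phi> (cr \<i> i (v a j)) + 2 * K\<^sup>2 / m * tl \<phi> R (v a j)"
      unfolding g_def[abs_def] by (rule plateau_estimates(1)[OF C0 p v m(1,3,4)])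
    also have "\<dots> \<le> G" unfolding G_def using m(1) tlb order_trans[OF energy_estimates(2)[OF v] B]
      by (intro add_mono mult_left_mono) auto
    finally show ?thesis .
  qed
  define U where "U = measure lebesgue (cball (0::(complex, 'n) vec) (R + 2)) + 1 / m * (C * B)"
  have U: "(LINT z|lebesgue. cmod (g a j z)) \<le> U" for a j
  proof -
    have "u2 (g a j) \<le> 1 / m * wn \<phi> (v a j)"
      unfolding g_def[abs_def] by (rule plateau_estimates(2)[OF C0 p v m(1,3,4)])
    also have "\<dots> \<le> 1 / m * (C * B)" using m(1) by (intro mult_left_mono wnb) auto
    finally show ?thesis using integral_norm_le_u2[of "g a j" "R + 2", OF gc gs] by (simp add: U_def)
  qed
  \<comment> \<open>The interior part will cost \<open>M * (10 * e1)\<close>, which is below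
    \<open>\<epsilon> / 2\<close>.\<close>
  define e1 where "e1 = \<epsilon> / (24 * M)"
  have e1: "e1 > 0" using e m by (simp add: e1_def)
  \<comment> \<open>The square root makes the uniform mollification error of
    \<open>u2_mollify\<close> at most \<open>e1\<close>; the bound 1 keeps all mollified functions
    supported in radius \<open>R + 3\<close>.\<close>
  define \<delta> where "\<delta> = min 1 (sqrt (e1 / (8 * real CARD('n) * G + 1)))"
  have G0: "G \<ge> 0" using order_trans[OF wn_nonneg G] by blast
  have den: "8 * real CARD('n) * G + 1 > 0" using G0 by (simp add: add_nonneg_pos)
  have \<delta>: "\<delta> > 0" "\<delta> \<le> 1" using den e1 by (auto simp: \<delta>_def)
  have \<delta>2: "\<delta>\<^sup>2 * (8 * real CARD('n) * G) \<le> e1"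
  proof -
    have "\<delta>\<^sup>2 \<le> (sqrt (e1 / (8 * real CARD('n) * G + 1)))\<^sup>2"
      using \<delta>(1) by (intro power_mono) (auto simp: \<delta>_def)
    also have "\<dots> = e1 / (8 * real CARD('n) * G + 1)" using e1 den by simp
    finally have "\<delta>\<^sup>2 * (8 * real CARD('n) * G) \<le> e1 / (8 * real CARD('n) * G + 1) * (8 * real CARD('n) * G)"
      using G0 by (intro mult_right_mono) auto
    also have "\<dots> \<le> e1" using e1 den G0 by (simp add: field_simps)
    finally show ?thesis .
  qed
  obtain \<rho> :: "(complex, 'n) vec \<Rightarrow> real" where \<rho>: "mollifier \<delta> \<rho>" using mollifier_exists[OF \<delta>(1)] by blast
  have \<rho>c: "Cc k \<rho>" for k by (rule mollifier_Cc[OF \<rho>])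
  obtain P where P: "P > 0" "\<And>x. norm (\<rho> x) \<le> P" using Cc_bounded[OF \<rho>c] by blast
  obtain L where L: "L > 0" "\<And>x y. \<bar>\<rho> x - \<rho> y\<bar> \<le> L * norm (x - y)" using Cc_lipschitz[OF \<rho>c] by blast
  have gi: "integrable lebesgue (g a j)" for a j by (rule Cc_integrable(2)[OF gc])
  have U0: "U \<ge> 0" using order_trans[OF _ U, of 0] by simp
  \<comment> \<open>All coefficients are packed into one vector-valued map, so that a single
    subsequence serves every \<open>j\<close>.\<close>
  define F where "F a x = (\<chi> j. conv \<rho> (g a j) x)" for a x
  have vecb: "norm w \<le> real CARD('n) * s" if "\<And>j. cmod (w $ j) \<le> s" for w :: "(complex, 'n) vec" and s
  proof -
    have "norm w \<le> (\<Sum>j\<in>UNIV. cmod (w $ j))" by (simp add: norm_vec_def L2_set_le_sum)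
    also have "\<dots> \<le> (\<Sum>j\<in>(UNIV::'n set). s)" by (intro sum_mono that)
    finally show ?thesis by simp
  qed
  have Fb: "norm (F a x) \<le> real CARD('n) * (P * U)" for a x
  proof (rule vecb)
    fix j
    have "cmod (conv \<rho> (g a j) x) \<le> P * (LINT y|lebesgue. cmod (g a j y))"
      using P by (intro conv_bounds(1)[OF \<rho>c gi]) auto
    also have "\<dots> \<le> P * U" using P(1) U by (intro mult_left_mono) auto
    finally show "cmod (F a x $ j) \<le> P * U" by (simp add: F_def)
  qed
  have FL: "norm (F a x - F a y) \<le> real CARD('n) * (L * norm (x - y) * U)" for a x y
  proof (rule vecb)
    fix j
    have "cmod (conv \<rho> (g a j) x - conv \<rho> (g a j) y) \<le> L * norm (x - y) * (LINT y|lebesgue. cmod (g a j y))"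
      using L by (intro conv_bounds(2)[OF \<rho>c gi]) auto
    also have "\<dots> \<le> L * norm (x - y) * U" using L(1) U by (intro mult_left_mono) auto
    finally show "cmod ((F a x - F a y) $ j) \<le> L * norm (x - y) * U" by (simp add: F_def)
  qed
  define V where "V = measure lebesgue (cball (0::(complex, 'n) vec) (R + 3))"
  \<comment> \<open>A uniform distance of \<open>s\<close> on the ball of volume \<open>V\<close>
    amounts to at most \<open>e1\<close> in squared norm.\<close>
  define s where "s = sqrt (e1 / (V + 1))"
  have V0: "V + 1 > 0" by (simp add: V_def add_nonneg_pos)
  have s: "s > 0" "s\<^sup>2 * V \<le> e1" using e1 V0 by (auto simp: s_def field_simps)
  obtain h k where k: "strict_mono (k :: nat \<Rightarrow> nat)"
    and unif: "\<And>e. 0 < e \<Longrightarrow> \<exists>N. \<forall>n x. n \<ge> N \<and> x \<in> cball 0 (R + 3) \<longrightarrow> norm (F (k n) x - h x) < e"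
  proof (rule Arzela_Ascoli[of "cball (0::(complex, 'n) vec) (R + 3)" F "real CARD('n) * (P * U)"])
    fix x :: "(complex, 'n) vec" and e' :: real assume e': "0 < e'"
    define d where "d = e' / (real CARD('n) * (L * U) + 1)"
    have den2: "real CARD('n) * (L * U) + 1 > 0" using L U0 by (intro add_nonneg_pos mult_nonneg_nonneg) auto
    have d: "d > 0" using e' den2 by (simp add: d_def)
    have "norm (F n x - F n y) < e'" if "norm (x - y) < d" for n y
    proof -
      have "norm (F n x - F n y) \<le> (real CARD('n) * (L * U)) * norm (x - y)" using FL[of n x y] by (simp add: mult_ac)
      also have "\<dots> \<le> (real CARD('n) * (L * U)) * d" using that L U0 by (intro mult_left_mono mult_nonneg_nonneg) auto
      also have "\<dots> < (real CARD('n) * (L * U) + 1) * d" using d by simp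
      also have "\<dots> = e'" using den2 by (simp add: d_def)
      finally show ?thesis .
    qed
    then show "\<exists>d>0. \<forall>n y. y \<in> cball 0 (R + 3) \<and> norm (x - y) < d \<longrightarrow> norm (F n x - F n y) < e'"
      using d by blast
  qed (use Fb in auto)
  obtain N where N: "\<And>n x. n \<ge> N \<Longrightarrow> norm x \<le> R + 3 \<Longrightarrow> norm (F (k n) x - h x) < s / 2"
    using unif[of "s / 2"] s(1) by auto
  define a b where "a = k N" and "b = k (Suc N)"
  have ab: "a < b" unfolding a_def b_def by (rule strict_monoD[OF k]) simp
  have "wn \<phi> (\<lambda>z. v a j z - v b j z) \<le> \<epsilon>" for j
  proof -
    define q where "q c = conv \<rho> (g c j)" for c
    have qt: "test_function (q c)" for c unfolding q_def by (rule test_function_conv[OF gi gs \<rho>])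
    have qc: "Cc 0 (q c)" for c using qt by (simp add: test_function_iff)
    have g0: "Cc 0 (g c j)" for c by (rule gc)
    have q0: "q c z = 0" if "norm z > R + 3" for c z
      unfolding q_def by (rule conv_outside[of \<delta> \<rho> "R + 2"]) (use \<rho> gs \<delta> that in \<open>auto simp: mollifier_def\<close>)
    have mol: "u2 (\<lambda>z. g c j z - q c z) \<le> e1" for c
      using u2_mollify[OF gc \<rho> less_imp_le[OF \<delta>(1)] G] \<delta>2 unfolding q_def by (rule order_trans)
    have mol': "u2 (\<lambda>z. q c z - g c j z) \<le> e1" for c using mol[of c] by (simp add: wn_def norm_minus_commute)
    have qq: "u2 (\<lambda>z. q a z - q b z) \<le> e1"
    proof -
      have "u2 (\<lambda>z. q a z - q b z) \<le> s\<^sup>2 * V"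
        unfolding V_def
      proof (rule u2_le_sup[OF Cc_diff[OF qc qc]])
        fix z :: "(complex, 'n) vec" assume z: "norm z \<le> R + 3"
        have "cmod (q a z - q b z) = cmod ((F a z - F b z) $ j)" by (simp add: F_def q_def)
        also have "\<dots> \<le> norm (F a z - F b z)" by (rule Finite_Cartesian_Product.norm_nth_le)
        also have "\<dots> \<le> norm (F a z - h z) + norm (F b z - h z)"
          using norm_triangle_ineq4[of "F a z - h z" "F b z - h z"] by simp
        also have "\<dots> \<le> s" using N[of N z] N[of "Suc N" z] z by (simp add: a_def b_def)
        finally show "cmod (q a z - q b z) \<le> s" .
      qed (use q0 in auto)
      then show ?thesis using s(2) by linarith
    qed
    have c1: "Cc 0 (\<lambda>z. g a j z - q a z)" "Cc 0 (\<lambda>z. q a z - q b z)" "Cc 0 (\<lambda>z. q b z - g b j z)"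
      by (intro Cc_diff g0 qc)+
    have "u2 (\<lambda>z. (g a j z - q a z) + ((q a z - q b z) + (q b z - g b j z))) \<le>
        2 * u2 (\<lambda>z. g a j z - q a z) + 2 * (2 * u2 (\<lambda>z. q a z - q b z) + 2 * u2 (\<lambda>z. q b z - g b j z))"
      using u2_add[OF c1(1) Cc_add[OF c1(2,3)]] u2_add[OF c1(2,3)] by argo
    also have "\<dots> \<le> 2 * e1 + 2 * (2 * e1 + 2 * e1)"
      using mol[of a] mol'[of b] qq by argo
    finally have gg: "u2 (\<lambda>z. g a j z - g b j z) \<le> 10 * e1" by simp
    have d2: "Cc 2 (\<lambda>z. v a j z - v b j z)" by (intro Cc_diff v)
    have "wn \<phi> (\<lambda>z. v a j z - v b j z) \<le> tl \<phi> R (\<lambda>z. v a j z - v b j z) + M * u2 (\<lambda>z. \<psi> z * (v a j z - v b j z))"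
      by (rule plateau_estimates(3)[OF C0 p d2 m(1,3,4)])
    also have "(\<lambda>z. \<psi> z * (v a j z - v b j z)) = (\<lambda>z. g a j z - g b j z)" by (simp add: g_def algebra_simps)
    also have "M * u2 (\<lambda>z. g a j z - g b j z) \<le> M * (10 * e1)" using m(2) gg by (intro mult_left_mono) auto
    also have "M * (10 * e1) \<le> \<epsilon> / 2" using m(2) e by (simp add: e1_def)
    also have "tl \<phi> R (\<lambda>z. v a j z - v b j z) \<le> 2 * tl \<phi> R (v a j) + 2 * tl \<phi> R (v b j)"
    proof -
      have i: "integrable lebesgue (\<lambda>z. indicator {z. R \<le> norm z} z * ((cmod (v c j z))\<^sup>2 * exp (- \<phi> z)))" for c
        by (rule tl_integrable[OF C0 v])
      have "tl \<phi> R (\<lambda>z. v a j z - v b j z) \<le> (LINT z|lebesgue.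
          2 * (indicator {z. R \<le> norm z} z * ((cmod (v a j z))\<^sup>2 * exp (- \<phi> z))) +
          2 * (indicator {z. R \<le> norm z} z * ((cmod (v b j z))\<^sup>2 * exp (- \<phi> z))))"
        unfolding tl_def
      proof (rule integral_mono)
        show "integrable lebesgue (\<lambda>z. indicator {z. R \<le> norm z} z * ((cmod (v a j z - v b j z))\<^sup>2 * exp (- \<phi> z)))"
          by (rule tl_integrable[OF C0 Cc_diff[OF v v]])
        show "integrable lebesgue (\<lambda>z. 2 * (indicator {z. R \<le> norm z} z * ((cmod (v a j z))\<^sup>2 * exp (- \<phi> z))) +
          2 * (indicator {z. R \<le> norm z} z * ((cmod (v b j z))\<^sup>2 * exp (- \<phi> z))))" using i by simp
        fix z
        have "(cmod (v a j z - v b j z))\<^sup>2 \<le> 2 * (cmod (v a j z))\<^sup>2 + 2 * (cmod (v b j z))\<^sup>2"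
          using cmod_add_sq[of "v a j z" "- v b j z"] by simp
        then have "(indicator {z. R \<le> norm z} z * exp (- \<phi> z)) * (cmod (v a j z - v b j z))\<^sup>2 \<le>
            (indicator {z. R \<le> norm z} z * exp (- \<phi> z)) * (2 * (cmod (v a j z))\<^sup>2 + 2 * (cmod (v b j z))\<^sup>2)"
          by (rule mult_left_mono) auto
        then show "indicator {z. R \<le> norm z} z * ((cmod (v a j z - v b j z))\<^sup>2 * exp (- \<phi> z)) \<le>
          2 * (indicator {z. R \<le> norm z} z * ((cmod (v a j z))\<^sup>2 * exp (- \<phi> z))) +
          2 * (indicator {z. R \<le> norm z} z * ((cmod (v b j z))\<^sup>2 * exp (- \<phi> z)))"
          by (simp add: algebra_simps)
      qed
      also have "\<dots> = 2 * tl \<phi> R (v a j) + 2 * tl \<phi> R (v b j)" unfolding tl_def using i by simp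
      finally show ?thesis .
    qed
    also have "2 * tl \<phi> R (v a j) + 2 * tl \<phi> R (v b j) \<le> \<epsilon> / 2"
    proof -
      have "B / t \<le> \<epsilon> / 8" using t by (simp add: field_simps)
      then show ?thesis using tlb[of a j] tlb[of b j] by argo
    qed
    finally show ?thesis by simp
  qed
  with ab show ?thesis by blast
qed

end

section \<open>Weighted square-integrable functions\<close>

lemma rep_add_aefun: "AE x in lebesgue. rep_aefun (f + g) x = rep_aefun f x + rep_aefun g x"
proof -
  have "f + g = abs_aefun (\<lambda>x. rep_aefun f x + rep_aefun g x)" by (simp add: plus_aefun_def)
  then show ?thesis using rep_abs_aefun[of "\<lambda>x. rep_aefun f x + rep_aefun g x"] by simp
qed

lemma rep_scale_aefun: "AE x in lebesgue. rep_aefun (aescale c f) x = c * rep_aefun f x"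
proof -
  have "aescale c f = abs_aefun (\<lambda>x. c * rep_aefun f x)" by (simp add: aescale_def)
  then show ?thesis using rep_abs_aefun[of "\<lambda>x. c * rep_aefun f x"] by simp
qed

lemma rep_zero_aefun: "AE x in lebesgue. rep_aefun 0 x = 0"
  using rep_abs_aefun[of "\<lambda>_. 0"] by (simp add: zero_aefun_def)

lemma form_scale_uminus: "- f = form_scale (- 1) f"
proof
  fix J
  have "- a = aescale (- 1) a" for a :: "(complex ^ 'a) aefun" by transfer simp
  then show "(- f) J = form_scale (- 1) f J" by (simp add: form_scale_def)
qed

definition L2w :: "(complex ^ 'n::finite \<Rightarrow> real) \<Rightarrow> (complex ^ 'n \<Rightarrow> complex) \<Rightarrow> bool" where
  "L2w \<phi> f \<longleftrightarrow> f \<in> borel_measurable lebesgue \<and> integrable lebesgue (\<lambda>z. (cmod (f z))\<^sup>2 * exp (- \<phi> z))"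

lemma Ck_lebesgue_measurable: "Ck 0 f \<Longrightarrow> f \<in> borel_measurable lebesgue"
  by (intro measurable_completion) (simp add: borel_measurable_continuous_onI)

lemma L2w_bound:
  assumes "Ck 0 \<phi>" and f: "f \<in> borel_measurable lebesgue" and h: "integrable lebesgue h"
    and le: "AE z in lebesgue. (cmod (f z))\<^sup>2 * exp (- \<phi> z) \<le> h z"
  shows "L2w \<phi> f"
  unfolding L2w_def
proof (intro conjI f Bochner_Integration.integrable_bound[OF h])
  have [measurable]: "\<phi> \<in> borel_measurable lebesgue" by (rule Ck_lebesgue_measurable[OF assms(1)])
  show "(\<lambda>z. (cmod (f z))\<^sup>2 * exp (- \<phi> z)) \<in> borel_measurable lebesgue" using f by measurable
  show "AE z in lebesgue. norm ((cmod (f z))\<^sup>2 * exp (- \<phi> z)) \<le> norm (h z)"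
    using le by eventually_elim simp
qed

lemma L2w_cong:
  assumes "Ck 0 \<phi>" "L2w \<phi> f" "g \<in> borel_measurable lebesgue" "AE z in lebesgue. f z = g z"
  shows "L2w \<phi> g" and "wn \<phi> f = wn \<phi> g"
proof -
  show "L2w \<phi> g"
    by (rule L2w_bound[OF assms(1,3), where h = "\<lambda>z. (cmod (f z))\<^sup>2 * exp (- \<phi> z)"])
      (use assms in \<open>auto simp: L2w_def elim: eventually_mono\<close>)
  then show "wn \<phi> f = wn \<phi> g"
    unfolding wn_def using assms by (intro integral_cong_AE) (auto simp: L2w_def elim: eventually_mono)
qed

lemma wn_cong:
  assumes "Ck 0 \<phi>" "f \<in> borel_measurable lebesgue" "g \<in> borel_measurable lebesgue" "AE z in lebesgue. f z = g z"
  shows "wn \<phi> f = wn \<phi> g"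
proof -
  have [measurable]: "\<phi> \<in> borel_measurable lebesgue" by (rule Ck_lebesgue_measurable[OF assms(1)])
  show ?thesis unfolding wn_def using assms by (intro integral_cong_AE) (auto elim: eventually_mono)
qed

lemma L2w_add:
  assumes \<phi>: "Ck 0 \<phi>" and f: "L2w \<phi> f" and g: "L2w \<phi> g"
  shows "L2w \<phi> (\<lambda>z. f z + g z)" and "wn \<phi> (\<lambda>z. f z + g z) \<le> 2 * wn \<phi> f + 2 * wn \<phi> g"
proof -
  let ?h = "\<lambda>z. 2 * ((cmod (f z))\<^sup>2 * exp (- \<phi> z)) + 2 * ((cmod (g z))\<^sup>2 * exp (- \<phi> z))"
  have h: "integrable lebesgue ?h" using f g by (simp add: L2w_def)
  have le: "(cmod (f z + g z))\<^sup>2 * exp (- \<phi> z) \<le> ?h z" for z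
    using mult_right_mono[OF cmod_add_sq[of "f z" "g z"], of "exp (- \<phi> z)"] by (simp add: algebra_simps)
  show s: "L2w \<phi> (\<lambda>z. f z + g z)"
    by (rule L2w_bound[OF \<phi> _ h]) (use f g le in \<open>auto simp: L2w_def\<close>)
  have "wn \<phi> (\<lambda>z. f z + g z) \<le> (LINT z|lebesgue. ?h z)"
    unfolding wn_def using s h le by (intro integral_mono) (auto simp: L2w_def)
  also have "\<dots> = 2 * wn \<phi> f + 2 * wn \<phi> g" unfolding wn_def using f g by (simp add: L2w_def)
  finally show "wn \<phi> (\<lambda>z. f z + g z) \<le> 2 * wn \<phi> f + 2 * wn \<phi> g" .
qed

lemma L2w_mult:
  assumes \<phi>: "Ck 0 \<phi>" and f: "L2w \<phi> f" and m: "m \<in> borel_measurable lebesgue" and K: "\<And>z. f z \<noteq> 0 \<Longrightarrow> cmod (m z) \<le> K"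
  shows "L2w \<phi> (\<lambda>z. m z * f z)" and "wn \<phi> (\<lambda>z. m z * f z) \<le> K\<^sup>2 * wn \<phi> f"
proof -
  let ?h = "\<lambda>z. K\<^sup>2 * ((cmod (f z))\<^sup>2 * exp (- \<phi> z))"
  have h: "integrable lebesgue ?h" using f by (simp add: L2w_def)
  have le: "(cmod (m z * f z))\<^sup>2 * exp (- \<phi> z) \<le> ?h z" for z
    using K[of z] by (cases "f z = 0") (auto simp: norm_mult power_mult_distrib intro!: mult_right_mono power_mono)
  show s: "L2w \<phi> (\<lambda>z. m z * f z)"
    by (rule L2w_bound[OF \<phi> _ h]) (use f m le in \<open>auto simp: L2w_def\<close>)
  have "wn \<phi> (\<lambda>z. m z * f z) \<le> (LINT z|lebesgue. ?h z)"
    unfolding wn_def using s h le by (intro integral_mono) (auto simp: L2w_def)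
  also have "\<dots> = K\<^sup>2 * wn \<phi> f" by (simp add: wn_def)
  finally show "wn \<phi> (\<lambda>z. m z * f z) \<le> K\<^sup>2 * wn \<phi> f" .
qed

lemma L2w_cmult: "Ck 0 \<phi> \<Longrightarrow> L2w \<phi> f \<Longrightarrow> L2w \<phi> (\<lambda>z. c * f z)"
  using L2w_mult(1)[of \<phi> f "\<lambda>_. c" "cmod c"] by simp

lemma L2w_diff: "Ck 0 \<phi> \<Longrightarrow> L2w \<phi> f \<Longrightarrow> L2w \<phi> g \<Longrightarrow> L2w \<phi> (\<lambda>z. f z - g z)"
  using L2w_add(1)[of \<phi> f "\<lambda>z. - 1 * g z"] L2w_cmult[of \<phi> g "- 1"] by simp

lemma wn_diff_commute: "wn \<phi> (\<lambda>z. f z - g z) = wn \<phi> (\<lambda>z. g z - f z)"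
  by (simp add: wn_def norm_minus_commute)

lemma wn_zero [simp]: "wn \<phi> (\<lambda>_. 0) = 0"
  by (simp add: wn_def)

lemma L2w_zero [simp]: "L2w \<phi> (\<lambda>_. 0)"
  by (simp add: L2w_def)

lemma L2w_sum:
  assumes \<phi>: "Ck 0 \<phi>" and f: "\<And>i. i \<in> I \<Longrightarrow> L2w \<phi> (f i)"
  shows "L2w \<phi> (\<lambda>z. \<Sum>i\<in>I. f i z)"
  using f by (induction I rule: infinite_finite_induct) (auto intro: L2w_add[OF \<phi>])

text \<open>Iterating \<open>L2w_add\<close> gives this coarse factor, which depends on the number
  of summands alone and can therefore be absorbed when the error is chosen.\<close>

lemma L2w_sum_small:
  assumes \<phi>: "Ck 0 \<phi>" and I: "finite I" and f: "\<And>i. i \<in> I \<Longrightarrow> L2w \<phi> (f i)" and e: "\<And>i. i \<in> I \<Longrightarrow> wn \<phi> (f i) \<le> e" and e0: "e \<ge> 0"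
  shows "wn \<phi> (\<lambda>z. \<Sum>i\<in>I. f i z) \<le> 4 ^ card I * e"
  using I f e
proof (induction I rule: finite_induct)
  case (insert i I)
  have "wn \<phi> (\<lambda>z. f i z + (\<Sum>i\<in>I. f i z)) \<le> 2 * wn \<phi> (f i) + 2 * wn \<phi> (\<lambda>z. \<Sum>i\<in>I. f i z)"
    using insert.prems by (intro L2w_add[OF \<phi>] L2w_sum[OF \<phi>]) auto
  also have "\<dots> \<le> 2 * e + 2 * (4 ^ card I * e)"
    using insert.prems insert.IH by (intro add_mono mult_left_mono) auto
  also have "\<dots> \<le> 2 * (4 ^ card I * e) + 2 * (4 ^ card I * e)"
    using e0 mult_right_mono[of 1 "4 ^ card I" e] by (simp add: mult.commute)
  finally show ?case using insert.hyps by (simp add: mult.assoc mult.commute[of e])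
qed (use e0 in simp)

lemma L2w_Cc: "Ck 0 \<phi> \<Longrightarrow> Cc 0 f \<Longrightarrow> L2w \<phi> f"
  using wn_integrable[of \<phi> f] Cc_integrable(2)[of 0 f] by (auto simp: L2w_def)

lemma L2w_product_integrable:
  assumes \<phi>: "Ck 0 \<phi>" and f: "L2w \<phi> f" and g: "L2w \<phi> g"
  shows "integrable lebesgue (\<lambda>z. f z * cnj (g z) * complex_of_real (exp (- \<phi> z)))"
proof (rule Bochner_Integration.integrable_bound)
  have [measurable]: "\<phi> \<in> borel_measurable lebesgue" by (rule Ck_lebesgue_measurable[OF \<phi>])
  show "integrable lebesgue (\<lambda>z. (cmod (f z))\<^sup>2 * exp (- \<phi> z) + (cmod (g z))\<^sup>2 * exp (- \<phi> z))"
    using f g by (simp add: L2w_def)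
  show "(\<lambda>z. f z * cnj (g z) * complex_of_real (exp (- \<phi> z))) \<in> borel_measurable lebesgue"
  proof -
    have [measurable]: "f \<in> borel_measurable lebesgue" "g \<in> borel_measurable lebesgue"
      using f g by (simp_all add: L2w_def)
    have [measurable]: "(\<lambda>z. cnj (g z)) \<in> borel_measurable lebesgue"
      by (rule measurable_compose[OF \<open>g \<in> _\<close> borel_measurable_continuous_onI]) (intro continuous_intros)
    show ?thesis by measurable
  qed
  show "AE z in lebesgue. norm (f z * cnj (g z) * complex_of_real (exp (- \<phi> z))) \<le>
      norm ((cmod (f z))\<^sup>2 * exp (- \<phi> z) + (cmod (g z))\<^sup>2 * exp (- \<phi> z))"
  proof (intro always_eventually allI)
    fix z
    have "cmod (f z) * cmod (g z) \<le> (cmod (f z))\<^sup>2 + (cmod (g z))\<^sup>2"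
      using sum_squares_bound[of "cmod (f z)" "cmod (g z)"] zero_le_power2[of "cmod (f z)"] zero_le_power2[of "cmod (g z)"]
        mult_nonneg_nonneg[OF norm_ge_zero[of "f z"] norm_ge_zero[of "g z"]] by linarith
    from mult_right_mono[OF this, of "exp (- \<phi> z)"]
    show "norm (f z * cnj (g z) * complex_of_real (exp (- \<phi> z))) \<le>
      norm ((cmod (f z))\<^sup>2 * exp (- \<phi> z) + (cmod (g z))\<^sup>2 * exp (- \<phi> z))"
      by (simp add: norm_mult algebra_simps)
  qed
qed

lemma nn2_weighted:
  assumes "L2w \<phi> f"
  shows "nn2 lebesgue (\<lambda>z. f z * of_real (exp (- \<phi> z / 2))) = ennreal (wn \<phi> f)"
proof -
  have "(cmod (f z * of_real (exp (- \<phi> z / 2))))\<^sup>2 = (cmod (f z))\<^sup>2 * exp (- \<phi> z)" for z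
    by (simp add: norm_mult power_mult_distrib flip: exp_double)
  then show ?thesis unfolding nn2_def wn_def
    using assms nn_integral_eq_integral[of lebesgue "\<lambda>z. (cmod (f z))\<^sup>2 * exp (- \<phi> z)"] by (simp add: L2w_def)
qed

text \<open>The Riesz--Fischer theorem: along a rapidly Cauchy subsequence the series of squared increments,
  weighted by powers of two, has finite integral.\<close>

lemma nn2_complete:
  fixes F :: "nat \<Rightarrow> 'a \<Rightarrow> complex"
  assumes F [measurable]: "\<And>n. F n \<in> borel_measurable M"
    and cauchy: "\<And>e. e > (0::real) \<Longrightarrow> \<exists>N. \<forall>m\<ge>N. \<forall>n\<ge>N. nn2 M (\<lambda>x. F m x - F n x) \<le> ennreal e"
  shows "\<exists>G\<in>borel_measurable M. \<forall>e>0. \<exists>N. \<forall>n\<ge>N. nn2 M (\<lambda>x. F n x - G x) \<le> ennreal e"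
proof -
  obtain N0 :: "nat \<Rightarrow> nat" where N0: "\<And>i m n. m \<ge> N0 i \<Longrightarrow> n \<ge> N0 i \<Longrightarrow> nn2 M (\<lambda>x. F m x - F n x) \<le> ennreal ((1/4) ^ i)"
  proof -
    have "\<forall>i. \<exists>N. \<forall>m\<ge>N. \<forall>n\<ge>N. nn2 M (\<lambda>x. F m x - F n x) \<le> ennreal ((1/4) ^ i)"
      by (intro allI cauchy) simp
    then show ?thesis using that by metis
  qed
  \<comment> \<open>Summing makes \<open>k i\<close> and \<open>k (Suc i)\<close> both dominate
    \<open>N0 i\<close>; the added \<open>i\<close> sends the subsequence to infinity.\<close>
  define k where "k i = (\<Sum>l\<le>i. N0 l) + i" for i
  have k: "k i \<ge> N0 i" "k (Suc i) \<ge> N0 i" "k i \<ge> i" for i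
    using member_le_sum[of i "{..i}" N0] by (auto simp: k_def)
  define d where "d i x = F (k (Suc i)) x - F (k i) x" for i x
  have dm [measurable]: "d i \<in> borel_measurable M" for i unfolding d_def by measurable
  have di: "(\<integral>\<^sup>+x. ennreal (2 ^ i * (cmod (d i x))\<^sup>2) \<partial>M) \<le> ennreal ((1/2) ^ i)" for i
  proof -
    have "(\<integral>\<^sup>+x. ennreal (2 ^ i * (cmod (d i x))\<^sup>2) \<partial>M) = ennreal (2 ^ i) * nn2 M (d i)"
      unfolding nn2_def by (subst nn_integral_cmult[symmetric]) (auto simp: ennreal_mult)
    also have "\<dots> \<le> ennreal (2 ^ i) * ennreal ((1/4) ^ i)"
      unfolding d_def[abs_def] by (intro mult_left_mono N0 k) auto
    also have "\<dots> = ennreal ((1/2) ^ i)" by (simp add: ennreal_mult[symmetric] power_mult_distrib[symmetric])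
    finally show ?thesis .
  qed
  have "(\<integral>\<^sup>+x. (\<Sum>i. ennreal (2 ^ i * (cmod (d i x))\<^sup>2)) \<partial>M) = (\<Sum>i. \<integral>\<^sup>+x. ennreal (2 ^ i * (cmod (d i x))\<^sup>2) \<partial>M)"
    by (rule nn_integral_suminf) measurable
  also have "\<dots> \<le> (\<Sum>i. ennreal ((1/2) ^ i))" by (intro suminf_le di) auto
  also have "\<dots> = ennreal (\<Sum>i. (1/2) ^ i)" by (intro suminf_ennreal2) auto
  also have "\<dots> < \<infinity>" by simp
  finally have "AE x in M. (\<Sum>i. ennreal (2 ^ i * (cmod (d i x))\<^sup>2)) \<noteq> \<infinity>"
    by (intro nn_integral_PInf_AE) auto
  then have conv: "AE x in M. convergent (\<lambda>i. F (k i) x)"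
  proof eventually_elim
    case (elim x)
    define S where "S = enn2real (\<Sum>i. ennreal (2 ^ i * (cmod (d i x))\<^sup>2))"
    have S: "(\<Sum>i. ennreal (2 ^ i * (cmod (d i x))\<^sup>2)) = ennreal S" "S \<ge> 0"
      using elim unfolding S_def infinity_ennreal_def less_top[symmetric] by (simp_all only: ennreal_enn2real enn2real_nonneg less_top)
    \<comment> \<open>Each term of the series is at most its finite sum, so the increments decay
      geometrically and the telescoping series converges at \<open>x\<close>.\<close>
    have le: "cmod (d i x) \<le> sqrt S * (sqrt (1/2)) ^ i" for i
    proof -
      have "(\<Sum>j\<in>{i}. ennreal (2 ^ j * (cmod (d j x))\<^sup>2)) \<le> (\<Sum>j. ennreal (2 ^ j * (cmod (d j x))\<^sup>2))"
        by (rule sum_le_suminf) auto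
      then have "ennreal (2 ^ i * (cmod (d i x))\<^sup>2) \<le> ennreal S"
        unfolding S(1) by simp
      then have "2 ^ i * (cmod (d i x))\<^sup>2 \<le> S" using S(2) by (simp only: ennreal_le_iff)
      then have "(1/2) ^ i * (2 ^ i * (cmod (d i x))\<^sup>2) \<le> (1/2) ^ i * S" by (rule mult_left_mono) simp
      then have "(cmod (d i x))\<^sup>2 \<le> S * (1/2) ^ i"
        by (simp only: mult.assoc[symmetric] power_mult_distrib[symmetric]) (simp add: mult.commute)
      then have "sqrt ((cmod (d i x))\<^sup>2) \<le> sqrt (S * (1/2) ^ i)" by (rule real_sqrt_le_mono)
      moreover have "sqrt ((cmod (d i x))\<^sup>2) = cmod (d i x)" by simp
      moreover have "sqrt (S * (1/2) ^ i) = sqrt S * sqrt (1/2) ^ i" by (simp only: real_sqrt_mult real_sqrt_power)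
      ultimately show ?thesis by (simp only:)
    qed
    have "summable (\<lambda>i. sqrt S * (sqrt (1/2)) ^ i)"
      by (intro summable_mult summable_geometric) (simp add: real_sqrt_divide)
    then have "summable (\<lambda>i. d i x)" by (rule summable_comparison_test[rotated]) (use le in auto)
    then have "convergent (\<lambda>n. \<Sum>i<n. d i x)" by (simp add: summable_iff_convergent)
    moreover have "(\<Sum>i<n. d i x) = F (k n) x - F (k 0) x" for n
      unfolding d_def by (rule sum_lessThan_telescope)
    ultimately have "convergent (\<lambda>n. (F (k n) x - F (k 0) x) + F (k 0) x)"
      by (intro convergent_add convergent_const) simp
    then show ?case by simp
  qed
  define G where "G x = lim (\<lambda>i. F (k i) x)" for x
  have Gm [measurable]: "G \<in> borel_measurable M" unfolding G_def by measurable
  have "\<exists>N. \<forall>n\<ge>N. nn2 M (\<lambda>x. F n x - G x) \<le> ennreal e" if e: "e > 0" for e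
  proof -
    obtain N where N: "\<And>m n. m \<ge> N \<Longrightarrow> n \<ge> N \<Longrightarrow> nn2 M (\<lambda>x. F m x - F n x) \<le> ennreal e" using cauchy[OF e] by blast
    have "nn2 M (\<lambda>x. F n x - G x) \<le> ennreal e" if n: "n \<ge> N" for n
    proof -
      have "nn2 M (\<lambda>x. F n x - G x) = (\<integral>\<^sup>+x. liminf (\<lambda>i. ennreal ((cmod (F n x - F (k i) x))\<^sup>2)) \<partial>M)"
        unfolding nn2_def
      proof (rule nn_integral_cong_AE)
        show "AE x in M. ennreal ((cmod (F n x - G x))\<^sup>2) = liminf (\<lambda>i. ennreal ((cmod (F n x - F (k i) x))\<^sup>2))"
          using conv
        proof eventually_elim
          case (elim x)
          then have "(\<lambda>i. F (k i) x) \<longlonglongrightarrow> G x" unfolding G_def by (simp add: convergent_LIMSEQ_iff)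
          then have "(\<lambda>i. ennreal ((cmod (F n x - F (k i) x))\<^sup>2)) \<longlonglongrightarrow> ennreal ((cmod (F n x - G x))\<^sup>2)"
            by (intro tendsto_ennrealI tendsto_intros)
          then show ?case by (intro lim_imp_Liminf[symmetric]) auto
        qed
      qed
      also have "\<dots> \<le> liminf (\<lambda>i. \<integral>\<^sup>+x. ennreal ((cmod (F n x - F (k i) x))\<^sup>2) \<partial>M)"
        by (rule nn_integral_liminf) measurable
      also have "\<dots> \<le> liminf (\<lambda>i. ennreal e)"
      proof (rule Liminf_mono, unfold eventually_sequentially, intro exI[of _ N] allI impI)
        fix i assume "N \<le> i"
        then have "k i \<ge> N" using k(3)[of i] by linarith
        then show "(\<integral>\<^sup>+x. ennreal ((cmod (F n x - F (k i) x))\<^sup>2) \<partial>M) \<le> ennreal e"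
          using N[OF n] by (simp add: nn2_def)
      qed
      also have "\<dots> = ennreal e" by (simp add: Liminf_const)
      finally show ?thesis .
    qed
    then show ?thesis by blast
  qed
  with Gm show ?thesis by blast
qed

text \<open>Multiplication by e^(-\<phi>/2) is an isometry onto the unweighted space, where
  \<open>nn2_complete\<close> applies.\<close>

lemma L2w_complete:
  assumes \<phi>: "Ck 0 \<phi>" and f: "\<And>n. L2w \<phi> (f n)"
    and cauchy: "\<And>e. e > 0 \<Longrightarrow> \<exists>N. \<forall>m\<ge>N. \<forall>n\<ge>N. wn \<phi> (\<lambda>z. f m z - f n z) \<le> e"
  shows "\<exists>g. L2w \<phi> g \<and> (\<lambda>n. wn \<phi> (\<lambda>z. f n z - g z)) \<longlonglongrightarrow> 0"
proof -
  have [measurable]: "\<phi> \<in> borel_measurable lebesgue" by (rule Ck_lebesgue_measurable[OF \<phi>])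
  let ?s = "\<lambda>z. complex_of_real (exp (- \<phi> z / 2))"
  have fm [measurable]: "f n \<in> borel_measurable lebesgue" for n using f by (simp add: L2w_def)
  have eq: "nn2 lebesgue (\<lambda>z. f m z * ?s z - f n z * ?s z) = ennreal (wn \<phi> (\<lambda>z. f m z - f n z))" for m n
    using nn2_weighted[OF L2w_diff[OF \<phi> f[of m] f[of n]]] by (simp add: algebra_simps)
  have "\<exists>G\<in>borel_measurable lebesgue. \<forall>e>0. \<exists>N. \<forall>n\<ge>N. nn2 lebesgue (\<lambda>z. f n z * ?s z - G z) \<le> ennreal e"
  proof (rule nn2_complete)
    show "(\<lambda>z. f n z * ?s z) \<in> borel_measurable lebesgue" for n by measurable
    fix e :: real assume "e > 0"
    then show "\<exists>N. \<forall>m\<ge>N. \<forall>n\<ge>N. nn2 lebesgue (\<lambda>z. f m z * ?s z - f n z * ?s z) \<le> ennreal e"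
      unfolding eq using cauchy by (meson ennreal_leI)
  qed
  then obtain G where G [measurable]: "G \<in> borel_measurable lebesgue"
    and Glim: "\<And>e. e > 0 \<Longrightarrow> \<exists>N. \<forall>n\<ge>N. nn2 lebesgue (\<lambda>z. f n z * ?s z - G z) \<le> ennreal e" by blast
  define g where "g z = G z * of_real (exp (\<phi> z / 2))" for z
  have gm [measurable]: "g \<in> borel_measurable lebesgue" unfolding g_def by measurable
  have inv: "exp (\<phi> z / 2) * exp (- \<phi> z / 2) = 1" for z by (simp add: exp_minus field_simps)
  have pw: "(cmod (f n z * ?s z - G z))\<^sup>2 = (cmod (f n z - g z))\<^sup>2 * exp (- \<phi> z)" for n z
  proof -
    have "G z = g z * ?s z" using inv[of z] unfolding g_def by (metis mult.assoc mult_1_right of_real_1 of_real_mult)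
    then have "f n z * ?s z - G z = (f n z - g z) * ?s z" by (simp add: algebra_simps)
    then show ?thesis by (simp add: norm_mult power_mult_distrib flip: exp_double)
  qed
  have small: "L2w \<phi> (\<lambda>z. f n z - g z) \<and> wn \<phi> (\<lambda>z. f n z - g z) \<le> e"
    if "nn2 lebesgue (\<lambda>z. f n z * ?s z - G z) \<le> ennreal e" "e > 0" for n e
  proof -
    have b: "(\<integral>\<^sup>+z. ennreal ((cmod (f n z - g z))\<^sup>2 * exp (- \<phi> z)) \<partial>lebesgue) \<le> ennreal e"
      using that(1) by (simp only: nn2_def pw)
    have i: "integrable lebesgue (\<lambda>z. (cmod (f n z - g z))\<^sup>2 * exp (- \<phi> z))"
      using b by (intro integrableI_bounded) (auto simp: order_le_less_trans)
    then have "ennreal (wn \<phi> (\<lambda>z. f n z - g z)) \<le> ennreal e"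
      unfolding wn_def using b by (subst nn_integral_eq_integral[symmetric]) auto
    then show ?thesis using i that(2) by (auto simp: L2w_def ennreal_le_iff)
  qed
  obtain N where "nn2 lebesgue (\<lambda>z. f N z * ?s z - G z) \<le> ennreal 1" using Glim[of 1] by auto
  then have "L2w \<phi> (\<lambda>z. f N z - g z)" using small[of N 1] by simp
  then have "L2w \<phi> (\<lambda>z. f N z - (f N z - g z))" by (rule L2w_diff[OF \<phi> f])
  then have g: "L2w \<phi> g" by simp
  have "(\<lambda>n. wn \<phi> (\<lambda>z. f n z - g z)) \<longlonglongrightarrow> 0"
  proof (rule LIMSEQ_I)
    fix e :: real assume e: "e > 0"
    obtain N where N: "\<forall>n\<ge>N. nn2 lebesgue (\<lambda>z. f n z * ?s z - G z) \<le> ennreal (e / 2)" using Glim[of "e / 2"] e by auto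
    have "norm (wn \<phi> (\<lambda>z. f n z - g z) - 0) < e" if "n \<ge> N" for n
      using small[of n "e / 2"] N that e wn_nonneg[of \<phi> "\<lambda>z. f n z - g z"] by auto
    then show "\<exists>N. \<forall>n\<ge>N. norm (wn \<phi> (\<lambda>z. f n z - g z) - 0) < e" by blast
  qed
  with g show ?thesis by blast
qed

section \<open>Forms and the operators\<close>

definition single :: "'n set \<Rightarrow> (complex ^ 'n) aefun \<Rightarrow> 'n::finite form" where
  "single J a = (\<lambda>K. if K = J then a else 0)"

text \<open>Pairing with \<open>dual \<phi> \<eta> J\<close> in the weighted inner product is integration of the coefficient at \<open>J\<close>
  against \<open>\<eta>\<close>; it turns the distributional identities into statements about \<open>inner_L2\<close>.\<close>

definition dual :: "(complex ^ 'n::finite \<Rightarrow> real) \<Rightarrow> (complex ^ 'n \<Rightarrow> complex) \<Rightarrow> 'n set \<Rightarrow> 'n form" where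
  "dual \<phi> \<eta> J = single J (abs_aefun (\<lambda>z. cnj (\<eta> z) * complex_of_real (exp (\<phi> z))))"

lemma rep_abs_Cc:
  assumes "Cc k \<eta>" shows "AE z in lebesgue. rep_aefun (abs_aefun \<eta>) z = \<eta> z"
  by (rule rep_abs_aefun) (use Ck_lebesgue_measurable[OF Ck_mono[OF CcD[OF assms]]] in simp)

context weight begin

lemma cont: "continuous_on UNIV \<phi>" using C0 by simp

lemma weight_meas [measurable]: "\<phi> \<in> borel_measurable lebesgue"
  by (rule Ck_lebesgue_measurable[OF C0])

lemma L2_iff: "f \<in> L2 \<phi> q \<longleftrightarrow> (\<forall>J. L2w \<phi> (rep_aefun (f J))) \<and> (\<forall>J. card J \<noteq> q \<longrightarrow> f J = 0)"
  using integrable_L2[OF cont] by (auto simp: L2_def L2w_def)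

lemma L2_D: "f \<in> L2 \<phi> q \<Longrightarrow> L2w \<phi> (rep_aefun (f J))"
  by (simp add: L2_iff)

lemma norm_sq: "(norm_L2 \<phi> f)\<^sup>2 = (\<Sum>J\<in>UNIV. wn \<phi> (rep_aefun (f J)))"
  by (simp add: norm_sq_L2[OF cont] wn_def)

lemma zero_L2: "0 \<in> L2 \<phi> q"
proof -
  have "L2w \<phi> (rep_aefun (0 :: (complex, 'n) vec aefun))"
    by (rule L2w_cong(1)[OF C0 L2w_zero]) (use rep_zero_aefun in \<open>auto elim: eventually_mono\<close>)
  then show ?thesis by (simp add: L2_iff)
qed

lemma add_L2:
  assumes f: "f \<in> L2 \<phi> q" and g: "g \<in> L2 \<phi> q" shows "f + g \<in> L2 \<phi> q"
proof -
  have "L2w \<phi> (rep_aefun ((f + g) J))" for J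
    by (rule L2w_cong(1)[OF C0 L2w_add(1)[OF C0 L2_D[OF f, of J] L2_D[OF g, of J]]])
      (use rep_add_aefun[of "f J" "g J"] in \<open>auto elim: eventually_mono\<close>)
  then show ?thesis using f g by (simp add: L2_iff)
qed

lemma scale_L2:
  assumes f: "f \<in> L2 \<phi> q" shows "form_scale c f \<in> L2 \<phi> q"
proof -
  have "L2w \<phi> (rep_aefun (form_scale c f J))" for J
    by (rule L2w_cong(1)[OF C0 L2w_cmult[OF C0 L2_D[OF f, of J], of c]])
      (use rep_scale_aefun[of c "f J"] in \<open>auto simp: form_scale_def elim: eventually_mono\<close>)
  moreover have "aescale c (0 :: (complex, 'n) vec aefun) = 0" by transfer simp
  ultimately show ?thesis using f by (simp add: L2_iff form_scale_def)
qed

lemma inner_integrable: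
  "f \<in> L2 \<phi> q \<Longrightarrow> g \<in> L2 \<phi> r \<Longrightarrow>
    integrable lebesgue (\<lambda>z. rep_aefun (f J) z * cnj (rep_aefun (g J) z) * complex_of_real (exp (- \<phi> z)))"
  by (rule L2w_product_integrable[OF C0 L2_D L2_D])

lemma inner_measurable [measurable]: "(\<lambda>z. cnj (rep_aefun a z)) \<in> borel_measurable (lebesgue :: (complex, 'n) vec measure)"
  by (rule measurable_compose[OF rep_aefun_measurable borel_measurable_continuous_onI]) (intro continuous_intros)

lemma inner_self: "f \<in> L2 \<phi> q \<Longrightarrow> inner_L2 \<phi> f f = of_real ((norm_L2 \<phi> f)\<^sup>2)"
proof -
  assume f: "f \<in> L2 \<phi> q"
  have "(LINT z|lebesgue. a z * cnj (a z) * complex_of_real (exp (- \<phi> z))) = of_real (wn \<phi> a)" for a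
  proof -
    have "a z * cnj (a z) * complex_of_real (exp (- \<phi> z)) = of_real ((cmod (a z))\<^sup>2 * exp (- \<phi> z))" for z
      by (simp only: complex_norm_square of_real_mult)
    then show ?thesis by (simp only: wn_def integral_complex_of_real)
  qed
  then show ?thesis by (simp add: inner_L2_def norm_sq)
qed

sublocale L2: hermitian_space "L2 \<phi> q" form_scale "inner_L2 \<phi>" for q
proof
  fix f g h c
  show "0 \<in> L2 \<phi> q" by (rule zero_L2)
  show "- f = form_scale (- 1) f" for f :: "'n form" by (rule form_scale_uminus)
  assume f: "f \<in> L2 \<phi> q"
  show "form_scale c f \<in> L2 \<phi> q" by (rule scale_L2[OF f])
  show "0 \<le> Re (inner_L2 \<phi> f f)" by (simp add: inner_self[OF f])
  assume g: "g \<in> L2 \<phi> q"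
  show "f + g \<in> L2 \<phi> q" by (rule add_L2[OF f g])
  show "inner_L2 \<phi> g f = cnj (inner_L2 \<phi> f g)"
    unfolding inner_L2_def cnj_sum
  proof (rule sum.cong[OF refl])
    fix J
    have "cnj (LINT z|lebesgue. rep_aefun (f J) z * cnj (rep_aefun (g J) z) * complex_of_real (exp (- \<phi> z))) =
        (LINT z|lebesgue. cnj (rep_aefun (f J) z * cnj (rep_aefun (g J) z) * complex_of_real (exp (- \<phi> z))))"
      by (rule Bochner_Integration.integral_cnj[symmetric])
    also have "\<dots> = (LINT z|lebesgue. rep_aefun (g J) z * cnj (rep_aefun (f J) z) * complex_of_real (exp (- \<phi> z)))"
      by (intro Bochner_Integration.integral_cong refl) (simp add: mult_ac)
    finally show "(LINT z|lebesgue. rep_aefun (g J) z * cnj (rep_aefun (f J) z) * complex_of_real (exp (- \<phi> z))) =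
        cnj (LINT z|lebesgue. rep_aefun (f J) z * cnj (rep_aefun (g J) z) * complex_of_real (exp (- \<phi> z)))" ..
  qed
  show "inner_L2 \<phi> (form_scale c f) g = c * inner_L2 \<phi> f g"
    unfolding inner_L2_def sum_distrib_left
  proof (rule sum.cong[OF refl])
    fix J
    have "(LINT z|lebesgue. rep_aefun (form_scale c f J) z * cnj (rep_aefun (g J) z) * complex_of_real (exp (- \<phi> z))) =
        (LINT z|lebesgue. c * (rep_aefun (f J) z * cnj (rep_aefun (g J) z) * complex_of_real (exp (- \<phi> z))))"
      using rep_scale_aefun[of c "f J"]
      by (intro integral_cong_AE) (auto simp: form_scale_def elim: eventually_mono)
    then show "(LINT z|lebesgue. rep_aefun (form_scale c f J) z * cnj (rep_aefun (g J) z) * complex_of_real (exp (- \<phi> z))) =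
        c * (LINT z|lebesgue. rep_aefun (f J) z * cnj (rep_aefun (g J) z) * complex_of_real (exp (- \<phi> z)))" by simp
  qed
  assume h: "h \<in> L2 \<phi> q"
  show "inner_L2 \<phi> (f + g) h = inner_L2 \<phi> f h + inner_L2 \<phi> g h"
    unfolding inner_L2_def sum.distrib[symmetric]
  proof (rule sum.cong[OF refl])
    fix J
    have "(LINT z|lebesgue. rep_aefun ((f + g) J) z * cnj (rep_aefun (h J) z) * complex_of_real (exp (- \<phi> z))) =
        (LINT z|lebesgue. rep_aefun (f J) z * cnj (rep_aefun (h J) z) * complex_of_real (exp (- \<phi> z)) +
          rep_aefun (g J) z * cnj (rep_aefun (h J) z) * complex_of_real (exp (- \<phi> z)))"
      using rep_add_aefun[of "f J" "g J"]
      by (intro integral_cong_AE) (auto simp: algebra_simps elim: eventually_mono)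
    then show "(LINT z|lebesgue. rep_aefun ((f + g) J) z * cnj (rep_aefun (h J) z) * complex_of_real (exp (- \<phi> z))) =
        (LINT z|lebesgue. rep_aefun (f J) z * cnj (rep_aefun (h J) z) * complex_of_real (exp (- \<phi> z))) +
        (LINT z|lebesgue. rep_aefun (g J) z * cnj (rep_aefun (h J) z) * complex_of_real (exp (- \<phi> z)))"
      using inner_integrable[OF f h] inner_integrable[OF g h] by simp
  qed
qed

lemma Q_norm: "f \<in> L2 \<phi> q \<Longrightarrow> Re (inner_L2 \<phi> f f) = (norm_L2 \<phi> f)\<^sup>2"
  by (simp add: inner_self)

lemma Cauchy_Schwarz_L2: "f \<in> L2 \<phi> q \<Longrightarrow> g \<in> L2 \<phi> q \<Longrightarrow> cmod (inner_L2 \<phi> f g) \<le> norm_L2 \<phi> f * norm_L2 \<phi> g"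
  using L2.Cauchy_Schwarz[of f q g] by (simp add: Q_norm norm_L2_nonneg[OF cont])

lemma norm_L2_eq_0: "f \<in> L2 \<phi> q \<Longrightarrow> norm_L2 \<phi> f = 0 \<Longrightarrow> f = 0"
  using Metric_space.zero[OF Metric_space_L2[OF cont] _ zero_L2, of f q] by simp

lemma wn_rep_diff: "wn \<phi> (rep_aefun ((f - g) J)) = wn \<phi> (\<lambda>z. rep_aefun (f J) z - rep_aefun (g J) z)"
  by (rule wn_cong[OF C0]) (use rep_minus_aefun[of "f J" "g J"] in auto)

lemma L2_complete:
  assumes s: "\<And>n. s n \<in> L2 \<phi> q" and cauchy: "\<And>e. e > 0 \<Longrightarrow> \<exists>N. \<forall>m\<ge>N. \<forall>n\<ge>N. (norm_L2 \<phi> (s m - s n))\<^sup>2 < e"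
  shows "\<exists>x\<in>L2 \<phi> q. (\<lambda>n. (norm_L2 \<phi> (s n - x))\<^sup>2) \<longlonglongrightarrow> 0"
proof -
  have le: "wn \<phi> (rep_aefun (f J)) \<le> (norm_L2 \<phi> f)\<^sup>2" for f J
    unfolding norm_sq by (intro member_le_sum[of J UNIV "\<lambda>J. wn \<phi> (rep_aefun (f J))"] wn_nonneg) auto
  have "\<exists>g. L2w \<phi> g \<and> (\<lambda>n. wn \<phi> (\<lambda>z. rep_aefun (s n J) z - g z)) \<longlonglongrightarrow> 0" for J
  proof (rule L2w_complete[OF C0 L2_D[OF s]])
    fix e :: real assume "e > 0"
    then obtain N where N: "\<forall>m\<ge>N. \<forall>n\<ge>N. (norm_L2 \<phi> (s m - s n))\<^sup>2 < e" using cauchy by blast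
    have "wn \<phi> (\<lambda>z. rep_aefun (s m J) z - rep_aefun (s n J) z) \<le> e" if "m \<ge> N" "n \<ge> N" for m n
      using le[of "s m - s n" J] N that unfolding wn_rep_diff by (meson less_imp_le order_trans)
    then show "\<exists>N. \<forall>m\<ge>N. \<forall>n\<ge>N. wn \<phi> (\<lambda>z. rep_aefun (s m J) z - rep_aefun (s n J) z) \<le> e" by blast
  qed
  then have "\<forall>J. \<exists>g. L2w \<phi> g \<and> (\<lambda>n. wn \<phi> (\<lambda>z. rep_aefun (s n J) z - g z)) \<longlonglongrightarrow> 0" ..
  from choice[OF this]
  obtain g where g: "\<And>J. L2w \<phi> (g J)" "\<And>J. (\<lambda>n. wn \<phi> (\<lambda>z. rep_aefun (s n J) z - g J z)) \<longlonglongrightarrow> 0" by auto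
  define x where "x J = (if card J = q then abs_aefun (g J) else 0)" for J
  have rx: "AE z in lebesgue. rep_aefun (x J) z = g J z" if "card J = q" for J
    using rep_abs_aefun[of "g J"] g(1)[of J] that by (simp add: x_def L2w_def)
  have xL: "L2w \<phi> (rep_aefun (x J))" for J
  proof (cases "card J = q")
    case True
    show ?thesis by (rule L2w_cong(1)[OF C0 g(1)[of J]]) (use rx[OF True] in \<open>auto elim: eventually_mono\<close>)
  next
    case False
    then show ?thesis using zero_L2[of 0] by (simp add: x_def L2_iff)
  qed
  then have x: "x \<in> L2 \<phi> q" by (simp add: L2_iff x_def)
  have "(\<lambda>n. wn \<phi> (rep_aefun ((s n - x) J))) \<longlonglongrightarrow> 0" for J
  proof (cases "card J = q")
    case True
    have "wn \<phi> (rep_aefun ((s n - x) J)) = wn \<phi> (\<lambda>z. rep_aefun (s n J) z - g J z)" for n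
    proof -
      have gm [measurable]: "g J \<in> borel_measurable lebesgue" using g(1)[of J] by (simp add: L2w_def)
      show ?thesis unfolding wn_rep_diff
        by (rule wn_cong[OF C0]) (use rx[OF True] in \<open>auto elim: eventually_mono\<close>)
    qed
    then show ?thesis using g(2)[of J] by simp
  next
    case False
    then have "(s n - x) J = 0" for n using s[of n] by (simp add: L2_iff x_def)
    moreover have "wn \<phi> (rep_aefun 0) = 0"
      using wn_cong[OF C0 _ _ rep_zero_aefun] by simp
    ultimately show ?thesis by simp
  qed
  then have "(\<lambda>n. \<Sum>J\<in>UNIV. wn \<phi> (rep_aefun ((s n - x) J))) \<longlonglongrightarrow> (\<Sum>J\<in>(UNIV::'n set set). 0)" by (intro tendsto_sum)
  then show ?thesis using x unfolding norm_sq by auto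
qed

text \<open>Completeness turns total boundedness into compactness of the closure, the form that
  \<open>compact_operator\<close> asks for.\<close>

lemma mcomplete_L2: "Metric_space.mcomplete (L2 \<phi> q) (\<lambda>f g. norm_L2 \<phi> (f - g))"
proof -
  interpret Metric_space "L2 \<phi> q" "\<lambda>f g. norm_L2 \<phi> (f - g)" by (rule Metric_space_L2[OF cont])
  show ?thesis unfolding mcomplete_def
  proof (intro allI impI)
    fix s assume "MCauchy s"
    then have s: "\<And>n. s n \<in> L2 \<phi> q" and c: "\<And>e. e > 0 \<Longrightarrow> \<exists>N. \<forall>m n. N \<le> m \<longrightarrow> N \<le> n \<longrightarrow> norm_L2 \<phi> (s m - s n) < e"
      unfolding MCauchy_def by auto
    have "\<exists>x\<in>L2 \<phi> q. (\<lambda>n. (norm_L2 \<phi> (s n - x))\<^sup>2) \<longlonglongrightarrow> 0"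
    proof (rule L2_complete[OF s])
      fix e :: real assume e: "e > 0"
      then obtain N where N: "\<forall>m n. N \<le> m \<longrightarrow> N \<le> n \<longrightarrow> norm_L2 \<phi> (s m - s n) < sqrt e" using c[of "sqrt e"] by auto
      have "(norm_L2 \<phi> (s m - s n))\<^sup>2 < e" if "m \<ge> N" "n \<ge> N" for m n
      proof -
        have "(norm_L2 \<phi> (s m - s n))\<^sup>2 < (sqrt e)\<^sup>2" using N that norm_L2_nonneg[OF cont] by (intro power_strict_mono) auto
        then show ?thesis using e by simp
      qed
      then show "\<exists>N. \<forall>m\<ge>N. \<forall>n\<ge>N. (norm_L2 \<phi> (s m - s n))\<^sup>2 < e" by blast
    qed
    then obtain x where x: "x \<in> L2 \<phi> q" "(\<lambda>n. (norm_L2 \<phi> (s n - x))\<^sup>2) \<longlonglongrightarrow> 0" by blast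
    have "(\<lambda>n. norm_L2 \<phi> (s n - x)) \<longlonglongrightarrow> 0"
      using tendsto_real_sqrt[OF x(2)] norm_L2_nonneg[OF cont] by simp
    then have "limitin mtopology s x sequentially"
      unfolding limit_metric_sequentially using x(1) s norm_L2_nonneg[OF cont]
      by (auto simp: LIMSEQ_iff)
    then show "\<exists>x. limitin mtopology s x sequentially" by blast
  qed
qed

lemma single_L2:
  assumes a: "L2w \<phi> a" shows "single J (abs_aefun a) \<in> L2 \<phi> (card J)"
proof -
  have "L2w \<phi> (rep_aefun (abs_aefun a))"
    by (rule L2w_cong(1)[OF C0 a]) (use a rep_abs_aefun[of a] in \<open>auto simp: L2w_def elim: eventually_mono\<close>)
  moreover have "L2w \<phi> (rep_aefun (0 :: (complex, 'n) vec aefun))" using zero_L2[of 0] by (simp add: L2_iff)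
  ultimately show ?thesis by (auto simp: L2_iff single_def)
qed

lemma inner_single:
  assumes a: "a \<in> borel_measurable lebesgue"
  shows "inner_L2 \<phi> f (single J (abs_aefun a)) = (LINT z|lebesgue. rep_aefun (f J) z * cnj (a z) * complex_of_real (exp (- \<phi> z)))"
proof -
  have [measurable]: "(\<lambda>z. cnj (a z)) \<in> borel_measurable lebesgue"
    by (rule measurable_compose[OF a borel_measurable_continuous_onI]) (intro continuous_intros)
  have "(LINT z|lebesgue. rep_aefun (f K) z * cnj (rep_aefun (single J (abs_aefun a) K) z) * complex_of_real (exp (- \<phi> z))) =
      (if K = J then (LINT z|lebesgue. rep_aefun (f J) z * cnj (a z) * complex_of_real (exp (- \<phi> z))) else 0)" for K
  proof (cases "K = J")
    case True
    then show ?thesis using rep_abs_aefun[OF a]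
      by (simp add: single_def) (intro integral_cong_AE, auto elim: eventually_mono)
  next
    case False
    have "(LINT z|lebesgue. rep_aefun (f K) z * cnj (rep_aefun (single J (abs_aefun a) K) z) * complex_of_real (exp (- \<phi> z))) =
        (LINT z|lebesgue. 0 * rep_aefun (f K) z)"
    proof (rule integral_cong_AE)
      show "AE z in lebesgue. rep_aefun (f K) z * cnj (rep_aefun (single J (abs_aefun a) K) z) * complex_of_real (exp (- \<phi> z)) =
          0 * rep_aefun (f K) z"
        using rep_zero_aefun by eventually_elim (simp add: single_def False)
    qed measurable
    then show ?thesis using False by simp
  qed
  then show ?thesis by (simp add: inner_L2_def)
qed

section \<open>Distributional derivatives as pairings in the weighted space\<close>

lemma dual_Cc: "Cc k \<eta> \<Longrightarrow> k \<le> 2 \<Longrightarrow> Cc k (\<lambda>z. cnj (\<eta> z) * complex_of_real (exp (\<phi> z)))"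
  by (intro Cc_mult(1) Cc_cnj Ck_of_real Ck_exp Ck_mono[OF C2])

lemma dual_L2: "Cc 0 \<eta> \<Longrightarrow> dual \<phi> \<eta> J \<in> L2 \<phi> (card J)"
  unfolding dual_def by (intro single_L2 L2w_Cc[OF C0] dual_Cc) auto

lemma inner_dual:
  assumes "Cc 0 \<eta>" shows "inner_L2 \<phi> f (dual \<phi> \<eta> J) = (LINT z|lebesgue. rep_aefun (f J) z * \<eta> z)"
proof -
  have "complex_of_real (exp (\<phi> z)) * complex_of_real (exp (- \<phi> z)) = 1" for z
    by (simp add: exp_minus flip: of_real_mult)
  then have e: "x * cnj (cnj (\<eta> z) * complex_of_real (exp (\<phi> z))) * complex_of_real (exp (- \<phi> z)) = x * \<eta> z" for x z
    by (simp add: mult.assoc)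
  have "inner_L2 \<phi> f (dual \<phi> \<eta> J) =
      (LINT z|lebesgue. rep_aefun (f J) z * cnj (cnj (\<eta> z) * complex_of_real (exp (\<phi> z))) * complex_of_real (exp (- \<phi> z)))"
    unfolding dual_def
    by (rule inner_single, rule Ck_lebesgue_measurable, rule CcD, rule dual_Cc[OF assms]) simp
  then show ?thesis by (simp only: e)
qed

lemma testC: "test_function \<eta> \<Longrightarrow> Cc k \<eta>" by (simp add: test_function_iff)

lemma weak_dbar_inner:
  "weak_dbar f g \<longleftrightarrow> (\<forall>K \<eta>. test_function \<eta> \<longrightarrow> inner_L2 \<phi> g (dual \<phi> \<eta> K) =
    (\<Sum>J\<in>UNIV. \<Sum>j\<in>UNIV. wedge_coeff j J K * - inner_L2 \<phi> f (dual \<phi> (cr \<i> j \<eta>) J)))"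
proof -
  have eq: "inner_L2 \<phi> h (dual \<phi> \<eta> J) = (LINT z|lebesgue. rep_aefun (h J) z * \<eta> z)" "inner_L2 \<phi> h (dual \<phi> (cr \<i> j \<eta>) J) = (LINT z|lebesgue. rep_aefun (h J) z * cr \<i> j \<eta> z)"
    if "test_function \<eta>" for h \<eta> J j
    using that by (auto intro!: inner_dual testC Cc_cr)
  show ?thesis unfolding weak_dbar_def wirtinger_eq_cr
    by (rule iff_allI, rule iff_allI, rule imp_cong[OF refl]) (simp only: eq)
qed

text \<open>The fundamental lemma, coefficient by coefficient. On a ball the weight is bounded
  below, so a coefficient in the weighted space is locally square-integrable.\<close>

lemma L2_eqI:
  assumes f: "f \<in> L2 \<phi> q" and z: "\<And>J \<eta>. test_function \<eta> \<Longrightarrow> card J = q \<Longrightarrow> inner_L2 \<phi> f (dual \<phi> \<eta> J) = 0"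
  shows "f = 0"
proof
  fix J
  show "f J = 0 J"
  proof (cases "card J = q")
    case True
    have "AE z in lebesgue. rep_aefun (f J) z = 0"
    proof (rule fundamental_lemma)
      fix R :: real
      obtain m M where m: "m > 0" "\<And>z. norm z \<le> R \<Longrightarrow> m \<le> exp (- \<phi> z)" using weight_bounds[OF C0] by metis
      have "nn2 lebesgue (\<lambda>z. indicator (cball 0 R) z * rep_aefun (f J) z) \<le>
          (\<integral>\<^sup>+z. ennreal (1 / m * ((cmod (rep_aefun (f J) z))\<^sup>2 * exp (- \<phi> z))) \<partial>lebesgue)"
        unfolding nn2_def
      proof (intro nn_integral_mono ennreal_leI)
        fix z
        have "1 \<le> 1 / m * exp (- \<phi> z)" if "norm z \<le> R" using m(1) m(2)[OF that] by (simp add: field_simps)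
        from mult_left_mono[OF this, of "(cmod (rep_aefun (f J) z))\<^sup>2"]
        show "(cmod (indicator (cball 0 R) z * rep_aefun (f J) z))\<^sup>2 \<le> 1 / m * ((cmod (rep_aefun (f J) z))\<^sup>2 * exp (- \<phi> z))"
          using m(1) by (cases "norm z \<le> R") auto
      qed
      also have "\<dots> = ennreal (LINT z|lebesgue. 1 / m * ((cmod (rep_aefun (f J) z))\<^sup>2 * exp (- \<phi> z)))"
        using L2_D[OF f, of J] m(1) by (intro nn_integral_eq_integral) (auto simp: L2w_def)
      finally show "nn2 lebesgue (\<lambda>z. indicator (cball 0 R) z * rep_aefun (f J) z) < \<infinity>"
        by (simp add: order_le_less_trans)
      fix \<eta> :: "(complex, 'n) vec \<Rightarrow> complex" assume t: "test_function \<eta>"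
      show "(LINT z|lebesgue. rep_aefun (f J) z * \<eta> z) = 0"
        using z[OF t True] inner_dual[OF testC[OF t]] by simp
    qed simp
    then show ?thesis using rep_zero_aefun by (auto simp: aefun_eq_iff elim: eventually_elim2)
  next
    case False
    then show ?thesis using f by (simp add: L2_iff)
  qed
qed

text \<open>Justifies the definite description in \<open>dbar\<close>.\<close>

lemma weak_dbar_unique:
  assumes "g \<in> L2 \<phi> q" "g' \<in> L2 \<phi> q" "weak_dbar f g" "weak_dbar f g'" shows "g = g'"
proof -
  have "g - g' = 0"
  proof (rule L2_eqI[OF L2.diff[OF assms(1,2)]])
    fix J :: "'n set" and \<eta> :: "(complex, 'n) vec \<Rightarrow> complex" assume t: "test_function \<eta>" and J: "card J = q"
    have d: "dual \<phi> \<eta> J \<in> L2 \<phi> q" using dual_L2[OF testC[OF t], of J] J by simp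
    have "inner_L2 \<phi> g (dual \<phi> \<eta> J) = inner_L2 \<phi> g' (dual \<phi> \<eta> J)"
      using assms(3)[unfolded weak_dbar_inner, rule_format, OF t, of J]
        assms(4)[unfolded weak_dbar_inner, rule_format, OF t, of J] by (simp only:)
    then show "inner_L2 \<phi> (g - g') (dual \<phi> \<eta> J) = 0"
      using L2.B_diff[OF assms(1,2) d] by simp
  qed
  then show ?thesis by simp
qed

lemma dbarI:
  assumes "u \<in> L2 \<phi> q" "g \<in> L2 \<phi> (q + 1)" "weak_dbar u g"
  shows "u \<in> dom_dbar \<phi> q" and "dbar \<phi> q u = g"
  using assms by (auto simp: dom_dbar_def dbar_def intro!: the_equality weak_dbar_unique)

lemma dbarD:
  assumes "u \<in> dom_dbar \<phi> q"
  shows "u \<in> L2 \<phi> q" and "dbar \<phi> q u \<in> L2 \<phi> (q + 1)" and "weak_dbar u (dbar \<phi> q u)"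
proof -
  obtain g where g: "u \<in> L2 \<phi> q" "g \<in> L2 \<phi> (q + 1)" "weak_dbar u g" using assms by (auto simp: dom_dbar_def)
  then show "u \<in> L2 \<phi> q" "dbar \<phi> q u \<in> L2 \<phi> (q + 1)" "weak_dbar u (dbar \<phi> q u)" using dbarI(2)[OF g] by auto
qed

lemma weak_dbar_linear:
  assumes u: "u \<in> L2 \<phi> q" "v \<in> L2 \<phi> q" and g: "g \<in> L2 \<phi> (q + 1)" "h \<in> L2 \<phi> (q + 1)"
    and w: "weak_dbar u g" "weak_dbar v h"
  shows "weak_dbar (u + v) (g + h)" and "weak_dbar (form_scale c u) (form_scale c g)"
proof -
  have add: "inner_L2 \<phi> (f + f') (dual \<phi> \<eta> K) = inner_L2 \<phi> f (dual \<phi> \<eta> K) + inner_L2 \<phi> f' (dual \<phi> \<eta> K)"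
    and sc: "inner_L2 \<phi> (form_scale c f) (dual \<phi> \<eta> K) = c * inner_L2 \<phi> f (dual \<phi> \<eta> K)"
    if f: "f \<in> L2 \<phi> r" "f' \<in> L2 \<phi> r" and \<eta>: "Cc 0 \<eta>" for f f' r \<eta> K
  proof -
    \<comment> \<open>The linearity rules of the inner product hold within a single space
      \<open>L2 \<phi> r\<close>. In the wrong degree the dual form lies outside it, but then every
      pairing is zero.\<close>
    have z: "inner_L2 \<phi> k (dual \<phi> \<eta> K) = 0" if "k \<in> L2 \<phi> r" "card K \<noteq> r" for k
    proof -
      have "k K = 0" using that by (simp add: L2_iff)
      then have "inner_L2 \<phi> k (dual \<phi> \<eta> K) = (LINT z|lebesgue. rep_aefun 0 z * \<eta> z)" using inner_dual[OF \<eta>] by simp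
      also have "\<dots> = (LINT z|lebesgue. 0 * \<eta> z)"
      proof (rule integral_cong_AE)
        have [measurable]: "\<eta> \<in> borel_measurable lebesgue" by (rule Ck_lebesgue_measurable[OF CcD[OF \<eta>]])
        show "(\<lambda>z. rep_aefun 0 z * \<eta> z) \<in> borel_measurable lebesgue" by measurable
        show "(\<lambda>z. 0 * \<eta> z) \<in> borel_measurable lebesgue" by simp
      qed (use rep_zero_aefun in \<open>auto elim: eventually_mono\<close>)
      finally show ?thesis by simp
    qed
    show "inner_L2 \<phi> (f + f') (dual \<phi> \<eta> K) = inner_L2 \<phi> f (dual \<phi> \<eta> K) + inner_L2 \<phi> f' (dual \<phi> \<eta> K)"
      using L2.B_add[OF f] dual_L2[OF \<eta>, of K] z f add_L2[OF f] by (cases "card K = r") auto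
    show "inner_L2 \<phi> (form_scale c f) (dual \<phi> \<eta> K) = c * inner_L2 \<phi> f (dual \<phi> \<eta> K)"
      using L2.B_scale[OF f(1)] dual_L2[OF \<eta>, of K] z f scale_L2[OF f(1)] by (cases "card K = r") auto
  qed
  show "weak_dbar (u + v) (g + h)" unfolding weak_dbar_inner
  proof (intro allI impI)
    fix K :: "'n set" and \<eta> :: "(complex, 'n) vec \<Rightarrow> complex" assume t: "test_function \<eta>"
    have c: "Cc 0 (cr \<i> j \<eta>)" for j by (rule Cc_cr[OF testC[OF t]])
    show "inner_L2 \<phi> (g + h) (dual \<phi> \<eta> K) = (\<Sum>J\<in>UNIV. \<Sum>j\<in>UNIV. wedge_coeff j J K * - inner_L2 \<phi> (u + v) (dual \<phi> (cr \<i> j \<eta>) J))"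
      unfolding add[OF g testC[OF t]] add[OF u c] w[unfolded weak_dbar_inner, rule_format, OF t]
      by (simp only: minus_add_distrib distrib_left sum.distrib)
  qed
  show "weak_dbar (form_scale c u) (form_scale c g)" unfolding weak_dbar_inner
  proof (intro allI impI)
    fix K :: "'n set" and \<eta> :: "(complex, 'n) vec \<Rightarrow> complex" assume t: "test_function \<eta>"
    have c: "Cc 0 (cr \<i> j \<eta>)" for j by (rule Cc_cr[OF testC[OF t]])
    show "inner_L2 \<phi> (form_scale c g) (dual \<phi> \<eta> K) = (\<Sum>J\<in>UNIV. \<Sum>j\<in>UNIV. wedge_coeff j J K * - inner_L2 \<phi> (form_scale c u) (dual \<phi> (cr \<i> j \<eta>) J))"
      unfolding sc[OF g testC[OF t]] sc[OF u c] w(1)[unfolded weak_dbar_inner, rule_format, OF t]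
      by (simp add: sum_distrib_left mult_ac)
  qed
qed

lemma dbar_add: "u \<in> dom_dbar \<phi> q \<Longrightarrow> v \<in> dom_dbar \<phi> q \<Longrightarrow> u + v \<in> dom_dbar \<phi> q \<and> dbar \<phi> q (u + v) = dbar \<phi> q u + dbar \<phi> q v"
  using dbarI[of "u + v" q "dbar \<phi> q u + dbar \<phi> q v"] dbarD[of u q] dbarD[of v q] weak_dbar_linear(1)[of u q v]
  by (auto intro: add_L2)

lemma dbar_scale: "u \<in> dom_dbar \<phi> q \<Longrightarrow> form_scale c u \<in> dom_dbar \<phi> q \<and> dbar \<phi> q (form_scale c u) = form_scale c (dbar \<phi> q u)"
  using dbarI[of "form_scale c u" q "form_scale c (dbar \<phi> q u)"] dbarD[of u q] weak_dbar_linear(2)[of u q u]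
  by (auto intro: scale_L2)

lemma dbar_zero: "0 \<in> dom_dbar \<phi> q"
proof -
  have z: "inner_L2 \<phi> 0 (dual \<phi> \<eta> K) = 0" if "Cc 0 \<eta>" for \<eta> K
    using L2.B_diff[OF zero_L2 zero_L2 dual_L2[OF that]] by simp
  have "weak_dbar 0 (0::'n form)" unfolding weak_dbar_inner by (simp add: z testC Cc_cr)
  then show ?thesis using dbarI(1) zero_L2 by blast
qed

text \<open>Closedness comes down to the fact that the pairings with the dual forms are continuous.\<close>

lemma dbar_closed:
  assumes u: "\<And>n. u n \<in> dom_dbar \<phi> q" and x: "x \<in> L2 \<phi> q" and g: "g \<in> L2 \<phi> (q + 1)"
    and lx: "(\<lambda>n. (norm_L2 \<phi> (u n - x))\<^sup>2) \<longlonglongrightarrow> 0" and lg: "(\<lambda>n. (norm_L2 \<phi> (dbar \<phi> q (u n) - g))\<^sup>2) \<longlonglongrightarrow> 0"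
  shows "x \<in> dom_dbar \<phi> q \<and> dbar \<phi> q x = g"
proof -
  have lim: "(\<lambda>n. inner_L2 \<phi> (s n) (dual \<phi> \<eta> J)) \<longlonglongrightarrow> inner_L2 \<phi> y (dual \<phi> \<eta> J)"
    if s: "\<And>n. s n \<in> L2 \<phi> r" "y \<in> L2 \<phi> r" "(\<lambda>n. (norm_L2 \<phi> (s n - y))\<^sup>2) \<longlonglongrightarrow> 0" and \<eta>: "Cc 0 \<eta>" for s y r \<eta> J
  proof -
    show ?thesis
    proof (cases "card J = r")
      case True
      then have d: "dual \<phi> \<eta> J \<in> L2 \<phi> r" using dual_L2[OF \<eta>] by blast
      have "(\<lambda>n. inner_L2 \<phi> (s n - y) (dual \<phi> \<eta> J)) \<longlonglongrightarrow> 0"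
      proof (rule Lim_null_comparison)
        show "\<forall>\<^sub>F n in sequentially. norm (inner_L2 \<phi> (s n - y) (dual \<phi> \<eta> J)) \<le> norm_L2 \<phi> (s n - y) * norm_L2 \<phi> (dual \<phi> \<eta> J)"
          by (intro always_eventually allI Cauchy_Schwarz_L2[OF L2.diff[OF s(1,2)] d])
        have "(\<lambda>n. norm_L2 \<phi> (s n - y)) \<longlonglongrightarrow> 0"
          using tendsto_real_sqrt[OF s(3)] norm_L2_nonneg[OF cont] by simp
        then show "(\<lambda>n. norm_L2 \<phi> (s n - y) * norm_L2 \<phi> (dual \<phi> \<eta> J)) \<longlonglongrightarrow> 0" by (rule tendsto_mult_left_zero)
      qed
      then show ?thesis unfolding L2.B_diff[OF s(1,2) d] by (rule LIM_zero_cancel)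
    next
      case False
      then have "s n J = y J" for n using s(1)[of n] s(2) by (simp add: L2_iff)
      then show ?thesis by (simp add: inner_dual[OF \<eta>])
    qed
  qed
  have "weak_dbar x g" unfolding weak_dbar_inner
  proof (intro allI impI)
    fix K :: "'n set" and \<eta> :: "(complex, 'n) vec \<Rightarrow> complex" assume t: "test_function \<eta>"
    have c: "Cc 0 (cr \<i> j \<eta>)" for j by (rule Cc_cr[OF testC[OF t]])
    have e: "inner_L2 \<phi> (dbar \<phi> q (u n)) (dual \<phi> \<eta> K) = (\<Sum>J\<in>UNIV. \<Sum>j\<in>UNIV. wedge_coeff j J K * - inner_L2 \<phi> (u n) (dual \<phi> (cr \<i> j \<eta>) J))" for n
      by (rule dbarD(3)[OF u[of n], unfolded weak_dbar_inner, rule_format, OF t])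
    have "(\<lambda>n. \<Sum>J\<in>UNIV. \<Sum>j\<in>UNIV. wedge_coeff j J K * - inner_L2 \<phi> (u n) (dual \<phi> (cr \<i> j \<eta>) J)) \<longlonglongrightarrow>
        (\<Sum>J\<in>UNIV. \<Sum>j\<in>UNIV. wedge_coeff j J K * - inner_L2 \<phi> x (dual \<phi> (cr \<i> j \<eta>) J))"
      by (intro tendsto_sum tendsto_mult tendsto_const tendsto_minus lim[OF dbarD(1)[OF u] x lx c])
    moreover have "(\<lambda>n. inner_L2 \<phi> (dbar \<phi> q (u n)) (dual \<phi> \<eta> K)) \<longlonglongrightarrow> inner_L2 \<phi> g (dual \<phi> \<eta> K)"
      by (rule lim[OF dbarD(2)[OF u] g lg testC[OF t]])
    ultimately show "inner_L2 \<phi> g (dual \<phi> \<eta> K) = (\<Sum>J\<in>UNIV. \<Sum>j\<in>UNIV. wedge_coeff j J K * - inner_L2 \<phi> x (dual \<phi> (cr \<i> j \<eta>) J))"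
      unfolding e by (rule LIMSEQ_unique[rotated])
  qed
  then show ?thesis using dbarI[OF x g] by blast
qed

end

section \<open>The adjoint operator\<close>

context hermitian_space begin

lemma sum_mem: "(\<And>i. i \<in> I \<Longrightarrow> f i \<in> V) \<Longrightarrow> sum f I \<in> V"
  by (induction I rule: infinite_finite_induct) (auto intro: zero add)

lemma B_zero_right: "z \<in> V \<Longrightarrow> B z 0 = 0"
  using B_diff_right[of z z z] by simp

lemma B_zero_left: "z \<in> V \<Longrightarrow> B 0 z = 0"
  using B_diff[of z z z] by simp

lemma B_sum_right: "(\<And>i. i \<in> I \<Longrightarrow> f i \<in> V) \<Longrightarrow> z \<in> V \<Longrightarrow> B z (sum f I) = (\<Sum>i\<in>I. B z (f i))"
  by (induction I rule: infinite_finite_induct) (auto simp: B_zero_right B_add_right sum_mem)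

end

lemma cnj_wedge_coeff [simp]: "cnj (wedge_coeff j J K) = wedge_coeff j J K"
  by (simp add: wedge_coeff_def)

lemma wedge_coeff_card:
  fixes J :: "'n::{finite,linorder} set"
  shows "wedge_coeff j J K \<noteq> 0 \<Longrightarrow> card K = card J + 1"
  by (auto simp: wedge_coeff_def split: if_splits)

lemma wedge_coeff_empty: "wedge_coeff k {} J = (if J = {k} then 1 else 0)"
  by (simp add: wedge_coeff_def)

lemma wedge_coeff_singleton: "wedge_coeff j {k} K = (if j \<noteq> k \<and> K = {j, k} then (if k < j then - 1 else 1) else 0)"
proof -
  have "{i \<in> {k}. i < j} = (if k < j then {k} else {})" by auto
  then show ?thesis by (simp add: wedge_coeff_def)
qed

lemma wedge_coeff_antisym: "wedge_coeff j {k} K = - wedge_coeff k {j} K"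
  by (auto simp: wedge_coeff_singleton insert_commute)

lemma test_function_cr: "test_function \<eta> \<Longrightarrow> test_function (cr s j \<eta>)"
  by (simp add: test_function_iff Cc_cr)

context weight begin

lemma inner_dual_zero:
  assumes "Cc 0 \<eta>" "f J = 0"
  shows "inner_L2 \<phi> f (dual \<phi> \<eta> J) = 0"
proof -
  have "(LINT z|lebesgue. rep_aefun (f J) z * \<eta> z) = (LINT z|lebesgue. 0 * \<eta> z)"
  proof (rule integral_cong_AE)
    have [measurable]: "\<eta> \<in> borel_measurable lebesgue" by (rule Ck_lebesgue_measurable[OF CcD[OF assms(1)]])
    show "(\<lambda>z. rep_aefun (f J) z * \<eta> z) \<in> borel_measurable lebesgue" "(\<lambda>z. 0 * \<eta> z) \<in> borel_measurable lebesgue"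
      by measurable
  qed (use rep_zero_aefun assms(2) in \<open>auto elim: eventually_mono\<close>)
  then show ?thesis using inner_dual[OF assms(1)] by simp
qed

text \<open>For a compactly supported coefficient the classical derivative is the distributional
  one, by \<open>cr_by_parts\<close>. Class C^1 accommodates the dual forms, whose factor e^\<phi>
  is no smoother than \<open>\<phi>\<close>. They supply a dense part of the domain.\<close>

lemma dbar_single:
  fixes J :: "'n set"
  assumes \<eta>: "Cc 1 \<eta>"
  defines "g \<equiv> \<lambda>K. abs_aefun (\<lambda>z. \<Sum>j\<in>UNIV. wedge_coeff j J K * cr \<i> j \<eta> z)"
  shows "single J (abs_aefun \<eta>) \<in> dom_dbar \<phi> (card J)" and "dbar \<phi> (card J) (single J (abs_aefun \<eta>)) = g"
proof -
  have \<eta>0: "Cc 0 \<eta>" by (rule Cc_mono[OF \<eta>]) simp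
  have c: "Cc 0 (\<lambda>z. \<Sum>j\<in>UNIV. wedge_coeff j J K * cr \<i> j \<eta> z)" for K
    by (intro Cc_sum Cc_mult(2) Ck_const Cc1_cr \<eta>)
  have rg: "AE z in lebesgue. rep_aefun (g K) z = (\<Sum>j\<in>UNIV. wedge_coeff j J K * cr \<i> j \<eta> z)" for K
    unfolding g_def by (rule rep_abs_Cc[OF c])
  have s: "single J (abs_aefun \<eta>) \<in> L2 \<phi> (card J)" by (rule single_L2[OF L2w_Cc[OF C0 \<eta>0]])
  have g: "g \<in> L2 \<phi> (card J + 1)"
    unfolding L2_iff
  proof (intro conjI allI impI)
    fix K
    have cm: "(\<lambda>z. \<Sum>j\<in>UNIV. wedge_coeff j J K * cr \<i> j \<eta> z) \<in> borel_measurable lebesgue"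
      by (rule Ck_lebesgue_measurable[OF CcD[OF c]])
    show "L2w \<phi> (rep_aefun (g K))"
      by (rule L2w_cong(1)[OF C0 L2w_Cc[OF C0 c[of K]]]) (use rg[of K] in \<open>auto elim: eventually_mono\<close>)
    assume "card K \<noteq> card J + 1"
    then have "wedge_coeff j J K = 0" for j using wedge_coeff_card by blast
    then show "g K = 0" by (simp add: g_def zero_aefun_def)
  qed
  have w: "weak_dbar (single J (abs_aefun \<eta>)) g"
    unfolding weak_dbar_inner
  proof (intro allI impI)
    fix K :: "'n set" and \<theta> :: "(complex, 'n) vec \<Rightarrow> complex" assume t: "test_function \<theta>"
    note tc = testC[OF t]
    have [measurable]: "\<theta> \<in> borel_measurable lebesgue" by (rule Ck_lebesgue_measurable[OF CcD[OF tc]])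
    have [measurable]: "cr \<i> j \<theta> \<in> borel_measurable lebesgue" for j by (rule Ck_lebesgue_measurable[OF CcD[OF Cc_cr[OF tc]]])
    have em [measurable]: "\<eta> \<in> borel_measurable lebesgue" by (rule Ck_lebesgue_measurable[OF CcD[OF \<eta>0]])
    have [measurable]: "cr \<i> j \<eta> \<in> borel_measurable lebesgue" for j by (rule Ck_lebesgue_measurable[OF CcD[OF Cc1_cr[OF \<eta>]]])
    have "inner_L2 \<phi> g (dual \<phi> \<theta> K) = (LINT z|lebesgue. (\<Sum>j\<in>UNIV. wedge_coeff j J K * (cr \<i> j \<eta> z * \<theta> z)))"
      unfolding inner_dual[OF tc]
    proof (rule integral_cong_AE)
      show "AE z in lebesgue. rep_aefun (g K) z * \<theta> z = (\<Sum>j\<in>UNIV. wedge_coeff j J K * (cr \<i> j \<eta> z * \<theta> z))"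
        using rg[of K] by eventually_elim (simp add: sum_distrib_right mult.assoc)
    qed measurable
    also have "\<dots> = (\<Sum>j\<in>UNIV. LINT z|lebesgue. wedge_coeff j J K * (cr \<i> j \<eta> z * \<theta> z))"
      by (intro Bochner_Integration.integral_sum Cc_integrable(2)[where k=0] Cc_mult(2)[OF Ck_const] Cc_mult(1) Cc1_cr \<eta> CcD tc)
    also have "\<dots> = (\<Sum>j\<in>UNIV. wedge_coeff j J K * - (LINT z|lebesgue. \<eta> z * cr \<i> j \<theta> z))"
      using cr_by_parts[of 0 \<eta> \<theta> \<i>] \<eta> CcD[OF tc, of 1] by simp
    also have "\<dots> = (\<Sum>j\<in>UNIV. wedge_coeff j J K * - inner_L2 \<phi> (single J (abs_aefun \<eta>)) (dual \<phi> (cr \<i> j \<theta>) J))"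
    proof (intro sum.cong refl arg_cong2[where f = "(*)"] arg_cong[where f = uminus])
      fix j
      show "(LINT z|lebesgue. \<eta> z * cr \<i> j \<theta> z) = inner_L2 \<phi> (single J (abs_aefun \<eta>)) (dual \<phi> (cr \<i> j \<theta>) J)"
        unfolding inner_dual[OF Cc_cr[OF tc]]
      proof (rule integral_cong_AE)
        show "AE z in lebesgue. \<eta> z * cr \<i> j \<theta> z = rep_aefun (single J (abs_aefun \<eta>) J) z * cr \<i> j \<theta> z"
          using rep_abs_Cc[OF \<eta>0] by eventually_elim (simp add: single_def)
      qed measurable
    qed
    also have "\<dots> = (\<Sum>J'\<in>UNIV. if J' = J then (\<Sum>j\<in>UNIV. wedge_coeff j J K * - inner_L2 \<phi> (single J (abs_aefun \<eta>)) (dual \<phi> (cr \<i> j \<theta>) J)) else 0)"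
      by simp
    also have "\<dots> = (\<Sum>J'\<in>UNIV. \<Sum>j\<in>UNIV. wedge_coeff j J' K * - inner_L2 \<phi> (single J (abs_aefun \<eta>)) (dual \<phi> (cr \<i> j \<theta>) J'))"
    proof (rule sum.cong[OF refl])
      fix J'
      have "inner_L2 \<phi> (single J (abs_aefun \<eta>)) (dual \<phi> (cr \<i> j \<theta>) J') = 0" if "J' \<noteq> J" for j
        using that by (intro inner_dual_zero Cc_cr tc) (simp add: single_def)
      then show "(if J' = J then (\<Sum>j\<in>UNIV. wedge_coeff j J K * - inner_L2 \<phi> (single J (abs_aefun \<eta>)) (dual \<phi> (cr \<i> j \<theta>) J)) else 0) =
          (\<Sum>j\<in>UNIV. wedge_coeff j J' K * - inner_L2 \<phi> (single J (abs_aefun \<eta>)) (dual \<phi> (cr \<i> j \<theta>) J'))" by simp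
    qed
    finally show "inner_L2 \<phi> g (dual \<phi> \<theta> K) = (\<Sum>J'\<in>UNIV. \<Sum>j\<in>UNIV. wedge_coeff j J' K * - inner_L2 \<phi> (single J (abs_aefun \<eta>)) (dual \<phi> (cr \<i> j \<theta>) J'))" .
  qed
  show "single J (abs_aefun \<eta>) \<in> dom_dbar \<phi> (card J)" "dbar \<phi> (card J) (single J (abs_aefun \<eta>)) = g"
    using dbarI[OF s g w] by auto
qed

lemma dual_dom: "Cc 1 \<eta> \<Longrightarrow> dual \<phi> \<eta> J \<in> dom_dbar \<phi> (card J)"
  unfolding dual_def by (intro dbar_single(1) dual_Cc) auto

text \<open>The dual forms lie in the domain and separate points, which is the density of the domain
  in the form needed to justify the definite description in \<open>dbar_adj\<close>.\<close>

lemma adj_unique: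
  assumes w: "w \<in> L2 \<phi> q" "w' \<in> L2 \<phi> q" and eq: "\<And>u. u \<in> dom_dbar \<phi> q \<Longrightarrow> inner_L2 \<phi> u w = inner_L2 \<phi> u w'"
  shows "w = w'"
proof -
  have "w - w' = 0"
  proof (rule L2_eqI[OF L2.diff[OF w]])
    fix J :: "'n set" and \<eta> :: "(complex, 'n) vec \<Rightarrow> complex" assume t: "test_function \<eta>" and J: "card J = q"
    have d: "dual \<phi> \<eta> J \<in> dom_dbar \<phi> q" using dual_dom[OF testC[OF t], of J] J by simp
    note dL = dbarD(1)[OF d]
    have "inner_L2 \<phi> (dual \<phi> \<eta> J) (w - w') = 0" using eq[OF d] L2.B_diff_right[OF w dL] by simp
    then show "inner_L2 \<phi> (w - w') (dual \<phi> \<eta> J) = 0" using L2.B_sym[OF dL L2.diff[OF w]] by simp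
  qed
  then show ?thesis by simp
qed

lemma adjI:
  assumes "v \<in> L2 \<phi> (q + 1)" "w \<in> L2 \<phi> q" "\<And>u. u \<in> dom_dbar \<phi> q \<Longrightarrow> inner_L2 \<phi> (dbar \<phi> q u) v = inner_L2 \<phi> u w"
  shows "v \<in> dom_dbar_adj \<phi> q" and "dbar_adj \<phi> q v = w"
proof -
  show "v \<in> dom_dbar_adj \<phi> q" using assms by (auto simp: dom_dbar_adj_def)
  show "dbar_adj \<phi> q v = w" unfolding dbar_adj_def
  proof (rule the_equality)
    show "w \<in> L2 \<phi> q \<and> (\<forall>u\<in>dom_dbar \<phi> q. inner_L2 \<phi> (dbar \<phi> q u) v = inner_L2 \<phi> u w)" using assms by blast
    fix w' assume "w' \<in> L2 \<phi> q \<and> (\<forall>u\<in>dom_dbar \<phi> q. inner_L2 \<phi> (dbar \<phi> q u) v = inner_L2 \<phi> u w')"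
    then show "w' = w" using assms by (intro adj_unique) auto
  qed
qed

lemma adjD:
  assumes "v \<in> dom_dbar_adj \<phi> q"
  shows "v \<in> L2 \<phi> (q + 1)" and "dbar_adj \<phi> q v \<in> L2 \<phi> q"
    and "u \<in> dom_dbar \<phi> q \<Longrightarrow> inner_L2 \<phi> (dbar \<phi> q u) v = inner_L2 \<phi> u (dbar_adj \<phi> q v)"
proof -
  obtain w where w: "v \<in> L2 \<phi> (q + 1)" "w \<in> L2 \<phi> q" "\<And>u. u \<in> dom_dbar \<phi> q \<Longrightarrow> inner_L2 \<phi> (dbar \<phi> q u) v = inner_L2 \<phi> u w"
    using assms by (auto simp: dom_dbar_adj_def)
  have "dbar_adj \<phi> q v = w" by (rule adjI(2)[OF w])
  with w show "v \<in> L2 \<phi> (q + 1)" "dbar_adj \<phi> q v \<in> L2 \<phi> q"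
    "u \<in> dom_dbar \<phi> q \<Longrightarrow> inner_L2 \<phi> (dbar \<phi> q u) v = inner_L2 \<phi> u (dbar_adj \<phi> q v)" by auto
qed

lemma adj_add:
  assumes v: "v \<in> dom_dbar_adj \<phi> q" and w: "w \<in> dom_dbar_adj \<phi> q"
  shows "v + w \<in> dom_dbar_adj \<phi> q \<and> dbar_adj \<phi> q (v + w) = dbar_adj \<phi> q v + dbar_adj \<phi> q w"
proof -
  have "inner_L2 \<phi> (dbar \<phi> q u) (v + w) = inner_L2 \<phi> u (dbar_adj \<phi> q v + dbar_adj \<phi> q w)" if u: "u \<in> dom_dbar \<phi> q" for u
    using L2.B_add_right[OF adjD(1)[OF v] adjD(1)[OF w] dbarD(2)[OF u]]
      L2.B_add_right[OF adjD(2)[OF v] adjD(2)[OF w] dbarD(1)[OF u]] adjD(3)[OF v u] adjD(3)[OF w u] by simp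
  from adjI[OF add_L2[OF adjD(1)[OF v] adjD(1)[OF w]] add_L2[OF adjD(2)[OF v] adjD(2)[OF w]] this]
  show ?thesis by blast
qed

lemma adj_scale:
  assumes v: "v \<in> dom_dbar_adj \<phi> q"
  shows "form_scale c v \<in> dom_dbar_adj \<phi> q \<and> dbar_adj \<phi> q (form_scale c v) = form_scale c (dbar_adj \<phi> q v)"
proof -
  have "inner_L2 \<phi> (dbar \<phi> q u) (form_scale c v) = inner_L2 \<phi> u (form_scale c (dbar_adj \<phi> q v))" if u: "u \<in> dom_dbar \<phi> q" for u
    using L2.B_scale_right[OF adjD(1)[OF v] dbarD(2)[OF u]]
      L2.B_scale_right[OF adjD(2)[OF v] dbarD(1)[OF u]] adjD(3)[OF v u] by simp
  from adjI[OF scale_L2[OF adjD(1)[OF v]] scale_L2[OF adjD(2)[OF v]] this]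
  show ?thesis by blast
qed

lemma inner_lim:
  assumes s: "\<And>n. s n \<in> L2 \<phi> r" and y: "y \<in> L2 \<phi> r" and d: "d \<in> L2 \<phi> r" and l: "(\<lambda>n. (norm_L2 \<phi> (s n - y))\<^sup>2) \<longlonglongrightarrow> 0"
  shows "(\<lambda>n. inner_L2 \<phi> d (s n)) \<longlonglongrightarrow> inner_L2 \<phi> d y"
proof -
  have "(\<lambda>n. inner_L2 \<phi> d (s n - y)) \<longlonglongrightarrow> 0"
  proof (rule Lim_null_comparison)
    show "\<forall>\<^sub>F n in sequentially. norm (inner_L2 \<phi> d (s n - y)) \<le> norm_L2 \<phi> d * norm_L2 \<phi> (s n - y)"
      by (intro always_eventually allI Cauchy_Schwarz_L2[OF d L2.diff[OF s y]])
    have "(\<lambda>n. norm_L2 \<phi> (s n - y)) \<longlonglongrightarrow> 0"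
      using tendsto_real_sqrt[OF l] norm_L2_nonneg[OF cont] by simp
    then show "(\<lambda>n. norm_L2 \<phi> d * norm_L2 \<phi> (s n - y)) \<longlonglongrightarrow> 0" by (rule tendsto_mult_right_zero)
  qed
  then show ?thesis unfolding L2.B_diff_right[OF s y d] by (rule LIM_zero_cancel)
qed

lemma adj_closed:
  assumes v: "\<And>n. v n \<in> dom_dbar_adj \<phi> q" and x: "x \<in> L2 \<phi> (q + 1)" and w: "w \<in> L2 \<phi> q"
    and lx: "(\<lambda>n. (norm_L2 \<phi> (v n - x))\<^sup>2) \<longlonglongrightarrow> 0" and lw: "(\<lambda>n. (norm_L2 \<phi> (dbar_adj \<phi> q (v n) - w))\<^sup>2) \<longlonglongrightarrow> 0"
  shows "x \<in> dom_dbar_adj \<phi> q \<and> dbar_adj \<phi> q x = w"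
proof -
  have "inner_L2 \<phi> (dbar \<phi> q u) x = inner_L2 \<phi> u w" if u: "u \<in> dom_dbar \<phi> q" for u
    using inner_lim[OF adjD(1)[OF v] x dbarD(2)[OF u] lx] inner_lim[OF adjD(2)[OF v] w dbarD(1)[OF u] lw]
    unfolding adjD(3)[OF v u] by (rule LIMSEQ_unique)
  from adjI[OF x w this] show ?thesis by blast
qed

text \<open>The distributional identity only involves the dual forms,
  which lie in the domain of the adjoint.\<close>

lemma dbar_biadjoint:
  assumes x: "x \<in> L2 \<phi> q" and h: "h \<in> L2 \<phi> (q + 1)"
    and eq: "\<And>v. v \<in> dom_dbar_adj \<phi> q \<Longrightarrow> inner_L2 \<phi> x (dbar_adj \<phi> q v) = inner_L2 \<phi> h v"
  shows "x \<in> dom_dbar \<phi> q \<and> dbar \<phi> q x = h"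
proof -
  have "weak_dbar x h" unfolding weak_dbar_inner
  proof (intro allI impI)
    fix K :: "'n set" and \<eta> :: "(complex, 'n) vec \<Rightarrow> complex" assume t: "test_function \<eta>"
    have c: "Cc 0 (cr \<i> j \<eta>)" for j by (rule Cc_cr[OF testC[OF t]])
    show "inner_L2 \<phi> h (dual \<phi> \<eta> K) = (\<Sum>J\<in>UNIV. \<Sum>j\<in>UNIV. wedge_coeff j J K * - inner_L2 \<phi> x (dual \<phi> (cr \<i> j \<eta>) J))"
    proof (cases "card K = q + 1")
      case True
      \<comment> \<open>The sum \<open>w\<close> of these forms will be the adjoint applied to the
        dual form at \<open>K\<close>. The coefficient may move into the second argument, as it is
        real; the test on \<open>card J\<close> keeps every summand in degree
        \<open>q\<close>.\<close>
      define T where "T J j = (if card J = q then form_scale (- wedge_coeff j J K) (dual \<phi> (cr \<i> j \<eta>) J) else 0)" for J j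
      have T: "T J j \<in> L2 \<phi> q" for J j
        using dual_L2[OF c, of j J] by (auto simp: T_def intro: scale_L2 zero_L2)
      define w where "w = (\<Sum>J\<in>UNIV. \<Sum>j\<in>UNIV. T J j)"
      have w: "w \<in> L2 \<phi> q" unfolding w_def by (intro L2.sum_mem T)
      have iw: "inner_L2 \<phi> u w = (\<Sum>J\<in>UNIV. \<Sum>j\<in>UNIV. wedge_coeff j J K * - inner_L2 \<phi> u (dual \<phi> (cr \<i> j \<eta>) J))"
        if u: "u \<in> L2 \<phi> q" for u
      proof -
        have "inner_L2 \<phi> u w = (\<Sum>J\<in>UNIV. inner_L2 \<phi> u (\<Sum>j\<in>UNIV. T J j))"
          unfolding w_def by (rule L2.B_sum_right[OF L2.sum_mem[OF T] u])
        also have "\<dots> = (\<Sum>J\<in>UNIV. \<Sum>j\<in>UNIV. inner_L2 \<phi> u (T J j))"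
          by (intro sum.cong refl L2.B_sum_right[OF T u])
        also have "\<dots> = (\<Sum>J\<in>UNIV. \<Sum>j\<in>UNIV. wedge_coeff j J K * - inner_L2 \<phi> u (dual \<phi> (cr \<i> j \<eta>) J))"
        proof (intro sum.cong refl)
          fix J j
          show "inner_L2 \<phi> u (T J j) = wedge_coeff j J K * - inner_L2 \<phi> u (dual \<phi> (cr \<i> j \<eta>) J)"
          proof (cases "card J = q")
            case True
            then show ?thesis using L2.B_scale_right[OF _ u, of "dual \<phi> (cr \<i> j \<eta>) J"] dual_L2[OF c, of j J] by (simp add: T_def)
          next
            case False
            then have "wedge_coeff j J K = 0" using wedge_coeff_card[of j J K] \<open>card K = q + 1\<close> by auto
            then show ?thesis using False by (simp add: T_def L2.B_zero_right[OF u])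
          qed
        qed
        finally show ?thesis .
      qed
      have dK: "dual \<phi> \<eta> K \<in> L2 \<phi> (q + 1)" using dual_L2[OF testC[OF t], of K] True by simp
      have "inner_L2 \<phi> (dbar \<phi> q u) (dual \<phi> \<eta> K) = inner_L2 \<phi> u w" if u: "u \<in> dom_dbar \<phi> q" for u
        using dbarD(3)[OF u, unfolded weak_dbar_inner, rule_format, OF t, of K] iw[OF dbarD(1)[OF u]] by simp
      from adjI[OF dK w this] eq[of "dual \<phi> \<eta> K"] iw[OF x] show ?thesis by simp
    next
      case False
      have "wedge_coeff j J K * - inner_L2 \<phi> x (dual \<phi> (cr \<i> j \<eta>) J) = 0" for J j
      proof (cases "card J = q")
        case True
        then show ?thesis using wedge_coeff_card[of j J K] False by auto
      next
        case J: False
        then have "x J = 0" using x by (simp add: L2_iff)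
        then show ?thesis using inner_dual_zero[where f = x and J = J, OF c] by simp
      qed
      moreover have "inner_L2 \<phi> h (dual \<phi> \<eta> K) = 0"
        using h False by (intro inner_dual_zero testC t) (auto simp: L2_iff)
      ultimately show ?thesis by (simp only: sum.neutral_const)
    qed
  qed
  then show ?thesis using dbarI[OF x h] by blast
qed

text \<open>Both derivatives fall on the test function, where they commute, while the wedge
  coefficient changes sign under the exchange of the two indices. The double sum therefore equals
  its own negative.\<close>

lemma dbar_dbar:
  assumes u: "u \<in> dom_dbar \<phi> 0"
  shows "dbar \<phi> 0 u \<in> dom_dbar \<phi> 1 \<and> dbar \<phi> 1 (dbar \<phi> 0 u) = 0"
proof -
  have g: "dbar \<phi> 0 u \<in> L2 \<phi> 1" using dbarD(2)[OF u] by simp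
  have "weak_dbar (dbar \<phi> 0 u) 0" unfolding weak_dbar_inner
  proof (intro allI impI)
    fix K :: "'n set" and \<eta> :: "(complex, 'n) vec \<Rightarrow> complex" assume t: "test_function \<eta>"
    define X where "X k j = inner_L2 \<phi> u (dual \<phi> (cr \<i> k (cr \<i> j \<eta>)) {})" for k j
    have Xs: "X k j = X j k" for k j
    proof -
      have "cr \<i> k (cr \<i> j \<eta>) = cr \<i> j (cr \<i> k \<eta>)" using cr_commute[OF CcD[OF testC[OF t]]] by blast
      then show ?thesis by (simp add: X_def)
    qed
    have in1: "inner_L2 \<phi> (dbar \<phi> 0 u) (dual \<phi> (cr \<i> j \<eta>) J) = (\<Sum>k\<in>UNIV. wedge_coeff k {} J * - X k j)" for j J
    proof -
      have "inner_L2 \<phi> (dbar \<phi> 0 u) (dual \<phi> (cr \<i> j \<eta>) J) =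
          (\<Sum>I\<in>UNIV. \<Sum>k\<in>UNIV. wedge_coeff k I J * - inner_L2 \<phi> u (dual \<phi> (cr \<i> k (cr \<i> j \<eta>)) I))"
        by (rule dbarD(3)[OF u, unfolded weak_dbar_inner, rule_format, OF test_function_cr[OF t]])
      also have "\<dots> = (\<Sum>I\<in>(UNIV :: 'n set set). if I = {} then (\<Sum>k\<in>UNIV. wedge_coeff k {} J * - X k j) else 0)"
      proof (rule sum.cong[OF refl])
        fix I :: "'n set"
        have "inner_L2 \<phi> u (dual \<phi> (cr \<i> k (cr \<i> j \<eta>)) I) = 0" if "I \<noteq> {}" for k
          using dbarD(1)[OF u] that by (intro inner_dual_zero testC test_function_cr t) (auto simp: L2_iff)
        then show "(\<Sum>k\<in>UNIV. wedge_coeff k I J * - inner_L2 \<phi> u (dual \<phi> (cr \<i> k (cr \<i> j \<eta>)) I)) =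
            (if I = {} then (\<Sum>k\<in>UNIV. wedge_coeff k {} J * - X k j) else 0)" by (simp add: X_def)
      qed
      also have "\<dots> = (\<Sum>k\<in>UNIV. wedge_coeff k {} J * - X k j)" by simp
      finally show ?thesis .
    qed
    define S where "S = (\<Sum>j\<in>UNIV. \<Sum>k\<in>UNIV. wedge_coeff j {k} K * X k j)"
    have "(\<Sum>J\<in>UNIV. \<Sum>j\<in>UNIV. wedge_coeff j J K * - inner_L2 \<phi> (dbar \<phi> 0 u) (dual \<phi> (cr \<i> j \<eta>) J)) =
        (\<Sum>J\<in>UNIV. \<Sum>j\<in>UNIV. \<Sum>k\<in>UNIV. if J = {k} then wedge_coeff j J K * X k j else 0)"
      unfolding in1 sum_distrib_left sum_negf[symmetric] by (intro sum.cong refl) (simp add: wedge_coeff_empty)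
    also have "\<dots> = (\<Sum>j\<in>UNIV. \<Sum>k\<in>UNIV. \<Sum>J\<in>UNIV. if J = {k} then wedge_coeff j J K * X k j else 0)"
      by (subst sum.swap) (intro sum.cong refl sum.swap)
    also have "\<dots> = S" by (simp add: S_def)
    also have "S = 0"
    proof -
      have "S = (\<Sum>k\<in>UNIV. \<Sum>j\<in>UNIV. wedge_coeff j {k} K * X k j)" unfolding S_def by (rule sum.swap)
      also have "\<dots> = (\<Sum>k\<in>UNIV. \<Sum>j\<in>UNIV. - (wedge_coeff k {j} K * X j k))"
        by (intro sum.cong refl) (subst wedge_coeff_antisym, simp add: Xs)
      also have "\<dots> = - S" by (simp add: S_def sum_negf)
      finally show ?thesis by simp
    qed
    finally have "(\<Sum>J\<in>UNIV. \<Sum>j\<in>UNIV. wedge_coeff j J K * - inner_L2 \<phi> (dbar \<phi> 0 u) (dual \<phi> (cr \<i> j \<eta>) J)) = 0" .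
    moreover have "inner_L2 \<phi> 0 (dual \<phi> \<eta> K) = 0" by (rule inner_dual_zero[OF testC[OF t]]) simp
    ultimately show "inner_L2 \<phi> 0 (dual \<phi> \<eta> K) =
        (\<Sum>J\<in>UNIV. \<Sum>j\<in>UNIV. wedge_coeff j J K * - inner_L2 \<phi> (dbar \<phi> 0 u) (dual \<phi> (cr \<i> j \<eta>) J))" by simp
  qed
  then show ?thesis using dbarI[OF g zero_L2] by blast
qed

end

section \<open>Density of test forms in the graph norm\<close>

text \<open>Dominated convergence makes the tail of \<open>h\<close> small. The radius depends on
  the multiplier only through its bound \<open>K\<close>, so one radius serves 1 minus the cut-off
  and all first derivatives of the cut-off.\<close>

lemma wn_tail:
  fixes \<phi> :: "complex ^ 'a::finite \<Rightarrow> real"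
  assumes \<phi>: "Ck 0 \<phi>" and h: "L2w \<phi> h" and e: "e > 0"
  obtains R0 where "\<And>R m. R \<ge> R0 \<Longrightarrow> m \<in> borel_measurable lebesgue \<Longrightarrow> (\<And>z. cmod (m z) \<le> K) \<Longrightarrow> (\<And>z. norm z < R \<Longrightarrow> m z = 0) \<Longrightarrow>
    wn \<phi> (\<lambda>z. m z * h z) \<le> e"
proof -
  let ?c = "\<lambda>n::nat. \<lambda>z. if norm z < real n then 0 else h z"
  have hm [measurable]: "h \<in> borel_measurable lebesgue" using h by (simp add: L2w_def)
  have pm [measurable]: "\<phi> \<in> borel_measurable lebesgue" by (rule Ck_lebesgue_measurable[OF \<phi>])
  have nm [measurable]: "{z :: (complex, 'a) vec. norm z < real n} \<in> sets lebesgue" for n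
  proof -
    have "{z :: (complex, 'a) vec. norm z < real n} = ball 0 (real n)" by auto
    then show ?thesis by simp
  qed
  have cm [measurable]: "?c n \<in> borel_measurable lebesgue" for n
    using nm[of n] by (intro measurable_If) simp_all
  have lim: "(\<lambda>n. wn \<phi> (?c n)) \<longlonglongrightarrow> (LINT z|(lebesgue :: (complex, 'a) vec measure). (0::real))"
    unfolding wn_def
  proof (rule integral_dominated_convergence)
    show "integrable lebesgue (\<lambda>z. (cmod (h z))\<^sup>2 * exp (- \<phi> z))" using h by (simp add: L2w_def)
    show "AE z in lebesgue. (\<lambda>n. (cmod (?c n z))\<^sup>2 * exp (- \<phi> z)) \<longlonglongrightarrow> 0"
    proof (intro always_eventually allI)
      fix z :: "(complex, 'a) vec"
      obtain N :: nat where "norm z < real N" using reals_Archimedean2 by blast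
      then have "\<forall>\<^sub>F n in sequentially. (cmod (?c n z))\<^sup>2 * exp (- \<phi> z) = 0"
        by (intro eventually_sequentiallyI[of N]) auto
      then show "(\<lambda>n. (cmod (?c n z))\<^sup>2 * exp (- \<phi> z)) \<longlonglongrightarrow> 0" by (rule tendsto_eventually)
    qed
  qed auto
  then have "(\<lambda>n. wn \<phi> (?c n)) \<longlonglongrightarrow> 0" by simp
  then have "\<forall>\<^sub>F n in sequentially. wn \<phi> (?c n) < e / (K\<^sup>2 + 1)"
    using e by (intro order_tendstoD(2)) (auto intro!: divide_pos_pos add_nonneg_pos)
  then obtain N where N: "wn \<phi> (?c N) < e / (K\<^sup>2 + 1)" by (auto dest: eventually_happens)
  show ?thesis
  proof (rule that)
    fix R and m :: "(complex, 'a) vec \<Rightarrow> complex" assume R: "R \<ge> real N" and m: "m \<in> borel_measurable lebesgue" "\<And>z. cmod (m z) \<le> K" "\<And>z. norm z < R \<Longrightarrow> m z = 0"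
    have c: "L2w \<phi> (?c N)"
      by (rule L2w_bound[OF \<phi> cm, where h = "\<lambda>z. (cmod (h z))\<^sup>2 * exp (- \<phi> z)"]) (use h in \<open>auto simp: L2w_def\<close>)
    have "wn \<phi> (\<lambda>z. m z * h z) = wn \<phi> (\<lambda>z. m z * ?c N z)"
      using m(3) R by (intro arg_cong[where f = "wn \<phi>"]) auto
    also have "\<dots> \<le> K\<^sup>2 * wn \<phi> (?c N)" by (rule L2w_mult(2)[OF \<phi> c m(1,2)])
    also have "\<dots> \<le> (K\<^sup>2 + 1) * (e / (K\<^sup>2 + 1))"
      using N by (intro mult_mono) (auto simp: wn_nonneg)
    also have "\<dots> = e"
    proof -
      have "K\<^sup>2 + 1 \<noteq> 0" using zero_le_power2[of K] by linarith
      then show ?thesis by simp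
    qed
    finally show "wn \<phi> (\<lambda>z. m z * h z) \<le> e" .
  qed
qed

context weight begin

definition weight_grad :: "'n \<Rightarrow> (complex, 'n) vec \<Rightarrow> complex" where
  "weight_grad j = cr (- \<i>) j (\<lambda>w. of_real (\<phi> w))"

lemma Ck_weight_grad: "Ck 1 (weight_grad j)" "Ck 0 (weight_grad j)"
proof -
  show "Ck 1 (weight_grad j)" unfolding weight_grad_def by (rule Ck2_cr[OF Ck_of_real[OF C2]])
  then show "Ck 0 (weight_grad j)" by (rule Ck_mono) simp
qed

text \<open>The equations satisfied by a form in \<open>WQ \<phi>\<close>, for coefficient functions
  in place of classes so that cut-off and convolution can act on them. In the sense of distributions
  \<open>g j k\<close> is the derivative of \<open>f k\<close> in direction \<open>j\<close> minus
  that of \<open>f j\<close> in direction \<open>k\<close>, and \<open>w\<close> is the formal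
  adjoint of \<open>f\<close>.\<close>

definition weak_system :: "('n \<Rightarrow> (complex, 'n) vec \<Rightarrow> complex) \<Rightarrow> ('n \<Rightarrow> 'n \<Rightarrow> (complex, 'n) vec \<Rightarrow> complex) \<Rightarrow> ((complex, 'n) vec \<Rightarrow> complex) \<Rightarrow> bool" where
  "weak_system f g w \<longleftrightarrow> (\<forall>j. L2w \<phi> (f j)) \<and> (\<forall>j k. L2w \<phi> (g j k)) \<and> L2w \<phi> w \<and>
    (\<forall>\<eta> j k. test_function \<eta> \<longrightarrow> (LINT z|lebesgue. g j k z * \<eta> z) =
      (LINT z|lebesgue. f j z * cr \<i> k \<eta> z) - (LINT z|lebesgue. f k z * cr \<i> j \<eta> z)) \<and>
    (\<forall>\<eta>. test_function \<eta> \<longrightarrow> (LINT z|lebesgue. w z * \<eta> z) =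
      (\<Sum>j\<in>UNIV. LINT z|lebesgue. f j z * (cr (- \<i>) j \<eta> z + weight_grad j z * \<eta> z)))"

lemma weak_systemD:
  assumes "weak_system f g w"
  shows "L2w \<phi> (f j)" "L2w \<phi> (g j k)" "L2w \<phi> w"
    "test_function \<eta> \<Longrightarrow> (LINT z|lebesgue. g j k z * \<eta> z) = (LINT z|lebesgue. f j z * cr \<i> k \<eta> z) - (LINT z|lebesgue. f k z * cr \<i> j \<eta> z)"
    "test_function \<eta> \<Longrightarrow> (LINT z|lebesgue. w z * \<eta> z) = (\<Sum>j\<in>UNIV. LINT z|lebesgue. f j z * (cr (- \<i>) j \<eta> z + weight_grad j z * \<eta> z))"
  using assms by (auto simp: weak_system_def)

lemma L2w_Cc_integrable:
  assumes h: "L2w \<phi> h" and \<eta>: "Cc 0 \<eta>"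
  shows "integrable lebesgue (\<lambda>z. h z * \<eta> z)"
proof -
  let ?g = "\<lambda>z. cnj (\<eta> z) * complex_of_real (exp (\<phi> z))"
  have "L2w \<phi> ?g" by (rule L2w_Cc[OF C0 dual_Cc[OF \<eta>]]) simp
  from L2w_product_integrable[OF C0 h this]
  have "integrable lebesgue (\<lambda>z. h z * cnj (?g z) * complex_of_real (exp (- \<phi> z)))" .
  moreover have "h z * cnj (?g z) * complex_of_real (exp (- \<phi> z)) = h z * \<eta> z" for z
    by (simp add: exp_minus field_simps)
  ultimately show ?thesis by (simp only:)
qed

lemma L2w_mult_Cc: "L2w \<phi> h \<Longrightarrow> Cc 0 \<psi> \<Longrightarrow> L2w \<phi> (\<lambda>z. \<psi> z * h z)"
proof -
  assume h: "L2w \<phi> h" and p: "Cc 0 \<psi>"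
  obtain K where "\<And>z. cmod (\<psi> z) \<le> K" using Cc_bounded[OF p] by blast
  then show "L2w \<phi> (\<lambda>z. \<psi> z * h z)"
    by (intro L2w_mult(1)[OF C0 h Ck_lebesgue_measurable[OF CcD[OF p]], where K = K])
qed

lemma cr_test_mult:
  assumes "test_function \<psi>" "test_function \<eta>"
  shows "cr s j (\<lambda>z. \<psi> z * \<eta> z) z = cr s j \<psi> z * \<eta> z + \<psi> z * cr s j \<eta> z"
  using cr_mult[OF Ck_differentiable2[OF CcD[OF testC[OF assms(1)]]] Ck_differentiable2[OF CcD[OF testC[OF assms(2)]]], of s j z]
  by (simp add: algebra_simps)

text \<open>The product of cut-off and test function is again a test function; its Leibniz rule
  produces commutators that merely multiply \<open>f\<close> by first derivatives of the
  cut-off.\<close>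

lemma weak_system_cutoff:
  assumes s: "weak_system f g w" and p: "test_function \<psi>"
  shows "weak_system (\<lambda>j z. \<psi> z * f j z) (\<lambda>j k z. \<psi> z * g j k z + (cr \<i> j \<psi> z * f k z - cr \<i> k \<psi> z * f j z))
    (\<lambda>z. \<psi> z * w z - (\<Sum>j\<in>UNIV. cr (- \<i>) j \<psi> z * f j z))"
  unfolding weak_system_def
proof (intro conjI allI impI)
  note D = weak_systemD[OF s]
  have pc: "Cc 0 \<psi>" by (rule testC[OF p])
  have pr: "Cc 0 (cr s j \<psi>)" for s j by (rule testC[OF test_function_cr[OF p]])
  show "L2w \<phi> (\<lambda>z. \<psi> z * f j z)" for j by (rule L2w_mult_Cc[OF D(1) pc])
  show "L2w \<phi> (\<lambda>z. \<psi> z * g j k z + (cr \<i> j \<psi> z * f k z - cr \<i> k \<psi> z * f j z))" for j k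
    by (intro L2w_add(1)[OF C0] L2w_diff[OF C0] L2w_mult_Cc D pc pr)
  show "L2w \<phi> (\<lambda>z. \<psi> z * w z - (\<Sum>j\<in>UNIV. cr (- \<i>) j \<psi> z * f j z))"
    by (intro L2w_diff[OF C0] L2w_sum[OF C0] L2w_mult_Cc D pc pr)
  fix \<eta> :: "(complex, 'n) vec \<Rightarrow> complex" assume t: "test_function \<eta>"
  have tp: "test_function (\<lambda>z. \<psi> z * \<eta> z)" by (intro test_function_mult p CcD testC t)
  have tc: "Cc 0 \<eta>" by (rule testC[OF t])
  have tr: "Cc 0 (cr s j \<eta>)" for s j by (rule testC[OF test_function_cr[OF t]])
  have i1: "integrable lebesgue (\<lambda>z. f j z * (cr s k \<psi> z * \<eta> z))" "integrable lebesgue (\<lambda>z. f j z * (\<psi> z * cr s k \<eta> z))"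
     "integrable lebesgue (\<lambda>z. f j z * (\<psi> z * (weight_grad k z * \<eta> z)))" for s j k
    by (intro L2w_Cc_integrable D Cc_mult(1) Cc_mult(2) pc pr tr tc CcD Ck_weight_grad)+
  { fix j k
    have i0: "integrable lebesgue (\<lambda>z. g j k z * (\<psi> z * \<eta> z))"
      by (intro L2w_Cc_integrable D Cc_mult(1) pc CcD[OF tc])
    have "(LINT z|lebesgue. (\<psi> z * g j k z + (cr \<i> j \<psi> z * f k z - cr \<i> k \<psi> z * f j z)) * \<eta> z) =
      (LINT z|lebesgue. g j k z * (\<psi> z * \<eta> z) + (f k z * (cr \<i> j \<psi> z * \<eta> z) - f j z * (cr \<i> k \<psi> z * \<eta> z)))"
      by (rule Bochner_Integration.integral_cong) (auto simp: algebra_simps)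
    also have "\<dots> = (LINT z|lebesgue. g j k z * (\<psi> z * \<eta> z)) + ((LINT z|lebesgue. f k z * (cr \<i> j \<psi> z * \<eta> z)) - (LINT z|lebesgue. f j z * (cr \<i> k \<psi> z * \<eta> z)))"
      using i0 i1 by simp
    also have "(LINT z|lebesgue. g j k z * (\<psi> z * \<eta> z)) =
       ((LINT z|lebesgue. f j z * (cr \<i> k \<psi> z * \<eta> z)) + (LINT z|lebesgue. f j z * (\<psi> z * cr \<i> k \<eta> z))) -
       ((LINT z|lebesgue. f k z * (cr \<i> j \<psi> z * \<eta> z)) + (LINT z|lebesgue. f k z * (\<psi> z * cr \<i> j \<eta> z)))"
      unfolding D(4)[OF tp] cr_test_mult[OF p t] distrib_left using i1 by simp
    finally show "(LINT z|lebesgue. (\<psi> z * g j k z + (cr \<i> j \<psi> z * f k z - cr \<i> k \<psi> z * f j z)) * \<eta> z) =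
        (LINT z|lebesgue. \<psi> z * f j z * cr \<i> k \<eta> z) - (LINT z|lebesgue. \<psi> z * f k z * cr \<i> j \<eta> z)"
      by (simp add: mult.assoc mult.left_commute) }
  have i0: "integrable lebesgue (\<lambda>z. w z * (\<psi> z * \<eta> z))"
    by (intro L2w_Cc_integrable D Cc_mult(1) pc CcD[OF tc])
  have "(LINT z|lebesgue. (\<psi> z * w z - (\<Sum>j\<in>UNIV. cr (- \<i>) j \<psi> z * f j z)) * \<eta> z) =
      (LINT z|lebesgue. w z * (\<psi> z * \<eta> z) - (\<Sum>j\<in>UNIV. f j z * (cr (- \<i>) j \<psi> z * \<eta> z)))"
    by (rule Bochner_Integration.integral_cong) (auto simp: algebra_simps sum_distrib_left sum_distrib_right)
  also have "\<dots> = (LINT z|lebesgue. w z * (\<psi> z * \<eta> z)) - (\<Sum>j\<in>UNIV. LINT z|lebesgue. f j z * (cr (- \<i>) j \<psi> z * \<eta> z))"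
    using i0 i1 by (simp add: Bochner_Integration.integral_sum)
  also have "(LINT z|lebesgue. w z * (\<psi> z * \<eta> z)) =
     (\<Sum>j\<in>UNIV. (LINT z|lebesgue. f j z * (cr (- \<i>) j \<psi> z * \<eta> z)) + (LINT z|lebesgue. \<psi> z * f j z * (cr (- \<i>) j \<eta> z + weight_grad j z * \<eta> z)))"
    unfolding D(5)[OF tp]
  proof (intro sum.cong refl)
    fix j
    have "(LINT z|lebesgue. f j z * (cr (- \<i>) j (\<lambda>z. \<psi> z * \<eta> z) z + weight_grad j z * (\<psi> z * \<eta> z))) =
       (LINT z|lebesgue. f j z * (cr (- \<i>) j \<psi> z * \<eta> z) + (f j z * (\<psi> z * cr (- \<i>) j \<eta> z) + f j z * (\<psi> z * (weight_grad j z * \<eta> z))))"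
      unfolding cr_test_mult[OF p t] by (rule Bochner_Integration.integral_cong) (auto simp: algebra_simps)
    also have "\<dots> = (LINT z|lebesgue. f j z * (cr (- \<i>) j \<psi> z * \<eta> z)) +
        (LINT z|lebesgue. f j z * (\<psi> z * cr (- \<i>) j \<eta> z) + f j z * (\<psi> z * (weight_grad j z * \<eta> z)))"
      by (intro Bochner_Integration.integral_add Bochner_Integration.integrable_add i1)
    also have "(LINT z|lebesgue. f j z * (\<psi> z * cr (- \<i>) j \<eta> z) + f j z * (\<psi> z * (weight_grad j z * \<eta> z))) =
        (LINT z|lebesgue. \<psi> z * f j z * (cr (- \<i>) j \<eta> z + weight_grad j z * \<eta> z))"
      by (rule Bochner_Integration.integral_cong) (auto simp: algebra_simps)
    finally show "(LINT z|lebesgue. f j z * (cr (- \<i>) j (\<lambda>z. \<psi> z * \<eta> z) z + weight_grad j z * (\<psi> z * \<eta> z))) =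
       (LINT z|lebesgue. f j z * (cr (- \<i>) j \<psi> z * \<eta> z)) + (LINT z|lebesgue. \<psi> z * f j z * (cr (- \<i>) j \<eta> z + weight_grad j z * \<eta> z))" .
  qed
  finally show "(LINT z|lebesgue. (\<psi> z * w z - (\<Sum>j\<in>UNIV. cr (- \<i>) j \<psi> z * f j z)) * \<eta> z) =
      (\<Sum>j\<in>UNIV. LINT z|lebesgue. \<psi> z * f j z * (cr (- \<i>) j \<eta> z + weight_grad j z * \<eta> z))"
    by (simp add: sum.distrib)
qed

lemma compact_support_L2:
  assumes h: "L2w \<phi> h" and R: "\<And>z. norm z > R \<Longrightarrow> h z = 0"
  shows "nn2 lebesgue h < \<infinity>" and "integrable lebesgue h"
proof -
  obtain m where m: "m > 0" "\<And>z. norm z \<le> R \<Longrightarrow> m \<le> exp (- \<phi> z)" using weight_bounds[OF C0] by metis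
  have "nn2 lebesgue h \<le> (\<integral>\<^sup>+z. ennreal (1 / m * ((cmod (h z))\<^sup>2 * exp (- \<phi> z))) \<partial>lebesgue)"
    unfolding nn2_def
  proof (intro nn_integral_mono ennreal_leI)
    fix z
    show "(cmod (h z))\<^sup>2 \<le> 1 / m * ((cmod (h z))\<^sup>2 * exp (- \<phi> z))"
    proof (cases "norm z > R")
      case False
      then have "(cmod (h z))\<^sup>2 * m \<le> (cmod (h z))\<^sup>2 * exp (- \<phi> z)" using m by (intro mult_left_mono) auto
      then show ?thesis using m(1) by (simp add: field_simps)
    qed (simp add: R)
  qed
  also have "\<dots> < \<infinity>"
  proof -
    have "integrable lebesgue (\<lambda>z. 1 / m * ((cmod (h z))\<^sup>2 * exp (- \<phi> z)))" using h by (simp add: L2w_def)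
    then show ?thesis using m(1) by (subst nn_integral_eq_integral) auto
  qed
  finally show 1: "nn2 lebesgue h < \<infinity>" .
  show "integrable lebesgue h"
    by (rule integrable_L2_compact_support[OF _ 1 R]) (use h in \<open>auto simp: L2w_def\<close>)
qed

text \<open>For kernels of radius at most 1 everything happens within radius \<open>R + 1\<close>,
  where the weight is at most \<open>M\<close>; an unweighted error of \<open>e / M\<close> is then
  enough.\<close>

lemma mollify_weighted:
  assumes h: "L2w \<phi> h" and R: "\<And>z. norm z > R \<Longrightarrow> h z = 0" and e: "e > 0"
  shows "\<exists>\<delta>0>0. \<forall>\<delta> \<rho>. \<delta> \<le> \<delta>0 \<longrightarrow> mollifier \<delta> \<rho> \<longrightarrow> wn \<phi> (\<lambda>z. h z - conv \<rho> h z) \<le> e"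
proof -
  obtain M where M: "M > 0" "\<And>z. norm z \<le> R + 1 \<Longrightarrow> exp (- \<phi> z) \<le> M" using weight_bounds[OF C0] by metis
  have hm: "h \<in> borel_measurable lebesgue" using h by (simp add: L2w_def)
  have "e / M > 0" using e M by simp
  from mollify_L2[OF hm compact_support_L2(1)[OF h R] R this]
  obtain d where d: "d > 0" "\<And>\<delta> \<rho>. \<delta> \<le> d \<Longrightarrow> mollifier \<delta> \<rho> \<Longrightarrow> nn2 lebesgue (\<lambda>x. h x - conv \<rho> h x) \<le> ennreal (e / M)" by blast
  have "wn \<phi> (\<lambda>z. h z - conv \<rho> h z) \<le> e" if "\<delta> \<le> min d 1" and \<rho>: "mollifier \<delta> \<rho>" for \<delta> \<rho>
  proof -
    have c: "Cc 0 (conv \<rho> h)" by (rule testC[OF test_function_conv[OF compact_support_L2(2)[OF h R] R \<rho>]])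
    have L: "L2w \<phi> (\<lambda>z. h z - conv \<rho> h z)" by (intro L2w_diff[OF C0] h L2w_Cc[OF C0] c)
    have out: "h z - conv \<rho> h z = 0" if "norm z > R + 1" for z
    proof -
      have "conv \<rho> h z = 0"
        by (rule conv_outside[of \<delta> \<rho> R]) (use \<rho> R that \<open>\<delta> \<le> min d 1\<close> in \<open>auto simp: mollifier_def\<close>)
      then show ?thesis using R that by simp
    qed
    have "ennreal (wn \<phi> (\<lambda>z. h z - conv \<rho> h z)) = (\<integral>\<^sup>+z. ennreal ((cmod (h z - conv \<rho> h z))\<^sup>2 * exp (- \<phi> z)) \<partial>lebesgue)"
      unfolding wn_def using L by (subst nn_integral_eq_integral) (auto simp: L2w_def)
    also have "\<dots> \<le> (\<integral>\<^sup>+z. ennreal M * ennreal ((cmod (h z - conv \<rho> h z))\<^sup>2) \<partial>lebesgue)"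
    proof (intro nn_integral_mono)
      fix z
      show "ennreal ((cmod (h z - conv \<rho> h z))\<^sup>2 * exp (- \<phi> z)) \<le> ennreal M * ennreal ((cmod (h z - conv \<rho> h z))\<^sup>2)"
      proof (cases "norm z > R + 1")
        case True
        then show ?thesis by (simp add: out)
      next
        case False
        then have "(cmod (h z - conv \<rho> h z))\<^sup>2 * exp (- \<phi> z) \<le> M * (cmod (h z - conv \<rho> h z))\<^sup>2"
          using mult_left_mono[OF M(2), of z "(cmod (h z - conv \<rho> h z))\<^sup>2"] by (simp add: mult.commute)
        then show ?thesis using M(1) by (subst ennreal_mult[symmetric]) (auto intro: ennreal_leI)
      qed
    qed
    also have "\<dots> = ennreal M * nn2 lebesgue (\<lambda>z. h z - conv \<rho> h z)"
      unfolding nn2_def using L by (intro nn_integral_cmult) (auto simp: L2w_def)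
    also have "\<dots> \<le> ennreal M * ennreal (e / M)"
      using d(2)[OF _ \<rho>] that by (intro mult_left_mono) auto
    also have "\<dots> = ennreal e" using M e by (simp flip: ennreal_mult)
    finally show ?thesis using e by simp
  qed
  then show ?thesis using d(1) by (intro exI[of _ "min d 1"]) auto
qed

text \<open>The mollified \<open>f\<close>, \<open>g\<close> and \<open>w\<close> stay linked by the
  equations only if a single kernel is used for all of them.\<close>

lemma mollify_finite:
  assumes I: "finite I" and h: "\<And>h. h \<in> I \<Longrightarrow> L2w \<phi> h" and R: "\<And>h z. h \<in> I \<Longrightarrow> norm z > R \<Longrightarrow> h z = 0" and e: "e > 0"
  obtains \<delta> \<rho> where "mollifier \<delta> \<rho>" "\<delta> \<le> 1" "\<And>h. h \<in> I \<Longrightarrow> wn \<phi> (\<lambda>z. h z - conv \<rho> h z) \<le> e"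
proof -
  have "\<forall>h\<in>I. \<exists>\<delta>0>0. \<forall>\<delta> \<rho>. \<delta> \<le> \<delta>0 \<longrightarrow> mollifier \<delta> \<rho> \<longrightarrow> wn \<phi> (\<lambda>z. h z - conv \<rho> h z) \<le> e"
  proof
    fix h assume hI: "h \<in> I"
    show "\<exists>\<delta>0>0. \<forall>\<delta> \<rho>. \<delta> \<le> \<delta>0 \<longrightarrow> mollifier \<delta> \<rho> \<longrightarrow> wn \<phi> (\<lambda>z. h z - conv \<rho> h z) \<le> e"
      by (rule mollify_weighted[OF h[OF hI] R[OF hI] e])
  qed
  from bchoice[OF this] obtain d where d: "\<forall>h\<in>I. d h > 0 \<and> (\<forall>\<delta> \<rho>. \<delta> \<le> d h \<longrightarrow> mollifier \<delta> \<rho> \<longrightarrow> wn \<phi> (\<lambda>z. h z - conv \<rho> h z) \<le> e)" ..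
  define \<delta> where "\<delta> = Min (insert 1 (d ` I))"
  have p: "\<delta> > 0" "\<delta> \<le> 1" using I d by (auto simp: \<delta>_def)
  have le: "\<delta> \<le> d h" if "h \<in> I" for h using I that by (auto simp: \<delta>_def)
  obtain \<rho> :: "(complex, 'n) vec \<Rightarrow> real" where "mollifier \<delta> \<rho>" using mollifier_exists[OF p(1)] by blast
  then show ?thesis using that[of \<delta> \<rho>] p d le by blast
qed

end

section \<open>Mollification of weak systems\<close>

context weight begin

lemma cr_reflect_mollifier:
  assumes "mollifier \<delta> \<rho>"
  shows "cr s j (\<lambda>y. complex_of_real (\<rho> (x - y))) y = - cr s j (\<lambda>z. complex_of_real (\<rho> z)) (x - y)"
  by (rule cr_reflect[where f = "\<lambda>z. complex_of_real (\<rho> z)"])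
    (intro Ck_differentiable2 Ck_of_real, use assms in \<open>simp add: mollifier_def\<close>)

text \<open>Convolution commutes with the constant-coefficient operators; only the zeroth-order term of the
  formal adjoint produces a commutator.\<close>

lemma weak_system_mollify:
  assumes s: "weak_system f g w" and R: "\<And>j z. norm z > R \<Longrightarrow> f j z = 0" "\<And>j k z. norm z > R \<Longrightarrow> g j k z = 0" "\<And>z. norm z > R \<Longrightarrow> w z = 0"
    and \<rho>: "mollifier \<delta> \<rho>"
  shows "test_function (conv \<rho> (f j))"
    and "cr \<i> j (conv \<rho> (f k)) z - cr \<i> k (conv \<rho> (f j)) z = conv \<rho> (g j k) z"
    and "form_adj \<phi> (\<lambda>j. conv \<rho> (f j)) z = conv \<rho> w z -
      (\<Sum>j\<in>UNIV. conv \<rho> (\<lambda>z. weight_grad j z * f j z) z - weight_grad j z * conv \<rho> (f j) z)"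
proof -
  note D = weak_systemD[OF s]
  have i: "integrable lebesgue (f j)" for j by (rule compact_support_L2(2)[OF D(1) R(1)])
  show "test_function (conv \<rho> (f j))" by (rule test_function_conv[OF i R(1) \<rho>])
  have t: "test_function (\<lambda>y. complex_of_real (\<rho> (z - y)))" by (rule test_function_reflect[OF \<rho>])
  have c: "cr s j (conv \<rho> (f k)) z = - (LINT y|lebesgue. f k y * cr s j (\<lambda>y. complex_of_real (\<rho> (z - y))) y)" for s j k
    unfolding cr_reflect_mollifier[OF \<rho>] cr_conv[OF i mollifier_Cc[OF \<rho>]]
    by (simp add: mult.commute)
  have cv: "conv \<rho> h z = (LINT y|lebesgue. h y * complex_of_real (\<rho> (z - y)))" for h
    unfolding conv_def by (simp add: scaleR_conv_of_real mult.commute)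
  show "cr \<i> j (conv \<rho> (f k)) z - cr \<i> k (conv \<rho> (f j)) z = conv \<rho> (g j k) z"
    unfolding cv D(4)[OF t] c by simp
  have tc: "Cc 0 (\<lambda>y. complex_of_real (\<rho> (z - y)))" "Cc 0 (cr s j (\<lambda>y. complex_of_real (\<rho> (z - y))))" for s j
    by (rule testC[OF t], rule testC[OF test_function_cr[OF t]])
  have "conv \<rho> w z = (\<Sum>j\<in>UNIV. conv \<rho> (\<lambda>z. weight_grad j z * f j z) z - cr (- \<i>) j (conv \<rho> (f j)) z)"
    unfolding cv D(5)[OF t] c
  proof (intro sum.cong refl)
    fix j
    have i1: "integrable lebesgue (\<lambda>y. f j y * cr (- \<i>) j (\<lambda>y. complex_of_real (\<rho> (z - y))) y)"
      by (rule L2w_Cc_integrable[OF D(1) tc(2)])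
    have i2: "integrable lebesgue (\<lambda>y. f j y * (weight_grad j y * complex_of_real (\<rho> (z - y))))"
      by (rule L2w_Cc_integrable[OF D(1) Cc_mult(2)[OF Ck_weight_grad(2) tc(1)]])
    show "(LINT y|lebesgue. f j y * (cr (- \<i>) j (\<lambda>y. complex_of_real (\<rho> (z - y))) y + weight_grad j y * complex_of_real (\<rho> (z - y)))) =
        (LINT y|lebesgue. weight_grad j y * f j y * complex_of_real (\<rho> (z - y))) -
        - (LINT y|lebesgue. f j y * cr (- \<i>) j (\<lambda>y. complex_of_real (\<rho> (z - y))) y)"
      using i1 i2 by (simp add: distrib_left mult.assoc mult.left_commute)
  qed
  then show "form_adj \<phi> (\<lambda>j. conv \<rho> (f j)) z = conv \<rho> w z -
      (\<Sum>j\<in>UNIV. conv \<rho> (\<lambda>z. weight_grad j z * f j z) z - weight_grad j z * conv \<rho> (f j) z)"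
    unfolding form_adj_def weight_grad_def[symmetric] by (simp add: sum_subtractf)
qed

lemma Ck_bounded_ball:
  assumes "Ck 0 (m :: (complex, 'n) vec \<Rightarrow> complex)"
  obtains K where "K \<ge> 0" "\<And>z. norm z \<le> R \<Longrightarrow> cmod (m z) \<le> K"
proof -
  have "bounded (m ` cball 0 R)"
    using assms by (intro compact_imp_bounded compact_continuous_image) (auto intro: continuous_on_subset)
  then obtain K where "\<forall>y\<in>m ` cball 0 R. norm y \<le> K" unfolding bounded_iff by blast
  then show ?thesis using that[of "max K 0"] by force
qed

text \<open>The derivatives of the mollified form are exactly the mollified \<open>g\<close>. In the
  formal adjoint the gradient of \<open>\<phi>\<close> leaves a commutator, which is small because
  that gradient is continuous, hence bounded on the support.\<close>

lemma weak_system_approx_compact: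
  assumes s: "weak_system f g w" and R: "\<And>j z. norm z > R \<Longrightarrow> f j z = 0" "\<And>j k z. norm z > R \<Longrightarrow> g j k z = 0" "\<And>z. norm z > R \<Longrightarrow> w z = 0"
    and e: "e > 0"
  obtains v where "\<And>j. test_function (v j)" "\<And>j. wn \<phi> (\<lambda>z. f j z - v j z) \<le> e"
    "\<And>j k. wn \<phi> (\<lambda>z. g j k z - (cr \<i> j (v k) z - cr \<i> k (v j) z)) \<le> e"
    "wn \<phi> (\<lambda>z. w z - form_adj \<phi> v z) \<le> e"
proof -
  note D = weak_systemD[OF s]
  have "\<forall>j. \<exists>K\<ge>0. \<forall>z. norm z \<le> R + 1 \<longrightarrow> cmod (weight_grad j z) \<le> K" using Ck_bounded_ball[OF Ck_weight_grad(2)] by metis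
  from choice[OF this] obtain P where P: "\<And>j. P j \<ge> 0" "\<And>j z. norm z \<le> R + 1 \<Longrightarrow> cmod (weight_grad j z) \<le> P j" by blast
  define Q where "Q = (\<Sum>j\<in>UNIV. P j)"
  have Q: "cmod (weight_grad j z) \<le> Q" if "norm z \<le> R + 1" for j z
    using P(2)[OF that, of j] member_le_sum[of j UNIV P] P(1) by (simp add: Q_def)
  have wg: "weight_grad j \<in> borel_measurable lebesgue" for j by (rule Ck_lebesgue_measurable[OF Ck_weight_grad(2)])
  define N where "N = (4::real) ^ CARD('n)"
  have N: "N > 0" by (simp add: N_def)
  \<comment> \<open>The error of the formal adjoint is a sum of three parts bounded by
    \<open>d\<close>, \<open>N * d\<close> and \<open>N * (Q\<^sup>2 * d)\<close>. Two applications
    of \<open>L2w_add\<close> give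
    \<open>2 * d + 2 * (2 * (N * d) + 2 * (N * (Q\<^sup>2 * d)))\<close>, which is
    \<open>e\<close>.\<close>
  define d where "d = e / (2 + 4 * N * (1 + Q\<^sup>2))"
  have den: "2 + 4 * N * (1 + Q\<^sup>2) \<ge> 1" using N by (simp add: add_increasing2)
  have d: "d > 0" "d \<le> e" "d * (2 + 4 * N * (1 + Q\<^sup>2)) = e"
    using e den by (auto simp: d_def divide_le_eq mult_le_cancel_left1)
  \<comment> \<open>With p the gradient of \<open>\<phi>\<close> and * the convolution, \<rho>*(p f)
    - p (\<rho>*f) is the sum of \<rho>*(p f) - p f and p (f - \<rho>*f). So the products p f are
    put among the functions that the kernel has to approximate.\<close>
  define pf where "pf j z = weight_grad j z * f j z" for j z
  have pfL: "L2w \<phi> (pf j)" for j unfolding pf_def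
    by (rule L2w_mult(1)[OF C0 D(1) wg, where K = Q]) (use R(1) Q in force)
  define I where "I = range f \<union> range (case_prod g) \<union> {w} \<union> range pf"
  have fI: "finite I" by (simp add: I_def)
  have LI: "L2w \<phi> h" if "h \<in> I" for h using that D pfL by (auto simp: I_def)
  have RI: "h z = 0" if "h \<in> I" "norm z > R" for h z using that R by (auto simp: I_def pf_def)
  obtain \<delta> \<rho> where \<rho>: "mollifier \<delta> \<rho>" "\<delta> \<le> 1" and m: "\<And>h. h \<in> I \<Longrightarrow> wn \<phi> (\<lambda>z. h z - conv \<rho> h z) \<le> d"
  proof (rule mollify_finite[of I R d, OF fI])
    show "L2w \<phi> h" if "h \<in> I" for h by (rule LI[OF that])
    show "h z = 0" if "h \<in> I" "norm z > R" for h z by (rule RI[OF that])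
    show "d > 0" by (rule d(1))
  qed blast
  note M = weak_system_mollify[OF s R \<rho>(1)]
  have cL: "L2w \<phi> (\<lambda>z. h z - conv \<rho> h z)" if "h \<in> I" for h
  proof -
    have "test_function (conv \<rho> h)"
      by (rule test_function_conv[OF compact_support_L2(2)[OF LI[OF that] RI[OF that]] RI[OF that] \<rho>(1)])
    then show ?thesis by (intro L2w_diff[OF C0] L2w_Cc[OF C0] LI that testC)
  qed
  show ?thesis
  proof (rule that)
    show "test_function (conv \<rho> (f j))" for j by (rule M(1))
    show "wn \<phi> (\<lambda>z. f j z - conv \<rho> (f j) z) \<le> e" for j
      using m[of "f j"] d(2) by (auto simp: I_def)
    show "wn \<phi> (\<lambda>z. g j k z - (cr \<i> j (conv \<rho> (f k)) z - cr \<i> k (conv \<rho> (f j)) z)) \<le> e" for j k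
    proof -
      have "g j k \<in> I" using image_eqI[of "g j k" "case_prod g" "(j,k)" UNIV] by (auto simp: I_def)
      then have "wn \<phi> (\<lambda>z. g j k z - conv \<rho> (g j k) z) \<le> e" using m[of "g j k"] d(2) by linarith
      moreover have "cr \<i> j (conv \<rho> (f k)) z - cr \<i> k (conv \<rho> (f j)) z = conv \<rho> (g j k) z" for z by (rule M(2))
      ultimately show ?thesis by (simp only:)
    qed
    have Ij: "f j \<in> I" "pf j \<in> I" "w \<in> I" for j by (auto simp: I_def)
    define A where "A z = w z - conv \<rho> w z" for z
    define B where "B z = (\<Sum>j\<in>UNIV. conv \<rho> (pf j) z - pf j z)" for z
    define C where "C z = (\<Sum>j\<in>UNIV. weight_grad j z * (f j z - conv \<rho> (f j) z))" for z
    have AL: "L2w \<phi> A" "wn \<phi> A \<le> d" unfolding A_def using cL[OF Ij(3)] m[OF Ij(3)] by auto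
    have Bj: "L2w \<phi> (\<lambda>z. conv \<rho> (pf j) z - pf j z)" "wn \<phi> (\<lambda>z. conv \<rho> (pf j) z - pf j z) \<le> d" for j
      using L2w_cmult[OF C0 cL[OF Ij(2)], of "-1" j] m[OF Ij(2), of j] by (auto simp: wn_diff_commute[of \<phi> "conv \<rho> (pf j)"])
    have BL: "L2w \<phi> B" "wn \<phi> B \<le> N * d" unfolding B_def N_def
      by (rule L2w_sum[OF C0 Bj(1)], rule L2w_sum_small[OF C0 finite]) (use Bj d(1) in auto)
    have out: "conv \<rho> (f j) z = 0" if "norm z > R + 1" for j z
      by (rule conv_outside[of \<delta> \<rho> R]) (use \<rho> R that in \<open>auto simp: mollifier_def\<close>)
    have bd: "cmod (weight_grad j z) \<le> Q" if "f j z - conv \<rho> (f j) z \<noteq> 0" for j z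
      using that Q[of z j] out[of z j] R(1)[of z j] by force
    have Cj: "L2w \<phi> (\<lambda>z. weight_grad j z * (f j z - conv \<rho> (f j) z))" "wn \<phi> (\<lambda>z. weight_grad j z * (f j z - conv \<rho> (f j) z)) \<le> Q\<^sup>2 * d" for j
    proof -
      show "L2w \<phi> (\<lambda>z. weight_grad j z * (f j z - conv \<rho> (f j) z))" by (rule L2w_mult(1)[OF C0 cL[OF Ij(1)] wg bd])
      have "wn \<phi> (\<lambda>z. weight_grad j z * (f j z - conv \<rho> (f j) z)) \<le> Q\<^sup>2 * wn \<phi> (\<lambda>z. f j z - conv \<rho> (f j) z)"
        by (rule L2w_mult(2)[OF C0 cL[OF Ij(1)] wg bd])
      also have "\<dots> \<le> Q\<^sup>2 * d" by (intro mult_left_mono m Ij) simp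
      finally show "wn \<phi> (\<lambda>z. weight_grad j z * (f j z - conv \<rho> (f j) z)) \<le> Q\<^sup>2 * d" .
    qed
    have CL: "L2w \<phi> C" "wn \<phi> C \<le> N * (Q\<^sup>2 * d)" unfolding C_def N_def
      by (rule L2w_sum[OF C0 Cj(1)], rule L2w_sum_small[OF C0 finite]) (use Cj d(1) in auto)
    have adj: "form_adj \<phi> (\<lambda>j. conv \<rho> (f j)) z = conv \<rho> w z -
        (\<Sum>j\<in>UNIV. conv \<rho> (\<lambda>z. weight_grad j z * f j z) z - weight_grad j z * conv \<rho> (f j) z)" for z by (rule M(3))
    have eq: "(\<lambda>z. w z - form_adj \<phi> (\<lambda>j. conv \<rho> (f j)) z) = (\<lambda>z. A z + (B z + C z))"
      unfolding adj A_def B_def C_def pf_def by (simp add: sum_subtractf right_diff_distrib sum.distrib[symmetric] fun_eq_iff)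
    have "wn \<phi> (\<lambda>z. A z + (B z + C z)) \<le> 2 * wn \<phi> A + 2 * wn \<phi> (\<lambda>z. B z + C z)"
      by (rule L2w_add(2)[OF C0 AL(1) L2w_add(1)[OF C0 BL(1) CL(1)]])
    moreover have "wn \<phi> (\<lambda>z. B z + C z) \<le> 2 * wn \<phi> B + 2 * wn \<phi> C"
      by (rule L2w_add(2)[OF C0 BL(1) CL(1)])
    moreover have "2 * d + 2 * (2 * (N * d) + 2 * (N * (Q\<^sup>2 * d))) = e"
      using d(3) by (simp add: algebra_simps)
    ultimately show "wn \<phi> (\<lambda>z. w z - form_adj \<phi> (\<lambda>j. conv \<rho> (f j)) z) \<le> e"
      unfolding eq using AL(2) BL(2) CL(2) by argo
  qed
qed

lemma wn_approx_trans:
  assumes "L2w \<phi> a" "L2w \<phi> b" "L2w \<phi> c" "wn \<phi> (\<lambda>z. a z - b z) \<le> e" "wn \<phi> (\<lambda>z. b z - c z) \<le> e"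
  shows "wn \<phi> (\<lambda>z. a z - c z) \<le> 4 * e"
proof -
  have "wn \<phi> (\<lambda>z. (a z - b z) + (b z - c z)) \<le> 2 * wn \<phi> (\<lambda>z. a z - b z) + 2 * wn \<phi> (\<lambda>z. b z - c z)"
    by (rule L2w_add(2)[OF C0 L2w_diff[OF C0 assms(1,2)] L2w_diff[OF C0 assms(2,3)]])
  then show ?thesis using assms(4,5) by simp
qed

lemma L2w_form_adj: "(\<And>j. test_function (v j)) \<Longrightarrow> L2w \<phi> (form_adj \<phi> v)"
  unfolding form_adj_def weight_grad_def[symmetric]
  by (intro L2w_Cc[OF C0] Cc_minus Cc_sum Cc_diff Cc_mult(2)[OF Ck_weight_grad(2)] testC test_function_cr)

text \<open>The cut-off has to precede the mollification, because the weight and its gradient are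
  bounded only on compact sets. Its errors are tails of \<open>f\<close>, \<open>g\<close> and
  \<open>w\<close>, small since the derivatives of the cut-off are bounded independently of its
  radius.\<close>

lemma weak_system_approx:
  assumes s: "weak_system f g w" and e: "e > 0"
  obtains v where "\<And>j. test_function (v j)" "\<And>j. wn \<phi> (\<lambda>z. f j z - v j z) \<le> e"
    "\<And>j k. wn \<phi> (\<lambda>z. g j k z - (cr \<i> j (v k) z - cr \<i> k (v j) z)) \<le> e"
    "wn \<phi> (\<lambda>z. w z - form_adj \<phi> v z) \<le> e"
proof -
  note D = weak_systemD[OF s]
  obtain K' where K': "\<And>R. \<exists>\<psi> :: (complex, 'n) vec \<Rightarrow> complex. plateau K' R \<psi>" using plateau_exists by blast
  define N where "N = (4::real) ^ CARD('n)"
  have N: "N \<ge> 1" by (simp add: N_def)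
  \<comment> \<open>After the cut-off all three errors are at most
    \<open>d' = 10 * d + 2 * (N * d)\<close>; combining them with mollification errors of the same
    size multiplies by 4, which gives \<open>e\<close>.\<close>
  define d where "d = e / (4 * (10 + 2 * N))"
  have d: "d > 0" 
    using e N by (auto simp: d_def field_simps)
  \<comment> \<open>Bounds all multipliers that occur: \<open>K'\<close> for the first derivatives
    of the cut-off, 2 for 1 minus the cut-off.\<close>
  define L where "L = max K' 2"
  define I where "I = range f \<union> range (case_prod g) \<union> {w}"
  have fI: "finite I" by (simp add: I_def)
  have LI: "L2w \<phi> h" if "h \<in> I" for h using that D by (auto simp: I_def)
  have "\<forall>h\<in>I. \<exists>R0. \<forall>R m. R \<ge> R0 \<longrightarrow> m \<in> borel_measurable lebesgue \<longrightarrow> (\<forall>z. cmod (m z) \<le> L) \<longrightarrow> (\<forall>z. norm z < R \<longrightarrow> m z = 0) \<longrightarrow> wn \<phi> (\<lambda>z. m z * h z) \<le> d"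
  proof
    fix h assume "h \<in> I"
    from wn_tail[OF C0 LI[OF this] d(1), where K = L] obtain R0 where
      "\<And>R m. R \<ge> R0 \<Longrightarrow> m \<in> borel_measurable lebesgue \<Longrightarrow> (\<And>z. cmod (m z) \<le> L) \<Longrightarrow> (\<And>z. norm z < R \<Longrightarrow> m z = 0) \<Longrightarrow> wn \<phi> (\<lambda>z. m z * h z) \<le> d" by blast
    then show "\<exists>R0. \<forall>R m. R \<ge> R0 \<longrightarrow> m \<in> borel_measurable lebesgue \<longrightarrow> (\<forall>z. cmod (m z) \<le> L) \<longrightarrow> (\<forall>z. norm z < R \<longrightarrow> m z = 0) \<longrightarrow> wn \<phi> (\<lambda>z. m z * h z) \<le> d" by blast
  qed
  from bchoice[OF this] obtain r where r: "\<forall>h\<in>I. \<forall>R m. R \<ge> r h \<longrightarrow> m \<in> borel_measurable lebesgue \<longrightarrow> (\<forall>z. cmod (m z) \<le> L) \<longrightarrow> (\<forall>z. norm z < R \<longrightarrow> m z = 0) \<longrightarrow> wn \<phi> (\<lambda>z. m z * h z) \<le> d" ..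
  define R where "R = Max (r ` I)"
  obtain \<psi> where \<psi>: "plateau K' R (\<psi> :: (complex, 'n) vec \<Rightarrow> complex)" using K' by blast
  then have p: "test_function \<psi>" by (simp add: plateau_def)
  have small: "wn \<phi> (\<lambda>z. m z * h z) \<le> d"
    if "h \<in> I" "Ck 0 m" "\<And>z. cmod (m z) \<le> L" "\<And>z. norm z < R \<Longrightarrow> m z = 0" for h m
  proof -
    have "r h \<le> R" using that(1) fI by (simp add: R_def)
    then show ?thesis using r[rule_format, OF that(1) _ Ck_lebesgue_measurable[OF that(2)] that(3,4)] by blast
  qed
  have pC: "Ck 0 \<psi>" by (rule CcD[OF testC[OF p]])
  have s1: "wn \<phi> (\<lambda>z. h z - \<psi> z * h z) \<le> d" if "h \<in> I" for h
  proof -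
    have "wn \<phi> (\<lambda>z. (1 - \<psi> z) * h z) \<le> d"
    proof (rule small[OF that])
      show "Ck 0 (\<lambda>z. 1 - \<psi> z)" using pC by (intro Ck_diff Ck_const)
      fix z
      have "cmod (\<psi> z) \<le> 1" using \<psi> by (simp add: plateau_def)
      then show "cmod (1 - \<psi> z) \<le> L" using norm_triangle_ineq4[of 1 "\<psi> z"] by (simp add: L_def)
      show "1 - \<psi> z = 0" if "norm z < R" using that \<psi> by (simp add: plateau_def)
    qed
    then show ?thesis by (simp add: left_diff_distrib)
  qed
  have s2: "wn \<phi> (\<lambda>z. cr t j \<psi> z * h z) \<le> d" if "h \<in> I" "cmod t = 1" for h t j
    using plateau_cr[OF \<psi> that(2)] CcD[OF testC[OF test_function_cr[OF p]]]
    by (intro small[OF that(1)]) (auto simp: L_def le_max_iff_disj)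
  have L2: "L2w \<phi> (\<lambda>z. cr t j \<psi> z * h z)" "L2w \<phi> (\<lambda>z. \<psi> z * h z)" if "h \<in> I" for h t j
    by (intro L2w_mult_Cc LI that testC test_function_cr p)+
  have out: "\<psi> z = 0" "cr t j \<psi> z = 0" if "norm z > R + 2" for z t j
  proof -
    have z: "\<psi> z = 0" if "norm z > R + 2" for z using that \<psi> by (simp add: plateau_def)
    then show "\<psi> z = 0" "cr t j \<psi> z = 0" using that cr_outside[of "R + 2" \<psi>] by blast+
  qed
  have fI': "f j \<in> I" "w \<in> I" for j by (auto simp: I_def)
  have gI: "g j k \<in> I" for j k using image_eqI[of "g j k" "case_prod g" "(j,k)" UNIV] by (auto simp: I_def)
  define F where "F j z = \<psi> z * f j z" for j z
  define G where "G j k z = \<psi> z * g j k z + (cr \<i> j \<psi> z * f k z - cr \<i> k \<psi> z * f j z)" for j k z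
  define W where "W z = \<psi> z * w z - (\<Sum>j\<in>UNIV. cr (- \<i>) j \<psi> z * f j z)" for z
  have S: "weak_system F G W" unfolding F_def G_def W_def by (rule weak_system_cutoff[OF s p])
  note E = weak_systemD[OF S]
  have eF: "wn \<phi> (\<lambda>z. f j z - F j z) \<le> 6 * d" for j
    using s1[OF fI'(1), of j] d(1) by (simp add: F_def)
  have eG: "wn \<phi> (\<lambda>z. g j k z - G j k z) \<le> 10 * d" for j k
  proof -
    have a: "L2w \<phi> (\<lambda>z. g j k z - \<psi> z * g j k z)" by (intro L2w_diff[OF C0] D L2 gI)
    have b: "L2w \<phi> (\<lambda>z. cr \<i> k \<psi> z * f j z - cr \<i> j \<psi> z * f k z)" by (intro L2w_diff[OF C0] L2 fI')
    have c: "L2w \<phi> (\<lambda>z. - (cr \<i> j \<psi> z * f k z))" using L2w_cmult[OF C0 L2(1)[OF fI'(1)], of "-1"] by simp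
    have "wn \<phi> (\<lambda>z. cr \<i> k \<psi> z * f j z + - (cr \<i> j \<psi> z * f k z)) \<le> 2 * wn \<phi> (\<lambda>z. cr \<i> k \<psi> z * f j z) + 2 * wn \<phi> (\<lambda>z. - (cr \<i> j \<psi> z * f k z))"
      by (rule L2w_add(2)[OF C0 L2(1)[OF fI'(1)] c])
    also have "\<dots> \<le> 2 * d + 2 * d"
      using s2[OF fI'(1), of \<i> k j] s2[OF fI'(1), of \<i> j k] by (simp add: wn_def)
    finally have 1: "wn \<phi> (\<lambda>z. cr \<i> k \<psi> z * f j z - cr \<i> j \<psi> z * f k z) \<le> 4 * d" by simp
    have "wn \<phi> (\<lambda>z. (g j k z - \<psi> z * g j k z) + (cr \<i> k \<psi> z * f j z - cr \<i> j \<psi> z * f k z)) \<le> 2 * d + 2 * (4 * d)"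
      using L2w_add(2)[OF C0 a b] s1[OF gI, of j k] 1 by argo
    then show ?thesis by (simp add: G_def algebra_simps)
  qed
  have eW: "wn \<phi> (\<lambda>z. w z - W z) \<le> 2 * d + 2 * (N * d)"
  proof -
    have a: "L2w \<phi> (\<lambda>z. w z - \<psi> z * w z)" by (intro L2w_diff[OF C0] D L2 fI')
    have b: "L2w \<phi> (\<lambda>z. \<Sum>j\<in>UNIV. cr (- \<i>) j \<psi> z * f j z)" by (intro L2w_sum[OF C0] L2 fI')
    have "wn \<phi> (\<lambda>z. \<Sum>j\<in>UNIV. cr (- \<i>) j \<psi> z * f j z) \<le> N * d"
      unfolding N_def using d(1) by (intro L2w_sum_small[OF C0] L2 s2 fI') auto
    then have "wn \<phi> (\<lambda>z. (w z - \<psi> z * w z) + (\<Sum>j\<in>UNIV. cr (- \<i>) j \<psi> z * f j z)) \<le> 2 * d + 2 * (N * d)"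
      using L2w_add(2)[OF C0 a b] s1[OF fI'(2)] by argo
    then show ?thesis by (simp add: W_def algebra_simps)
  qed
  define d' where "d' = 10 * d + 2 * (N * d)"
  have d': "d' > 0" using d N by (simp add: d'_def add_pos_nonneg)
  have N0: "0 \<le> N * d" using N d by simp
  obtain v where v: "\<And>j. test_function (v j)" "\<And>j. wn \<phi> (\<lambda>z. F j z - v j z) \<le> d'"
    "\<And>j k. wn \<phi> (\<lambda>z. G j k z - (cr \<i> j (v k) z - cr \<i> k (v j) z)) \<le> d'" "wn \<phi> (\<lambda>z. W z - form_adj \<phi> v z) \<le> d'"
    by (rule weak_system_approx_compact[OF S, of "R + 2" d']) (use out d' in \<open>auto simp: F_def G_def W_def\<close>)
  have vc: "Cc 0 (v j)" "Cc 0 (cr t k (v j))" for j t k by (intro testC test_function_cr v)+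
  have le: "4 * d' \<le> e"
  proof -
    have "4 * (10 + 2 * N) \<noteq> 0" using N by simp
    moreover have "x \<noteq> 0 \<Longrightarrow> e / x * x = e" for x by simp
    ultimately have "d * (4 * (10 + 2 * N)) = e" unfolding d_def by blast
    then show ?thesis by (simp add: d'_def algebra_simps)
  qed
  show ?thesis
  proof (rule that[OF v(1)])
    show "wn \<phi> (\<lambda>z. f j z - v j z) \<le> e" for j
      using wn_approx_trans[OF D(1)[of j] E(1)[of j] L2w_Cc[OF C0 vc(1)[of j]], of d'] eF[of j] v(2)[of j] d(1) N0 le by (simp add: d'_def)
    show "wn \<phi> (\<lambda>z. g j k z - (cr \<i> j (v k) z - cr \<i> k (v j) z)) \<le> e" for j k
      using wn_approx_trans[OF D(2)[of j k] E(2)[of j k] L2w_diff[OF C0 L2w_Cc[OF C0 vc(2)[of \<i> j k]] L2w_Cc[OF C0 vc(2)[of \<i> k j]]], of d']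
        eG[of j k] v(3)[of j k] d(1) N0 le by (simp add: d'_def)
    show "wn \<phi> (\<lambda>z. w z - form_adj \<phi> v z) \<le> e"
      using wn_approx_trans[OF D(3) E(3) L2w_form_adj[of v], of d'] v eW d(1) N0 le by (simp add: d'_def)
  qed
qed

end

section \<open>Forms of finite energy\<close>

lemma sum_singletons:
  fixes F :: "'n::finite set \<Rightarrow> 'a::comm_monoid_add"
  assumes "\<And>J. card J \<noteq> 1 \<Longrightarrow> F J = 0"
  shows "(\<Sum>J\<in>UNIV. F J) = (\<Sum>j\<in>UNIV. F {j})"
proof -
  have "(\<Sum>J\<in>UNIV. F J) = sum F (range (\<lambda>j. {j}))"
    by (intro sum.mono_neutral_right) (use assms in \<open>auto simp: card_1_singleton_iff image_iff\<close>)
  also have "\<dots> = (\<Sum>j\<in>UNIV. F {j})" by (subst sum.reindex) (auto simp: inj_def)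
  finally show ?thesis .
qed

lemma sum_sum_pair:
  fixes G :: "'a::finite \<Rightarrow> 'a \<Rightarrow> 'b::comm_monoid_add"
  assumes "j \<noteq> k" and z: "\<And>i l. G i l \<noteq> 0 \<Longrightarrow> i \<noteq> l \<and> {i, l} = {j, k}"
  shows "(\<Sum>l\<in>UNIV. \<Sum>i\<in>UNIV. G i l) = G j k + G k j"
proof -
  have "(\<Sum>l\<in>UNIV. \<Sum>i\<in>UNIV. G i l) = (\<Sum>(l, i)\<in>UNIV. G i l)"
    by (simp add: sum.cartesian_product)
  also have "\<dots> = (\<Sum>(l, i)\<in>{(k, j), (j, k)}. G i l)"
    by (rule sum.mono_neutral_right) (use z in \<open>force simp: doubleton_eq_iff\<close>)+
  also have "\<dots> = G j k + G k j" using assms(1) by simp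
  finally show ?thesis .
qed

context weight begin

lemma norm_sq_1:
  assumes "u \<in> L2 \<phi> 1" shows "(norm_L2 \<phi> u)\<^sup>2 = (\<Sum>j\<in>UNIV. wn \<phi> (rep_aefun (u {j})))"
  unfolding norm_sq
proof (rule sum_singletons)
  fix J :: "'n set" assume "card J \<noteq> 1"
  then have "u J = 0" using assms by (simp add: L2_iff)
  moreover have "wn \<phi> (rep_aefun (0 :: (complex, 'n) vec aefun)) = wn \<phi> (\<lambda>_. 0)"
    by (rule wn_cong[OF C0]) (use rep_zero_aefun in auto)
  ultimately show "wn \<phi> (rep_aefun (u J)) = 0" by simp
qed

lemma wn_le_norm_sq: "wn \<phi> (rep_aefun (u J)) \<le> (norm_L2 \<phi> u)\<^sup>2"
  unfolding norm_sq by (intro member_le_sum) (auto simp: wn_nonneg)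

text \<open>A form stores one coefficient for the set \<open>{j, k}\<close>. The sign
  \<open>wedge_coeff j {k} {j, k}\<close> turns it into the antisymmetric coefficient of the ordered
  pair and vanishes for \<open>j = k\<close>, where the right side is zero as well.\<close>

lemma dbar_weak_system:
  assumes u: "u \<in> dom_dbar \<phi> 1" and t: "test_function \<eta>"
  shows "(LINT z|lebesgue. wedge_coeff j {k} {j, k} * rep_aefun (dbar \<phi> 1 u {j, k}) z * \<eta> z) =
    (LINT z|lebesgue. rep_aefun (u {j}) z * cr \<i> k \<eta> z) - (LINT z|lebesgue. rep_aefun (u {k}) z * cr \<i> j \<eta> z)"
proof (cases "j = k")
  case False
  define X where "X i l = inner_L2 \<phi> u (dual \<phi> (cr \<i> i \<eta>) {l})" for i l
  define s where "s = wedge_coeff j {k} {j, k}"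
  have ss: "s * s = 1" using False by (simp add: s_def wedge_coeff_singleton)
  have s': "wedge_coeff k {j} {j, k} = - s" unfolding s_def by (rule wedge_coeff_antisym)
  have c: "Cc 0 (cr \<i> i \<eta>)" for i by (rule testC[OF test_function_cr[OF t]])
  have XI: "X i l = (LINT z|lebesgue. rep_aefun (u {l}) z * cr \<i> i \<eta> z)" for i l
    unfolding X_def by (rule inner_dual[OF c])
  have "(LINT z|lebesgue. s * rep_aefun (dbar \<phi> 1 u {j, k}) z * \<eta> z) = s * inner_L2 \<phi> (dbar \<phi> 1 u) (dual \<phi> \<eta> {j, k})"
    unfolding inner_dual[OF testC[OF t]] by (simp add: mult.assoc)
  also have "inner_L2 \<phi> (dbar \<phi> 1 u) (dual \<phi> \<eta> {j, k}) =
      (\<Sum>J\<in>UNIV. \<Sum>i\<in>UNIV. wedge_coeff i J {j, k} * - inner_L2 \<phi> u (dual \<phi> (cr \<i> i \<eta>) J))"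
    by (rule dbarD(3)[OF u, unfolded weak_dbar_inner, rule_format, OF t])
  also have "\<dots> = (\<Sum>l\<in>UNIV. \<Sum>i\<in>UNIV. wedge_coeff i {l} {j, k} * - X i l)"
    unfolding X_def
  proof (rule sum_singletons)
    fix J :: "'n set" assume "card J \<noteq> 1"
    then have "u J = 0" using dbarD(1)[OF u] by (simp add: L2_iff)
    then show "(\<Sum>i\<in>UNIV. wedge_coeff i J {j, k} * - inner_L2 \<phi> u (dual \<phi> (cr \<i> i \<eta>) J)) = 0"
      using inner_dual_zero[OF c, of u J] by simp
  qed
  also have "\<dots> = wedge_coeff j {k} {j, k} * - X j k + wedge_coeff k {j} {j, k} * - X k j"
    by (rule sum_sum_pair[OF False]) (auto simp: wedge_coeff_singleton split: if_splits)
  also have "s * \<dots> = (s * s) * X k j - (s * s) * X j k" unfolding s' s_def[symmetric] by (simp add: algebra_simps)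
  finally show ?thesis unfolding ss XI[symmetric] s_def[symmetric] by simp
qed (simp add: wedge_coeff_singleton)

text \<open>The abstract adjoint is tested with the dual form of degree 0. Its coefficient contains
  e^\<phi>, and differentiating that factor produces the gradient term of the formal
  adjoint.\<close>

lemma adj_weak_system:
  assumes u: "u \<in> dom_dbar_adj \<phi> 0" and t: "test_function \<eta>"
  shows "(LINT z|lebesgue. rep_aefun (dbar_adj \<phi> 0 u {}) z * \<eta> z) =
    (\<Sum>j\<in>UNIV. LINT z|lebesgue. rep_aefun (u {j}) z * (cr (- \<i>) j \<eta> z + weight_grad j z * \<eta> z))"
proof -
  define \<zeta> where "\<zeta> z = cnj (\<eta> z) * complex_of_real (exp (\<phi> z))" for z
  have \<zeta>: "Cc 2 \<zeta>" "Cc 1 \<zeta>" using dual_Cc[OF testC[OF t]] by (auto simp: \<zeta>_def[abs_def])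
  define h where "h = dbar \<phi> 0 (dual \<phi> \<eta> {})"
  have d: "dual \<phi> \<eta> {} = single {} (abs_aefun \<zeta>)" by (simp add: dual_def \<zeta>_def[abs_def])
  have dd: "dual \<phi> \<eta> {} \<in> dom_dbar \<phi> 0" using dual_dom[OF testC[OF t], of "{}"] by simp
  have h: "h = (\<lambda>K. abs_aefun (\<lambda>z. \<Sum>j\<in>UNIV. wedge_coeff j {} K * cr \<i> j \<zeta> z))"
    using dbar_single(2)[OF \<zeta>(2), of "{}"] unfolding h_def d by simp
  have hl: "AE z in lebesgue. rep_aefun (h {l}) z = cr \<i> l \<zeta> z" for l
  proof -
    have "h {l} = abs_aefun (cr \<i> l \<zeta>)" unfolding h by (simp add: wedge_coeff_empty mult_delta_left)
    then show ?thesis using rep_abs_Cc[OF Cc1_cr[OF \<zeta>(2)]] by simp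
  qed
  \<comment> \<open>Differentiation of the product of the conjugate of \<open>\<eta>\<close> and
    e^\<phi>; conjugation makes the derivative holomorphic, and the weight e^(-\<phi>) cancels the
    exponential.\<close>
  have hp: "cnj (cr \<i> l \<zeta> z) * complex_of_real (exp (- \<phi> z)) = cr (- \<i>) l \<eta> z + weight_grad l z * \<eta> z" for l z
  proof -
    have de: "\<eta> differentiable at z" by (rule Ck_differentiable2[OF CcD[OF testC[OF t]]])
    have df: "\<phi> differentiable at z" by (rule Ck_differentiable2[OF C2])
    have dx: "(\<lambda>z. complex_of_real (exp (\<phi> z))) differentiable at z"
      by (rule Ck_differentiable2[OF Ck_of_real[OF Ck_exp[OF C2]]])
    have dz: "\<zeta> differentiable at z" by (rule Ck_differentiable2[OF CcD[OF \<zeta>(1)]])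
    have "cnj (cr \<i> l \<zeta> z) = cr (- \<i>) l (\<lambda>z. cnj (\<zeta> z)) z" using cr_cnj[OF dz, of "- \<i>" l] by simp
    also have "(\<lambda>z. cnj (\<zeta> z)) = (\<lambda>z. \<eta> z * complex_of_real (exp (\<phi> z)))" by (simp add: \<zeta>_def)
    also have "cr (- \<i>) l \<dots> z = \<eta> z * (complex_of_real (exp (\<phi> z)) * weight_grad l z) + cr (- \<i>) l \<eta> z * complex_of_real (exp (\<phi> z))"
      by (subst cr_mult[OF de dx]) (simp add: cr_exp[OF df] weight_grad_def)
    finally have "cnj (cr \<i> l \<zeta> z) * complex_of_real (exp (- \<phi> z)) =
        (complex_of_real (exp (\<phi> z)) * complex_of_real (exp (- \<phi> z))) * (cr (- \<i>) l \<eta> z + weight_grad l z * \<eta> z)"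
      by (simp add: algebra_simps)
    also have "complex_of_real (exp (\<phi> z)) * complex_of_real (exp (- \<phi> z)) = 1"
      by (simp flip: of_real_mult add: exp_minus)
    finally show ?thesis by simp
  qed
  have hL: "h \<in> L2 \<phi> 1" using dbarD(2)[OF dd] by (simp add: h_def)
  have uL: "u \<in> L2 \<phi> 1" using adjD(1)[OF u] by simp
  have dL: "dual \<phi> \<eta> {} \<in> L2 \<phi> 0" by (rule dbarD(1)[OF dd])
  have "(LINT z|lebesgue. rep_aefun (dbar_adj \<phi> 0 u {}) z * \<eta> z) = inner_L2 \<phi> (dbar_adj \<phi> 0 u) (dual \<phi> \<eta> {})"
    by (rule inner_dual[OF testC[OF t], symmetric])
  also have "\<dots> = cnj (inner_L2 \<phi> (dual \<phi> \<eta> {}) (dbar_adj \<phi> 0 u))" by (rule L2.B_sym[OF dL adjD(2)[OF u]])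
  also have "\<dots> = cnj (inner_L2 \<phi> h u)" unfolding h_def using adjD(3)[OF u dd] by simp
  also have "\<dots> = inner_L2 \<phi> u h" using L2.B_sym[OF hL uL] by simp
  also have "\<dots> = (\<Sum>l\<in>UNIV. LINT z|lebesgue. rep_aefun (u {l}) z * cnj (rep_aefun (h {l}) z) * complex_of_real (exp (- \<phi> z)))"
    unfolding inner_L2_def
  proof (rule sum_singletons)
    fix J :: "'n set" assume "card J \<noteq> 1"
    then have z: "u J = 0" using uL by (simp add: L2_iff)
    have "(LINT z|lebesgue. rep_aefun (u J) z * cnj (rep_aefun (h J) z) * complex_of_real (exp (- \<phi> z))) = (LINT z|(lebesgue :: (complex, 'n) vec measure). 0)"
      by (rule integral_cong_AE) (use rep_zero_aefun z in \<open>auto elim: eventually_mono\<close>)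
    then show "(LINT z|lebesgue. rep_aefun (u J) z * cnj (rep_aefun (h J) z) * complex_of_real (exp (- \<phi> z))) = 0" by simp
  qed
  also have "\<dots> = (\<Sum>j\<in>UNIV. LINT z|lebesgue. rep_aefun (u {j}) z * (cr (- \<i>) j \<eta> z + weight_grad j z * \<eta> z))"
  proof (intro sum.cong refl integral_cong_AE)
    fix j
    have [measurable]: "\<eta> \<in> borel_measurable lebesgue" "cr (- \<i>) j \<eta> \<in> borel_measurable lebesgue" "weight_grad j \<in> borel_measurable lebesgue"
      by (rule Ck_lebesgue_measurable[OF CcD[OF testC[OF t]]], rule Ck_lebesgue_measurable[OF CcD[OF testC[OF test_function_cr[OF t]]]], rule Ck_lebesgue_measurable[OF Ck_weight_grad(2)])
    show "(\<lambda>z. rep_aefun (u {j}) z * (cr (- \<i>) j \<eta> z + weight_grad j z * \<eta> z)) \<in> borel_measurable lebesgue" by measurable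
    show "(\<lambda>z. rep_aefun (u {j}) z * cnj (rep_aefun (h {j}) z) * complex_of_real (exp (- \<phi> z))) \<in> borel_measurable lebesgue" by measurable
    show "AE z in lebesgue. rep_aefun (u {j}) z * cnj (rep_aefun (h {j}) z) * complex_of_real (exp (- \<phi> z)) =
        rep_aefun (u {j}) z * (cr (- \<i>) j \<eta> z + weight_grad j z * \<eta> z)"
      using hl[of j] by eventually_elim (simp add: mult.assoc hp)
  qed
  finally show ?thesis .
qed

lemma WQ_iff: "u \<in> WQ \<phi> \<longleftrightarrow> u \<in> dom_dbar \<phi> 1 \<and> u \<in> dom_dbar_adj \<phi> 0"
  using dbarD(1) by (auto simp: WQ_def)

lemma norm_Q_sq: "(norm_Q \<phi> u)\<^sup>2 = (norm_L2 \<phi> (dbar \<phi> 1 u))\<^sup>2 + (norm_L2 \<phi> (dbar_adj \<phi> 0 u))\<^sup>2"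
  by (simp add: norm_Q_def)

text \<open>The factor is coarse: each of the n^2 ordered pairs is charged the whole norm of the
  derivative, doubled by the approximation and halved by \<open>form_energy\<close>; the adjoint
  term is doubled. Neither the a priori estimate nor compactness is sensitive to such a
  constant.\<close>

lemma WQ_approx:
  assumes u: "u \<in> WQ \<phi>" and e: "e > 0"
  obtains v where "\<And>j. test_function (v j)" "\<And>j. wn \<phi> (\<lambda>z. rep_aefun (u {j}) z - v j z) \<le> e"
    "form_energy \<phi> v \<le> ((real CARD('n))\<^sup>2 + 2) * ((norm_Q \<phi> u)\<^sup>2 + e)"
proof -
  define f where "f j = rep_aefun (u {j})" for j
  define g where "g j k z = wedge_coeff j {k} {j, k} * rep_aefun (dbar \<phi> 1 u {j, k}) z" for j k z
  define w where "w = rep_aefun (dbar_adj \<phi> 0 u {})"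
  have d: "u \<in> dom_dbar \<phi> 1" and a: "u \<in> dom_dbar_adj \<phi> 0" using u by (auto simp: WQ_iff)
  have gL: "L2w \<phi> (g j k)" for j k
    unfolding g_def by (rule L2w_cmult[OF C0 L2_D[OF dbarD(2)[OF d]]])
  have s: "weak_system f g w"
    unfolding weak_system_def
  proof (intro conjI allI impI gL)
    show "L2w \<phi> (f j)" for j unfolding f_def by (rule L2_D[OF dbarD(1)[OF d]])
    show "L2w \<phi> w" unfolding w_def by (rule L2_D[OF adjD(2)[OF a]])
  qed (simp_all only: f_def g_def w_def dbar_weak_system[OF d] adj_weak_system[OF a])
  obtain v where v: "\<And>j. test_function (v j)" "\<And>j. wn \<phi> (\<lambda>z. f j z - v j z) \<le> e"
    "\<And>j k. wn \<phi> (\<lambda>z. g j k z - (cr \<i> j (v k) z - cr \<i> k (v j) z)) \<le> e"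
    "wn \<phi> (\<lambda>z. w z - form_adj \<phi> v z) \<le> e" using weak_system_approx[OF s e] by blast
  have vc: "L2w \<phi> (\<lambda>z. cr \<i> j (v k) z - cr \<i> k (v j) z)" for j k
    by (intro L2w_diff[OF C0] L2w_Cc[OF C0] testC test_function_cr v)
  have step: "wn \<phi> b \<le> 2 * wn \<phi> a + 2 * e" if "L2w \<phi> a" "L2w \<phi> b" "wn \<phi> (\<lambda>z. a z - b z) \<le> e" for a b
  proof -
    have "wn \<phi> (\<lambda>z. a z + (b z - a z)) \<le> 2 * wn \<phi> a + 2 * wn \<phi> (\<lambda>z. b z - a z)"
      by (rule L2w_add(2)[OF C0 that(1) L2w_diff[OF C0 that(2,1)]])
    then show ?thesis using that(3) by (simp add: wn_diff_commute[of \<phi> b a])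
  qed
  have gn: "wn \<phi> (g j k) \<le> (norm_L2 \<phi> (dbar \<phi> 1 u))\<^sup>2" for j k
  proof -
    have "wn \<phi> (g j k) \<le> 1\<^sup>2 * wn \<phi> (rep_aefun (dbar \<phi> 1 u {j, k}))"
      unfolding g_def by (rule L2w_mult(2)[OF C0 L2_D[OF dbarD(2)[OF d]]]) (auto simp: wedge_coeff_singleton)
    then show ?thesis using wn_le_norm_sq[of "dbar \<phi> 1 u" "{j, k}"] by simp
  qed
  have "wn \<phi> (\<lambda>z. cr \<i> j (v k) z - cr \<i> k (v j) z) \<le> 2 * (norm_L2 \<phi> (dbar \<phi> 1 u))\<^sup>2 + 2 * e" for j k
    using step[OF gL vc v(3), of j k] gn[of j k] by linarith
  then have "(\<Sum>j\<in>UNIV. \<Sum>k\<in>UNIV. wn \<phi> (\<lambda>z. cr \<i> j (v k) z - cr \<i> k (v j) z)) \<le>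
      (\<Sum>j\<in>(UNIV :: 'n set). \<Sum>k\<in>(UNIV :: 'n set). 2 * (norm_L2 \<phi> (dbar \<phi> 1 u))\<^sup>2 + 2 * e)"
    by (intro sum_mono)
  then have 1: "(\<Sum>j\<in>UNIV. \<Sum>k\<in>UNIV. wn \<phi> (\<lambda>z. cr \<i> j (v k) z - cr \<i> k (v j) z)) / 2 \<le>
      (real CARD('n))\<^sup>2 * ((norm_L2 \<phi> (dbar \<phi> 1 u))\<^sup>2 + e)"
    by (simp add: power2_eq_square algebra_simps)
  have "wn \<phi> (form_adj \<phi> v) \<le> 2 * wn \<phi> w + 2 * e"
    by (rule step[OF _ L2w_form_adj[OF v(1)] v(4)]) (use s in \<open>simp add: weak_system_def\<close>)
  then have 2: "wn \<phi> (form_adj \<phi> v) \<le> 2 * ((norm_L2 \<phi> (dbar_adj \<phi> 0 u))\<^sup>2 + e)"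
    using wn_le_norm_sq[of "dbar_adj \<phi> 0 u" "{}"] by (simp add: w_def)
  have "(real CARD('n))\<^sup>2 * ((norm_L2 \<phi> (dbar \<phi> 1 u))\<^sup>2 + e) \<le> (real CARD('n))\<^sup>2 * ((norm_Q \<phi> u)\<^sup>2 + e)"
    by (intro mult_left_mono) (auto simp: norm_Q_sq)
  moreover have "2 * ((norm_L2 \<phi> (dbar_adj \<phi> 0 u))\<^sup>2 + e) \<le> 2 * ((norm_Q \<phi> u)\<^sup>2 + e)" by (simp add: norm_Q_sq)
  ultimately have "form_energy \<phi> v \<le> ((real CARD('n))\<^sup>2 + 2) * ((norm_Q \<phi> u)\<^sup>2 + e)"
    unfolding form_energy_def distrib_right using 1 2 by linarith
  with v(1,2) show ?thesis using that unfolding f_def by blast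
qed

end

section \<open>Total boundedness of sets of bounded energy\<close>

context psh_weight begin

lemma WQ_estimate: "\<exists>C>0. \<forall>u\<in>WQ \<phi>. (norm_L2 \<phi> u)\<^sup>2 \<le> C * (norm_Q \<phi> u)\<^sup>2"
proof -
  obtain C where C: "C > 0" "\<forall>v. (\<forall>j. Cc 2 (v j)) \<longrightarrow> (\<forall>k. wn \<phi> (v k) \<le> C * form_energy \<phi> v)"
    using basic_estimate by blast
  define N where "N = (real CARD('n))\<^sup>2 + 2"
  have N: "N > 0" by (simp add: N_def add_nonneg_pos)
  have "wn \<phi> (rep_aefun (u {j})) \<le> 2 * C * N * (norm_Q \<phi> u)\<^sup>2" if u: "u \<in> WQ \<phi>" for u j
  proof (rule field_le_epsilon)
    fix \<epsilon> :: real assume \<epsilon>: "\<epsilon> > 0"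
    \<comment> \<open>The approximation enters twice, through the energy with factor
      \<open>2 * C * N\<close> and through the distance with factor 2; together they use up
      \<open>\<epsilon>\<close>.\<close>
    define e where "e = \<epsilon> / (2 * C * N + 2)"
    have den: "2 * C * N + 2 > 0" using C N by (simp add: add_pos_pos)
    have e: "e > 0" "(2 * C * N + 2) * e = \<epsilon>" using \<epsilon> den by (auto simp: e_def)
    obtain v where v: "\<And>j. test_function (v j)" "\<And>j. wn \<phi> (\<lambda>z. rep_aefun (u {j}) z - v j z) \<le> e"
      "form_energy \<phi> v \<le> N * ((norm_Q \<phi> u)\<^sup>2 + e)"
      using WQ_approx[OF u e(1)] unfolding N_def by blast
    have uL: "L2w \<phi> (rep_aefun (u {j}))" using u by (intro L2_D[of _ 1]) (simp add: WQ_def)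
    have vL: "L2w \<phi> (v j)" by (rule L2w_Cc[OF C0 testC[OF v(1)]])
    have "wn \<phi> (\<lambda>z. v j z + (rep_aefun (u {j}) z - v j z)) \<le> 2 * wn \<phi> (v j) + 2 * wn \<phi> (\<lambda>z. rep_aefun (u {j}) z - v j z)"
      by (rule L2w_add(2)[OF C0 vL L2w_diff[OF C0 uL vL]])
    moreover have "wn \<phi> (v j) \<le> C * form_energy \<phi> v" using C(2) testC[OF v(1)] by blast
    moreover have "C * form_energy \<phi> v \<le> C * (N * ((norm_Q \<phi> u)\<^sup>2 + e))"
      using v(3) C(1) by (intro mult_left_mono) auto
    ultimately have "wn \<phi> (rep_aefun (u {j})) \<le> 2 * (C * (N * ((norm_Q \<phi> u)\<^sup>2 + e))) + 2 * e"
      using v(2)[of j] by simp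
    also have "\<dots> = 2 * C * N * (norm_Q \<phi> u)\<^sup>2 + (2 * C * N + 2) * e" by (simp add: algebra_simps)
    finally show "wn \<phi> (rep_aefun (u {j})) \<le> 2 * C * N * (norm_Q \<phi> u)\<^sup>2 + \<epsilon>" unfolding e(2) .
  qed
  then have "(\<Sum>j\<in>UNIV. wn \<phi> (rep_aefun (u {j}))) \<le> (\<Sum>j\<in>(UNIV :: 'n set). 2 * C * N * (norm_Q \<phi> u)\<^sup>2)" if "u \<in> WQ \<phi>" for u
    using that by (intro sum_mono)
  then have "(norm_L2 \<phi> u)\<^sup>2 \<le> (real CARD('n) * (2 * C * N)) * (norm_Q \<phi> u)\<^sup>2" if "u \<in> WQ \<phi>" for u
    using that norm_sq_1[of u] by (simp add: WQ_def mult.assoc)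
  moreover have "real CARD('n) * (2 * C * N) > 0" using C N by simp
  ultimately show ?thesis by blast
qed

lemma WQ_sequence_clusters:
  assumes u: "\<And>m. u m \<in> WQ \<phi>" and B: "\<And>m::nat. norm_Q \<phi> (u m) \<le> B" and \<epsilon>: "\<epsilon> > 0"
  shows "\<exists>a b. a < b \<and> (norm_L2 \<phi> (u a - u b))\<^sup>2 \<le> \<epsilon>"
proof -
  define N where "N = (real CARD('n))\<^sup>2 + 2"
  have N: "N \<ge> 0" by (simp add: N_def)
  \<comment> \<open>Each coefficient of the difference is a sum of three terms of size
    \<open>e\<close>, hence at most \<open>10 * e\<close>, and there are n coefficients.\<close>
  define e where "e = \<epsilon> / (real CARD('n) * 10)"
  have e: "e > 0" "real CARD('n) * (10 * e) = \<epsilon>" using \<epsilon> by (auto simp: e_def)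
  have "\<forall>m. \<exists>v. (\<forall>j. test_function (v j)) \<and> (\<forall>j. wn \<phi> (\<lambda>z. rep_aefun (u m {j}) z - v j z) \<le> e) \<and>
      form_energy \<phi> v \<le> N * ((norm_Q \<phi> (u m))\<^sup>2 + e)"
    using WQ_approx[OF u e(1)] unfolding N_def by metis
  from choice[OF this] obtain v where v: "\<And>m j. test_function (v m j)" "\<And>m j. wn \<phi> (\<lambda>z. rep_aefun (u m {j}) z - v m j z) \<le> e"
    "\<And>m. form_energy \<phi> (v m) \<le> N * ((norm_Q \<phi> (u m))\<^sup>2 + e)" by blast
  have E: "form_energy \<phi> (v m) \<le> N * (B\<^sup>2 + e)" for m
  proof -
    have "0 \<le> norm_Q \<phi> (u m)" by (simp add: norm_Q_def)
    then have "(norm_Q \<phi> (u m))\<^sup>2 \<le> B\<^sup>2" using B[of m] by (intro power_mono)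
    then have "N * ((norm_Q \<phi> (u m))\<^sup>2 + e) \<le> N * (B\<^sup>2 + e)" using N by (intro mult_left_mono) auto
    then show ?thesis using v(3)[of m] by linarith
  qed
  obtain a b where ab: "a < b" "\<And>j. wn \<phi> (\<lambda>z. v a j z - v b j z) \<le> e"
    using energy_compactness[OF testC[OF v(1)] E e(1)] by blast
  have uL: "L2w \<phi> (rep_aefun (u m {j}))" for m j using u by (intro L2_D[of _ 1]) (simp add: WQ_def)
  have vL: "L2w \<phi> (v m j)" for m j by (rule L2w_Cc[OF C0 testC[OF v(1)]])
  have "wn \<phi> (rep_aefun ((u a - u b) {j})) \<le> 10 * e" for j
  proof -
    have 1: "L2w \<phi> (\<lambda>z. rep_aefun (u a {j}) z - v a j z)" "L2w \<phi> (\<lambda>z. v a j z - v b j z)" "L2w \<phi> (\<lambda>z. v b j z - rep_aefun (u b {j}) z)"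
      by (intro L2w_diff[OF C0] uL vL)+
    have "wn \<phi> (\<lambda>z. (rep_aefun (u a {j}) z - v a j z) + ((v a j z - v b j z) + (v b j z - rep_aefun (u b {j}) z))) \<le>
        2 * wn \<phi> (\<lambda>z. rep_aefun (u a {j}) z - v a j z) + 2 * wn \<phi> (\<lambda>z. (v a j z - v b j z) + (v b j z - rep_aefun (u b {j}) z))"
      by (rule L2w_add(2)[OF C0 1(1) L2w_add(1)[OF C0 1(2,3)]])
    moreover have "wn \<phi> (\<lambda>z. (v a j z - v b j z) + (v b j z - rep_aefun (u b {j}) z)) \<le>
        2 * wn \<phi> (\<lambda>z. v a j z - v b j z) + 2 * wn \<phi> (\<lambda>z. v b j z - rep_aefun (u b {j}) z)"
      by (rule L2w_add(2)[OF C0 1(2,3)])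
    ultimately show ?thesis
      using v(2)[of a j] v(2)[of b j] ab(2)[of j] unfolding wn_rep_diff by (simp add: wn_diff_commute[of \<phi> "v b j"])
  qed
  then have "(\<Sum>j\<in>UNIV. wn \<phi> (rep_aefun ((u a - u b) {j}))) \<le> (\<Sum>j\<in>(UNIV :: 'n set). 10 * e)" by (intro sum_mono)
  moreover have "u a - u b \<in> L2 \<phi> 1" using u by (intro L2.diff) (auto simp: WQ_def)
  ultimately have "(norm_L2 \<phi> (u a - u b))\<^sup>2 \<le> \<epsilon>" using norm_sq_1 e(2) by simp
  with ab(1) show ?thesis by blast
qed

text \<open>Without a finite net of radius \<open>\<epsilon>\<close> one can keep choosing points
  outside the balls around all earlier ones. The resulting separated sequence contradicts
  \<open>WQ_sequence_clusters\<close>.\<close>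

lemma WQ_totally_bounded:
  assumes S: "S \<subseteq> WQ \<phi>" and B: "\<And>u. u \<in> S \<Longrightarrow> norm_Q \<phi> u \<le> B"
  shows "Metric_space.mtotally_bounded (L2 \<phi> 1) (\<lambda>f g. norm_L2 \<phi> (f - g)) S"
proof -
  interpret Metric_space "L2 \<phi> 1" "\<lambda>f g. norm_L2 \<phi> (f - g)" by (rule Metric_space_L2[OF cont])
  have SL: "S \<subseteq> L2 \<phi> 1" using S by (auto simp: WQ_def)
  show ?thesis
  proof (rule ccontr)
    assume "\<not> mtotally_bounded S"
    then have "\<exists>\<epsilon>>0. \<not> (\<exists>K. finite K \<and> K \<subseteq> S \<and> S \<subseteq> (\<Union>x\<in>K. mball x \<epsilon>))"
      unfolding mtotally_bounded_def by (simp only: not_all not_imp)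
    then obtain \<epsilon> where \<epsilon>: "\<epsilon> > 0" and no: "\<not> (\<exists>K. finite K \<and> K \<subseteq> S \<and> S \<subseteq> (\<Union>x\<in>K. mball x \<epsilon>))"
      by (elim exE conjE) (rule that)
    have "\<exists>x. finite K \<and> K \<subseteq> S \<longrightarrow> x \<in> S \<and> (\<forall>y\<in>K. x \<notin> mball y \<epsilon>)" for K
    proof (cases "finite K \<and> K \<subseteq> S")
      case True
      then have "\<not> S \<subseteq> (\<Union>x\<in>K. mball x \<epsilon>)" using no by simp
      then obtain x where "x \<in> S" "x \<notin> (\<Union>x\<in>K. mball x \<epsilon>)" unfolding subset_iff not_all not_imp by (elim exE conjE) (rule that)
      then show ?thesis by (intro exI[of _ x]) simp
    next
      case False
      show ?thesis by (intro exI[of _ undefined] impI) (rule notE[OF False])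
    qed
    then have "\<forall>K. \<exists>x. finite K \<and> K \<subseteq> S \<longrightarrow> x \<in> S \<and> (\<forall>y\<in>K. x \<notin> mball y \<epsilon>)" by (rule allI)
    from choice[OF this] obtain f where f0: "\<forall>K. finite K \<and> K \<subseteq> S \<longrightarrow> f K \<in> S \<and> (\<forall>y\<in>K. f K \<notin> mball y \<epsilon>)" by (elim exE) (rule that)
    then have f: "finite K \<Longrightarrow> K \<subseteq> S \<Longrightarrow> f K \<in> S \<and> (\<forall>y\<in>K. f K \<notin> mball y \<epsilon>)" for K by simp
    \<comment> \<open>\<open>L n\<close> is the set of the first n chosen points, and
      \<open>f\<close> selects a point of \<open>S\<close> away from it.\<close>
    define L where "L = rec_nat {} (\<lambda>_ K. insert (f K) K)"
    have LS: "L (Suc n) = insert (f (L n)) (L n)" for n by (simp add: L_def)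
    have L: "finite (L n) \<and> L n \<subseteq> S" for n
    proof (induction n)
      case (Suc n)
      then show ?case using f by (auto simp: LS)
    qed (simp add: L_def)
    have Lm: "L m \<subseteq> L n" if "m \<le> n" for m n by (rule lift_Suc_mono_le[of L, OF _ that]) (simp add: LS subset_insertI)
    define s where "s n = f (L n)" for n
    have sS: "s n \<in> S" for n using f L by (simp add: s_def)
    \<comment> \<open>Half of \<open>\<epsilon>\<close> turns the non-strict bound into membership
      in the open ball around the earlier point.\<close>
    obtain a b where ab: "a < b" "(norm_L2 \<phi> (s a - s b))\<^sup>2 \<le> (\<epsilon> / 2)\<^sup>2"
      using WQ_sequence_clusters[of s B "(\<epsilon> / 2)\<^sup>2"] sS S B \<epsilon> by (auto simp: subset_iff)
    have "s a \<in> L b" using Lm[of "Suc a" b] ab(1) by (auto simp: LS s_def)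
    then have "s b \<notin> mball (s a) \<epsilon>" using f L by (simp add: s_def)
    moreover have "norm_L2 \<phi> (s a - s b) \<le> \<epsilon> / 2" by (rule power2_le_imp_le[OF ab(2)]) (use \<epsilon> in simp)
    then have "s b \<in> mball (s a) \<epsilon>"
      unfolding in_mball using subsetD[OF SL sS, of a] subsetD[OF SL sS, of b] \<epsilon> by simp
    ultimately show False by (rule notE)
  qed
qed

end

section \<open>The Laplacian and its inverse\<close>

context weight begin

lemma dbar_diff: "u \<in> dom_dbar \<phi> q \<Longrightarrow> v \<in> dom_dbar \<phi> q \<Longrightarrow> u - v \<in> dom_dbar \<phi> q \<and> dbar \<phi> q (u - v) = dbar \<phi> q u - dbar \<phi> q v"
  using dbar_add[of u q "form_scale (- 1) v"] dbar_scale[of v q "- 1"] by (simp flip: form_scale_uminus)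

lemma adj_diff: "u \<in> dom_dbar_adj \<phi> q \<Longrightarrow> v \<in> dom_dbar_adj \<phi> q \<Longrightarrow> u - v \<in> dom_dbar_adj \<phi> q \<and> dbar_adj \<phi> q (u - v) = dbar_adj \<phi> q u - dbar_adj \<phi> q v"
  using adj_add[of u q "form_scale (- 1) v"] adj_scale[of v q "- 1"] by (simp flip: form_scale_uminus)

lemma adj_zero: "0 \<in> dom_dbar_adj \<phi> q"
  by (rule adjI(1)[OF zero_L2 zero_L2]) (simp add: L2.B_zero_right[OF dbarD(1)] L2.B_zero_right[OF dbarD(2)])

text \<open>The sesquilinear form whose quadratic form is the square of \<open>norm_Q\<close>; it
  also gives the weak form of the Laplacian.\<close>

definition inner_Q :: "'n form \<Rightarrow> 'n form \<Rightarrow> complex" where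
  "inner_Q u v = inner_L2 \<phi> (dbar \<phi> 1 u) (dbar \<phi> 1 v) + inner_L2 \<phi> (dbar_adj \<phi> 0 u) (dbar_adj \<phi> 0 v)"

lemma WQ_D:
  assumes "u \<in> WQ \<phi>"
  shows "u \<in> L2 \<phi> 1" "u \<in> dom_dbar \<phi> 1" "u \<in> dom_dbar_adj \<phi> 0" "dbar \<phi> 1 u \<in> L2 \<phi> 2" "dbar_adj \<phi> 0 u \<in> L2 \<phi> 0"
  using assms dbarD(2)[of u 1] adjD(2)[of u 0] unfolding WQ_def by (simp_all add: numeral_2_eq_2)

sublocale WQ: hermitian_space "WQ \<phi>" form_scale inner_Q
proof
  fix u v w c
  show "0 \<in> WQ \<phi>" by (simp only: WQ_iff dbar_zero adj_zero)
  show "- u = form_scale (- 1) u" for u :: "'n form" by (rule form_scale_uminus)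
  assume u: "u \<in> WQ \<phi>"
  note U = WQ_D[OF u]
  show "form_scale c u \<in> WQ \<phi>" using dbar_scale[OF U(2)] adj_scale[OF U(3)] by (simp add: WQ_iff)
  show "0 \<le> Re (inner_Q u u)" unfolding inner_Q_def using L2.B_pos[OF U(4)] L2.B_pos[OF U(5)] by simp
  assume v: "v \<in> WQ \<phi>"
  note V = WQ_D[OF v]
  show "u + v \<in> WQ \<phi>" using dbar_add[OF U(2) V(2)] adj_add[OF U(3) V(3)] by (simp add: WQ_iff)
  show "inner_Q v u = cnj (inner_Q u v)" unfolding inner_Q_def using L2.B_sym[OF U(4) V(4)] L2.B_sym[OF U(5) V(5)] by simp
next
  fix u v w c assume u: "u \<in> WQ \<phi>" and w: "w \<in> WQ \<phi>"
  note U = WQ_D[OF u] and W = WQ_D[OF w]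
  show "inner_Q (form_scale c u) w = c * inner_Q u w"
    unfolding inner_Q_def dbar_scale[OF U(2), THEN conjunct2] adj_scale[OF U(3), THEN conjunct2]
    using L2.B_scale[OF U(4) W(4), of c] L2.B_scale[OF U(5) W(5), of c] by (simp add: distrib_left)
next
  fix u v w assume u: "u \<in> WQ \<phi>" and v: "v \<in> WQ \<phi>" and w: "w \<in> WQ \<phi>"
  note U = WQ_D[OF u] and V = WQ_D[OF v] and W = WQ_D[OF w]
  show "inner_Q (u + v) w = inner_Q u w + inner_Q v w"
    unfolding inner_Q_def dbar_add[OF U(2) V(2), THEN conjunct2] adj_add[OF U(3) V(3), THEN conjunct2]
    using L2.B_add[OF U(4) V(4) W(4)] L2.B_add[OF U(5) V(5) W(5)] by simp
qed

lemma Q_norm_Q: "u \<in> WQ \<phi> \<Longrightarrow> Re (inner_Q u u) = (norm_Q \<phi> u)\<^sup>2"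
  unfolding inner_Q_def norm_Q_sq using Q_norm[OF WQ_D(4)] Q_norm[OF WQ_D(5)] by simp

section \<open>Orthogonal decomposition along the kernel\<close>

definition ker_dbar :: "'n form set" where
  "ker_dbar = {v \<in> dom_dbar \<phi> 1. dbar \<phi> 1 v = 0}"

lemma ker_dbar_L2: "v \<in> ker_dbar \<Longrightarrow> v \<in> L2 \<phi> 1"
  by (simp add: ker_dbar_def dbarD(1))

text \<open>The projection of \<open>f\<close> is the Riesz representative, within the kernel, of
  the pairing with \<open>f\<close>. The kernel is complete because the Cauchy--Riemann operator is
  closed.\<close>

lemma ker_projection:
  assumes f: "f \<in> L2 \<phi> 1"
  shows "\<exists>p\<in>ker_dbar. \<forall>v\<in>ker_dbar. inner_L2 \<phi> v (f - p) = 0"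
proof -
  have z: "dbar \<phi> 1 0 = 0"
    using dbar_diff[of 0 1 0, OF dbar_zero dbar_zero] by simp
  interpret ker: hermitian_space ker_dbar form_scale "inner_L2 \<phi>"
  proof
    show "0 \<in> ker_dbar" by (simp only: ker_dbar_def mem_Collect_eq dbar_zero z simp_thms)
    show "- u = form_scale (- 1) u" for u :: "'n form" by (rule form_scale_uminus)
    show "u + v \<in> ker_dbar" if "u \<in> ker_dbar" "v \<in> ker_dbar" for u v
      using that dbar_add[of u 1 v] by (simp add: ker_dbar_def)
    show "form_scale c u \<in> ker_dbar" if "u \<in> ker_dbar" for u c
    proof -
      have "aescale c (0 :: (complex, 'n) vec aefun) = 0" by transfer simp
      then have "form_scale c (0 :: 'n form) = 0" by (simp add: form_scale_def fun_eq_iff)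
      then show ?thesis using that dbar_scale[of u 1 c] by (simp add: ker_dbar_def)
    qed
    show "inner_L2 \<phi> (u + v) w = inner_L2 \<phi> u w + inner_L2 \<phi> v w" if "u \<in> ker_dbar" "v \<in> ker_dbar" "w \<in> ker_dbar" for u v w
      by (rule L2.B_add[OF that[THEN ker_dbar_L2]])
    show "inner_L2 \<phi> (form_scale c u) w = c * inner_L2 \<phi> u w" if "u \<in> ker_dbar" "w \<in> ker_dbar" for u w c
      by (rule L2.B_scale[OF that[THEN ker_dbar_L2]])
    show "inner_L2 \<phi> v u = cnj (inner_L2 \<phi> u v)" if "u \<in> ker_dbar" "v \<in> ker_dbar" for u v
      by (rule L2.B_sym[OF that[THEN ker_dbar_L2]])
    show "0 \<le> Re (inner_L2 \<phi> u u)" if "u \<in> ker_dbar" for u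
      by (rule L2.B_pos[OF that[THEN ker_dbar_L2]])
  qed
  have "\<exists>p\<in>ker_dbar. \<forall>v\<in>ker_dbar. inner_L2 \<phi> v f = inner_L2 \<phi> v p"
  proof (rule ker.riesz[where K = "norm_L2 \<phi> f"])
    show "inner_L2 \<phi> (x + y) f = inner_L2 \<phi> x f + inner_L2 \<phi> y f" if "x \<in> ker_dbar" "y \<in> ker_dbar" for x y
      by (rule L2.B_add[OF ker_dbar_L2[OF that(1)] ker_dbar_L2[OF that(2)] f])
    show "inner_L2 \<phi> (form_scale c x) f = c * inner_L2 \<phi> x f" if "x \<in> ker_dbar" for x c
      by (rule L2.B_scale[OF ker_dbar_L2[OF that] f])
    show "cmod (inner_L2 \<phi> x f) \<le> norm_L2 \<phi> f * sqrt (Re (inner_L2 \<phi> x x))" if "x \<in> ker_dbar" for x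
      using Cauchy_Schwarz_L2[OF ker_dbar_L2[OF that] f] Q_norm[OF ker_dbar_L2[OF that]]
      by (simp add: norm_L2_nonneg[OF cont] mult.commute)
    fix s :: "nat \<Rightarrow> 'n form" assume s: "\<And>n. s n \<in> ker_dbar" and c: "\<And>e. e > 0 \<Longrightarrow> \<exists>N. \<forall>m\<ge>N. \<forall>n\<ge>N. Re (inner_L2 \<phi> (s m - s n) (s m - s n)) < e"
    have sL: "s n \<in> L2 \<phi> 1" "s n \<in> dom_dbar \<phi> 1" "dbar \<phi> 1 (s n) = 0" for n using s[of n] dbarD(1) by (auto simp: ker_dbar_def)
    have "\<exists>x\<in>L2 \<phi> 1. (\<lambda>n. (norm_L2 \<phi> (s n - x))\<^sup>2) \<longlonglongrightarrow> 0"
      by (rule L2_complete[OF sL(1)]) (use c Q_norm[OF L2.diff[OF sL(1) sL(1)]] in simp)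
    then obtain x where x: "x \<in> L2 \<phi> 1" "(\<lambda>n. (norm_L2 \<phi> (s n - x))\<^sup>2) \<longlonglongrightarrow> 0" by blast
    have n0: "norm_L2 \<phi> (0 :: 'n form) = 0" using Q_norm[OF zero_L2] L2.B_zero_left[OF zero_L2] by simp
    have "(\<lambda>n. (norm_L2 \<phi> (dbar \<phi> 1 (s n) - 0))\<^sup>2) \<longlonglongrightarrow> 0" using sL(3) n0 by simp
    from dbar_closed[OF sL(2) x(1) zero_L2 x(2) this] have "x \<in> ker_dbar" by (simp add: ker_dbar_def)
    then show "\<exists>x\<in>ker_dbar. (\<lambda>n. Re (inner_L2 \<phi> (s n - x) (s n - x))) \<longlonglongrightarrow> 0"
      by (rule bexI[rotated]) (simp only: Q_norm[OF L2.diff[OF sL(1) x(1)]] x(2))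
  qed
  then obtain p where p: "p \<in> ker_dbar" "\<forall>v\<in>ker_dbar. inner_L2 \<phi> v f = inner_L2 \<phi> v p" by blast
  have "inner_L2 \<phi> v (f - p) = 0" if "v \<in> ker_dbar" for v
    using L2.B_diff_right[OF f ker_dbar_L2[OF p(1)] ker_dbar_L2[OF that]] p(2) that by simp
  with p(1) show ?thesis by blast
qed

lemma dbar_in_ker: "u \<in> dom_dbar \<phi> 0 \<Longrightarrow> dbar \<phi> 0 u \<in> ker_dbar"
  using dbar_dbar[of u] by (simp add: ker_dbar_def)

text \<open>The kernel contains the range of the Cauchy--Riemann operator on functions, so the
  defining identity of the adjoint holds with the value 0.\<close>

lemma orthogonal_ker_adj:
  assumes w: "w \<in> L2 \<phi> 1" and o: "\<And>v. v \<in> ker_dbar \<Longrightarrow> inner_L2 \<phi> v w = 0"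
  shows "w \<in> dom_dbar_adj \<phi> 0" and "dbar_adj \<phi> 0 w = 0"
proof -
  have w': "w \<in> L2 \<phi> (0 + 1)" using w by simp
  have "inner_L2 \<phi> (dbar \<phi> 0 u) w = inner_L2 \<phi> u 0" if "u \<in> dom_dbar \<phi> 0" for u
    using o[OF dbar_in_ker[OF that]] L2.B_zero_right[OF dbarD(1)[OF that]] by simp
  from adjI[OF w' zero_L2 this] show "w \<in> dom_dbar_adj \<phi> 0" "dbar_adj \<phi> 0 w = 0" by blast+
qed

text \<open>A weak solution solves the equation strongly: testing against the two parts of the orthogonal
  decomposition along the kernel separates the two summands of the Laplacian.\<close>

lemma weak_solution_laplacian:
  assumes f: "f \<in> L2 \<phi> 1" and u: "u \<in> WQ \<phi>" and weak: "\<And>v. v \<in> WQ \<phi> \<Longrightarrow> inner_L2 \<phi> v f = inner_Q v u"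
  shows "u \<in> dom_laplacian \<phi>" and "laplacian \<phi> u = f"
proof -
  note U = WQ_D[OF u]
  obtain p where p: "p \<in> ker_dbar" and po: "\<And>v. v \<in> ker_dbar \<Longrightarrow> inner_L2 \<phi> v (f - p) = 0"
    using ker_projection[OF f] by blast
  have pL: "p \<in> L2 \<phi> 1" by (rule ker_dbar_L2[OF p])
  have split: "\<exists>k\<in>ker_dbar. k \<in> L2 \<phi> 1 \<and> v - k \<in> L2 \<phi> 1 \<and> v - k \<in> dom_dbar_adj \<phi> 0 \<and> dbar_adj \<phi> 0 (v - k) = 0 \<and> inner_L2 \<phi> p (v - k) = 0"
    if v: "v \<in> L2 \<phi> 1" for v
  proof -
    obtain k where k: "k \<in> ker_dbar" "\<And>w. w \<in> ker_dbar \<Longrightarrow> inner_L2 \<phi> w (v - k) = 0" using ker_projection[OF v] by blast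
    have kL: "k \<in> L2 \<phi> 1" by (rule ker_dbar_L2[OF k(1)])
    have d: "v - k \<in> L2 \<phi> 1" by (rule L2.diff[OF v kL])
    from orthogonal_ker_adj[OF d k(2)] k kL d p show ?thesis by blast
  qed
  \<comment> \<open>The kernel part \<open>k\<close> of \<open>v\<close> lies in
    \<open>WQ \<phi>\<close>, since both \<open>v\<close> and \<open>v - k\<close> are in the domain
    of the adjoint. Testing with \<open>k\<close> leaves only the adjoint term of
    \<open>inner_Q\<close>, and on the other side only the projection \<open>p\<close> of
    \<open>f\<close>.\<close>
  have 1: "dbar_adj \<phi> 0 u \<in> dom_dbar \<phi> 0 \<and> dbar \<phi> 0 (dbar_adj \<phi> 0 u) = p"
  proof (rule dbar_biadjoint[OF U(5)])
    show "p \<in> L2 \<phi> (0 + 1)" using pL by simp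
    fix v assume v: "v \<in> dom_dbar_adj \<phi> 0"
    have vL: "v \<in> L2 \<phi> 1" using adjD(1)[OF v] by simp
    obtain k where k: "k \<in> ker_dbar" "k \<in> L2 \<phi> 1" "v - k \<in> L2 \<phi> 1" "v - k \<in> dom_dbar_adj \<phi> 0" "dbar_adj \<phi> 0 (v - k) = 0" "inner_L2 \<phi> p (v - k) = 0"
      using split[OF vL] by blast
    have ka: "k \<in> dom_dbar_adj \<phi> 0" "dbar_adj \<phi> 0 k = dbar_adj \<phi> 0 v" using adj_diff[OF v k(4)] k(5) by auto
    have kd: "k \<in> dom_dbar \<phi> 1" "dbar \<phi> 1 k = 0" using k(1) by (auto simp: ker_dbar_def)
    have "k \<in> WQ \<phi>" using ka kd by (simp add: WQ_iff)
    from weak[OF this] have "inner_L2 \<phi> k f = inner_L2 \<phi> (dbar_adj \<phi> 0 v) (dbar_adj \<phi> 0 u)"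
      unfolding inner_Q_def kd(2) ka(2) using L2.B_zero_left[OF U(4)] by simp
    moreover have "inner_L2 \<phi> k f = inner_L2 \<phi> k p" using po[OF k(1)] L2.B_diff_right[OF f pL k(2)] by simp
    moreover have "inner_L2 \<phi> p v = inner_L2 \<phi> p k" using k(6) L2.B_diff_right[OF vL k(2) pL] by simp
    moreover have "inner_L2 \<phi> p k = cnj (inner_L2 \<phi> k p)" by (rule L2.B_sym[OF k(2) pL])
    moreover have "inner_L2 \<phi> (dbar_adj \<phi> 0 u) (dbar_adj \<phi> 0 v) = cnj (inner_L2 \<phi> (dbar_adj \<phi> 0 v) (dbar_adj \<phi> 0 u))"
      by (rule L2.B_sym[OF adjD(2)[OF v] U(5)])
    ultimately show "inner_L2 \<phi> (dbar_adj \<phi> 0 u) (dbar_adj \<phi> 0 v) = inner_L2 \<phi> p v" by simp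
  qed
  \<comment> \<open>The complementary test: the part \<open>v - k\<close> has adjoint 0 and the same
    Cauchy--Riemann derivative as \<open>v\<close>, so the other term of \<open>inner_Q\<close>
    remains and pairs with \<open>f - p\<close>.\<close>
  have 2: "dbar \<phi> 1 u \<in> dom_dbar_adj \<phi> 1 \<and> dbar_adj \<phi> 1 (dbar \<phi> 1 u) = f - p"
  proof -
    have fp: "f - p \<in> L2 \<phi> 1" by (rule L2.diff[OF f pL])
    have "inner_L2 \<phi> (dbar \<phi> 1 v) (dbar \<phi> 1 u) = inner_L2 \<phi> v (f - p)" if v: "v \<in> dom_dbar \<phi> 1" for v
    proof -
      have vL: "v \<in> L2 \<phi> 1" by (rule dbarD(1)[OF v])
      obtain k where k: "k \<in> ker_dbar" "k \<in> L2 \<phi> 1" "v - k \<in> L2 \<phi> 1" "v - k \<in> dom_dbar_adj \<phi> 0" "dbar_adj \<phi> 0 (v - k) = 0" "inner_L2 \<phi> p (v - k) = 0"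
        using split[OF vL] by blast
      have kd: "k \<in> dom_dbar \<phi> 1" "dbar \<phi> 1 k = 0" using k(1) by (auto simp: ker_dbar_def)
      have d: "v - k \<in> dom_dbar \<phi> 1" "dbar \<phi> 1 (v - k) = dbar \<phi> 1 v" using dbar_diff[OF v kd(1)] kd(2) by auto
      have "v - k \<in> WQ \<phi>" using d k by (simp add: WQ_iff)
      from weak[OF this] have "inner_L2 \<phi> (v - k) f = inner_L2 \<phi> (dbar \<phi> 1 v) (dbar \<phi> 1 u)"
        unfolding inner_Q_def d(2) k(5) using L2.B_zero_left[OF U(5)] by simp
      moreover have "inner_L2 \<phi> (v - k) p = 0" using L2.B_sym[OF pL k(3)] k(6) by simp
      moreover have "inner_L2 \<phi> (v - k) (f - p) = inner_L2 \<phi> (v - k) f - inner_L2 \<phi> (v - k) p" by (rule L2.B_diff_right[OF f pL k(3)])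
      moreover have "inner_L2 \<phi> (v - k) (f - p) = inner_L2 \<phi> v (f - p) - inner_L2 \<phi> k (f - p)" by (rule L2.B_diff[OF vL k(2) fp])
      moreover have "inner_L2 \<phi> k (f - p) = 0" by (rule po[OF k(1)])
      ultimately show ?thesis by simp
    qed
    from adjI[OF dbarD(2)[OF U(2)] fp this] show ?thesis by blast
  qed
  show "u \<in> dom_laplacian \<phi>" using 1 2 U by (simp add: dom_laplacian_def)
  show "laplacian \<phi> u = f" using 1 2 by (simp add: laplacian_def)
qed

text \<open>Converse to \<open>weak_solution_laplacian\<close>. Injectivity of the Laplacian, and
  linearity and boundedness of its inverse, can thus be read off the weak equation.\<close>

lemma laplacian_weak:
  assumes u: "u \<in> dom_laplacian \<phi>"
  shows "u \<in> WQ \<phi>" and "laplacian \<phi> u \<in> L2 \<phi> 1" and "v \<in> WQ \<phi> \<Longrightarrow> inner_L2 \<phi> v (laplacian \<phi> u) = inner_Q v u"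
proof -
  have D: "u \<in> dom_dbar \<phi> 1" "u \<in> dom_dbar_adj \<phi> 0" "dbar \<phi> 1 u \<in> dom_dbar_adj \<phi> 1" "dbar_adj \<phi> 0 u \<in> dom_dbar \<phi> 0"
    using u by (auto simp: dom_laplacian_def)
  show "u \<in> WQ \<phi>" using D by (simp add: WQ_iff)
  have L: "dbar \<phi> 0 (dbar_adj \<phi> 0 u) \<in> L2 \<phi> 1" "dbar_adj \<phi> 1 (dbar \<phi> 1 u) \<in> L2 \<phi> 1"
    using dbarD(2)[OF D(4)] adjD(2)[OF D(3)] by simp_all
  show "laplacian \<phi> u \<in> L2 \<phi> 1" unfolding laplacian_def by (rule add_L2[OF L])
  assume v: "v \<in> WQ \<phi>"
  note V = WQ_D[OF v]
  have "inner_L2 \<phi> v (dbar \<phi> 0 (dbar_adj \<phi> 0 u)) = inner_L2 \<phi> (dbar_adj \<phi> 0 v) (dbar_adj \<phi> 0 u)"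
    using L2.B_sym[OF L(1) V(1)] L2.B_sym[OF dbarD(1)[OF D(4)] V(5)] adjD(3)[OF V(3) D(4)] by simp
  then show "inner_L2 \<phi> v (laplacian \<phi> u) = inner_Q v u"
    unfolding laplacian_def inner_Q_def L2.B_add_right[OF L V(1)] using adjD(3)[OF D(3) V(2)] by simp
qed

lemma bounded_set_precompact:
  assumes "Metric_space.mtotally_bounded (L2 \<phi> q) (\<lambda>f g. norm_L2 \<phi> (f - g)) S"
  shows "compactin (Metric_space.mtopology (L2 \<phi> q) (\<lambda>f g. norm_L2 \<phi> (f - g)))
    ((Metric_space.mtopology (L2 \<phi> q) (\<lambda>f g. norm_L2 \<phi> (f - g))) closure_of S)"
  using Metric_space.mtotally_bounded_eq_compact_closure_of[OF Metric_space_L2[OF cont] mcomplete_L2] assms by blast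

end

section \<open>Inversion of the Laplacian and the two compact operators\<close>

context psh_weight begin

text \<open>By \<open>WQ_estimate\<close> a Cauchy sequence for the energy is Cauchy in the weighted
  space as well. Its limit and those of the two images fit together because both operators are
  closed.\<close>

lemma WQ_complete:
  fixes s :: "nat \<Rightarrow> 'n form"
  assumes s: "\<And>n. s n \<in> WQ \<phi>" and c: "\<And>e. e > 0 \<Longrightarrow> \<exists>N. \<forall>m\<ge>N. \<forall>n\<ge>N. Re (inner_Q (s m - s n) (s m - s n)) < e"
  shows "\<exists>x\<in>WQ \<phi>. (\<lambda>n. Re (inner_Q (s n - x) (s n - x))) \<longlonglongrightarrow> 0"
proof -
  obtain C where C: "C > 0" "\<forall>u\<in>WQ \<phi>. (norm_L2 \<phi> u)\<^sup>2 \<le> C * (norm_Q \<phi> u)\<^sup>2" using WQ_estimate by blast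
  note S = WQ_D[OF s]
  have d: "s m - s n \<in> WQ \<phi>" for m n by (rule WQ.diff[OF s s])
  have dd: "dbar \<phi> 1 (s m - s n) = dbar \<phi> 1 (s m) - dbar \<phi> 1 (s n)" "dbar_adj \<phi> 0 (s m - s n) = dbar_adj \<phi> 0 (s m) - dbar_adj \<phi> 0 (s n)" for m n
    using dbar_diff[OF S(2) S(2)] adj_diff[OF S(3) S(3)] by blast+
  have c': "\<exists>N. \<forall>m\<ge>N. \<forall>n\<ge>N. (norm_Q \<phi> (s m - s n))\<^sup>2 < e" if "e > 0" for e
    using c[OF that] unfolding Q_norm_Q[OF d] .
  have "\<exists>x\<in>L2 \<phi> 1. (\<lambda>n. (norm_L2 \<phi> (s n - x))\<^sup>2) \<longlonglongrightarrow> 0"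
  proof (rule L2_complete[OF S(1)])
    fix e :: real assume "e > 0"
    then obtain N where N: "\<forall>m\<ge>N. \<forall>n\<ge>N. (norm_Q \<phi> (s m - s n))\<^sup>2 < e / C" using c'[of "e / C"] C(1) by auto
    have "(norm_L2 \<phi> (s m - s n))\<^sup>2 < e" if "m \<ge> N" "n \<ge> N" for m n
    proof -
      have "(norm_L2 \<phi> (s m - s n))\<^sup>2 \<le> C * (norm_Q \<phi> (s m - s n))\<^sup>2" using C(2) d by blast
      also have "\<dots> < C * (e / C)" using N that C(1) by (intro mult_strict_left_mono) auto
      finally show ?thesis using C(1) by simp
    qed
    then show "\<exists>N. \<forall>m\<ge>N. \<forall>n\<ge>N. (norm_L2 \<phi> (s m - s n))\<^sup>2 < e" by blast
  qed
  then obtain x where x: "x \<in> L2 \<phi> 1" "(\<lambda>n. (norm_L2 \<phi> (s n - x))\<^sup>2) \<longlonglongrightarrow> 0" by blast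
  have "\<exists>g\<in>L2 \<phi> 2. (\<lambda>n. (norm_L2 \<phi> (dbar \<phi> 1 (s n) - g))\<^sup>2) \<longlonglongrightarrow> 0"
  proof (rule L2_complete[OF S(4)])
    fix e :: real assume "e > 0"
    then obtain N where "\<forall>m\<ge>N. \<forall>n\<ge>N. (norm_Q \<phi> (s m - s n))\<^sup>2 < e" using c' by blast
    then show "\<exists>N. \<forall>m\<ge>N. \<forall>n\<ge>N. (norm_L2 \<phi> (dbar \<phi> 1 (s m) - dbar \<phi> 1 (s n)))\<^sup>2 < e"
      unfolding norm_Q_sq dd by (intro exI[of _ N]) (smt (verit) zero_le_power2)
  qed
  then obtain g where g: "g \<in> L2 \<phi> 2" "(\<lambda>n. (norm_L2 \<phi> (dbar \<phi> 1 (s n) - g))\<^sup>2) \<longlonglongrightarrow> 0" by blast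
  have "\<exists>w\<in>L2 \<phi> 0. (\<lambda>n. (norm_L2 \<phi> (dbar_adj \<phi> 0 (s n) - w))\<^sup>2) \<longlonglongrightarrow> 0"
  proof (rule L2_complete[OF S(5)])
    fix e :: real assume "e > 0"
    then obtain N where "\<forall>m\<ge>N. \<forall>n\<ge>N. (norm_Q \<phi> (s m - s n))\<^sup>2 < e" using c' by blast
    then show "\<exists>N. \<forall>m\<ge>N. \<forall>n\<ge>N. (norm_L2 \<phi> (dbar_adj \<phi> 0 (s m) - dbar_adj \<phi> 0 (s n)))\<^sup>2 < e"
      unfolding norm_Q_sq dd by (intro exI[of _ N]) (smt (verit) zero_le_power2)
  qed
  then obtain w where w: "w \<in> L2 \<phi> 0" "(\<lambda>n. (norm_L2 \<phi> (dbar_adj \<phi> 0 (s n) - w))\<^sup>2) \<longlonglongrightarrow> 0" by blast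
  have g': "g \<in> L2 \<phi> (1 + 1)" using g(1) by (simp add: numeral_2_eq_2)
  have x': "x \<in> L2 \<phi> (0 + 1)" using x(1) by simp
  have xd: "x \<in> dom_dbar \<phi> 1" "dbar \<phi> 1 x = g" using dbar_closed[OF S(2) x(1) g' x(2) g(2)] by blast+
  have xa: "x \<in> dom_dbar_adj \<phi> 0" "dbar_adj \<phi> 0 x = w" using adj_closed[OF S(3) x' w(1) x(2) w(2)] by blast+
  have xW: "x \<in> WQ \<phi>" using xd xa by (simp add: WQ_iff)
  have "Re (inner_Q (s n - x) (s n - x)) = (norm_L2 \<phi> (dbar \<phi> 1 (s n) - g))\<^sup>2 + (norm_L2 \<phi> (dbar_adj \<phi> 0 (s n) - w))\<^sup>2" for n
    unfolding Q_norm_Q[OF WQ.diff[OF s xW]] norm_Q_sq using dbar_diff[OF S(2) xd(1)] adj_diff[OF S(3) xa(1)] xd(2) xa(2) by simp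
  then have "(\<lambda>n. Re (inner_Q (s n - x) (s n - x))) \<longlonglongrightarrow> 0" using tendsto_add[OF g(2) w(2)] by simp
  with xW show ?thesis by blast
qed

text \<open>\<open>WQ_estimate\<close> makes the energy form definite, so an element is determined
  by its pairings.\<close>

lemma WQ_unique:
  assumes u: "u \<in> WQ \<phi>" "u' \<in> WQ \<phi>" and eq: "\<And>v. v \<in> WQ \<phi> \<Longrightarrow> inner_Q v u = inner_Q v u'"
  shows "u = u'"
proof -
  obtain C where C: "C > 0" "\<forall>u\<in>WQ \<phi>. (norm_L2 \<phi> u)\<^sup>2 \<le> C * (norm_Q \<phi> u)\<^sup>2" using WQ_estimate by blast
  have d: "u - u' \<in> WQ \<phi>" by (rule WQ.diff[OF u])
  have "inner_Q (u - u') (u - u') = 0" using WQ.B_diff_right[OF u d] eq[OF d] by simp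
  then have "(norm_Q \<phi> (u - u'))\<^sup>2 = 0" using Q_norm_Q[OF d] by simp
  then have "norm_L2 \<phi> (u - u') = 0" using bspec[OF C(2) d] by simp
  then have "u - u' = 0" by (rule norm_L2_eq_0[OF WQ_D(1)[OF d]])
  then show ?thesis by simp
qed

text \<open>Bijectivity makes \<open>inv_into\<close> in \<open>dbar_neumann\<close> a genuine
  inverse. For the Riesz theorem the functional given by \<open>f\<close> has the bound
  \<open>sqrt C * norm_L2 \<phi> f\<close> by Cauchy--Schwarz and
  \<open>WQ_estimate\<close>.\<close>

lemma laplacian_bij: "bij_betw (laplacian \<phi>) (dom_laplacian \<phi>) (L2 \<phi> 1)"
  unfolding bij_betw_def
proof
  show "inj_on (laplacian \<phi>) (dom_laplacian \<phi>)"
  proof (rule inj_onI)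
    fix u u' assume u: "u \<in> dom_laplacian \<phi>" "u' \<in> dom_laplacian \<phi>" and eq: "laplacian \<phi> u = laplacian \<phi> u'"
    show "u = u'"
    proof (rule WQ_unique[OF laplacian_weak(1)[OF u(1)] laplacian_weak(1)[OF u(2)]])
      fix v assume v: "v \<in> WQ \<phi>"
      show "inner_Q v u = inner_Q v u'" using laplacian_weak(3)[OF u(1) v] laplacian_weak(3)[OF u(2) v] eq by simp
    qed
  qed
  obtain C where C: "C > 0" "\<forall>u\<in>WQ \<phi>. (norm_L2 \<phi> u)\<^sup>2 \<le> C * (norm_Q \<phi> u)\<^sup>2" using WQ_estimate by blast
  have "f \<in> laplacian \<phi> ` dom_laplacian \<phi>" if f: "f \<in> L2 \<phi> 1" for f
  proof -
    have "\<exists>u\<in>WQ \<phi>. \<forall>v\<in>WQ \<phi>. inner_L2 \<phi> v f = inner_Q v u"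
    proof (rule WQ.riesz[where K = "sqrt C * norm_L2 \<phi> f"])
      show "\<exists>x\<in>WQ \<phi>. (\<lambda>n. Re (inner_Q (s n - x) (s n - x))) \<longlonglongrightarrow> 0"
        if "\<And>n. s n \<in> WQ \<phi>" "\<And>e. e > 0 \<Longrightarrow> \<exists>N. \<forall>m\<ge>N. \<forall>n\<ge>N. Re (inner_Q (s m - s n) (s m - s n)) < e" for s :: "nat \<Rightarrow> 'n form"
        using that by (rule WQ_complete)
      show "inner_L2 \<phi> (x + y) f = inner_L2 \<phi> x f + inner_L2 \<phi> y f" if "x \<in> WQ \<phi>" "y \<in> WQ \<phi>" for x y
        by (rule L2.B_add[OF WQ_D(1)[OF that(1)] WQ_D(1)[OF that(2)] f])
      show "inner_L2 \<phi> (form_scale c x) f = c * inner_L2 \<phi> x f" if "x \<in> WQ \<phi>" for x c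
        by (rule L2.B_scale[OF WQ_D(1)[OF that] f])
      show "cmod (inner_L2 \<phi> x f) \<le> sqrt C * norm_L2 \<phi> f * sqrt (Re (inner_Q x x))" if x: "x \<in> WQ \<phi>" for x
      proof -
        have "norm_L2 \<phi> x \<le> sqrt (C * (norm_Q \<phi> x)\<^sup>2)" using C(2) x by (intro real_le_rsqrt) blast
        then have "norm_L2 \<phi> x \<le> sqrt C * sqrt (Re (inner_Q x x))" unfolding Q_norm_Q[OF x] by (simp add: real_sqrt_mult)
        then have "norm_L2 \<phi> x * norm_L2 \<phi> f \<le> sqrt C * sqrt (Re (inner_Q x x)) * norm_L2 \<phi> f"
          by (intro mult_right_mono norm_L2_nonneg[OF cont])
        then show ?thesis using Cauchy_Schwarz_L2[OF WQ_D(1)[OF x] f] by (simp add: mult_ac)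
      qed
    qed
    then obtain u where u: "u \<in> WQ \<phi>" "\<And>v. v \<in> WQ \<phi> \<Longrightarrow> inner_L2 \<phi> v f = inner_Q v u" by blast
    show ?thesis using weak_solution_laplacian[OF f u] by blast
  qed
  then show "laplacian \<phi> ` dom_laplacian \<phi> = L2 \<phi> 1" using laplacian_weak(2) by blast
qed

lemma neumann_weak:
  assumes f: "f \<in> L2 \<phi> 1"
  shows "dbar_neumann \<phi> f \<in> WQ \<phi>" and "v \<in> WQ \<phi> \<Longrightarrow> inner_L2 \<phi> v f = inner_Q v (dbar_neumann \<phi> f)"
proof -
  have im: "f \<in> laplacian \<phi> ` dom_laplacian \<phi>" using laplacian_bij f by (simp add: bij_betw_def)
  have N: "dbar_neumann \<phi> f \<in> dom_laplacian \<phi>" "laplacian \<phi> (dbar_neumann \<phi> f) = f"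
    unfolding dbar_neumann_def by (rule inv_into_into[OF im], rule f_inv_into_f[OF im])
  show "dbar_neumann \<phi> f \<in> WQ \<phi>" by (rule laplacian_weak(1)[OF N(1)])
  show "v \<in> WQ \<phi> \<Longrightarrow> inner_L2 \<phi> v f = inner_Q v (dbar_neumann \<phi> f)" using laplacian_weak(3)[OF N(1)] N(2) by simp
qed

text \<open>Both sides solve the weak equation with the same right-hand side, so
  \<open>WQ_unique\<close> identifies them.\<close>

lemma neumann_add:
  assumes f: "f \<in> L2 \<phi> 1" and g: "g \<in> L2 \<phi> 1"
  shows "dbar_neumann \<phi> (f + g) = dbar_neumann \<phi> f + dbar_neumann \<phi> g"
proof (rule WQ_unique)
  note F = neumann_weak[OF f] and G = neumann_weak[OF g] and H = neumann_weak[OF add_L2[OF f g]]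
  show "dbar_neumann \<phi> (f + g) \<in> WQ \<phi>" "dbar_neumann \<phi> f + dbar_neumann \<phi> g \<in> WQ \<phi>"
    by (rule H(1), rule WQ.add[OF F(1) G(1)])
  fix v assume v: "v \<in> WQ \<phi>"
  show "inner_Q v (dbar_neumann \<phi> (f + g)) = inner_Q v (dbar_neumann \<phi> f + dbar_neumann \<phi> g)"
    unfolding WQ.B_add_right[OF F(1) G(1) v] using H(2)[OF v] F(2)[OF v] G(2)[OF v] L2.B_add_right[OF f g WQ_D(1)[OF v]] by simp
qed

lemma neumann_scale:
  assumes f: "f \<in> L2 \<phi> 1"
  shows "dbar_neumann \<phi> (form_scale c f) = form_scale c (dbar_neumann \<phi> f)"
proof (rule WQ_unique)
  note F = neumann_weak[OF f] and H = neumann_weak[OF scale_L2[OF f]]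
  show "dbar_neumann \<phi> (form_scale c f) \<in> WQ \<phi>" "form_scale c (dbar_neumann \<phi> f) \<in> WQ \<phi>"
    by (rule H(1), rule WQ.scale[OF F(1)])
  fix v assume v: "v \<in> WQ \<phi>"
  show "inner_Q v (dbar_neumann \<phi> (form_scale c f)) = inner_Q v (form_scale c (dbar_neumann \<phi> f))"
    unfolding WQ.B_scale_right[OF F(1) v] using H(2)[OF v] F(2)[OF v] L2.B_scale_right[OF f WQ_D(1)[OF v]] by simp
qed

text \<open>Testing the weak equation with the solution itself bounds its squared energy norm by the
  product of the L^2 norms of solution and datum. \<open>WQ_estimate\<close> replaces the former by
  the energy norm, of which one power then cancels.\<close>

lemma neumann_bounded: "\<exists>K\<ge>0. \<forall>f\<in>L2 \<phi> 1. norm_Q \<phi> (dbar_neumann \<phi> f) \<le> K * norm_L2 \<phi> f"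
proof -
  obtain C where C: "C > 0" "\<forall>u\<in>WQ \<phi>. (norm_L2 \<phi> u)\<^sup>2 \<le> C * (norm_Q \<phi> u)\<^sup>2" using WQ_estimate by blast
  have "norm_Q \<phi> (dbar_neumann \<phi> f) \<le> sqrt C * norm_L2 \<phi> f" if f: "f \<in> L2 \<phi> 1" for f
  proof -
    define u where "u = dbar_neumann \<phi> f"
    note N = neumann_weak[OF f, folded u_def]
    have q: "0 \<le> norm_Q \<phi> u" by (simp add: norm_Q_def)
    have "norm_L2 \<phi> u \<le> sqrt (C * (norm_Q \<phi> u)\<^sup>2)" using C(2) N(1) by (intro real_le_rsqrt) blast
    then have le: "norm_L2 \<phi> u \<le> sqrt C * norm_Q \<phi> u" using q by (simp add: real_sqrt_mult)
    have "(norm_Q \<phi> u)\<^sup>2 = Re (inner_L2 \<phi> u f)" using Q_norm_Q[OF N(1)] N(2)[OF N(1)] by simp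
    also have "\<dots> \<le> cmod (inner_L2 \<phi> u f)" by (rule complex_Re_le_cmod)
    also have "\<dots> \<le> norm_L2 \<phi> u * norm_L2 \<phi> f" by (rule Cauchy_Schwarz_L2[OF WQ_D(1)[OF N(1)] f])
    also have "\<dots> \<le> (sqrt C * norm_Q \<phi> u) * norm_L2 \<phi> f" by (intro mult_right_mono le norm_L2_nonneg[OF cont])
    finally have "norm_Q \<phi> u * norm_Q \<phi> u \<le> norm_Q \<phi> u * (sqrt C * norm_L2 \<phi> f)" by (simp add: power2_eq_square mult_ac)
    then have "norm_Q \<phi> u \<le> sqrt C * norm_L2 \<phi> f"
      using q C(1) norm_L2_nonneg[OF cont, of f] by (cases "norm_Q \<phi> u = 0") (auto simp: mult_le_cancel_left)
    then show ?thesis by (simp add: u_def)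
  qed
  then show ?thesis using C(1) by (intro exI[of _ "sqrt C"]) auto
qed

lemma embedding_compact: "compact_operator (WQ \<phi>) (norm_Q \<phi>) (L2 \<phi> 1) (norm_L2 \<phi>) (\<lambda>u. u)"
  unfolding compact_operator_def
proof (intro conjI allI impI ballI)
  show "(\<lambda>u. u) ` WQ \<phi> \<subseteq> L2 \<phi> 1" using WQ_D(1) by blast
  fix S assume S: "S \<subseteq> WQ \<phi>" and "\<exists>B. \<forall>f\<in>S. norm_Q \<phi> f \<le> B"
  then obtain B where B: "\<forall>f\<in>S. norm_Q \<phi> f \<le> B" by blast
  have "Metric_space.mtotally_bounded (L2 \<phi> 1) (\<lambda>f g. norm_L2 \<phi> (f - g)) S"
    by (rule WQ_totally_bounded[OF S]) (rule bspec[OF B])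
  then show "compactin (Metric_space.mtopology (L2 \<phi> 1) (\<lambda>f g. norm_L2 \<phi> (f - g)))
      ((Metric_space.mtopology (L2 \<phi> 1) (\<lambda>f g. norm_L2 \<phi> (f - g))) closure_of ((\<lambda>u. u) ` S))"
    unfolding image_ident by (rule bounded_set_precompact)
qed (rule refl)+

text \<open>By \<open>neumann_bounded\<close> the operator factors through \<open>WQ \<phi>\<close>:
  images of bounded sets are bounded for \<open>norm_Q\<close>, and
  \<open>WQ_totally_bounded\<close> applies to them.\<close>

lemma neumann_compact: "compact_operator (L2 \<phi> 1) (norm_L2 \<phi>) (L2 \<phi> 1) (norm_L2 \<phi>) (dbar_neumann \<phi>)"
  unfolding compact_operator_def
proof (intro conjI allI impI ballI)
  show "dbar_neumann \<phi> ` L2 \<phi> 1 \<subseteq> L2 \<phi> 1" using neumann_weak(1) WQ_D(1) by blast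
  fix S assume S: "S \<subseteq> L2 \<phi> 1" and "\<exists>B. \<forall>f\<in>S. norm_L2 \<phi> f \<le> B"
  then obtain B where B: "\<forall>f\<in>S. norm_L2 \<phi> f \<le> B" by blast
  obtain K where K: "K \<ge> 0" "\<forall>f\<in>L2 \<phi> 1. norm_Q \<phi> (dbar_neumann \<phi> f) \<le> K * norm_L2 \<phi> f" using neumann_bounded by blast
  have "Metric_space.mtotally_bounded (L2 \<phi> 1) (\<lambda>f g. norm_L2 \<phi> (f - g)) (dbar_neumann \<phi> ` S)"
  proof (rule WQ_totally_bounded)
    show "dbar_neumann \<phi> ` S \<subseteq> WQ \<phi>" using neumann_weak(1) S by blast
    fix u assume "u \<in> dbar_neumann \<phi> ` S"
    then obtain f where f: "f \<in> S" "u = dbar_neumann \<phi> f" by blast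
    have "norm_Q \<phi> u \<le> K * norm_L2 \<phi> f" using K(2) f S by blast
    also have "\<dots> \<le> K * B" using bspec[OF B f(1)] K(1) by (intro mult_left_mono)
    finally show "norm_Q \<phi> u \<le> K * B" .
  qed
  then show "compactin (Metric_space.mtopology (L2 \<phi> 1) (\<lambda>f g. norm_L2 \<phi> (f - g)))
      ((Metric_space.mtopology (L2 \<phi> 1) (\<lambda>f g. norm_L2 \<phi> (f - g))) closure_of (dbar_neumann \<phi> ` S))"
    by (rule bounded_set_precompact)
qed (rule neumann_add neumann_scale; assumption)+

end

theorem theorem1p2:
  fixes \<phi> :: "complex ^ 'n::{finite,linorder} \<Rightarrow> real"
  assumes "Ck 2 \<phi>"
    and "plurisubharmonic \<phi>"
    and "filterlim (\<lambda>z. lowest_eigenvalue (levi_matrix \<phi> z)) at_top at_infinity"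
  shows "compact_operator (WQ \<phi>) (norm_Q \<phi>) (L2 \<phi> 1) (norm_L2 \<phi>) (\<lambda>u. u) \<and>
    bij_betw (laplacian \<phi>) (dom_laplacian \<phi>) (L2 \<phi> 1) \<and>
    compact_operator (L2 \<phi> 1) (norm_L2 \<phi>) (L2 \<phi> 1) (norm_L2 \<phi>) (dbar_neumann \<phi>)"
proof -
  interpret psh_weight \<phi> by unfold_locales (rule assms)+
  show ?thesis by (intro conjI embedding_compact laplacian_bij neumann_compact)
qed

end
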